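(* Let $X$ be a complex Banach space, $p\in(1,\infty)$, $r>0$, let $A:D(A)\subset X\to X$ generate a strongly continuous semigroup on $X$, and let $a\in W^{1,p}(\mathbb{R}_+,\mathbb{C})$. Let $\mu:[-r,0]\to\mathcal{L}(X)$ be of bounded variation, continuous at $0$, whose total variation measure $|\mu|$ satisfies $|\mu|([-\varepsilon,0])\to0$ as $\varepsilon\to0$, and let $L\varphi=\int_{-r}^0d\mu(\theta)\varphi(\theta)$ for $\varphi\in W^{1,p}([-r,0],X)$. On $\mathcal{X}=X\times L^p(\mathbb{R}_+,X)\times L^p([-r,0],X)$ define $$\mathfrak{A}_L\begin{pmatrix}x\\ f\\ \varphi\end{pmatrix}=\begin{pmatrix}Ax+f(0)+L\varphi\\ a(\cdot)Ax+f'\\ \varphi'\end{pmatrix},$$ $$D(\mathfrak{A}_L)=\{(x,f,\varphi)\in D(A)\times W^{1,p}(\mathbb{R}_+,X)\times W^{1,p}([-r,0],X):\ \varphi(0)=x\}.$$ Then $\mathfrak{A}_L$ generates a strongly continuous semigroup $(\mathfrak{T}_L(t))_{t\ge0}$ on $\mathcal{X}$.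
   Context: The integral defining $L$ is a Riemann–Stieltjes integral. The norm on $\mathcal{X}$ is the sum of the norms of the components. Equivalently, $\mathfrak{A}_L=\mathfrak{A}+\mathcal{L}$ where $\mathfrak{A}$ is $\mathfrak{A}_L$ without the term $L\varphi$ and $\mathcal{L}(x,f,\varphi)=(L\varphi,0,0)$. *)

theory Defs
  imports "HOL-Analysis.Analysis"
begin

class complex_banach = banach +
  fixes scaleC :: "complex \<Rightarrow> 'a \<Rightarrow> 'a"
  assumes scaleC_add_right: "scaleC c (x + y) = scaleC c x + scaleC c y"
    and scaleC_add_left: "scaleC (c + d) x = scaleC c x + scaleC d x"
    and scaleC_scaleC: "scaleC c (scaleC d x) = scaleC (c * d) x"
    and scaleC_one: "scaleC 1 x = x"
    and scaleR_scaleC: "scaleR s x = scaleC (complex_of_real s) x"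
    and norm_scaleC: "norm (scaleC c x) = cmod c * norm x"

text \<open>A (complex) seminormed space is given by a carrier V of representatives, a seminorm N,
addition and complex scalar multiplication; elements u, v with N (u - v) = 0 are identified
(this is how L^p classes are handled).  For a genuine Banach space take V = UNIV, N = norm.\<close>

definition vsub :: "('v \<Rightarrow> 'v \<Rightarrow> 'v) \<Rightarrow> (complex \<Rightarrow> 'v \<Rightarrow> 'v) \<Rightarrow> 'v \<Rightarrow> 'v \<Rightarrow> 'v" where
  "vsub add sc u v = add u (sc (-1) v)"

definition C0_semigroup ::
  "'v set \<Rightarrow> ('v \<Rightarrow> real) \<Rightarrow> ('v \<Rightarrow> 'v \<Rightarrow> 'v) \<Rightarrow> (complex \<Rightarrow> 'v \<Rightarrow> 'v) \<Rightarrow> (real \<Rightarrow> 'v \<Rightarrow> 'v) \<Rightarrow> bool"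
  where
  "C0_semigroup V N add sc T \<longleftrightarrow>
     (\<forall>t\<ge>0. \<forall>u\<in>V. T t u \<in> V) \<and>
     (\<forall>t\<ge>0. \<forall>u\<in>V. \<forall>v\<in>V. \<forall>c d.
        N (vsub add sc (T t (add (sc c u) (sc d v))) (add (sc c (T t u)) (sc d (T t v)))) = 0) \<and>
     (\<forall>t\<ge>0. \<exists>M. \<forall>u\<in>V. N (T t u) \<le> M * N u) \<and>
     (\<forall>u\<in>V. N (vsub add sc (T 0 u) u) = 0) \<and>
     (\<forall>s\<ge>0. \<forall>t\<ge>0. \<forall>u\<in>V. N (vsub add sc (T (s + t) u) (T s (T t u))) = 0) \<and>
     (\<forall>u\<in>V. \<forall>t0\<ge>0. ((\<lambda>t. N (vsub add sc (T t u) (T t0 u))) \<longlongrightarrow> 0) (at t0 within {0..}))"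

definition generator_of ::
  "'v set \<Rightarrow> ('v \<Rightarrow> real) \<Rightarrow> ('v \<Rightarrow> 'v \<Rightarrow> 'v) \<Rightarrow> (complex \<Rightarrow> 'v \<Rightarrow> 'v) \<Rightarrow> (real \<Rightarrow> 'v \<Rightarrow> 'v)
    \<Rightarrow> 'v set \<Rightarrow> ('v \<Rightarrow> 'v) \<Rightarrow> bool"
  where
  "generator_of V N add sc T D G \<longleftrightarrow>
     D \<subseteq> V \<and> G ` D \<subseteq> V \<and>
     (\<forall>u\<in>D. ((\<lambda>h. N (vsub add sc (sc (complex_of_real (1 / h)) (vsub add sc (T h u) u)) (G u)))
                 \<longlongrightarrow> 0) (at_right 0)) \<and>
     (\<forall>u\<in>V. (\<exists>w\<in>D. N (vsub add sc u w) = 0) \<longleftrightarrow>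
        (\<exists>v\<in>V. ((\<lambda>h. N (vsub add sc (sc (complex_of_real (1 / h)) (vsub add sc (T h u) u)) v))
                 \<longlongrightarrow> 0) (at_right 0)))"

definition generates_C0 ::
  "'v set \<Rightarrow> ('v \<Rightarrow> real) \<Rightarrow> ('v \<Rightarrow> 'v \<Rightarrow> 'v) \<Rightarrow> (complex \<Rightarrow> 'v \<Rightarrow> 'v) \<Rightarrow> 'v set \<Rightarrow> ('v \<Rightarrow> 'v) \<Rightarrow> bool"
  where
  "generates_C0 V N add sc D G \<longleftrightarrow>
     (\<exists>T. C0_semigroup V N add sc T \<and> generator_of V N add sc T D G)"

definition strongly_measurable :: "'m measure \<Rightarrow> ('m \<Rightarrow> 'b::banach) \<Rightarrow> bool" where
  "strongly_measurable M f \<longleftrightarrow> f \<in> borel_measurable M \<and>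
     (\<exists>s. (\<forall>i. simple_function M (s i)) \<and> (\<forall>x\<in>space M. (\<lambda>i. s i x) \<longlonglongrightarrow> f x))"

definition memLp :: "real \<Rightarrow> 'm measure \<Rightarrow> ('m \<Rightarrow> 'b::banach) \<Rightarrow> bool" where
  "memLp p M f \<longleftrightarrow> strongly_measurable M f \<and> integrable M (\<lambda>x. norm (f x) powr p)"

definition Lpnorm :: "real \<Rightarrow> 'm measure \<Rightarrow> ('m \<Rightarrow> 'b::banach) \<Rightarrow> real" where
  "Lpnorm p M f = (\<integral>x. norm (f x) powr p \<partial>M) powr (1 / p)"

text \<open>f (the continuous representative) lies in W^{1,p}(I) with derivative g.\<close>
definition W1p_with :: "real \<Rightarrow> real set \<Rightarrow> (real \<Rightarrow> 'b::banach) \<Rightarrow> (real \<Rightarrow> 'b) \<Rightarrow> bool" where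
  "W1p_with p I f g \<longleftrightarrow> memLp p (lebesgue_on I) f \<and> memLp p (lebesgue_on I) g \<and>
     (\<forall>s\<in>I. \<forall>t\<in>I. s \<le> t \<longrightarrow> (g has_integral (f t - f s)) {s..t})"

definition W1p :: "real \<Rightarrow> real set \<Rightarrow> (real \<Rightarrow> 'b::banach) \<Rightarrow> bool" where
  "W1p p I f \<longleftrightarrow> (\<exists>g. W1p_with p I f g)"

definition wderiv :: "real \<Rightarrow> real set \<Rightarrow> (real \<Rightarrow> 'b::banach) \<Rightarrow> (real \<Rightarrow> 'b)" where
  "wderiv p I f = (SOME g. W1p_with p I f g)"

definition is_partition :: "real \<Rightarrow> real \<Rightarrow> nat \<Rightarrow> (nat \<Rightarrow> real) \<Rightarrow> bool" where
  "is_partition a b n t \<longleftrightarrow> t 0 = a \<and> t n = b \<and> (\<forall>i<n. t i \<le> t (Suc i))"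

definition var_sums :: "(real \<Rightarrow> 'b::real_normed_vector) \<Rightarrow> real \<Rightarrow> real \<Rightarrow> real set" where
  "var_sums \<mu> a b = {\<Sum>i<n. norm (\<mu> (t (Suc i)) - \<mu> (t i)) | n t. is_partition a b n t}"

definition bounded_variation :: "(real \<Rightarrow> 'b::real_normed_vector) \<Rightarrow> real \<Rightarrow> real \<Rightarrow> bool" where
  "bounded_variation \<mu> a b \<longleftrightarrow> bdd_above (var_sums \<mu> a b)"

definition total_variation :: "(real \<Rightarrow> 'b::real_normed_vector) \<Rightarrow> real \<Rightarrow> real \<Rightarrow> real" where
  "total_variation \<mu> a b = Sup (var_sums \<mu> a b)"

definition has_RS_integral ::
  "(real \<Rightarrow> ('a::real_normed_vector \<Rightarrow>\<^sub>L 'b::real_normed_vector)) \<Rightarrow> (real \<Rightarrow> 'a) \<Rightarrow> real \<Rightarrow> real \<Rightarrow> 'b \<Rightarrow> bool"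
  where
  "has_RS_integral \<mu> \<phi> a b I \<longleftrightarrow>
     (\<forall>\<epsilon>>0. \<exists>\<delta>>0. \<forall>n t \<xi>. is_partition a b n t \<and>
        (\<forall>i<n. t (Suc i) - t i < \<delta> \<and> \<xi> i \<in> {t i..t (Suc i)}) \<longrightarrow>
        norm ((\<Sum>i<n. blinfun_apply (\<mu> (t (Suc i)) - \<mu> (t i)) (\<phi> (\<xi> i))) - I) < \<epsilon>)"

definition RS_integral ::
  "(real \<Rightarrow> ('a::real_normed_vector \<Rightarrow>\<^sub>L 'b::real_normed_vector)) \<Rightarrow> (real \<Rightarrow> 'a) \<Rightarrow> real \<Rightarrow> real \<Rightarrow> 'b"
  where "RS_integral \<mu> \<phi> a b = (THE I. has_RS_integral \<mu> \<phi> a b I)"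

type_synonym 'a state = "'a \<times> (real \<Rightarrow> 'a) \<times> (real \<Rightarrow> 'a)"

definition st_space :: "real \<Rightarrow> real \<Rightarrow> 'a::complex_banach state set" where
  "st_space p r = {(x, f, \<phi>). memLp p (lebesgue_on {0..}) f \<and> memLp p (lebesgue_on {-r..0}) \<phi>}"

definition st_norm :: "real \<Rightarrow> real \<Rightarrow> 'a::complex_banach state \<Rightarrow> real" where
  "st_norm p r u = (case u of (x, f, \<phi>) \<Rightarrow>
     norm x + Lpnorm p (lebesgue_on {0..}) f + Lpnorm p (lebesgue_on {-r..0}) \<phi>)"

definition st_add :: "'a::complex_banach state \<Rightarrow> 'a state \<Rightarrow> 'a state" where
  "st_add u v = (case u of (x, f, \<phi>) \<Rightarrow> case v of (y, g, \<psi>) \<Rightarrow>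
     (x + y, \<lambda>t. f t + g t, \<lambda>t. \<phi> t + \<psi> t))"

definition st_scale :: "complex \<Rightarrow> 'a::complex_banach state \<Rightarrow> 'a state" where
  "st_scale c u = (case u of (x, f, \<phi>) \<Rightarrow>
     (scaleC c x, \<lambda>t. scaleC c (f t), \<lambda>t. scaleC c (\<phi> t)))"

definition AL_dom :: "real \<Rightarrow> real \<Rightarrow> 'a::complex_banach set \<Rightarrow> 'a state set" where
  "AL_dom p r DA = {(x, f, \<phi>). x \<in> DA \<and> W1p p {0..} f \<and> W1p p {-r..0} \<phi> \<and> \<phi> 0 = x}"

definition AL_op ::
  "real \<Rightarrow> real \<Rightarrow> ('a::complex_banach \<Rightarrow> 'a) \<Rightarrow> (real \<Rightarrow> complex) \<Rightarrow> (real \<Rightarrow> ('a \<Rightarrow>\<^sub>L 'a))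
     \<Rightarrow> 'a state \<Rightarrow> 'a state" where
  "AL_op p r A a \<mu> u = (case u of (x, f, \<phi>) \<Rightarrow>
     (A x + f 0 + RS_integral \<mu> \<phi> (-r) 0,
      \<lambda>t. scaleC (a t) (A x) + wderiv p {0..} f t,
      wderiv p {-r..0} \<phi>))"

end

theory Submission
  imports Defs "HOL-Library.Function_Algebras"
begin

text \<open>The operator becomes quasi-dissipative in an equivalent norm
  \<open>(\<nu> x powr p + \<integral>norm (f t - a t x) powr p + \<integral>(1 + V s) * norm (\<phi> s) powr p) powr (1 / p)\<close>, where
  \<open>\<nu>\<close> makes the given semigroup on \<open>X\<close> quasi-contractive and \<open>V s\<close> is the variation of \<open>\<mu>\<close> on
  \<open>[-r, s]\<close>.  Passing from \<open>f\<close> to \<open>f - a x\<close> removes the unbounded term \<open>a A x\<close>.  Both unbounded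
  terms \<open>f 0\<close> and \<open>L \<phi>\<close> of the first component are then dominated by boundary gains: translation
  on the half line loses \<open>norm (f 0 - a 0 x) powr p\<close>, and the weight \<open>V\<close> makes translation on
  \<open>[-r, 0]\<close> lose \<open>\<integral>norm (\<phi> s) powr p dV\<close>, which dominates a multiple of \<open>norm (L \<phi>) powr p\<close>.
  The weight is finite without any smallness of \<open>\<mu>\<close> near \<open>0\<close>; convexity with \<open>p > 1\<close> makes the
  coefficient in front of \<open>norm (f 0 + L \<phi>) powr p\<close> as small as needed.  For small \<open>h\<close> the
  resolvent equation is a fixed point problem for \<open>f 0 + L \<phi>\<close>, which is a contraction because
  its data enter with a factor \<open>h powr (p - 1)\<close>.  Generation follows by the implicit Euler
  scheme.\<close>

section \<open>Generation for dissipative relations on seminormed spaces\<close>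

text \<open>Along the evolution the coordinate f - a x has derivative (f - a x)' + a' x - a y0 with
  y0 = f 0 + L \<phi>: the two occurrences of a A x cancel. Apart from translation and bounded terms
  only y0 remains, and y0 is also the only unbounded input of the first component. So the one
  quantity to control is norm y0 powr p. It enters the resolvent estimates with the factor
  \<open>\<kappa> powr (1 - p)\<close> of \<open>powr_perturbation\<close>, where
  \<open>\<kappa>\<close> is free and is paid for only in the exponential growth rate; it is chosen
  so large that this loss falls below the boundary gains, whose coefficients are fixed. A second
  obstacle shapes the form of the generation theorem: states are functions, not classes. Resolvent
  and semigroup are chosen representatives, linear and multiplicative in time only up to elements of
  norm zero, and the domain is not stable under changing a function on a null set. Identities there
  are therefore proved modulo null elements, for a linear relation, and carried over to the given
  norm at the end through the equivalence of norms.\<close>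

text \<open>The operator is given by its graph \<open>Gr\<close>, so that no representative of a weak derivative
  has to be chosen.\<close>

locale dissipative_relation = module sc
  for sc :: "complex \<Rightarrow> 'v::ab_group_add \<Rightarrow> 'v" +
  fixes V :: "'v set" and N :: "'v \<Rightarrow> real" and Gr :: "('v \<times> 'v) set"
    and \<omega> h0 :: real
  assumes V_zero: "0 \<in> V"
    and V_add: "u \<in> V \<Longrightarrow> v \<in> V \<Longrightarrow> u + v \<in> V"
    and V_sc: "u \<in> V \<Longrightarrow> sc c u \<in> V"
    and N_triangle: "u \<in> V \<Longrightarrow> v \<in> V \<Longrightarrow> N (u + v) \<le> N u + N v"
    and N_sc: "u \<in> V \<Longrightarrow> N (sc c u) = cmod c * N u"
    and complete: "(\<And>n. s n \<in> V) \<Longrightarrow>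
        (\<And>\<epsilon>. \<epsilon> > 0 \<Longrightarrow> \<exists>n0. \<forall>m\<ge>n0. \<forall>n\<ge>n0. N (s m - s n) < \<epsilon>) \<Longrightarrow>
        \<exists>l\<in>V. (\<lambda>n. N (s n - l)) \<longlonglongrightarrow> 0"
    and Gr_V: "(u, w) \<in> Gr \<Longrightarrow> u \<in> V \<and> w \<in> V"
    and Gr_add: "(u, w) \<in> Gr \<Longrightarrow> (u', w') \<in> Gr \<Longrightarrow> (u + u', w + w') \<in> Gr"
    and Gr_sc: "(u, w) \<in> Gr \<Longrightarrow> (sc c u, sc c w) \<in> Gr"
    and dense: "v \<in> V \<Longrightarrow> \<epsilon> > 0 \<Longrightarrow> \<exists>u w. (u, w) \<in> Gr \<and> N (v - u) < \<epsilon>"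
    and diss: "(u, w) \<in> Gr \<Longrightarrow> 0 < h \<Longrightarrow> h \<le> h0 \<Longrightarrow>
        N u \<le> exp (\<omega> * h) * N (u - sc (complex_of_real h) w)"
    and surj: "0 < h \<Longrightarrow> h \<le> h0 \<Longrightarrow> v \<in> V \<Longrightarrow>
        \<exists>u w. (u, w) \<in> Gr \<and> u - sc (complex_of_real h) w = v"
    and \<omega>_nonneg: "0 \<le> \<omega>" and h0_pos: "0 < h0"
begin

section \<open>Calculus modulo elements of seminorm zero\<close>

lemma sc_minus1: "sc (-1) u = - u"
  by (simp add: scale_minus_left)

lemma V_minus: "u \<in> V \<Longrightarrow> - u \<in> V"
  using V_sc[of u "-1"] by (simp add: sc_minus1)

lemma V_diff: "u \<in> V \<Longrightarrow> v \<in> V \<Longrightarrow> u - v \<in> V"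
  using V_add[of u "- v"] V_minus by simp

lemmas V_rules = V_zero V_add V_sc V_minus V_diff

lemma N_zero [simp]: "N 0 = 0"
  using N_sc[of 0 0] V_zero by simp

lemma N_minus: "u \<in> V \<Longrightarrow> N (- u) = N u"
  using N_sc[of u "-1"] by (simp add: sc_minus1)

lemma N_commute: "u \<in> V \<Longrightarrow> v \<in> V \<Longrightarrow> N (u - v) = N (v - u)"
  using N_minus[of "u - v"] V_diff by simp

lemma N_nonneg: "u \<in> V \<Longrightarrow> 0 \<le> N u"
  using N_triangle[of u "- u"] V_minus N_minus by simp

lemma N_diff: "u \<in> V \<Longrightarrow> v \<in> V \<Longrightarrow> N (u - v) \<le> N u + N v"
  using N_triangle[of u "- v"] V_minus N_minus by simp

lemma N_tri3: "u \<in> V \<Longrightarrow> v \<in> V \<Longrightarrow> w \<in> V \<Longrightarrow> N (u - w) \<le> N (u - v) + N (v - w)"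
  using N_triangle[of "u - v" "v - w"] V_diff by simp

text \<open>Two representatives of the same class. Membership in \<open>V\<close> is part of the
  relation, so that symmetry, transitivity and congruence carry no side conditions and can be
  chained.\<close>

definition eqv :: "'v \<Rightarrow> 'v \<Rightarrow> bool" where
  "eqv u v \<longleftrightarrow> u \<in> V \<and> v \<in> V \<and> N (u - v) = 0"

lemma eqv_refl: "u \<in> V \<Longrightarrow> eqv u u" by (simp add: eqv_def)

lemma eqv_sym: "eqv u v \<Longrightarrow> eqv v u" by (auto simp: eqv_def N_commute)

lemma eqv_trans [trans]: "eqv u v \<Longrightarrow> eqv v w \<Longrightarrow> eqv u w"
  unfolding eqv_def using N_tri3[of u v w] N_nonneg[of "u - w"] V_diff by force

lemma eqv_add: "eqv u v \<Longrightarrow> eqv u' v' \<Longrightarrow> eqv (u + u') (v + v')"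
  unfolding eqv_def
  using N_triangle[of "u - v" "u' - v'"] N_nonneg[of "u + u' - (v + v')"] V_diff V_add
  by (force simp: algebra_simps)

lemma eqv_sc: "eqv u v \<Longrightarrow> eqv (sc c u) (sc c v)"
  unfolding eqv_def using N_sc[of "u - v" c] V_diff V_sc by (simp add: scale_right_diff_distrib)

lemma eqv_diff: "eqv u v \<Longrightarrow> eqv u' v' \<Longrightarrow> eqv (u - u') (v - v')"
  using eqv_add[of u v "- u'" "- v'"] eqv_sc[of u' v' "-1"] by (simp add: sc_minus1)

lemma eqv_N: "eqv u v \<Longrightarrow> N u = N v"
  unfolding eqv_def
  using N_triangle[of "u - v" v] N_triangle[of "v - u" u] N_commute[of u v] V_diff
  by (intro antisym) auto

text \<open>Linearity is asked only up to \<open>eqv\<close>: resolvents and limits below are chosen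
  representatives, and a choice need not respect addition exactly.\<close>

definition blin :: "real \<Rightarrow> ('v \<Rightarrow> 'v) \<Rightarrow> bool" where
  "blin C S \<longleftrightarrow> (\<forall>u\<in>V. S u \<in> V) \<and>
     (\<forall>u\<in>V. \<forall>v\<in>V. \<forall>c d. eqv (S (sc c u + sc d v)) (sc c (S u) + sc d (S v))) \<and>
     (\<forall>u\<in>V. N (S u) \<le> C * N u)"

lemma blinD:
  assumes "blin C S" "u \<in> V"
  shows "S u \<in> V" "N (S u) \<le> C * N u"
  using assms by (auto simp: blin_def)

lemma blin_diff: "blin C S \<Longrightarrow> u \<in> V \<Longrightarrow> v \<in> V \<Longrightarrow> eqv (S (u - v)) (S u - S v)"
  unfolding blin_def by (metis add_uminus_conv_diff sc_minus1 scale_one)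

lemma blin_add: "blin C S \<Longrightarrow> u \<in> V \<Longrightarrow> v \<in> V \<Longrightarrow> eqv (S (u + v)) (S u + S v)"
  unfolding blin_def by (metis scale_one)

lemma blin_sc: "blin C S \<Longrightarrow> u \<in> V \<Longrightarrow> eqv (S (sc c u)) (sc c (S u))"
  unfolding blin_def by (metis add.right_neutral scale_zero_left)

lemma blin_N_diff:
  "blin C S \<Longrightarrow> u \<in> V \<Longrightarrow> v \<in> V \<Longrightarrow> N (S u - S v) \<le> C * N (u - v)"
  using blin_diff[of C S u v] eqv_N[of "S (u - v)" "S u - S v"] blinD(2)[of C S "u - v"] V_diff
  by simp

text \<open>A bound sends null differences to null differences, so such maps act on classes. This
  justifies rewriting with \<open>eqv\<close> under \<open>J\<close> and its powers.\<close>

lemma blin_eqv: "blin C S \<Longrightarrow> eqv u v \<Longrightarrow> eqv (S u) (S v)"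
  using blin_N_diff[of C S u v] N_nonneg[of "S u - S v"] V_diff[of "S u" "S v"]
  by (auto simp: eqv_def blinD)

lemma blin_comp:
  assumes S: "blin C S" and S': "blin C' S'" and "0 \<le> C"
  shows "blin (C * C') (\<lambda>u. S (S' u))"
  unfolding blin_def
proof (intro conjI ballI allI)
  fix u assume u: "u \<in> V"
  show "S (S' u) \<in> V" using S S' u by (simp add: blinD)
  have "N (S (S' u)) \<le> C * N (S' u)" using S S' u by (simp add: blinD)
  also have "\<dots> \<le> C * (C' * N u)"
    using S' u \<open>0 \<le> C\<close> by (simp add: blinD mult_left_mono)
  finally show "N (S (S' u)) \<le> C * C' * N u" by simp
  fix v c d assume v: "v \<in> V"
  have "eqv (S (S' (sc c u + sc d v))) (S (sc c (S' u) + sc d (S' v)))"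
    using S' u v by (intro blin_eqv[OF S]) (simp add: blin_def)
  also have "eqv \<dots> (sc c (S (S' u)) + sc d (S (S' v)))"
    using S S' u v by (simp add: blin_def)
  finally show "eqv (S (S' (sc c u + sc d v))) (sc c (S (S' u)) + sc d (S (S' v)))" .
qed

lemma blin_funpow:
  assumes "blin C S" "0 \<le> C"
  shows "blin (C ^ n) (S ^^ n)"
proof (induction n)
  case 0
  show ?case by (simp add: blin_def eqv_refl V_rules)
next
  case (Suc n)
  then show ?case using blin_comp[OF assms(1) Suc assms(2)] by (simp add: comp_def)
qed

section \<open>The resolvent and the error of implicit Euler steps\<close>

lemma Gr_diff: "(u, w) \<in> Gr \<Longrightarrow> (u', w') \<in> Gr \<Longrightarrow> (u - u', w - w') \<in> Gr"
  using Gr_add[of u w "- u'" "- w'"] Gr_sc[of u' w' "-1"] by (simp add: sc_minus1)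

text \<open>The resolvent, which is one implicit Euler step of length \<open>h\<close>. It is a
  choice because the solution is determined only up to \<open>eqv\<close>, see
  \<open>J_unique\<close>.\<close>

definition J :: "real \<Rightarrow> 'v \<Rightarrow> 'v" where
  "J h v = (SOME u. \<exists>w. (u, w) \<in> Gr \<and> u - sc (complex_of_real h) w = v)"

lemma J_Gr:
  assumes h: "0 < h" "h \<le> h0" and v: "v \<in> V"
  shows "(J h v, sc (complex_of_real (1 / h)) (J h v - v)) \<in> Gr"
proof -
  obtain w where w: "(J h v, w) \<in> Gr" "J h v - sc (complex_of_real h) w = v"
    using someI_ex[OF surj[OF h v]] unfolding J_def by blast
  have "sc (complex_of_real (1 / h)) (J h v - v) = sc (complex_of_real (1 / h)) (sc (complex_of_real h) w)"
    using w(2) by (metis add_diff_cancel_left' diff_add_cancel diff_eq_eq)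
  also have "\<dots> = w" using h by (simp add: scale_scale flip: of_real_mult)
  finally show ?thesis using w(1) by simp
qed

lemma J_V: "0 < h \<Longrightarrow> h \<le> h0 \<Longrightarrow> v \<in> V \<Longrightarrow> J h v \<in> V"
  using J_Gr Gr_V by blast

lemma sc_cancel: "h > 0 \<Longrightarrow> sc (complex_of_real h) (sc (complex_of_real (1 / h)) u) = u"
  by (simp add: scale_scale flip: of_real_mult)

text \<open>The difference of two solutions belongs to the graph with right-hand side zero, so
  \<open>diss\<close> bounds its seminorm by zero.\<close>

lemma J_unique:
  assumes h: "0 < h" "h \<le> h0" and uw: "(u, w) \<in> Gr"
  shows "eqv (J h (u - sc (complex_of_real h) w)) u"
proof -
  define v where "v = u - sc (complex_of_real h) w"
  have V: "u \<in> V" "w \<in> V" "v \<in> V" using Gr_V[OF uw] by (auto simp: v_def V_rules)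
  have "(J h v - u, sc (complex_of_real (1 / h)) (J h v - v) - w) \<in> Gr"
    by (rule Gr_diff[OF J_Gr[OF h V(3)] uw])
  from diss[OF this h] have "N (J h v - u) \<le> 0"
    using h(1) by (simp add: scale_right_diff_distrib sc_cancel, simp add: v_def)
  then show ?thesis using N_nonneg[of "J h v - u"] V J_V[OF h V(3)] V_diff
    by (auto simp: eqv_def v_def)
qed

lemma J_blin:
  assumes h: "0 < h" "h \<le> h0"
  shows "blin (exp (\<omega> * h)) (J h)"
  unfolding blin_def
proof (intro conjI ballI allI)
  fix u assume u: "u \<in> V"
  show "J h u \<in> V" by (rule J_V[OF h u])
  show "N (J h u) \<le> exp (\<omega> * h) * N u"
    using diss[OF J_Gr[OF h u] h] h by (simp add: sc_cancel)
  fix v c d assume v: "v \<in> V"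
  \<comment> \<open>The combination of the two solutions solves the equation for the combined data,
    and uniqueness turns this into linearity.\<close>
  have "(sc c (J h u) + sc d (J h v),
        sc c (sc (complex_of_real (1 / h)) (J h u - u)) +
        sc d (sc (complex_of_real (1 / h)) (J h v - v))) \<in> Gr"
    by (intro Gr_add Gr_sc J_Gr h u v)
  from J_unique[OF h this]
  moreover have "sc (complex_of_real h) (sc b (sc (complex_of_real (1 / h)) y)) = sc b y" for b y
    by (subst scale_left_commute) (simp only: sc_cancel[OF h(1)])
  ultimately have "eqv (J h (sc c (J h u) + sc d (J h v) -
      (sc c (J h u - u) + sc d (J h v - v)))) (sc c (J h u) + sc d (J h v))"
    by (simp only: scale_right_distrib)
  moreover have "sc c (J h u) + sc d (J h v) - (sc c (J h u - u) + sc d (J h v - v)) = sc c u + sc d v"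
    by (simp add: scale_right_diff_distrib)
  ultimately show "eqv (J h (sc c u + sc d v)) (sc c (J h u) + sc d (J h v))"
    by simp
qed

lemma J_funpow_blin:
  assumes h: "0 < h" "h \<le> h0"
  shows "blin (exp (\<omega> * (h * n))) (J h ^^ n)"
  using blin_funpow[OF J_blin[OF h], of n]
  by (simp add: exp_of_nat_mult[symmetric] ac_simps)

text \<open>Uniqueness lets \<open>u\<close> be written as \<open>J h\<close> applied to
  \<open>u - sc (complex_of_real h) w\<close>; subtracting leaves \<open>J h\<close> of the multiple
  of \<open>w\<close>.\<close>

lemma J_minus_id:
  assumes h: "0 < h" "h \<le> h0" and uw: "(u, w) \<in> Gr"
  shows "eqv (J h u - u) (sc (complex_of_real h) (J h w))"
proof -
  have V: "u \<in> V" "w \<in> V" using Gr_V[OF uw] by auto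
  note b = J_blin[OF h]
  have "eqv (J h u - u) (J h u - J h (u - sc (complex_of_real h) w))"
    by (intro eqv_diff eqv_refl eqv_sym[OF J_unique] J_V h uw V)
  also have "eqv \<dots> (J h u - (J h u - J h (sc (complex_of_real h) w)))"
    by (intro eqv_diff eqv_refl blin_diff[OF b] J_V h V V_rules)
  also have "\<dots> = J h (sc (complex_of_real h) w)" by simp
  also have "eqv \<dots> (sc (complex_of_real h) (J h w))"
    by (intro blin_sc[OF b] V)
  finally show ?thesis .
qed

lemma N_J_minus_id:
  assumes h: "0 < h" "h \<le> h0" and uw: "(u, w) \<in> Gr"
  shows "N (J h u - u) \<le> h * exp (\<omega> * h) * N w"
  using eqv_N[OF J_minus_id[OF assms]] N_sc[of "J h w" "complex_of_real h"] J_V[OF h, of w]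
    Gr_V[OF uw] blinD(2)[OF J_blin[OF h], of w] h
  by simp

text \<open>The \<open>m\<close> increments telescope. Each is a power of \<open>J h\<close> applied
  to \<open>J h u - u\<close>, which is of order \<open>h\<close> on the domain.\<close>

lemma N_J_funpow_diff:
  assumes h: "0 < h" "h \<le> h0" and uw: "(u, w) \<in> Gr"
  shows "N ((J h ^^ (n + m)) u - (J h ^^ n) u) \<le> m * h * exp (\<omega> * (h * real (n + m))) * N w"
proof (induction m)
  case 0
  then show ?case by simp
next
  case (Suc m)
  have V: "u \<in> V" "w \<in> V" using Gr_V[OF uw] by auto
  note bl = J_funpow_blin[OF h]
  have nw: "0 \<le> N w" using V N_nonneg by blast
  have PV: "(J h ^^ k) u \<in> V" for k using blinD(1)[OF bl V(1)] .
  have "N ((J h ^^ (n + Suc m)) u - (J h ^^ (n + m)) u)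
      = N ((J h ^^ (n + m)) (J h u) - (J h ^^ (n + m)) u)"
    by (simp add: funpow_swap1)
  also have "\<dots> \<le> exp (\<omega> * (h * real (n + m))) * N (J h u - u)"
    by (intro blin_N_diff[OF bl] J_V h V)
  also have "\<dots> \<le> exp (\<omega> * (h * real (n + m))) * (h * exp (\<omega> * h) * N w)"
    by (intro mult_left_mono N_J_minus_id[OF h uw]) simp
  also have "\<dots> = h * exp (\<omega> * (h * (n + Suc m))) * N w"
    by (simp add: exp_add[symmetric] algebra_simps)
  finally have 1: "N ((J h ^^ (n + Suc m)) u - (J h ^^ (n + m)) u) \<le> h * exp (\<omega> * (h * (n + Suc m))) * N w" .
  have "m * h * exp (\<omega> * (h * (n + m))) * N w \<le> m * h * exp (\<omega> * (h * (n + Suc m))) * N w"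
    using h nw \<omega>_nonneg by (intro mult_right_mono mult_left_mono) (auto intro!: mult_left_mono)
  with Suc.IH 1 N_tri3[of "(J h ^^ (n + Suc m)) u" "(J h ^^ (n + m)) u" "(J h ^^ n) u", OF PV PV PV]
  show ?case by (simp add: algebra_simps)
qed

text \<open>Compares one step of length \<open>2 * h\<close> with two of length \<open>h\<close>.
  Put a = \<open>J h v\<close> and b = \<open>J h a\<close>. The graph contains b with value (b - a)
  / h, hence b minus \<open>2 * h\<close> times this value is 2 a - b, so b is itself the image of 2
  a - b under \<open>J (2 * h)\<close>. Subtracting leaves the second difference b - 2 a + v inside
  \<open>J (2 * h)\<close>.\<close>

lemma J_double:
  assumes h: "0 < h" "2 * h \<le> h0" and v: "v \<in> V"
  shows "eqv (J (2 * h) v - J h (J h v)) (J (2 * h) (J h (J h v) - sc 2 (J h v) + v))"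
proof -
  have h': "0 < h" "h \<le> h0" and 2: "0 < 2 * h" "2 * h \<le> h0" using h by auto
  let ?a = "J h v" let ?b = "J h (J h v)"
  have V: "?a \<in> V" "?b \<in> V" using J_V h' v by auto
  note b = J_blin[OF 2]
  have "(?b, sc (complex_of_real (1 / h)) (?b - ?a)) \<in> Gr" by (intro J_Gr h' V)
  from J_unique[OF 2 this] have "eqv (J (2 * h) (?b - sc 2 (sc (complex_of_real h) (sc (complex_of_real (1 / h)) (?b - ?a))))) ?b"
    by (simp only: of_real_mult scale_scale of_real_numeral mult.assoc)
  then have *: "eqv (J (2 * h) (sc 2 ?a - ?b)) ?b"
    unfolding sc_cancel[OF h(1)] scale_right_diff_distrib
    using scale_left_distrib[of 1 1 ?b] by (simp add: algebra_simps)
  have "eqv (J (2 * h) v - ?b) (J (2 * h) v - J (2 * h) (sc 2 ?a - ?b))"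
    by (intro eqv_diff eqv_refl eqv_sym[OF *] J_V 2 v)
  also have "eqv \<dots> (J (2 * h) (v - (sc 2 ?a - ?b)))"
    by (intro eqv_sym[OF blin_diff[OF b]] v V V_rules)
  finally show ?thesis by (simp add: algebra_simps)
qed

text \<open>Formally the second difference is the square of \<open>J h - I\<close> applied to
  \<open>u\<close>. Each factor contributes \<open>h\<close> and one application of the operator,
  which is why \<open>u\<close> must lie in the domain of the square.\<close>

lemma N_second_difference:
  assumes h: "0 < h" "h \<le> h0" and uw: "(u, w) \<in> Gr" and wz: "(w, z) \<in> Gr"
  shows "N (J h (J h u) - sc 2 (J h u) + u) \<le> h\<^sup>2 * exp (\<omega> * (2 * h)) * N z"
proof -
  have V: "u \<in> V" "w \<in> V" "z \<in> V" using Gr_V[OF uw] Gr_V[OF wz] by auto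
  note b = J_blin[OF h] and JV = J_V[OF h]
  let ?h = "complex_of_real h"
  have "J h (J h u) - sc 2 (J h u) + u = (J h (J h u) - J h u) - (J h u - u)"
    using scale_left_distrib[of 1 1 "J h u"] by (simp add: algebra_simps)
  also have "eqv \<dots> (J h (J h u - u) - sc ?h (J h w))"
    by (intro eqv_diff J_minus_id h uw eqv_sym[OF blin_diff[OF b]] JV V)
  also have "eqv \<dots> (J h (sc ?h (J h w)) - sc ?h (J h w))"
    by (intro eqv_diff eqv_refl blin_eqv[OF b] J_minus_id h uw V_rules JV V)
  also have "eqv \<dots> (sc ?h (J h (J h w)) - sc ?h (J h w))"
    by (intro eqv_diff eqv_refl blin_sc[OF b] V_rules JV V)
  also have "\<dots> = sc ?h (J h (J h w) - J h w)" by (simp add: scale_right_diff_distrib)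
  also have "eqv \<dots> (sc ?h (J h (J h w - w)))"
    by (intro eqv_sc eqv_sym[OF blin_diff[OF b]] JV V)
  finally have "N (J h (J h u) - sc 2 (J h u) + u) = N (sc ?h (J h (J h w - w)))"
    by (rule eqv_N)
  also have "\<dots> = h * N (J h (J h w - w))"
    using h N_sc[OF JV[OF V_diff[OF JV[OF V(2)] V(2)]], of ?h] by simp
  also have "\<dots> \<le> h * (exp (\<omega> * h) * N (J h w - w))"
    using h by (intro mult_left_mono blinD[OF b]) (auto intro!: V_rules JV V)
  also have "\<dots> \<le> h * (exp (\<omega> * h) * (h * exp (\<omega> * h) * N z))"
    using h by (intro mult_left_mono N_J_minus_id wz) auto
  also have "\<dots> = h\<^sup>2 * exp (\<omega> * (2 * h)) * N z"
    by (simp add: power2_eq_square exp_add[symmetric] algebra_simps)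
  finally show ?thesis .
qed

lemma N_second_difference_funpow:
  assumes h: "0 < h" "h \<le> h0" and uw: "(u, w) \<in> Gr" and wz: "(w, z) \<in> Gr"
    and v: "v = (J h ^^ m) u"
  shows "N (J h (J h v) - sc 2 (J h v) + v) \<le> h\<^sup>2 * exp (\<omega> * (h * (real m + 2))) * N z"
proof -
  have V: "u \<in> V" "w \<in> V" "z \<in> V" using Gr_V[OF uw] Gr_V[OF wz] by auto
  note b = J_funpow_blin[OF h, of m] and JV = J_V[OF h]
  have JV': "J h u \<in> V" "J h (J h u) \<in> V" "sc 2 (J h u) \<in> V" "J h (J h u) - sc 2 (J h u) \<in> V"
    "J h (J h u) - sc 2 (J h u) + u \<in> V"
    using JV V V_rules by auto
  have PV: "(J h ^^ m) (J h (J h u)) \<in> V" "(J h ^^ m) u \<in> V"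
    using blinD(1)[OF b] JV' V by auto
  let ?P = "J h ^^ m"
  have eq: "J h (J h v) - sc 2 (J h v) + v = ?P (J h (J h u)) - sc 2 (?P (J h u)) + ?P u"
    unfolding v funpow_swap1[of "J h" m] by (rule refl)
  have "eqv (?P (J h (J h u)) - sc 2 (?P (J h u)) + ?P u) (?P (J h (J h u)) - ?P (sc 2 (J h u)) + ?P u)"
    by (rule eqv_add[OF eqv_diff[OF eqv_refl eqv_sym[OF blin_sc[OF b]]] eqv_refl]) (fact PV JV')+
  also have "eqv \<dots> (?P (J h (J h u) - sc 2 (J h u)) + ?P u)"
    by (rule eqv_add[OF eqv_sym[OF blin_diff[OF b]] eqv_refl]) (fact PV JV')+
  also have "eqv \<dots> (?P (J h (J h u) - sc 2 (J h u) + u))"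
    by (rule eqv_sym[OF blin_add[OF b]]) (fact JV' V)+
  finally have "N (J h (J h v) - sc 2 (J h v) + v) = N (?P (J h (J h u) - sc 2 (J h u) + u))"
    unfolding eq by (rule eqv_N)
  also have "\<dots> \<le> exp (\<omega> * (h * m)) * N (J h (J h u) - sc 2 (J h u) + u)"
    by (rule blinD(2)[OF b]) (fact JV')
  also have "\<dots> \<le> exp (\<omega> * (h * m)) * (h\<^sup>2 * exp (\<omega> * (2 * h)) * N z)"
    by (intro mult_left_mono N_second_difference[OF h uw wz]) auto
  also have "\<dots> = h\<^sup>2 * exp (\<omega> * (h * (real m + 2))) * N z"
    by (simp add: exp_add[symmetric] algebra_simps)
  finally show ?thesis .
qed

text \<open>Stability carries the accumulated error through one more coarse step, and
  \<open>J_double\<close> adds a local error of order \<open>h\<^sup>2\<close>. The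
  \<open>+ 2\<close> in the exponent covers the two steps inside the second difference.\<close>

lemma N_step_halving:
  assumes h: "0 < h" "2 * h \<le> h0" and uw: "(u, w) \<in> Gr" and wz: "(w, z) \<in> Gr"
  shows "N ((J (2 * h) ^^ n) u - (J h ^^ (2 * n)) u) \<le> n * h\<^sup>2 * exp (\<omega> * (h * (2 * real n + 2))) * N z"
proof (induction n)
  case 0
  then show ?case by simp
next
  case (Suc n)
  have h': "0 < h" "h \<le> h0" and 2: "0 < 2 * h" "2 * h \<le> h0" using h by auto
  have V: "u \<in> V" "w \<in> V" "z \<in> V" using Gr_V[OF uw] Gr_V[OF wz] by auto
  let ?v = "(J h ^^ (2 * n)) u" and ?q = "(J (2 * h) ^^ n) u"
  have vV: "?v \<in> V" and qV: "?q \<in> V"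
    using blinD(1)[OF J_funpow_blin] h' 2 V by auto
  have sV: "J h (J h ?v) - sc 2 (J h ?v) + ?v \<in> V" by (intro V_rules J_V h' vV)
  have "N (J (2 * h) ?q - J (2 * h) ?v) \<le> exp (\<omega> * (2 * h)) * N (?q - ?v)"
    by (rule blin_N_diff[OF J_blin[OF 2] qV vV])
  also have "\<dots> \<le> exp (\<omega> * (2 * h)) * (n * h\<^sup>2 * exp (\<omega> * (h * (2 * real n + 2))) * N z)"
    using Suc.IH by (intro mult_left_mono) (simp_all add: add.commute)
  also have "\<dots> = n * h\<^sup>2 * exp (\<omega> * (h * (2 * Suc n + 2))) * N z"
    by (simp add: exp_add[symmetric] algebra_simps)
  finally have 1: "N (J (2 * h) ?q - J (2 * h) ?v) \<le> n * h\<^sup>2 * exp (\<omega> * (h * (2 * Suc n + 2))) * N z" .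
  have "N (J (2 * h) ?v - J h (J h ?v)) = N (J (2 * h) (J h (J h ?v) - sc 2 (J h ?v) + ?v))"
    by (intro eqv_N J_double h vV)
  also have "\<dots> \<le> exp (\<omega> * (2 * h)) * N (J h (J h ?v) - sc 2 (J h ?v) + ?v)"
    by (rule blinD[OF J_blin[OF 2] sV])
  also have "\<dots> \<le> exp (\<omega> * (2 * h)) * (h\<^sup>2 * exp (\<omega> * (h * (real (2 * n) + 2))) * N z)"
    using N_second_difference_funpow[OF h' uw wz refl, of "2 * n"] by (intro mult_left_mono) (simp_all add: add.commute)
  also have "\<dots> = h\<^sup>2 * exp (\<omega> * (h * (2 * Suc n + 2))) * N z"
    by (simp add: exp_add[symmetric] algebra_simps)
  finally have 2: "N (J (2 * h) ?v - J h (J h ?v)) \<le> h\<^sup>2 * exp (\<omega> * (h * (2 * Suc n + 2))) * N z" .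
  have "N (J (2 * h) ?q - J h (J h ?v)) \<le> N (J (2 * h) ?q - J (2 * h) ?v) + N (J (2 * h) ?v - J h (J h ?v))"
    using h' h by (intro N_tri3 J_V qV vV) auto
  with 1 2 show ?case by (simp add: algebra_simps)
qed

text \<open>Implicit Euler with dyadic steps: only \<open>J (2 * h)\<close> and \<open>J h ^^ 2\<close> have to be compared, and
  the errors of successive halvings are summable on the domain of the square.\<close>

definition k0 :: nat where "k0 = (SOME k. (1 / 2) ^ k \<le> h0)"

lemma k0: "(1 / 2 :: real) ^ k0 \<le> h0"
proof -
  have "\<exists>k. (1 / 2 :: real) ^ k < h0" by (rule real_arch_pow_inv[OF h0_pos]) simp
  then have "\<exists>k. (1 / 2 :: real) ^ k \<le> h0" by (meson less_imp_le)
  then show ?thesis unfolding k0_def by (rule someI_ex)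
qed

text \<open>The shift by \<open>k0\<close> keeps every step length at most \<open>h0\<close>, so
  that \<open>diss\<close> and \<open>surj\<close> apply for all \<open>k\<close>.\<close>

definition e :: "nat \<Rightarrow> real" where "e k = (1 / 2) ^ (k + k0)"

lemma e_pos: "0 < e k" by (simp add: e_def)

lemma e_le: "e k \<le> h0"
proof -
  have "e k \<le> (1 / 2) ^ k0" unfolding e_def by (intro power_decreasing) auto
  then show ?thesis using k0 by linarith
qed

lemma e_le1: "e k \<le> 1" by (simp add: e_def power_le_one)

lemma e_Suc: "e k = 2 * e (Suc k)" by (simp add: e_def)

lemma e_lim: "e \<longlonglongrightarrow> 0"
  unfolding e_def using LIMSEQ_ignore_initial_segment[OF LIMSEQ_power_zero[of "1 / 2 :: real"], of k0]
  by simp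

definition steps :: "nat \<Rightarrow> real \<Rightarrow> nat" where "steps k t = nat \<lfloor>t / e k\<rfloor>"

lemma steps_le: "0 \<le> t \<Longrightarrow> e k * steps k t \<le> t"
  using e_pos[of k] mult_right_mono[OF of_int_floor_le[of "t / e k"], of "e k"]
  by (simp add: steps_def mult.commute)

lemma steps_ge: "0 \<le> t \<Longrightarrow> t \<le> e k * steps k t + e k"
proof -
  assume "0 \<le> t"
  then have "t / e k \<le> real (steps k t) + 1" using e_pos[of k]
    by (simp add: steps_def)
  then show ?thesis using e_pos[of k] by (simp add: field_simps)
qed

lemma steps_lim: "0 \<le> t \<Longrightarrow> (\<lambda>k. e k * steps k t) \<longlonglongrightarrow> t"
proof (rule tendsto_sandwich[of "\<lambda>k. t - e k" _ _ "\<lambda>_. t"])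
  assume t: "0 \<le> t"
  show "\<forall>\<^sub>F k in sequentially. t - e k \<le> e k * real (steps k t)"
    using steps_ge[OF t] by (auto simp: algebra_simps)
  show "\<forall>\<^sub>F k in sequentially. e k * real (steps k t) \<le> t"
    using steps_le[OF t] by auto
  show "(\<lambda>k. t - e k) \<longlonglongrightarrow> t" using tendsto_diff[OF tendsto_const e_lim] by simp
qed simp

text \<open>The floor of \<open>2 * y\<close> is twice the floor of \<open>y\<close> or one more.
  Halving the step length may thus add a single extra step, which \<open>S_halving\<close> pays for
  separately.\<close>

lemma steps_Suc: "steps (Suc k) t = 2 * steps k t \<or> steps (Suc k) t = Suc (2 * steps k t)" if "0 \<le> t"
proof -
  define y where "y = t / e k"
  have y: "0 \<le> y" using that e_pos[of k] by (simp add: y_def)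
  have "t / e (Suc k) = 2 * y" using e_Suc[of k] e_pos[of "Suc k"] by (simp add: y_def)
  moreover have "\<lfloor>2 * y\<rfloor> = 2 * \<lfloor>y\<rfloor> \<or> \<lfloor>2 * y\<rfloor> = 2 * \<lfloor>y\<rfloor> + 1" by linarith
  ultimately show ?thesis using y unfolding steps_def y_def[symmetric]
    by (auto simp: nat_mult_distrib nat_add_distrib)
qed

definition S :: "nat \<Rightarrow> real \<Rightarrow> 'v \<Rightarrow> 'v" where "S k t = J (e k) ^^ steps k t"

lemma S_blin: "0 \<le> t \<Longrightarrow> blin (exp (\<omega> * t)) (S k t)"
proof -
  assume t: "0 \<le> t"
  have b: "blin (exp (\<omega> * (e k * steps k t))) (S k t)"
    unfolding S_def by (intro J_funpow_blin e_pos e_le)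
  have "exp (\<omega> * (e k * steps k t)) \<le> exp (\<omega> * t)"
    using steps_le[OF t] \<omega>_nonneg by (simp add: mult_left_mono)
  then show ?thesis using b N_nonneg unfolding blin_def by (meson mult_right_mono order_trans)
qed

lemmas S_V = blinD(1)[OF S_blin]

text \<open>About \<open>t / e k\<close> steps with local error of order \<open>e k\<close> squared
  give the term with \<open>N z\<close>; the term with \<open>N w\<close> is the possible extra
  step.\<close>

lemma S_halving:
  assumes t: "0 \<le> t" and uw: "(u, w) \<in> Gr" and wz: "(w, z) \<in> Gr"
  shows "N (S k t u - S (Suc k) t u) \<le> e k * (exp (\<omega> * (t + 1)) * (t * N z + N w))"
proof -
  have V: "u \<in> V" "w \<in> V" "z \<in> V" using Gr_V[OF uw] Gr_V[OF wz] by auto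
  have nn: "0 \<le> N w" "0 \<le> N z" using V N_nonneg by auto
  let ?h = "e (Suc k)" and ?n = "steps k t"
  have h: "0 < ?h" "2 * ?h \<le> h0" "?h \<le> h0" using e_pos e_le e_Suc[symmetric] by auto
  have hn: "2 * ?h * ?n \<le> t" using steps_le[OF t, of k] e_Suc[of k] by simp
  have h2: "?h \<le> 1/2" using e_Suc[of k] e_le1[of k] by simp
  have hn': "?h * (2 * real ?n + 2) \<le> t + 1" using hn h2 by (simp add: algebra_simps)
  have hn'': "?h * (2 * real ?n + 1) \<le> t + 1" using hn h2 by (simp add: algebra_simps)
  have ek: "J (e k) = J (2 * ?h)" using e_Suc[of k] by simp
  have PV: "(J ?h ^^ m) u \<in> V" for m using blinD(1)[OF J_funpow_blin] h V by auto
  have ex: "exp (\<omega> * (?h * (2 * real ?n + 2))) \<le> exp (\<omega> * (t + 1))"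
    using hn' \<omega>_nonneg by (simp add: mult_left_mono)
  have "N (S k t u - (J ?h ^^ (2 * ?n)) u) \<le> ?n * ?h\<^sup>2 * exp (\<omega> * (?h * (2 * real ?n + 2))) * N z"
    unfolding S_def ek by (rule N_step_halving[OF h(1,2) uw wz])
  also have "\<dots> \<le> (t * e k) * exp (\<omega> * (t + 1)) * N z"
  proof (rule mult_right_mono[OF mult_mono[OF _ ex]])
    have "?n * ?h\<^sup>2 = (2 * ?h * ?n) * (?h / 2)" by (simp add: power2_eq_square)
    also have "\<dots> \<le> t * e k" using hn h e_Suc[of k] t by (intro mult_mono) auto
    finally show "?n * ?h\<^sup>2 \<le> t * e k" .
  qed (use nn t e_pos[of k] in auto)
  finally have 1: "N (S k t u - (J ?h ^^ (2 * ?n)) u) \<le> e k * exp (\<omega> * (t + 1)) * (t * N z)"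
    by (simp add: algebra_simps)
  have 2: "N ((J ?h ^^ (2 * ?n)) u - S (Suc k) t u) \<le> e k * exp (\<omega> * (t + 1)) * N w"
  proof (cases "steps (Suc k) t = 2 * ?n")
    case True
    then show ?thesis unfolding S_def using e_pos[of k] nn by simp
  next
    case False
    then have s: "steps (Suc k) t = 2 * ?n + 1" using steps_Suc[OF t, of k] by auto
    have "N ((J ?h ^^ (2 * ?n)) u - S (Suc k) t u) = N (S (Suc k) t u - (J ?h ^^ (2 * ?n)) u)"
      unfolding S_def by (intro N_commute PV)
    also have "\<dots> \<le> 1 * ?h * exp (\<omega> * (?h * (2 * real ?n + 1))) * N w"
      unfolding S_def s using N_J_funpow_diff[OF h(1,3) uw, of "2 * ?n" 1] by (simp add: add.commute)
    also have "\<dots> \<le> e k * exp (\<omega> * (t + 1)) * N w"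
      using e_Suc[of k] h hn'' \<omega>_nonneg nn
      by (intro mult_right_mono mult_mono) (auto intro!: mult_left_mono)
    finally show ?thesis .
  qed
  have "N (S k t u - S (Suc k) t u) \<le> N (S k t u - (J ?h ^^ (2 * ?n)) u) + N ((J ?h ^^ (2 * ?n)) u - S (Suc k) t u)"
    by (intro N_tri3 PV S_V t V)
  then show ?thesis using 1 2 by (simp add: algebra_simps)
qed

text \<open>For \<open>u\<close> in the domain, \<open>J h u\<close> lies in the domain of the
  square: the value there is a multiple of \<open>J h u - u\<close>, again a domain element. As
  \<open>h\<close> tends to zero, \<open>J h u\<close> tends to \<open>u\<close>.\<close>

lemma dense2:
  assumes "v \<in> V" "\<epsilon> > 0"
  shows "\<exists>u w z. (u, w) \<in> Gr \<and> (w, z) \<in> Gr \<and> N (v - u) < \<epsilon>"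
proof -
  obtain u w where uw: "(u, w) \<in> Gr" and 1: "N (v - u) < \<epsilon> / 2"
    using dense[OF assms(1), of "\<epsilon> / 2"] assms(2) by auto
  have V: "u \<in> V" "w \<in> V" using Gr_V[OF uw] by auto
  have lim: "(\<lambda>k. e k * exp (\<omega> * h0) * N w) \<longlonglongrightarrow> 0 * exp (\<omega> * h0) * N w"
    by (intro tendsto_intros e_lim)
  have "\<forall>\<^sub>F k in sequentially. e k * exp (\<omega> * h0) * N w < \<epsilon> / 2"
    using lim assms(2) by (intro order_tendstoD(2)) auto
  then obtain k where k: "e k * exp (\<omega> * h0) * N w < \<epsilon> / 2"
    using eventually_happens'[OF sequentially_bot] by blast
  let ?h = "e k" let ?w = "sc (complex_of_real (1 / ?h)) (J ?h u - u)"
  have "N (J ?h u - u) \<le> ?h * exp (\<omega> * ?h) * N w" by (intro N_J_minus_id e_pos e_le uw)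
  also have "\<dots> \<le> e k * exp (\<omega> * h0) * N w"
    using e_pos[of k] e_le[of k] N_nonneg[OF V(2)] \<omega>_nonneg
    by (intro mult_right_mono mult_left_mono) (auto intro!: mult_left_mono)
  finally have "N (J ?h u - u) < \<epsilon> / 2" using k by linarith
  moreover have "N (v - J ?h u) \<le> N (v - u) + N (u - J ?h u)" by (intro N_tri3 J_V e_pos e_le V assms)
  ultimately have "N (v - J ?h u) < \<epsilon>" using 1 N_commute[of u "J ?h u"] J_V[OF e_pos e_le V(1), of k] V by auto
  moreover have "(J ?h u, ?w) \<in> Gr" by (intro J_Gr e_pos e_le V)
  moreover have "(?w, sc (complex_of_real (1 / ?h)) (?w - w)) \<in> Gr"
    by (intro Gr_sc Gr_diff uw) fact
  ultimately show ?thesis by blast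
qed

lemma S_Cauchy_smooth:
  assumes t: "0 \<le> t" and uw: "(u, w) \<in> Gr" and wz: "(w, z) \<in> Gr" and "\<epsilon> > 0"
  shows "\<exists>n0. \<forall>m\<ge>n0. \<forall>n\<ge>n0. N (S m t u - S n t u) < \<epsilon>"
proof -
  define C where "C = exp (\<omega> * (t + 1)) * (t * N z + N w)"
  have V: "u \<in> V" "w \<in> V" "z \<in> V" using Gr_V[OF uw] Gr_V[OF wz] by auto
  have C: "0 \<le> C" unfolding C_def using V N_nonneg t by auto
  note SV = S_V[OF t V(1)]
  \<comment> \<open>Because \<open>e k = 2 * e (Suc k)\<close>, the halving error
    \<open>C * e k\<close> equals \<open>2 * C * e k - 2 * C * e (Suc k)\<close>, so the sum of
    errors telescopes.\<close>
  have 1: "N (S m t u - S (m + j) t u) \<le> 2 * C * e m - 2 * C * e (m + j)" for m j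
  proof (induction j)
    case 0
    then show ?case by simp
  next
    case (Suc j)
    have "N (S (m + j) t u - S (Suc (m + j)) t u) \<le> e (m + j) * C"
      unfolding C_def by (rule S_halving[OF t uw wz])
    then show ?case using Suc N_tri3[of "S m t u" "S (m + j) t u" "S (Suc (m + j)) t u", OF SV SV SV] e_Suc[of "m + j"]
      by (simp add: algebra_simps)
  qed
  have "(\<lambda>k. 4 * C * e k) \<longlonglongrightarrow> 4 * C * 0" by (intro tendsto_intros e_lim)
  then have "\<forall>\<^sub>F k in sequentially. 4 * C * e k < \<epsilon>" using \<open>\<epsilon> > 0\<close> by (intro order_tendstoD(2)) auto
  then obtain n0 where n0: "4 * C * e n0 < \<epsilon>" using eventually_happens'[OF sequentially_bot] by blast
  have 2: "N (S n0 t u - S m t u) \<le> 2 * C * e n0" if "m \<ge> n0" for m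
  proof -
    have "0 \<le> 2 * C * e m" using C e_pos[of m] by simp
    with 1[of n0 "m - n0"] that show ?thesis by simp
  qed
  show ?thesis
  proof (intro exI allI impI)
    fix m n assume "m \<ge> n0" "n \<ge> n0"
    then show "N (S m t u - S n t u) < \<epsilon>"
      using 2[of m] 2[of n] n0 N_tri3[of "S m t u" "S n0 t u" "S n t u", OF SV SV SV] N_commute[of "S m t u" "S n0 t u", OF SV SV] by simp
  qed
qed

text \<open>The bound \<open>exp (\<omega> * t)\<close> is uniform in \<open>k\<close>, so
  convergence extends from the dense domain of the square to all of \<open>V\<close>.\<close>

lemma S_Cauchy:
  assumes t: "0 \<le> t" and v: "v \<in> V" and "\<epsilon> > 0"
  shows "\<exists>n0. \<forall>m\<ge>n0. \<forall>n\<ge>n0. N (S m t v - S n t v) < \<epsilon>"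
proof -
  define d where "d = \<epsilon> / (3 * exp (\<omega> * t))"
  have d: "0 < d" "exp (\<omega> * t) * d = \<epsilon> / 3" using \<open>\<epsilon> > 0\<close> by (auto simp: d_def)
  obtain u w z where uw: "(u, w) \<in> Gr" and wz: "(w, z) \<in> Gr" and 1: "N (v - u) < d"
    using dense2[OF v d(1)] by blast
  have u: "u \<in> V" using Gr_V[OF uw] by auto
  note SV = S_V[OF t]
  obtain n0 where n0: "\<And>m n. m \<ge> n0 \<Longrightarrow> n \<ge> n0 \<Longrightarrow> N (S m t u - S n t u) < \<epsilon> / 3"
    using S_Cauchy_smooth[OF t uw wz, of "\<epsilon> / 3"] \<open>\<epsilon> > 0\<close> by auto
  have 2: "N (S m t v - S m t u) < \<epsilon> / 3" for m
  proof -
    have "N (S m t v - S m t u) \<le> exp (\<omega> * t) * N (v - u)" by (intro blin_N_diff[OF S_blin] t u v)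
    also have "\<dots> < exp (\<omega> * t) * d" using 1 by simp
    finally show ?thesis using d by simp
  qed
  show ?thesis
  proof (intro exI allI impI)
    fix m n assume "m \<ge> n0" "n \<ge> n0"
    then show "N (S m t v - S n t v) < \<epsilon>"
      using 2[of m] 2[of n] n0[of m n] N_tri3[of "S m t v" "S m t u" "S n t v", OF SV SV SV] N_tri3[of "S m t u" "S n t u" "S n t v", OF SV SV SV]
        N_commute[of "S n t v" "S n t u", OF SV SV] u v by simp
  qed
qed

section \<open>The limit semigroup\<close>

definition T :: "real \<Rightarrow> 'v \<Rightarrow> 'v" where
  "T t v = (SOME l. l \<in> V \<and> (\<lambda>k. N (S k t v - l)) \<longlonglongrightarrow> 0)"

lemma T_lim:
  assumes t: "0 \<le> t" and v: "v \<in> V"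
  shows "T t v \<in> V" "(\<lambda>k. N (S k t v - T t v)) \<longlonglongrightarrow> 0"
proof -
  have "\<exists>l. l \<in> V \<and> (\<lambda>k. N (S k t v - l)) \<longlonglongrightarrow> 0"
    using complete[of "\<lambda>k. S k t v", OF S_V[OF t v] S_Cauchy[OF t v]] by blast
  from someI_ex[OF this] show "T t v \<in> V" "(\<lambda>k. N (S k t v - T t v)) \<longlonglongrightarrow> 0"
    unfolding T_def by auto
qed

lemma conv_bound:
  assumes x: "\<And>k. x k \<in> V" "l \<in> V" "(\<lambda>k. N (x k - l)) \<longlonglongrightarrow> 0"
    and b: "\<And>k. N (x k) \<le> c k" "c \<longlonglongrightarrow> C"
  shows "N l \<le> C"
proof -
  have 1: "N l \<le> c k + N (x k - l)" for k
    using N_diff[of "x k" "x k - l"] x b(1)[of k] V_diff by simp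
  have "(\<lambda>k. c k + N (x k - l)) \<longlonglongrightarrow> C + 0" by (intro tendsto_intros b x)
  from LIMSEQ_le_const[OF this, of "N l"] show ?thesis using 1 by auto
qed

lemma conv_squeeze:
  assumes "\<And>k. x k \<in> V" "\<And>k. N (x k) \<le> c k" "c \<longlonglongrightarrow> 0"
  shows "(\<lambda>k. N (x k)) \<longlonglongrightarrow> 0"
  by (rule tendsto_sandwich[OF _ _ tendsto_const assms(3)]) (simp_all add: assms N_nonneg)

lemma conv_unique:
  assumes "\<And>k. x k \<in> V" "l \<in> V" "(\<lambda>k. N (x k - l)) \<longlonglongrightarrow> 0"
    and "l' \<in> V" "(\<lambda>k. N (x k - l')) \<longlonglongrightarrow> 0"
  shows "eqv l l'"
proof -
  have 1: "N (l - l') \<le> N (x k - l) + N (x k - l')" for k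
    using N_tri3[of l "x k" l'] N_commute[of l "x k"] assms by simp
  have "(\<lambda>k. N (x k - l) + N (x k - l')) \<longlonglongrightarrow> 0 + 0" by (intro tendsto_intros assms)
  from LIMSEQ_le_const[OF this, of "N (l - l')"] have "N (l - l') \<le> 0" using 1 by auto
  then show ?thesis using N_nonneg[of "l - l'"] assms V_diff by (auto simp: eqv_def)
qed

lemma T_blin:
  assumes t: "0 \<le> t"
  shows "blin (exp (\<omega> * t)) (T t)"
  unfolding blin_def
proof (intro conjI ballI allI)
  fix u assume u: "u \<in> V"
  show TV: "T t u \<in> V" by (rule T_lim[OF t u])
  show "N (T t u) \<le> exp (\<omega> * t) * N u"
    using conv_bound[OF S_V[OF t u] T_lim[OF t u], of "\<lambda>_. exp (\<omega> * t) * N u"]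
      blinD(2)[OF S_blin[OF t] u] by simp
  fix v c d assume v: "v \<in> V"
  let ?y = "sc c u + sc d v"
  have y: "?y \<in> V" by (intro V_rules u v)
  have TV': "sc c (T t u) + sc d (T t v) \<in> V" by (intro V_rules T_lim t u v)
  show "eqv (T t ?y) (sc c (T t u) + sc d (T t v))"
  proof (rule conv_unique[OF S_V[OF t y] T_lim[OF t y] TV'])
    let ?b = "\<lambda>k. cmod c * N (S k t u - T t u) + cmod d * N (S k t v - T t v)"
    show "(\<lambda>k. N (S k t ?y - (sc c (T t u) + sc d (T t v)))) \<longlonglongrightarrow> 0"
    proof (rule conv_squeeze[of _ ?b])
      fix k
      show "S k t ?y - (sc c (T t u) + sc d (T t v)) \<in> V" by (intro V_rules S_V T_lim t u v)
      have "eqv (S k t ?y - (sc c (T t u) + sc d (T t v)))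
         ((sc c (S k t u) + sc d (S k t v)) - (sc c (T t u) + sc d (T t v)))"
        using S_blin[OF t, of k] u v by (intro eqv_diff eqv_refl TV') (simp add: blin_def)
      also have "\<dots> = sc c (S k t u - T t u) + sc d (S k t v - T t v)"
        by (simp add: scale_right_diff_distrib)
      finally have "N (S k t ?y - (sc c (T t u) + sc d (T t v))) = N (sc c (S k t u - T t u) + sc d (S k t v - T t v))"
        by (rule eqv_N)
      also have "\<dots> \<le> N (sc c (S k t u - T t u)) + N (sc d (S k t v - T t v))"
        by (intro N_triangle V_rules S_V T_lim t u v)
      also have "\<dots> = ?b k"
        by (simp add: N_sc S_V T_lim t u v V_rules)
      finally show "N (S k t ?y - (sc c (T t u) + sc d (T t v))) \<le> ?b k" .
    next
      have "?b \<longlonglongrightarrow> cmod c * 0 + cmod d * 0" by (intro tendsto_intros T_lim t u v)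
      then show "?b \<longlonglongrightarrow> 0" by simp
    qed
  qed
qed

lemmas T_V = T_lim(1)

lemma eqv_by_density:
  assumes P: "blin C P" and Q: "blin C Q" and D: "\<And>u w. (u, w) \<in> Gr \<Longrightarrow> eqv (P u) (Q u)"
    and v: "v \<in> V" and C: "0 < C"
  shows "eqv (P v) (Q v)"
proof -
  have "N (P v - Q v) \<le> \<epsilon>" if "\<epsilon> > 0" for \<epsilon>
  proof -
    have "0 < \<epsilon> / (2 * C)" using that C by simp
    from dense[OF v this] obtain u w where uw: "(u, w) \<in> Gr" and *: "N (v - u) < \<epsilon> / (2 * C)"
      by blast
    have u: "u \<in> V" using Gr_V[OF uw] by auto
    have V: "P v \<in> V" "Q v \<in> V" "P u \<in> V" "Q u \<in> V" using P Q u v by (auto simp: blinD)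
    have "N (P v - Q v) \<le> N (P v - P u) + (N (P u - Q u) + N (Q u - Q v))"
      using N_tri3[of "P v" "P u" "Q v"] N_tri3[of "P u" "Q u" "Q v"] V by simp
    also have "\<dots> \<le> C * N (v - u) + (0 + C * N (v - u))"
      using blin_N_diff[OF P v u] blin_N_diff[OF Q v u] N_commute[of "Q u" "Q v"] V D[OF uw]
      by (auto simp: eqv_def)
    also have "\<dots> \<le> \<epsilon>" using * C by (simp add: field_simps)
    finally show ?thesis .
  qed
  then have "N (P v - Q v) \<le> 0" by (rule field_le_epsilon) simp
  then show ?thesis using N_nonneg[of "P v - Q v"] P Q v V_diff by (auto simp: eqv_def blinD)
qed

lemma T_zero: "u \<in> V \<Longrightarrow> eqv (T 0 u) u"
proof (rule conv_unique[of "\<lambda>k. S k 0 u"])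
  assume u: "u \<in> V"
  show "(\<lambda>k. N (S k 0 u - T 0 u)) \<longlonglongrightarrow> 0" "T 0 u \<in> V" using T_lim[OF _ u, of 0] by auto
  show "(\<lambda>k. N (S k 0 u - u)) \<longlonglongrightarrow> 0" by (simp add: S_def steps_def)
  show "S k 0 u \<in> V" for k using S_V[OF _ u] by simp
qed

lemma N_S_diff:
  assumes st: "0 \<le> s" "s \<le> t" and uw: "(u, w) \<in> Gr"
  shows "N (S k t u - S k s u) \<le> (t - s + e k) * exp (\<omega> * t) * N w"
proof -
  have V: "u \<in> V" "w \<in> V" using Gr_V[OF uw] by auto
  have t: "0 \<le> t" using st by simp
  have le: "steps k s \<le> steps k t"
    unfolding steps_def using st e_pos[of k] by (intro nat_mono floor_mono divide_right_mono) auto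
  define m where "m = steps k t - steps k s"
  have m: "steps k t = steps k s + m" using le by (simp add: m_def)
  have "N (S k t u - S k s u) \<le> m * e k * exp (\<omega> * (e k * real (steps k s + m))) * N w"
    unfolding S_def m by (intro N_J_funpow_diff e_pos e_le uw)
  also have "\<dots> \<le> (t - s + e k) * exp (\<omega> * t) * N w"
  proof (intro mult_right_mono mult_mono)
    show "m * e k \<le> t - s + e k"
      using steps_le[OF t, of k] steps_ge[OF st(1), of k] m by (simp add: algebra_simps)
    show "exp (\<omega> * (e k * real (steps k s + m))) \<le> exp (\<omega> * t)"
      using steps_le[OF t, of k] m \<omega>_nonneg by (simp add: mult_left_mono)
  qed (use st e_pos[of k] N_nonneg V in auto)
  finally show ?thesis .
qed

lemma T_add:
  assumes s: "0 \<le> s" and t: "0 \<le> t" and v: "v \<in> V"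
  shows "eqv (T (s + t) v) (T s (T t v))"
proof (rule eqv_by_density[of "exp (\<omega> * (s + t))", OF _ _ _ v])
  have st: "0 \<le> s + t" using s t by simp
  show "blin (exp (\<omega> * (s + t))) (T (s + t))" by (rule T_blin[OF st])
  show "blin (exp (\<omega> * (s + t))) (\<lambda>u. T s (T t u))"
    using blin_comp[OF T_blin[OF s] T_blin[OF t]] by (simp add: exp_add distrib_left)
  fix u w assume uw: "(u, w) \<in> Gr"
  then have V: "u \<in> V" "w \<in> V" using Gr_V by auto
  note SV = S_V[OF s] S_V[OF t] S_V[OF st] and TV = T_V[OF s] T_V[OF t] T_V[OF st]
  show "eqv (T (s + t) u) (T s (T t u))"
  proof (rule conv_unique[OF SV(3)[OF V(1)] T_lim[OF st V(1)]])
    show "T s (T t u) \<in> V" by (intro TV V)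
    let ?c = "\<lambda>k. 2 * e k * exp (\<omega> * (s + t)) * N w + (exp (\<omega> * s) * N (S k t u - T t u)
        + N (S k s (T t u) - T s (T t u)))"
    show "(\<lambda>k. N (S k (s + t) u - T s (T t u))) \<longlonglongrightarrow> 0"
    proof (rule conv_squeeze[of _ ?c])
      fix k
      show "S k (s + t) u - T s (T t u) \<in> V" by (intro V_rules SV TV V)
      define n m where "n = steps k s + steps k t" and "m = steps k (s + t) - n"
      have "steps k s + steps k t \<le> steps k (s + t)"
      proof -
        have "e k * (steps k s + steps k t) \<le> s + t"
          using steps_le[OF s, of k] steps_le[OF t, of k] by (simp add: algebra_simps)
        then have "real (steps k s + steps k t) \<le> (s + t) / e k" using e_pos[of k] by (simp add: field_simps)
        then show ?thesis unfolding steps_def[of k "s + t"] by linarith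
      qed
      then have nm: "steps k (s + t) = n + m" by (simp add: m_def n_def)
      \<comment> \<open>The floors for \<open>s\<close> and \<open>t\<close> together discard at
        most two steps; on the domain this surplus vanishes in the limit.\<close>
      have me: "m * e k \<le> 2 * e k"
        using steps_le[OF st, of k] steps_ge[OF s, of k] steps_ge[OF t, of k] nm
        by (simp add: n_def algebra_simps)
      have "N (S k (s + t) u - S k s (S k t u)) \<le> m * e k * exp (\<omega> * (e k * (n + m))) * N w"
        using N_J_funpow_diff[OF e_pos[of k] e_le[of k] uw, where n=n and m=m]
        unfolding S_def nm by (simp add: n_def funpow_add)
      also have "\<dots> \<le> 2 * e k * exp (\<omega> * (s + t)) * N w"
        using me steps_le[OF st, of k] nm \<omega>_nonneg e_pos[of k] N_nonneg[OF V(2)]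
        by (intro mult_right_mono mult_mono) (auto intro!: mult_left_mono)
      finally have 1: "N (S k (s + t) u - S k s (S k t u)) \<le> 2 * e k * exp (\<omega> * (s + t)) * N w" .
      have 2: "N (S k s (S k t u) - S k s (T t u)) \<le> exp (\<omega> * s) * N (S k t u - T t u)"
        by (intro blin_N_diff[OF S_blin[OF s]] SV TV V)
      have 3: "N (S k (s + t) u - T s (T t u)) \<le> N (S k (s + t) u - S k s (S k t u)) + N (S k s (S k t u) - T s (T t u))"
        by (intro N_tri3 SV TV V)
      have 4: "N (S k s (S k t u) - T s (T t u)) \<le> N (S k s (S k t u) - S k s (T t u)) + N (S k s (T t u) - T s (T t u))"
        by (intro N_tri3 SV TV V)
      show "N (S k (s + t) u - T s (T t u)) \<le> ?c k" using 1 2 3 4 by linarith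
    next
      have "?c \<longlonglongrightarrow> 2 * 0 * exp (\<omega> * (s + t)) * N w + (exp (\<omega> * s) * 0 + 0)"
        by (intro tendsto_intros e_lim T_lim s t V TV)
      then show "?c \<longlonglongrightarrow> 0" by simp
    qed
  qed
qed simp

lemma N_T_diff:
  assumes st: "0 \<le> s" "s \<le> t" and uw: "(u, w) \<in> Gr"
  shows "N (T t u - T s u) \<le> (t - s) * exp (\<omega> * t) * N w"
proof -
  have t: "0 \<le> t" using st by simp
  have V: "u \<in> V" "w \<in> V" using Gr_V[OF uw] by auto
  note rl = S_V[OF t V(1)] S_V[OF st(1) V(1)] T_lim[OF t V(1)] T_lim[OF st(1) V(1)]
  show ?thesis
  proof (rule conv_bound[of "\<lambda>k. S k t u - S k s u" _ "\<lambda>k. (t - s + e k) * exp (\<omega> * t) * N w"])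
    show "(\<lambda>k. N (S k t u - S k s u - (T t u - T s u))) \<longlonglongrightarrow> 0"
    proof (rule conv_squeeze[of _ "\<lambda>k. N (S k t u - T t u) + N (S k s u - T s u)"])
      fix k
      have eq: "S k t u - S k s u - (T t u - T s u) = (S k t u - T t u) - (S k s u - T s u)" by simp
      show "N (S k t u - S k s u - (T t u - T s u)) \<le> N (S k t u - T t u) + N (S k s u - T s u)"
        unfolding eq using N_diff[of "S k t u - T t u" "S k s u - T s u"] rl V_diff by simp
    qed (use rl V_diff tendsto_add[OF rl(4) rl(6)] in auto)
    have "(\<lambda>k. (t - s + e k) * exp (\<omega> * t) * N w) \<longlonglongrightarrow> (t - s + 0) * exp (\<omega> * t) * N w"
      by (intro tendsto_intros e_lim)
    then show "(\<lambda>k. (t - s + e k) * exp (\<omega> * t) * N w) \<longlonglongrightarrow> (t - s) * exp (\<omega> * t) * N w" by simp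
  qed (use rl V_diff N_S_diff[OF st uw] in auto)
qed

lemma T_cont:
  assumes t0: "0 \<le> t0" and v: "v \<in> V"
  shows "((\<lambda>t. N (T t v - T t0 v)) \<longlongrightarrow> 0) (at t0 within {0..})"
proof (rule tendstoI)
  fix \<epsilon> :: real assume "\<epsilon> > 0"
  define E where "E = exp (\<omega> * (t0 + 1))"
  have E: "0 < E" by (simp add: E_def)
  obtain u w where uw: "(u, w) \<in> Gr" and 1: "N (v - u) < \<epsilon> / (4 * E)"
    using dense[OF v, of "\<epsilon> / (4 * E)"] \<open>\<epsilon> > 0\<close> E by auto
  have V: "u \<in> V" "w \<in> V" using Gr_V[OF uw] by auto
  have nw: "0 \<le> N w" using N_nonneg V by auto
  define d where "d = min 1 (\<epsilon> / (4 * E * (N w + 1)))"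
  have d: "0 < d" "d \<le> 1" using \<open>\<epsilon> > 0\<close> E nw by (auto simp: d_def)
  have dE: "d * E * N w \<le> \<epsilon> / 4"
  proof -
    have "d * E * N w \<le> \<epsilon> / (4 * E * (N w + 1)) * E * N w"
      using E nw by (intro mult_right_mono) (auto simp: d_def)
    also have "\<dots> = \<epsilon> / 4 * (N w / (N w + 1))" using E by simp
    also have "\<dots> \<le> \<epsilon> / 4 * 1" using \<open>\<epsilon> > 0\<close> nw by (intro mult_left_mono) auto
    finally show ?thesis by simp
  qed
  show "\<forall>\<^sub>F t in at t0 within {0..}. dist (N (T t v - T t0 v)) 0 < \<epsilon>"
    unfolding eventually_at
  proof (intro exI[of _ d] conjI ballI impI d)
    fix t assume t: "t \<in> {0..}" and *: "t \<noteq> t0 \<and> dist t t0 < d"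
    have t': "0 \<le> t" using t by simp
    note TV = T_V[OF t'] T_V[OF t0]
    have dt: "\<bar>t - t0\<bar> < d" "t \<le> t0 + 1" using * d by (auto simp: dist_real_def)
    have exps: "exp (\<omega> * t) \<le> E" "exp (\<omega> * t0) \<le> E"
      using dt \<omega>_nonneg by (auto simp: E_def intro!: mult_left_mono)
    have 2: "N (T t u - T t0 u) \<le> \<epsilon> / 4"
    proof -
      have "N (T t u - T t0 u) \<le> \<bar>t - t0\<bar> * E * N w"
      proof (cases "t0 \<le> t")
        case True
        have "N (T t u - T t0 u) \<le> (t - t0) * exp (\<omega> * t) * N w" by (rule N_T_diff[OF t0 True uw])
        also have "\<dots> \<le> \<bar>t - t0\<bar> * E * N w" using True exps nw by (intro mult_right_mono mult_mono) auto
        finally show ?thesis .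
      next
        case False
        then have "N (T t0 u - T t u) \<le> (t0 - t) * exp (\<omega> * t0) * N w" by (intro N_T_diff[OF t' _ uw]) simp
        also have "\<dots> \<le> \<bar>t - t0\<bar> * E * N w" using False exps nw by (intro mult_right_mono mult_mono) auto
        finally show ?thesis using N_commute[of "T t u" "T t0 u"] TV V by simp
      qed
      also have "\<dots> \<le> d * E * N w" using dt E nw by (intro mult_right_mono) auto
      finally show ?thesis using dE by simp
    qed
    have 3: "N (T r v - T r u) \<le> \<epsilon> / 4" if "0 \<le> r" "exp (\<omega> * r) \<le> E" for r
    proof -
      have "N (T r v - T r u) \<le> exp (\<omega> * r) * N (v - u)" by (rule blin_N_diff[OF T_blin[OF that(1)] v V(1)])
      also have "\<dots> \<le> E * (\<epsilon> / (4 * E))" using that 1 E N_nonneg[of "v - u"] v V V_diff by (intro mult_mono) auto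
      finally show ?thesis using E by simp
    qed
    have "N (T t v - T t0 v) \<le> N (T t v - T t u) + (N (T t u - T t0 u) + N (T t0 u - T t0 v))"
      using N_tri3[of "T t v" "T t u" "T t0 v"] N_tri3[of "T t u" "T t0 u" "T t0 v"] TV v V by simp
    also have "\<dots> \<le> \<epsilon> / 4 + (\<epsilon> / 4 + \<epsilon> / 4)"
      using 2 3[OF t' exps(1)] 3[OF t0 exps(2)] N_commute[of "T t0 u" "T t0 v"] TV v V by simp
    finally have "N (T t v - T t0 v) < \<epsilon>" using \<open>\<epsilon> > 0\<close> by simp
    then show "dist (N (T t v - T t0 v)) 0 < \<epsilon>" using N_nonneg[of "T t v - T t0 v"] TV v V_diff
      by (simp add: dist_real_def)
  qed
qed

section \<open>The derivative at zero and the generator\<close>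

lemma N_funpow_minus_id_any:
  assumes h: "0 < h" "h \<le> h0" and w: "w \<in> V" and wz: "(w', z) \<in> Gr"
    and j: "h * real j \<le> t" "t \<le> 1"
  shows "N ((J h ^^ j) w - w) \<le> (exp \<omega> + 1) * N (w - w') + t * exp \<omega> * N z"
proof -
  have V: "w' \<in> V" "z \<in> V" using Gr_V[OF wz] by auto
  note bl = J_funpow_blin[OF h, of j]
  have ex: "exp (\<omega> * (h * j)) \<le> exp \<omega>" using j \<omega>_nonneg by (simp add: mult_left_le)
  have t0: "0 \<le> t" using j h mult_nonneg_nonneg[of h "real j"] by linarith
  have PV: "(J h ^^ j) w \<in> V" "(J h ^^ j) w' \<in> V" using blinD[OF bl] w V by auto
  have nn: "0 \<le> N (w - w')" "0 \<le> N z" using N_nonneg V w V_diff by auto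
  have 1: "N ((J h ^^ j) w - (J h ^^ j) w') \<le> exp \<omega> * N (w - w')"
    using blin_N_diff[OF bl w V(1)] mult_right_mono[OF ex nn(1)] by linarith
  have "N ((J h ^^ j) w' - w') \<le> j * h * exp (\<omega> * (h * j)) * N z"
    using N_J_funpow_diff[OF h wz, of 0 j] by simp
  also have "\<dots> \<le> t * exp \<omega> * N z" using j t0 ex nn h by (intro mult_right_mono mult_mono) (auto simp: mult.commute)
  finally have 2: "N ((J h ^^ j) w' - w') \<le> t * exp \<omega> * N z" .
  have "N ((J h ^^ j) w - w) \<le> N ((J h ^^ j) w - (J h ^^ j) w') + (N ((J h ^^ j) w' - w') + N (w' - w))"
    using N_tri3[of "(J h ^^ j) w" "(J h ^^ j) w'" w] N_tri3[of "(J h ^^ j) w'" w' w] PV w V by simp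
  then show ?thesis using 1 2 N_commute[OF V(1) w] by (simp add: algebra_simps)
qed

text \<open>\<open>(J h ^^ n) u - u\<close> is \<open>h\<close> times a sum of iterates of
  \<open>w\<close>, and each iterate stays near \<open>w\<close>. The domain element
  \<open>w'\<close> with value \<open>z\<close> measures this nearness for a \<open>w\<close> that
  may lie outside the domain; the derivative is thus obtained on the whole domain and not only on
  that of the square.\<close>

lemma N_funpow_derivative:
  assumes h: "0 < h" "h \<le> h0" and uw: "(u, w) \<in> Gr" and wz: "(w', z) \<in> Gr"
    and "h * real n \<le> t" "t \<le> 1"
  shows "N ((J h ^^ n) u - u - sc (complex_of_real (h * n)) w)
    \<le> h * n * ((exp \<omega> + 1) * N (w - w') + t * exp \<omega> * N z)"
  using assms(5)
proof (induction n)
  case 0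
  then show ?case by simp
next
  case (Suc n)
  let ?B = "(exp \<omega> + 1) * N (w - w') + t * exp \<omega> * N z"
  have V: "u \<in> V" "w \<in> V" "w' \<in> V" "z \<in> V" using Gr_V[OF uw] Gr_V[OF wz] by auto
  have PV: "(J h ^^ j) y \<in> V" if "y \<in> V" for j y using blinD(1)[OF J_funpow_blin[OF h] that] .
  have IH: "N ((J h ^^ n) u - u - sc (complex_of_real (h * n)) w) \<le> h * n * ?B"
    using Suc h by (intro Suc.IH) (simp add: algebra_simps)
  let ?d = "J h ((J h ^^ n) u) - (J h ^^ n) u"
  have eq: "?d = (J h ^^ n) (J h u) - (J h ^^ n) u" by (simp add: funpow_swap1)
  have "eqv ((J h ^^ n) (J h u) - (J h ^^ n) u) ((J h ^^ n) (J h u - u))"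
    by (intro eqv_sym[OF blin_diff[OF J_funpow_blin[OF h]]] J_V h V)
  also have "eqv \<dots> ((J h ^^ n) (sc (complex_of_real h) (J h w)))"
    by (intro blin_eqv[OF J_funpow_blin[OF h]] J_minus_id h uw)
  also have "eqv \<dots> (sc (complex_of_real h) ((J h ^^ n) (J h w)))"
    by (intro blin_sc[OF J_funpow_blin[OF h]] J_V h V)
  finally have "eqv ?d (sc (complex_of_real h) ((J h ^^ Suc n) w))" unfolding eq by (simp add: funpow_swap1)
  then have "eqv (?d - sc (complex_of_real h) w) (sc (complex_of_real h) ((J h ^^ Suc n) w) - sc (complex_of_real h) w)"
    by (intro eqv_diff eqv_refl V_rules V)
  then have "eqv (?d - sc (complex_of_real h) w) (sc (complex_of_real h) ((J h ^^ Suc n) w - w))"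
    by (simp add: scale_right_diff_distrib)
  then have "N (?d - sc (complex_of_real h) w) = h * N ((J h ^^ Suc n) w - w)"
    using h N_sc[of "(J h ^^ Suc n) w - w" "complex_of_real h"] V_diff[OF PV V(2)] V by (simp add: eqv_N del: funpow.simps)
  also have "\<dots> \<le> h * ?B"
    using h Suc.prems assms(6) by (intro mult_left_mono N_funpow_minus_id_any wz V) auto
  finally have 1: "N (?d - sc (complex_of_real h) w) \<le> h * ?B" .
  have "(J h ^^ Suc n) u - u - sc (complex_of_real (h * Suc n)) w
     = (?d - sc (complex_of_real h) w) + ((J h ^^ n) u - u - sc (complex_of_real (h * n)) w)"
    by (simp add: scale_left_distrib algebra_simps)
  moreover have "N (\<dots>) \<le> N (?d - sc (complex_of_real h) w) + N ((J h ^^ n) u - u - sc (complex_of_real (h * n)) w)"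
    by (intro N_triangle V_rules PV J_V h V)
  ultimately show ?case using 1 IH by (simp add: algebra_simps)
qed

lemma N_T_derivative:
  assumes uw: "(u, w) \<in> Gr" and wz: "(w', z) \<in> Gr" and t: "0 \<le> t" "t \<le> 1"
  shows "N (T t u - u - sc (complex_of_real t) w) \<le> t * ((exp \<omega> + 1) * N (w - w') + t * exp \<omega> * N z)"
proof -
  have V: "u \<in> V" "w \<in> V" "w' \<in> V" "z \<in> V" using Gr_V[OF uw] Gr_V[OF wz] by auto
  let ?B = "(exp \<omega> + 1) * N (w - w') + t * exp \<omega> * N z"
  let ?n = "\<lambda>k. e k * steps k t"
  have nn: "0 \<le> ?B" using N_nonneg V t V_diff by (intro add_nonneg_nonneg mult_nonneg_nonneg) auto
  show ?thesis
  proof (rule conv_bound[of "\<lambda>k. S k t u - u - sc (complex_of_real (?n k)) w" _ "\<lambda>k. ?n k * ?B"])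
    fix k
    show "S k t u - u - sc (complex_of_real (?n k)) w \<in> V" by (intro V_rules S_V t V)
    show "N (S k t u - u - sc (complex_of_real (?n k)) w) \<le> ?n k * ?B"
      unfolding S_def by (intro N_funpow_derivative e_pos e_le uw wz t steps_le)
  next
    show "T t u - u - sc (complex_of_real t) w \<in> V" by (intro V_rules T_V t V)
    show "(\<lambda>k. ?n k * ?B) \<longlonglongrightarrow> t * ?B" by (intro tendsto_intros steps_lim t)
    show "(\<lambda>k. N (S k t u - u - sc (complex_of_real (?n k)) w - (T t u - u - sc (complex_of_real t) w))) \<longlonglongrightarrow> 0"
    proof (rule conv_squeeze[of _ "\<lambda>k. N (S k t u - T t u) + \<bar>?n k - t\<bar> * N w"])
      fix k
      show "S k t u - u - sc (complex_of_real (?n k)) w - (T t u - u - sc (complex_of_real t) w) \<in> V"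
        by (intro V_rules S_V T_V t V)
      have eq: "S k t u - u - sc (complex_of_real (?n k)) w - (T t u - u - sc (complex_of_real t) w)
         = (S k t u - T t u) - sc (complex_of_real (?n k - t)) w"
        by (simp add: scale_left_diff_distrib algebra_simps)
      have "N (S k t u - T t u - sc (complex_of_real (?n k - t)) w) \<le> N (S k t u - T t u) + N (sc (complex_of_real (?n k - t)) w)"
        by (intro N_diff V_rules S_V T_V t V)
      moreover have "N (sc (complex_of_real (?n k - t)) w) = \<bar>?n k - t\<bar> * N w"
        using N_sc[OF V(2)] by (simp only: norm_of_real)
      ultimately show "N (S k t u - u - sc (complex_of_real (?n k)) w - (T t u - u - sc (complex_of_real t) w))
         \<le> N (S k t u - T t u) + \<bar>?n k - t\<bar> * N w" unfolding eq by (simp only:)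
    next
      have "(\<lambda>k. N (S k t u - T t u) + \<bar>?n k - t\<bar> * N w) \<longlonglongrightarrow> 0 + \<bar>t - t\<bar> * N w"
        by (intro tendsto_intros T_lim steps_lim t V)
      then show "(\<lambda>k. N (S k t u - T t u) + \<bar>?n k - t\<bar> * N w) \<longlonglongrightarrow> 0" by simp
    qed
  qed
qed

lemma N_quotient:
  assumes "0 < t" "u \<in> V" "v \<in> V"
  shows "N (sc (complex_of_real (1 / t)) (T t u - u) - v) = N (T t u - u - sc (complex_of_real t) v) / t"
proof -
  have "sc (complex_of_real (1 / t)) (T t u - u) - v = sc (complex_of_real (1 / t)) (T t u - u - sc (complex_of_real t) v)"
    using assms by (simp add: scale_right_diff_distrib scale_scale flip: of_real_mult)
  then show ?thesis using N_sc[of "T t u - u - sc (complex_of_real t) v" "complex_of_real (1 / t)"] assms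
    by (simp add: V_rules T_V norm_divide)
qed

lemma T_generator:
  assumes uw: "(u, w) \<in> Gr"
  shows "((\<lambda>h. N (sc (complex_of_real (1 / h)) (T h u - u) - w)) \<longlongrightarrow> 0) (at_right 0)"
proof (rule tendstoI)
  fix \<epsilon> :: real assume "\<epsilon> > 0"
  have V: "u \<in> V" "w \<in> V" using Gr_V[OF uw] by auto
  have E: "0 < exp \<omega> + 1" by (simp add: add_pos_pos)
  obtain w' z where wz: "(w', z) \<in> Gr" and 1: "N (w - w') < \<epsilon> / (2 * (exp \<omega> + 1))"
    using dense[OF V(2), of "\<epsilon> / (2 * (exp \<omega> + 1))"] \<open>\<epsilon> > 0\<close> E by (auto simp: add_pos_pos)
  have 2: "(exp \<omega> + 1) * N (w - w') < \<epsilon> / 2" using 1 E by (simp add: field_simps)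
  have "((\<lambda>t. (exp \<omega> + 1) * N (w - w') + t * exp \<omega> * N z) \<longlongrightarrow> (exp \<omega> + 1) * N (w - w') + 0 * exp \<omega> * N z) (at_right 0)"
    by (intro tendsto_intros)
  then have "\<forall>\<^sub>F t in at_right 0. (exp \<omega> + 1) * N (w - w') + t * exp \<omega> * N z < \<epsilon>"
    by (rule order_tendstoD(2)) (use 2 \<open>\<epsilon> > 0\<close> in simp)
  moreover have "\<forall>\<^sub>F t in at_right (0::real). 0 < t \<and> t < 1"
    using eventually_at_right_real[of 0 "1::real"] by simp
  ultimately show "\<forall>\<^sub>F t in at_right 0. dist (N (sc (complex_of_real (1 / t)) (T t u - u) - w)) 0 < \<epsilon>"
  proof eventually_elim
    case (elim t)
    have "N (T t u - u - sc (complex_of_real t) w) \<le> t * ((exp \<omega> + 1) * N (w - w') + t * exp \<omega> * N z)"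
      using elim by (intro N_T_derivative[OF uw wz]) auto
    also have "\<dots> < t * \<epsilon>" using elim by simp
    finally have "N (T t u - u - sc (complex_of_real t) w) / t < \<epsilon>"
      using elim by (simp add: pos_divide_less_eq mult.commute)
    then have "N (sc (complex_of_real (1 / t)) (T t u - u) - w) < \<epsilon>"
      using elim V by (subst N_quotient) auto
    moreover have "0 \<le> N (sc (complex_of_real (1 / t)) (T t u - u) - w)"
      using elim V by (intro N_nonneg V_rules T_V) auto
    ultimately show ?case by (simp add: dist_real_def)
  qed
qed

text \<open>The generator is not a proper extension of the graph. Solve the resolvent equation with
  right-hand side u - h v and solution w. Then z = u - w has derivative z / h at time zero, so it
  grows at rate 1 / h, while the semigroup grows at rate \<open>\<omega>\<close> at most. With
  \<open>\<omega> < 1 / h\<close> this forces \<open>N z = 0\<close>.\<close>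

lemma T_generator_converse:
  assumes u: "u \<in> V" and v: "v \<in> V"
    and lim: "((\<lambda>h. N (sc (complex_of_real (1 / h)) (T h u - u) - v)) \<longlongrightarrow> 0) (at_right 0)"
  shows "\<exists>w y. (w, y) \<in> Gr \<and> N (u - w) = 0"
proof -
  have "\<forall>\<^sub>F k in sequentially. e k < 1 / (\<omega> + 1)" using e_lim \<omega>_nonneg by (intro order_tendstoD) auto
  then obtain k where k: "e k < 1 / (\<omega> + 1)" using eventually_happens'[OF sequentially_bot] by blast
  define h where "h = e k"
  have h: "0 < h" "h \<le> h0" and h\<omega>: "\<omega> < 1 / h"
    using e_pos[of k] e_le[of k] k \<omega>_nonneg by (auto simp: h_def field_simps)
  let ?c = "complex_of_real h" and ?r = "complex_of_real (1 / h)"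
  define f where "f = u - sc ?c v"
  define w where "w = J h f"
  define y where "y = sc ?r (w - f)"
  have fV: "f \<in> V" by (auto simp: f_def intro!: V_rules u v)
  have wy: "(w, y) \<in> Gr" unfolding w_def y_def by (intro J_Gr h fV)
  have V: "w \<in> V" "y \<in> V" using Gr_V[OF wy] by auto
  define z where "z = u - w"
  have zV: "z \<in> V" by (simp add: z_def V_diff u V)
  have vy: "v - y = sc ?r z"
  proof -
    have "sc ?r (sc ?c v) = v" using h by (simp add: scale_scale flip: of_real_mult)
    then show ?thesis by (simp add: y_def f_def z_def scale_right_diff_distrib algebra_simps)
  qed
  let ?q = "\<lambda>t. N (sc (complex_of_real (1 / t)) (T t u - u) - v) + N (sc (complex_of_real (1 / t)) (T t w - w) - y)"
  have ql: "(?q \<longlongrightarrow> 0 + 0) (at_right 0)" by (intro tendsto_add lim T_generator[OF wy])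
  \<comment> \<open>The difference quotient of \<open>z\<close> differs from \<open>z / h\<close> by
    at most \<open>?q t\<close>. Comparing with the growth bound of \<open>T t\<close> gives the
    inequality whose limit at zero is wanted.\<close>
  have ev: "\<forall>\<^sub>F t in at_right 0. (1 / h - (exp (\<omega> * t) - 1) / t) * N z \<le> ?q t"
    using eventually_at_right_less[of 0]
  proof eventually_elim
    case (elim t)
    have t: "0 \<le> t" "0 < t" using elim by auto
    let ?t = "complex_of_real (1 / t)"
    have bl: "blin (exp (\<omega> * t)) (T t)" by (rule T_blin[OF t(1)])
    have "eqv (sc ?t (T t z - z) - sc ?r z) (sc ?t ((T t u - T t w) - z) - sc ?r z)"
      unfolding z_def by (intro eqv_diff eqv_sc eqv_refl blin_diff[OF bl] V_rules u V)
    also have "\<dots> = (sc ?t (T t u - u) - v) - (sc ?t (T t w - w) - y)"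
      unfolding vy[symmetric] by (simp add: z_def scale_right_diff_distrib algebra_simps)
    finally have "N (sc ?t (T t z - z) - sc ?r z) = N ((sc ?t (T t u - u) - v) - (sc ?t (T t w - w) - y))"
      by (rule eqv_N)
    also have "\<dots> \<le> ?q t" by (intro N_diff V_rules T_V t u v V)
    finally have 1: "N (sc ?t (T t z - z) - sc ?r z) \<le> ?q t" .
    have 2: "N (sc ?t (T t z) - (sc ?t (T t z - z) - sc ?r z)) \<le> N (sc ?t (T t z)) + N (sc ?t (T t z - z) - sc ?r z)"
      by (intro N_diff V_rules T_V t zV)
    have "sc ?t (T t z) - (sc ?t (T t z - z) - sc ?r z) = sc (complex_of_real (1 / t + 1 / h)) z"
      by (simp add: scale_right_diff_distrib scale_left_distrib algebra_simps)
    then have 3: "N (sc ?t (T t z) - (sc ?t (T t z - z) - sc ?r z)) = (1 / t + 1 / h) * N z"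
      using N_sc[OF zV, of "complex_of_real (1 / t + 1 / h)"] t h by (simp only: norm_of_real) simp
    have "N (sc ?t (T t z)) = N (T t z) / t"
      using N_sc[OF T_V[OF t(1) zV], of ?t] t by (simp add: norm_divide)
    also have "\<dots> \<le> exp (\<omega> * t) * N z / t"
      using t blinD(2)[OF bl zV] by (simp add: divide_right_mono)
    finally have "(1 / t + 1 / h) * N z \<le> exp (\<omega> * t) * N z / t + ?q t" using 1 2 3 by linarith
    moreover have "(1 / h - (exp (\<omega> * t) - 1) / t) * N z = (1 / t + 1 / h) * N z - exp (\<omega> * t) * N z / t"
      using t by (simp add: algebra_simps diff_divide_distrib)
    ultimately show ?case by linarith
  qed
  have "((\<lambda>t. exp (\<omega> * t)) has_real_derivative \<omega>) (at 0)"
    by (auto intro!: derivative_eq_intros)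
  then have "((\<lambda>t. (exp (\<omega> * t) - 1) / t) \<longlongrightarrow> \<omega>) (at_right 0)"
    unfolding has_field_derivative_iff by (simp add: filterlim_at_split)
  then have "((\<lambda>t. (1 / h - (exp (\<omega> * t) - 1) / t) * N z) \<longlongrightarrow> (1 / h - \<omega>) * N z) (at_right 0)"
    by (intro tendsto_intros)
  from tendsto_le[OF _ ql this ev] have "(1 / h - \<omega>) * N z \<le> 0" by simp
  then have "N z = 0" using h\<omega> N_nonneg[OF zV] by (simp add: mult_le_0_iff)
  then show ?thesis using wy by (auto simp: z_def)
qed

end

section \<open>Vector-valued functions on the real line\<close>

lemma strongly_measurableI:
  fixes f :: "'m \<Rightarrow> 'b::banach"
  assumes "\<And>i. simple_function M (s i)" "\<And>x. x \<in> space M \<Longrightarrow> (\<lambda>i. s i x) \<longlonglongrightarrow> f x"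
  shows "strongly_measurable M f"
  unfolding strongly_measurable_def
proof (intro conjI exI[of _ s] allI ballI)
  show "f \<in> borel_measurable M"
    by (rule borel_measurable_LIMSEQ_metric[OF borel_measurable_simple_function[OF assms(1)] assms(2)])
qed (fact assms)+

lemma strongly_measurableE:
  assumes "strongly_measurable M f"
  obtains s where "\<And>i. simple_function M (s i)" "\<And>x. x \<in> space M \<Longrightarrow> (\<lambda>i. s i x) \<longlonglongrightarrow> f x"
  using assms unfolding strongly_measurable_def by (elim conjE exE) auto

lemma strongly_measurable_simple:
  fixes f :: "'m \<Rightarrow> 'b::banach"
  shows "simple_function M f \<Longrightarrow> strongly_measurable M f"
  by (rule strongly_measurableI[of M "\<lambda>_. f"]) auto

lemma strongly_measurable_compose2:
  fixes f :: "'m \<Rightarrow> 'b::banach" and g :: "'m \<Rightarrow> 'c::banach" and h :: "'b \<Rightarrow> 'c \<Rightarrow> 'd::banach"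
  assumes f: "strongly_measurable M f" and g: "strongly_measurable M g"
    and h: "\<And>x y a b. x \<longlonglongrightarrow> a \<Longrightarrow> y \<longlonglongrightarrow> b \<Longrightarrow> (\<lambda>i. h (x i) (y i)) \<longlonglongrightarrow> h a b"
  shows "strongly_measurable M (\<lambda>x. h (f x) (g x))"
proof -
  obtain s t where s: "\<And>i. simple_function M (s i)" "\<And>x. x \<in> space M \<Longrightarrow> (\<lambda>i. s i x) \<longlonglongrightarrow> f x"
    using strongly_measurableE[OF f] by blast
  obtain t where t: "\<And>i. simple_function M (t i)" "\<And>x. x \<in> space M \<Longrightarrow> (\<lambda>i. t i x) \<longlonglongrightarrow> g x"
    using strongly_measurableE[OF g] by blast
  show ?thesis
  proof (rule strongly_measurableI)
    show "simple_function M (\<lambda>x. h (s i x) (t i x))" for i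
      by (rule simple_function_compose2[OF s(1) t(1)])
    show "(\<lambda>i. h (s i x) (t i x)) \<longlonglongrightarrow> h (f x) (g x)" if "x \<in> space M" for x
      by (rule h[OF s(2)[OF that] t(2)[OF that]])
  qed
qed

lemma strongly_measurable_add:
  "strongly_measurable M f \<Longrightarrow> strongly_measurable M g \<Longrightarrow> strongly_measurable M (\<lambda>x. f x + g x)"
  by (rule strongly_measurable_compose2[where h = "(+)"]) (auto intro: tendsto_add)

lemma strongly_measurable_diff:
  "strongly_measurable M f \<Longrightarrow> strongly_measurable M g \<Longrightarrow> strongly_measurable M (\<lambda>x. f x - g x)"
  by (rule strongly_measurable_compose2[where h = "(-)"]) (auto intro: tendsto_diff)

lemma strongly_measurable_bounded_linear:
  assumes "bounded_linear T" "strongly_measurable M f"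
  shows "strongly_measurable M (\<lambda>x. T (f x))"
  by (rule strongly_measurable_compose2[OF assms(2,2), of "\<lambda>x _. T x"])
    (rule bounded_linear.tendsto[OF assms(1)])

lemma strongly_measurable_norm:
  "strongly_measurable M f \<Longrightarrow> (\<lambda>x. norm (f x)) \<in> borel_measurable M"
  using measurable_compose[of f M borel norm borel]
    borel_measurable_continuous_onI[OF continuous_on_norm_id[of UNIV]]
  unfolding strongly_measurable_def by blast

lemma simple_function_lebesgue_on_subset:
  assumes s: "simple_function (lebesgue_on S) f" and T: "T \<subseteq> S" "T \<in> sets lebesgue" and "S \<in> sets lebesgue"
  shows "simple_function (lebesgue_on T) f"
  unfolding simple_function_def
proof (intro conjI ballI)
  have "finite (f ` S)" using s by (simp add: simple_function_def)
  then show "finite (f ` space (lebesgue_on T))" using T by (auto intro: finite_subset[of _ "f ` S"])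
  fix x assume "x \<in> f ` space (lebesgue_on T)"
  then have "x \<in> f ` space (lebesgue_on S)" using T by auto
  then have "f -` {x} \<inter> S \<in> sets (lebesgue_on S)" using s by (auto simp: simple_function_def)
  then have "f -` {x} \<inter> S \<in> sets lebesgue" using assms(4) by (simp add: sets_restrict_space_iff)
  then have "(f -` {x} \<inter> S) \<inter> T \<in> sets lebesgue" using T by blast
  moreover have "(f -` {x} \<inter> S) \<inter> T = f -` {x} \<inter> T" using T by auto
  ultimately show "f -` {x} \<inter> space (lebesgue_on T) \<in> sets (lebesgue_on T)"
    using T by (simp add: sets_restrict_space_iff)
qed

lemma strongly_measurable_lebesgue_on_subset:
  fixes f :: "real \<Rightarrow> 'b::banach"
  assumes f: "strongly_measurable (lebesgue_on S) f" and T: "T \<subseteq> S" "T \<in> sets lebesgue" and "S \<in> sets lebesgue"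
  shows "strongly_measurable (lebesgue_on T) f"
proof -
  obtain s where s: "\<And>i. simple_function (lebesgue_on S) (s i)" "\<And>x. x \<in> S \<Longrightarrow> (\<lambda>i. s i x) \<longlonglongrightarrow> f x"
    using strongly_measurableE[OF f] by auto
  show ?thesis
    by (rule strongly_measurableI[of _ s])
      (use s T simple_function_lebesgue_on_subset[OF s(1) T assms(4)] in auto)
qed

lemma strongly_measurable_cong:
  assumes "strongly_measurable M f" "\<And>x. x \<in> space M \<Longrightarrow> f x = g x"
  shows "strongly_measurable M g"
proof -
  obtain s where s: "\<And>i. simple_function M (s i)" "\<And>x. x \<in> space M \<Longrightarrow> (\<lambda>i. s i x) \<longlonglongrightarrow> f x"
    using strongly_measurableE[OF assms(1)] by blast
  show ?thesis by (rule strongly_measurableI[of _ s]) (use s assms(2) in auto)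
qed

text \<open>The function is sampled at arguments rounded down to a dyadic grid, with a cut-off that
  keeps the range finite. The conditions on \<open>S\<close> ensure that rounding down towards
  \<open>a\<close> stays inside \<open>S\<close>; they cover compact intervals and half
  lines.\<close>

lemma strongly_measurable_continuous:
  fixes f :: "real \<Rightarrow> 'b::banach"
  assumes c: "continuous_on S f" and S: "S \<in> sets lebesgue" and a: "a \<in> S"
    and conv: "\<And>x y. x \<in> S \<Longrightarrow> a \<le> y \<Longrightarrow> y \<le> x \<Longrightarrow> y \<in> S" and low: "\<And>x. x \<in> S \<Longrightarrow> a \<le> x"
  shows "strongly_measurable (lebesgue_on S) f"
proof (rule strongly_measurableI)
  define \<kappa> :: "nat \<Rightarrow> real \<Rightarrow> real" where
    "\<kappa> i x = (if x \<le> i then max a (\<lfloor>(2::real) ^ i * x\<rfloor> / 2 ^ i) else a)" for i x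
  have \<kappa>S: "\<kappa> i x \<in> S" if "x \<in> S" for i x
  proof -
    have "\<lfloor>(2::real) ^ i * x\<rfloor> / 2 ^ i \<le> x" by (simp add: pos_divide_le_eq mult.commute)
    then show ?thesis unfolding \<kappa>_def using conv[OF that] low[OF that] a by auto
  qed
  show "simple_function (lebesgue_on S) (\<lambda>x. f (\<kappa> i x))" for i
  proof (rule simple_function_compose1[of _ "\<kappa> i" f], rule simple_function_borel_measurable)
    show "\<kappa> i \<in> borel_measurable (lebesgue_on S)"
      unfolding \<kappa>_def by (intro measurable_restrict_space1 measurable_completion) measurable
    let ?K = "{\<lfloor>2 ^ i * a\<rfloor>..\<lfloor>2 ^ i * real i\<rfloor>}"
    have "\<kappa> i x \<in> insert a ((\<lambda>n. max a (of_int n / 2 ^ i)) ` ?K)" if "x \<in> S" for x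
    proof (cases "x \<le> i")
      case True
      then have "\<lfloor>2 ^ i * x\<rfloor> \<in> ?K" using low[OF that]
        by (intro iffD2[OF atLeastAtMost_iff] conjI floor_mono mult_left_mono) simp_all
      then have "max a (\<lfloor>2 ^ i * x\<rfloor> / 2 ^ i) \<in> (\<lambda>n. max a (of_int n / 2 ^ i)) ` ?K"
        by (rule imageI)
      then show ?thesis using True by (simp only: \<kappa>_def if_True insertI2)
    qed (simp add: \<kappa>_def)
    then have "\<kappa> i ` S \<subseteq> insert a ((\<lambda>n. max a (of_int n / 2 ^ i)) ` ?K)" by blast
    moreover have "finite (insert a ((\<lambda>n. max a (of_int n / 2 ^ i)) ` ?K))" by simp
    ultimately show "finite (\<kappa> i ` space (lebesgue_on S))"
      unfolding space_lebesgue_on by (rule finite_subset)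
  qed
  fix x assume "x \<in> space (lebesgue_on S)"
  then have x: "x \<in> S" by simp
  have "(\<lambda>i. \<kappa> i x) \<longlonglongrightarrow> x"
  proof (rule tendsto_sandwich[of "\<lambda>i. x - (1/2) ^ i" _ _ "\<lambda>_. x"])
    have "(\<lambda>i. x - (1/2::real) ^ i) \<longlonglongrightarrow> x - 0" by (intro tendsto_intros LIMSEQ_power_zero) auto
    then show "(\<lambda>i. x - (1/2) ^ i) \<longlonglongrightarrow> x" by simp
    have "\<forall>\<^sub>F i in sequentially. x \<le> real i" 
      using eventually_ge_at_top[of "nat \<lceil>x\<rceil>"] by eventually_elim linarith
    then show "\<forall>\<^sub>F i in sequentially. x - (1/2) ^ i \<le> \<kappa> i x"
    proof eventually_elim
      case (elim i)
      have "2 ^ i * x - 1 \<le> of_int \<lfloor>2 ^ i * x\<rfloor>" by linarith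
      then have "(2 ^ i * x - 1) / 2 ^ i \<le> of_int \<lfloor>2 ^ i * x\<rfloor> / 2 ^ i" by (intro divide_right_mono) auto
      then show ?case using elim by (simp add: \<kappa>_def diff_divide_distrib power_one_over)
    qed
    show "\<forall>\<^sub>F i in sequentially. \<kappa> i x \<le> x"
    proof (intro always_eventually allI)
      fix i
      have "\<lfloor>(2::real) ^ i * x\<rfloor> / 2 ^ i \<le> x" by (simp add: pos_divide_le_eq mult.commute)
      then show "\<kappa> i x \<le> x" using low[OF x] by (simp add: \<kappa>_def)
    qed
  qed simp
  then show "(\<lambda>i. f (\<kappa> i x)) \<longlonglongrightarrow> f x"
    using c x \<kappa>S by (auto simp: continuous_on_sequentially comp_def)
qed

text \<open>Approximants larger than twice the norm of the limit are replaced by zero. Where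
  \<open>f x\<close> is nonzero this eventually stops; where it is zero the replacement is already
  the limit. The domination is what later limit theorems consume.\<close>

lemma strongly_measurable_simple_dominated:
  assumes "strongly_measurable M f"
  obtains s where "\<And>i. simple_function M (s i)" "\<And>x. x \<in> space M \<Longrightarrow> (\<lambda>i. s i x) \<longlonglongrightarrow> f x"
    "\<And>i x. norm (s i x) \<le> 2 * norm (f x)"
proof -
  obtain s where s: "\<And>i. simple_function M (s i)" "\<And>x. x \<in> space M \<Longrightarrow> (\<lambda>i. s i x) \<longlonglongrightarrow> f x"
    using strongly_measurableE[OF assms] by blast
  define s' where "s' i x = (if norm (s i x) \<le> 2 * norm (f x) then s i x else 0)" for i x
  have nf[measurable]: "(\<lambda>x. norm (f x)) \<in> borel_measurable M" by (rule strongly_measurable_norm[OF assms])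
  show thesis
  proof
    fix i
    have [measurable]: "(\<lambda>x. norm (s i x)) \<in> borel_measurable M"
      using borel_measurable_simple_function[OF simple_function_compose1[OF s(1)]] .
    show "simple_function M (s' i)" unfolding s'_def
      by (intro simple_function_If s simple_function_const) measurable
    show "norm (s' i x) \<le> 2 * norm (f x)" for x by (simp add: s'_def)
  next
    fix x assume x: "x \<in> space M"
    show "(\<lambda>i. s' i x) \<longlonglongrightarrow> f x"
    proof (cases "f x = 0")
      case True
      then have "s' i x = 0" for i by (simp add: s'_def)
      then show ?thesis using True by simp
    next
      case False
      then have "\<forall>\<^sub>F i in sequentially. norm (s i x) < 2 * norm (f x)"
        using tendsto_norm[OF s(2)[OF x]] by (intro order_tendstoD(2)) auto
      then have "\<forall>\<^sub>F i in sequentially. s' i x = s i x" by eventually_elim (simp add: s'_def)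
      then show ?thesis using s(2)[OF x] by (simp add: tendsto_cong)
    qed
  qed
qed

text \<open>The library's Bochner integral needs a second countable codomain, so vector-valued
  integrals are Henstock--Kurzweil integrals throughout.\<close>

lemma integrable_on_cbox_approx:
  fixes f :: "'n::euclidean_space \<Rightarrow> 'a::banach"
  assumes approx: "\<And>\<epsilon>. \<epsilon> > 0 \<Longrightarrow> \<exists>g u. g integrable_on cbox a b \<and> u integrable_on cbox a b \<and>
     (\<forall>x\<in>cbox a b. norm (f x - g x) \<le> u x) \<and> integral (cbox a b) u < \<epsilon>"
  shows "f integrable_on cbox a b"
  unfolding integrable_Cauchy
proof (intro allI impI)
  fix e :: real assume "e > 0"
  \<comment> \<open>Riemann sums of \<open>f\<close> and \<open>g\<close> differ by at most a
    Riemann sum of \<open>u\<close>, below \<open>2 * \<eta>\<close>, and those of \<open>g\<close>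
    are within \<open>\<eta>\<close> of the integral. Two tagged divisions of \<open>f\<close>
    therefore differ by less than \<open>6 * \<eta>\<close>.\<close>
  define \<eta> where "\<eta> = e / 6"
  have \<eta>: "\<eta> > 0" using \<open>e > 0\<close> by (simp add: \<eta>_def)
  obtain g u where g: "g integrable_on cbox a b" and u: "u integrable_on cbox a b"
    and fg: "\<And>x. x \<in> cbox a b \<Longrightarrow> norm (f x - g x) \<le> u x" and iu: "integral (cbox a b) u < \<eta>"
    using approx[OF \<eta>] by blast
  obtain \<gamma>1 where \<gamma>1: "gauge \<gamma>1" "\<And>\<D>. \<D> tagged_division_of cbox a b \<Longrightarrow> \<gamma>1 fine \<D> \<Longrightarrow>
      norm ((\<Sum>(x,K)\<in>\<D>. measure lborel K *\<^sub>R g x) - integral (cbox a b) g) < \<eta>"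
    using has_integralD[OF integrable_integral[OF g] \<eta>] by metis
  obtain \<gamma>2 where \<gamma>2: "gauge \<gamma>2" "\<And>\<D>. \<D> tagged_division_of cbox a b \<Longrightarrow> \<gamma>2 fine \<D> \<Longrightarrow>
      norm ((\<Sum>(x,K)\<in>\<D>. measure lborel K *\<^sub>R u x) - integral (cbox a b) u) < \<eta>"
    using has_integralD[OF integrable_integral[OF u] \<eta>] by metis
  have key: "norm ((\<Sum>(x,K)\<in>\<D>. measure lborel K *\<^sub>R f x) - integral (cbox a b) g) < 3 * \<eta>"
    if \<D>: "\<D> tagged_division_of cbox a b" and "(\<lambda>x. \<gamma>1 x \<inter> \<gamma>2 x) fine \<D>" for \<D>
  proof -
    have fine: "\<gamma>1 fine \<D>" "\<gamma>2 fine \<D>" using that(2) by (auto simp: fine_Int)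
    have "norm ((\<Sum>(x,K)\<in>\<D>. measure lborel K *\<^sub>R f x) - (\<Sum>(x,K)\<in>\<D>. measure lborel K *\<^sub>R g x))
        = norm (\<Sum>(x,K)\<in>\<D>. measure lborel K *\<^sub>R (f x - g x))"
      by (simp add: sum_subtractf[symmetric] scaleR_diff_right case_prod_unfold)
    also have "\<dots> \<le> (\<Sum>(x,K)\<in>\<D>. measure lborel K *\<^sub>R u x)"
      using tag_in_interval[OF \<D>] fg
      by (intro sum_norm_le) (auto intro!: mult_left_mono)
    also have "\<dots> < 2 * \<eta>" using \<gamma>2(2)[OF \<D> fine(2)] iu by (simp add: abs_less_iff)
    finally have "norm ((\<Sum>(x,K)\<in>\<D>. measure lborel K *\<^sub>R f x) - (\<Sum>(x,K)\<in>\<D>. measure lborel K *\<^sub>R g x)) < 2 * \<eta>" .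
    then show ?thesis using norm_triangle_lt[of "(\<Sum>(x,K)\<in>\<D>. measure lborel K *\<^sub>R f x) - (\<Sum>(x,K)\<in>\<D>. measure lborel K *\<^sub>R g x)"
       "(\<Sum>(x,K)\<in>\<D>. measure lborel K *\<^sub>R g x) - integral (cbox a b) g" "3 * \<eta>"] \<gamma>1(2)[OF \<D> fine(1)]
      by simp
  qed
  show "\<exists>\<gamma>. gauge \<gamma> \<and> (\<forall>\<D>1 \<D>2. \<D>1 tagged_division_of cbox a b \<and> \<gamma> fine \<D>1 \<and>
      \<D>2 tagged_division_of cbox a b \<and> \<gamma> fine \<D>2 \<longrightarrow>
      norm ((\<Sum>(x,K)\<in>\<D>1. measure lborel K *\<^sub>R f x) - (\<Sum>(x,K)\<in>\<D>2. measure lborel K *\<^sub>R f x)) < e)"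
  proof (intro exI conjI allI impI)
    show "gauge (\<lambda>x. \<gamma>1 x \<inter> \<gamma>2 x)" using \<gamma>1(1) \<gamma>2(1) by (rule gauge_Int)
    fix \<D>1 \<D>2
    assume "\<D>1 tagged_division_of cbox a b \<and> (\<lambda>x. \<gamma>1 x \<inter> \<gamma>2 x) fine \<D>1 \<and>
      \<D>2 tagged_division_of cbox a b \<and> (\<lambda>x. \<gamma>1 x \<inter> \<gamma>2 x) fine \<D>2"
    then have "norm ((\<Sum>(x,K)\<in>\<D>1. measure lborel K *\<^sub>R f x) - integral (cbox a b) g) < 3 * \<eta>"
      "norm ((\<Sum>(x,K)\<in>\<D>2. measure lborel K *\<^sub>R f x) - integral (cbox a b) g) < 3 * \<eta>"
      using key by blast+
    then show "norm ((\<Sum>(x,K)\<in>\<D>1. measure lborel K *\<^sub>R f x) - (\<Sum>(x,K)\<in>\<D>2. measure lborel K *\<^sub>R f x)) < e"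
      unfolding \<eta>_def by (intro norm_diff_triangle_less[of _ "integral (cbox a b) g" "e/2" _ "e/2", simplified])
        (auto simp: norm_minus_commute)
  qed
qed

text \<open>The integral of \<open>u\<close> over any box is at most that over \<open>S\<close>.
  This gives integrability on boxes, and also lets \<open>f\<close> inherit from \<open>g\<close>
  the Cauchy condition for growing boxes.\<close>

lemma integrable_on_approx:
  fixes f :: "'n::euclidean_space \<Rightarrow> 'a::banach"
  assumes approx: "\<And>\<epsilon>. \<epsilon> > 0 \<Longrightarrow> \<exists>g u. g integrable_on S \<and> u integrable_on S \<and>
     (\<forall>x\<in>S. norm (f x - g x) \<le> u x) \<and> integral S u < \<epsilon>"
  shows "f integrable_on S"
proof -
  let ?r = "\<lambda>h x. if x \<in> S then h x else 0"
  have sub: "integral (cbox a b) (?r u) \<le> integral S u"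
    if "u integrable_on S" "\<And>x. x \<in> S \<Longrightarrow> 0 \<le> u x" for u :: "'n \<Rightarrow> real" and a b
  proof -
    have "integral (cbox a b) (?r u) \<le> integral UNIV (?r u)"
      using that by (intro integral_subset_le integrable_altD(1)) (auto simp: integrable_restrict_UNIV)
    then show ?thesis by (simp add: integral_restrict_UNIV)
  qed
  have nn: "0 \<le> u x" if "\<forall>x\<in>S. norm (f x - g x) \<le> u x" "x \<in> S" for u x and g :: "'n \<Rightarrow> 'a"
    using that order_trans[OF norm_ge_zero] by blast
  have box: "?r f integrable_on cbox a b" for a b
  proof (rule integrable_on_cbox_approx)
    fix \<epsilon> :: real assume "\<epsilon> > 0"
    from approx[OF this] obtain g u where gu: "g integrable_on S" "u integrable_on S"
      "\<forall>x\<in>S. norm (f x - g x) \<le> u x" "integral S u < \<epsilon>" by blast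
    show "\<exists>g u. g integrable_on cbox a b \<and> u integrable_on cbox a b \<and>
        (\<forall>x\<in>cbox a b. norm (?r f x - g x) \<le> u x) \<and> integral (cbox a b) u < \<epsilon>"
      using gu integrable_altD(1)[OF gu(1)] integrable_altD(1)[OF gu(2)] sub[OF gu(2) nn[OF gu(3)], of a b]
      by (intro exI[of _ "?r g"] exI[of _ "?r u"]) auto
  qed
  show ?thesis
    unfolding integrable_alt[of f]
  proof (intro conjI allI impI box)
    fix e :: real assume "e > 0"
    then have "e / 3 > 0" by simp
    from approx[OF this] obtain g u where gu: "g integrable_on S" "u integrable_on S"
      "\<forall>x\<in>S. norm (f x - g x) \<le> u x" "integral S u < e / 3" by blast
    obtain B where B: "B > 0" "\<And>a b c d. ball 0 B \<subseteq> cbox a b \<and> ball 0 B \<subseteq> cbox c d \<Longrightarrow>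
      norm (integral (cbox a b) (?r g) - integral (cbox c d) (?r g)) < e / 3"
      using integrable_altD(2)[OF gu(1) \<open>e / 3 > 0\<close>] by blast
    have close: "norm (integral (cbox a b) (?r f) - integral (cbox a b) (?r g)) < e / 3" for a b
    proof -
      have "norm (integral (cbox a b) (?r f) - integral (cbox a b) (?r g))
        = norm (integral (cbox a b) (\<lambda>x. ?r f x - ?r g x))"
        by (subst integral_diff[OF box integrable_altD(1)[OF gu(1)]]) simp
      also have "\<dots> \<le> integral (cbox a b) (?r u)"
        using gu by (intro integral_norm_bound_integral integrable_diff box integrable_altD(1)) auto
      also have "\<dots> < e / 3" using sub[OF gu(2) nn[OF gu(3)], of a b] gu(4) by simp
      finally show ?thesis .
    qed
    show "\<exists>B>0. \<forall>a b c d. ball 0 B \<subseteq> cbox a b \<and> ball 0 B \<subseteq> cbox c d \<longrightarrow>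
      norm (integral (cbox a b) (?r f) - integral (cbox c d) (?r f)) < e"
    proof (intro exI conjI allI impI)
      show "B > 0" by fact
      fix a b c d :: 'n assume *: "ball 0 B \<subseteq> cbox a b \<and> ball 0 B \<subseteq> cbox c d"
      have 1: "norm (integral (cbox a b) (?r f) - integral (cbox c d) (?r g)) < e / 3 + e / 3"
        by (rule norm_diff_triangle_less[OF close B(2)[OF *]])
      have 2: "norm (integral (cbox c d) (?r g) - integral (cbox c d) (?r f)) < e / 3"
        using close[of c d] by (simp add: norm_minus_commute)
      show "norm (integral (cbox a b) (?r f) - integral (cbox c d) (?r f)) < e"
        using norm_diff_triangle_less[OF 1 2] by simp
    qed
  qed
qed

lemma simple_function_integrable_on:
  fixes s :: "real \<Rightarrow> 'a::banach"
  assumes S: "S \<in> sets lebesgue" and s: "simple_function (lebesgue_on S) s"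
    and int: "integrable (lebesgue_on S) (\<lambda>x. norm (s x))"
  shows "s integrable_on S"
proof -
  have fin: "finite (s ` S)" using s by (simp add: simple_function_def)
  have "(\<lambda>x. indicat_real (s -` {y} \<inter> S) x *\<^sub>R y) integrable_on S" if y: "y \<in> s ` S" for y
  proof (cases "y = 0")
    case False
    have meas: "s -` {y} \<inter> S \<in> sets (lebesgue_on S)" using s y by (auto simp: simple_function_def)
    have "integrable (lebesgue_on S) (\<lambda>x. norm y * indicat_real (s -` {y} \<inter> S) x)"
    proof (rule Bochner_Integration.integrable_bound[OF int])
      show "(\<lambda>x. norm y * indicat_real (s -` {y} \<inter> S) x) \<in> borel_measurable (lebesgue_on S)"
        by (intro borel_measurable_times borel_measurable_const borel_measurable_indicator meas)
    qed (auto simp: indicator_def)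
    then have "integrable (lebesgue_on S) (\<lambda>x. indicat_real (s -` {y} \<inter> S) x)"
      using False by simp
    from has_integral_integral_lebesgue_on[OF this S]
    have "indicat_real (s -` {y} \<inter> S) integrable_on S" by (auto simp: integrable_on_def)
    then show ?thesis by (rule integrable_on_scaleR_left)
  qed (simp add: integrable_0)
  then have "(\<lambda>x. \<Sum>y\<in>s ` S. indicat_real (s -` {y} \<inter> S) x *\<^sub>R y) integrable_on S"
    using fin by (intro integrable_sum) auto
  moreover have "(\<Sum>y\<in>s ` S. indicat_real (s -` {y} \<inter> S) x *\<^sub>R y) = s x" if "x \<in> S" for x
  proof -
    have "(\<Sum>y\<in>s ` S. indicat_real (s -` {y} \<inter> S) x *\<^sub>R y) = (\<Sum>y\<in>s ` S. if y = s x then y else 0)"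
      using that by (intro sum.cong) (auto simp: indicator_def)
    also have "\<dots> = s x" using fin that by (simp add: sum.delta)
    finally show ?thesis .
  qed
  ultimately show ?thesis using integrable_eq by blast
qed

text \<open>Only the scalar functions \<open>norm (f x - s i x)\<close> are integrated in the
  Lebesgue sense. Dominated convergence makes their integrals small, and they serve as majorants in
  \<open>integrable_on_approx\<close>.\<close>

lemma strongly_measurable_integrable_on:
  fixes f :: "real \<Rightarrow> 'a::banach"
  assumes S: "S \<in> sets lebesgue" and f: "strongly_measurable (lebesgue_on S) f"
    and int: "integrable (lebesgue_on S) (\<lambda>x. norm (f x))"
  shows "f integrable_on S"
proof (rule integrable_on_approx)
  fix \<epsilon> :: real assume "\<epsilon> > 0"
  obtain s where s: "\<And>i. simple_function (lebesgue_on S) (s i)" "\<And>x. x \<in> S \<Longrightarrow> (\<lambda>i. s i x) \<longlonglongrightarrow> f x"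
    "\<And>i x. norm (s i x) \<le> 2 * norm (f x)"
    using strongly_measurable_simple_dominated[OF f] by auto
  let ?M = "lebesgue_on S"
  have sm: "strongly_measurable ?M (\<lambda>x. f x - s i x)" for i
    by (intro strongly_measurable_diff f strongly_measurable_simple s)
  have bound: "norm (f x - s i x) \<le> 3 * norm (f x)" for i x
    using norm_triangle_ineq4[of "f x" "s i x"] s(3)[of i x] by linarith
  have int3: "integrable ?M (\<lambda>x. 3 * norm (f x))" using int by simp
  have intd: "integrable ?M (\<lambda>x. norm (f x - s i x))" for i
    by (rule Bochner_Integration.integrable_bound[OF int3]) (use bound strongly_measurable_norm[OF sm] in auto)
  have ints: "integrable ?M (\<lambda>x. norm (s i x))" for i
    by (rule Bochner_Integration.integrable_bound[of _ "\<lambda>x. 2 * norm (f x)"])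
      (use int s(3) strongly_measurable_norm[OF strongly_measurable_simple[OF s(1)]] in auto)
  have "(\<lambda>i. \<integral>x. norm (f x - s i x) \<partial>?M) \<longlonglongrightarrow> (\<integral>x. 0 \<partial>?M)"
  proof (rule integral_dominated_convergence[OF _ _ int3])
    show "AE x in ?M. (\<lambda>i. norm (f x - s i x)) \<longlonglongrightarrow> 0"
    proof (rule AE_I2)
      fix x assume "x \<in> space ?M"
      then have "(\<lambda>i. norm (f x - s i x)) \<longlonglongrightarrow> norm (f x - f x)" by (intro tendsto_intros s) simp
      then show "(\<lambda>i. norm (f x - s i x)) \<longlonglongrightarrow> 0" by simp
    qed
  qed (use strongly_measurable_norm[OF sm] bound in auto)
  then have "\<forall>\<^sub>F i in sequentially. (\<integral>x. norm (f x - s i x) \<partial>?M) < \<epsilon>"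
    using \<open>\<epsilon> > 0\<close> by (intro order_tendstoD(2)) auto
  then obtain i where i: "(\<integral>x. norm (f x - s i x) \<partial>?M) < \<epsilon>"
    using eventually_happens'[OF sequentially_bot] by blast
  have "((\<lambda>x. norm (f x - s i x)) has_integral (\<integral>x. norm (f x - s i x) \<partial>?M)) S"
    by (rule has_integral_integral_lebesgue_on[OF intd S])
  then show "\<exists>g u. g integrable_on S \<and> u integrable_on S \<and> (\<forall>x\<in>S. norm (f x - g x) \<le> u x) \<and> integral S u < \<epsilon>"
    using simple_function_integrable_on[OF S s(1) ints, of i] i
    by (intro exI[of _ "s i"] exI[of _ "\<lambda>x. norm (f x - s i x)"]) (auto simp: integrable_on_def integral_unique)
qed

text \<open>Over a fine uniform mesh the errors add up to at most
  \<open>\<epsilon> * (K b - K a)\<close>. The lemma takes the place of a sign condition on a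
  derivative of \<open>F\<close> that need not exist. A general \<open>K\<close> is allowed because
  errors may be proportional to an integral rather than to the length of the step.\<close>

lemma local_to_global_mono:
  fixes F K :: "real \<Rightarrow> real"
  assumes "a \<le> b"
    and loc: "\<And>\<epsilon>. \<epsilon> > 0 \<Longrightarrow> \<exists>\<delta>>0. \<forall>s t. a \<le> s \<longrightarrow> s \<le> t \<longrightarrow> t \<le> b \<longrightarrow> t - s < \<delta> \<longrightarrow>
      - \<epsilon> * (K t - K s) \<le> F t - F s"
  shows "F a \<le> F b"
proof -
  have K: "F a - F b \<le> \<epsilon> * (K b - K a)" if "\<epsilon> > 0" for \<epsilon>
  proof -
    obtain \<delta> where "\<delta> > 0" and \<delta>: "\<And>s t. a \<le> s \<Longrightarrow> s \<le> t \<Longrightarrow> t \<le> b \<Longrightarrow> t - s < \<delta> \<Longrightarrow>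
      - \<epsilon> * (K t - K s) \<le> F t - F s"
      using loc[OF \<open>\<epsilon> > 0\<close>] by blast
    obtain n :: nat where n: "(b - a) / \<delta> < real n" using reals_Archimedean2 by blast
    have n0: "0 < n" using n \<open>\<delta> > 0\<close> \<open>a \<le> b\<close> by (cases n) (auto simp: field_simps)
    define t where "t i = a + (b - a) * real i / real n" for i
    have step: "t (Suc i) - t i = (b - a) / real n" for i
      by (simp add: t_def diff_divide_distrib[symmetric] distrib_left)
    have small: "(b - a) / real n < \<delta>"
      using n n0 \<open>\<delta> > 0\<close> by (simp add: pos_divide_less_eq mult.commute)
    have t: "a \<le> t i" "t i \<le> t (Suc i)" "t (Suc i) - t i < \<delta>" for i
    proof -
      have "0 \<le> (b - a) / real n" using \<open>a \<le> b\<close> by simp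
      then show "t i \<le> t (Suc i)" "t (Suc i) - t i < \<delta>" using step[of i] small by linarith+
      show "a \<le> t i" using \<open>a \<le> b\<close> by (simp add: t_def)
    qed
    have tb: "t (Suc i) \<le> b" if "i < n" for i
    proof -
      have "(b - a) * real (Suc i) \<le> (b - a) * real n" using that \<open>a \<le> b\<close> by (intro mult_left_mono) auto
      then have "(b - a) * real (Suc i) / real n \<le> b - a"
        using n0 by (simp add: pos_divide_le_eq)
      then show ?thesis by (simp add: t_def)
    qed
    have ends: "t 0 = a" "t n = b" using n0 by (auto simp: t_def)
    have "- \<epsilon> * (K b - K a) = (\<Sum>i<n. - \<epsilon> * (K (t (Suc i)) - K (t i)))"
      unfolding sum_distrib_left[symmetric] using sum_lessThan_telescope[of "\<lambda>i. K (t i)" n] ends by simp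
    also have "\<dots> \<le> (\<Sum>i<n. F (t (Suc i)) - F (t i))"
    proof (rule sum_mono)
      fix i assume "i \<in> {..<n}"
      then have "t (Suc i) \<le> b" by (intro tb) simp
      then show "- \<epsilon> * (K (t (Suc i)) - K (t i)) \<le> F (t (Suc i)) - F (t i)"
        by (intro \<delta> t)
    qed
    also have "\<dots> = F b - F a"
      using sum_lessThan_telescope[of "\<lambda>i. F (t i)" n] ends by simp
    finally show ?thesis by simp
  qed
  have "F a - F b \<le> 0 + e" if "e > 0" for e
  proof (cases "K b - K a \<le> 0")
    case True
    have "F a - F b \<le> 1 * (K b - K a)" by (rule K) simp
    then show ?thesis using True that by simp
  next
    case False
    then have "F a - F b \<le> e / (K b - K a) * (K b - K a)" using that by (intro K) auto
    then show ?thesis using False by simp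
  qed
  then have "F a - F b \<le> 0" by (rule field_le_epsilon)
  then show ?thesis by simp
qed

text \<open>Applied to minus the distance from \<open>F a\<close>, whose increments are dominated by
  those of \<open>F\<close>.\<close>

lemma local_to_global_const:
  fixes F :: "real \<Rightarrow> 'a::real_normed_vector"
  assumes "a \<le> b"
    and loc: "\<And>\<epsilon>. \<epsilon> > 0 \<Longrightarrow> \<exists>\<delta>>0. \<forall>s t. a \<le> s \<longrightarrow> s \<le> t \<longrightarrow> t \<le> b \<longrightarrow> t - s < \<delta> \<longrightarrow>
      norm (F t - F s) \<le> \<epsilon> * (K t - K s)"
  shows "F b = F a"
proof -
  have "- norm (F a - F a) \<le> - norm (F b - F a)"
  proof (rule local_to_global_mono[OF \<open>a \<le> b\<close>, of K])
    fix \<epsilon> :: real assume "\<epsilon> > 0"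
    from loc[OF this] obtain \<delta> where "\<delta> > 0" and \<delta>: "\<And>s t. a \<le> s \<Longrightarrow> s \<le> t \<Longrightarrow> t \<le> b \<Longrightarrow> t - s < \<delta> \<Longrightarrow>
      norm (F t - F s) \<le> \<epsilon> * (K t - K s)" by blast
    show "\<exists>\<delta>>0. \<forall>s t. a \<le> s \<longrightarrow> s \<le> t \<longrightarrow> t \<le> b \<longrightarrow> t - s < \<delta> \<longrightarrow>
      - \<epsilon> * (K t - K s) \<le> - norm (F t - F a) - - norm (F s - F a)"
    proof (intro exI conjI allI impI)
      show "\<delta> > 0" by fact
      fix s t assume "a \<le> s" "s \<le> t" "t \<le> b" "t - s < \<delta>"
      from \<delta>[OF this] show "- \<epsilon> * (K t - K s) \<le> - norm (F t - F a) - - norm (F s - F a)"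
        using norm_triangle_ineq[of "F t - F s" "F s - F a"] by simp
    qed
  qed
  then show ?thesis by simp
qed

text \<open>A convex function lies above its tangents. Convexity is used on the open half line, so
  the cases \<open>m = 0\<close> and \<open>y = 0\<close> are treated by hand.\<close>

lemma powr_tangent:
  fixes m y p :: real
  assumes "0 \<le> m" "0 \<le> y" "1 \<le> p"
  shows "p * m powr (p - 1) * (y - m) \<le> y powr p - m powr p"
proof (cases "m = 0")
  case True
  then show ?thesis using assms by simp
next
  case False
  then have m: "0 < m" using assms by simp
  have mp: "m powr (p - 1) * m = m powr p" using m by (simp add: powr_mult_base mult.commute)
  show ?thesis
  proof (cases "y = 0")
    case True
    have "1 * m powr p \<le> p * m powr p" using assms by (intro mult_right_mono) auto
    then show ?thesis using True mp assms by (simp add: mult.assoc)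
  next
    case False
    then have y: "0 < y" using assms by simp
    have "y powr p - m powr p \<ge> p * m powr (p - 1) * (y - m)"
    proof (rule convex_on_imp_above_tangent[OF powr_convex[OF assms(3)]])
      show "((\<lambda>x. x powr p) has_field_derivative p * m powr (p - 1)) (at m within {0<..})"
        by (rule has_field_derivative_at_within[OF has_real_derivative_powr[OF m]])
    qed (use m y in \<open>auto simp: interior_open\<close>)
    then show ?thesis .
  qed
qed

lemma integral_split:
  fixes f :: "real \<Rightarrow> 'a::banach"
  assumes "a \<le> s" "s \<le> t" "t \<le> b" and f: "f integrable_on {a..b}"
  shows "integral {a..t} f = integral {a..s} f + integral {s..t} f"
proof -
  have "f integrable_on {a..t}" by (rule integrable_subinterval_real[OF f]) (use assms in auto)
  from Henstock_Kurzweil_Integration.integral_combine[OF assms(1,2) this] show ?thesis by simp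
qed

text \<open>Formally h f' = f - \<gamma> gives h (norm f)' at least norm f - norm \<gamma>, and the
  tangent inequality turns this into the same statement for p-th powers. These derivatives need not
  exist, so the inequality is proved on short intervals with \<open>f\<close> frozen at the left end
  and made global by \<open>local_to_global_mono\<close>.\<close>

lemma norm_powr_growth:
  fixes f g \<gamma> :: "real \<Rightarrow> 'a::banach"
  assumes p: "1 \<le> p" and h: "0 < h" and ab: "a \<le> b"
    and cont: "continuous_on {a..b} f"
    and g: "\<And>s t. a \<le> s \<Longrightarrow> s \<le> t \<Longrightarrow> t \<le> b \<Longrightarrow> (g has_integral (f t - f s)) {s..t}"
    and \<gamma>: "\<And>\<tau>. \<tau> \<in> {a..b} \<Longrightarrow> \<gamma> \<tau> = f \<tau> - h *\<^sub>R g \<tau>"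
    and i1: "(\<lambda>\<tau>. norm (\<gamma> \<tau>)) integrable_on {a..b}"
    and ip: "(\<lambda>\<tau>. norm (\<gamma> \<tau>) powr p) integrable_on {a..b}"
  shows "norm (f a) powr p + (1 / h) * integral {a..b} (\<lambda>\<tau>. norm (f \<tau>) powr p - norm (\<gamma> \<tau>) powr p)
    \<le> norm (f b) powr p"
proof -
  let ?D = "\<lambda>\<tau>. norm (f \<tau>) powr p - norm (\<gamma> \<tau>) powr p"
  have cp: "continuous_on {a..b} (\<lambda>\<tau>. norm (f \<tau>) powr p)"
    using p by (intro continuous_on_powr' continuous_intros cont) auto
  have D: "?D integrable_on {a..b}"
    by (intro integrable_diff ip integrable_continuous_interval cp)
  define F where "F t = norm (f t) powr p - (1 / h) * integral {a..t} ?D" for t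
  have "F a \<le> F b"
  proof (rule local_to_global_mono[OF ab, of "\<lambda>t. t"])
    fix \<epsilon> :: real assume "\<epsilon> > 0"
    have "compact (f ` {a..b})" by (intro compact_continuous_image cont) simp
    from compact_imp_bounded[OF this]
    obtain B0 where "\<forall>x\<in>f ` {a..b}. norm x \<le> B0" unfolding bounded_iff by blast
    then have B0: "\<And>\<tau>. \<tau> \<in> {a..b} \<Longrightarrow> norm (f \<tau>) \<le> B0" by blast
    \<comment> \<open>An upper bound for the tangent slope \<open>p * m powr (p - 1)\<close> over
      all values \<open>m\<close> of the norm of \<open>f\<close>. The \<open>+ 1\<close> makes it
      positive, so that \<open>\<epsilon>1\<close> can be formed by division.\<close>
    define C where "C = p * (max B0 0) powr (p - 1) + 1"
    have C: "p * m powr (p - 1) \<le> C" if "0 \<le> m" "m \<le> B0" for m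
    proof -
      have "m powr (p - 1) \<le> (max B0 0) powr (p - 1)" using p that by (intro powr_mono2) auto
      then have "p * m powr (p - 1) \<le> p * (max B0 0) powr (p - 1)" using p by (intro mult_left_mono) auto
      then show ?thesis by (simp add: C_def)
    qed
    have C0: "C > 0" unfolding C_def using p by (intro add_nonneg_pos mult_nonneg_nonneg) auto
    define \<epsilon>1 where "\<epsilon>1 = \<epsilon> * h / (2 * C)"
    define \<epsilon>2 where "\<epsilon>2 = \<epsilon> * h / 2"
    have \<epsilon>12: "\<epsilon>1 > 0" "\<epsilon>2 > 0" using \<open>\<epsilon> > 0\<close> h C0 by (auto simp: \<epsilon>1_def \<epsilon>2_def)
    have e: "\<epsilon>2 + C * \<epsilon>1 = \<epsilon> * h" using C0 by (simp add: \<epsilon>1_def \<epsilon>2_def)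
    obtain \<delta>1 where \<delta>1: "\<delta>1 > 0" "\<And>s t. s \<in> {a..b} \<Longrightarrow> t \<in> {a..b} \<Longrightarrow> dist t s < \<delta>1 \<Longrightarrow> dist (f t) (f s) < \<epsilon>1"
      using compact_uniformly_continuous[OF cont] \<epsilon>12(1) unfolding uniformly_continuous_on_def by (metis compact_Icc)
    obtain \<delta>2 where \<delta>2: "\<delta>2 > 0" "\<And>s t. s \<in> {a..b} \<Longrightarrow> t \<in> {a..b} \<Longrightarrow> dist t s < \<delta>2 \<Longrightarrow>
        dist (norm (f t) powr p) (norm (f s) powr p) < \<epsilon>2"
      using compact_uniformly_continuous[OF cp] \<epsilon>12(2) unfolding uniformly_continuous_on_def by (metis compact_Icc)
    show "\<exists>\<delta>>0. \<forall>s t. a \<le> s \<longrightarrow> s \<le> t \<longrightarrow> t \<le> b \<longrightarrow> t - s < \<delta> \<longrightarrow> - \<epsilon> * (t - s) \<le> F t - F s"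
    proof (intro exI conjI allI impI)
      show "min \<delta>1 \<delta>2 > 0" using \<delta>1 \<delta>2 by simp
      fix s t assume st: "a \<le> s" "s \<le> t" "t \<le> b" "t - s < min \<delta>1 \<delta>2"
      have sub: "{s..t} \<subseteq> {a..b}" using st by auto
      define m where "m = norm (f s)"
      have m: "0 \<le> m" "m \<le> B0" using B0[of s] st by (auto simp: m_def)
      let ?c = "p * m powr (p - 1)"
      have c: "0 \<le> ?c" using p by simp
      have near: "norm (f \<tau> - f s) \<le> \<epsilon>1" "norm (f \<tau>) powr p \<le> m powr p + \<epsilon>2" if "\<tau> \<in> {s..t}" for \<tau>
        using \<delta>1(2)[of s \<tau>] \<delta>2(2)[of s \<tau>] that st by (auto simp: dist_norm m_def)
      have is1: "(\<lambda>\<tau>. norm (\<gamma> \<tau>)) integrable_on {s..t}" "(\<lambda>\<tau>. norm (\<gamma> \<tau>) powr p) integrable_on {s..t}"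
        "?D integrable_on {s..t}"
        using integrable_subinterval_real[OF i1 sub] integrable_subinterval_real[OF ip sub]
          integrable_subinterval_real[OF D sub] by auto
      define z where "z = f t - f s - ((t - s) / h) *\<^sub>R f s"
      have z: "((\<lambda>\<tau>. g \<tau> - (1 / h) *\<^sub>R f s) has_integral z) {s..t}"
        using has_integral_diff[OF g[OF st(1-3)] has_integral_const_real[of "(1 / h) *\<^sub>R f s" s t]] st
        by (simp add: z_def)
      have "norm z \<le> integral {s..t} (\<lambda>\<tau>. (1 / h) * (\<epsilon>1 + norm (\<gamma> \<tau>)))"
      proof -
        have "norm (integral {s..t} (\<lambda>\<tau>. g \<tau> - (1 / h) *\<^sub>R f s)) \<le> integral {s..t} (\<lambda>\<tau>. (1 / h) * (\<epsilon>1 + norm (\<gamma> \<tau>)))"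
        proof (rule integral_norm_bound_integral)
          show "(\<lambda>\<tau>. g \<tau> - (1 / h) *\<^sub>R f s) integrable_on {s..t}" using z by blast
          show "(\<lambda>\<tau>. (1 / h) * (\<epsilon>1 + norm (\<gamma> \<tau>))) integrable_on {s..t}"
            by (intro integrable_on_mult_right integrable_add integrable_const_ivl is1)
          fix \<tau> assume \<tau>: "\<tau> \<in> {s..t}"
          have "g \<tau> - (1 / h) *\<^sub>R f s = (1 / h) *\<^sub>R ((f \<tau> - f s) - \<gamma> \<tau>)"
            using \<gamma>[of \<tau>] \<tau> sub h by (auto simp: scaleR_diff_right)
          then have "norm (g \<tau> - (1 / h) *\<^sub>R f s) = (1 / h) * norm ((f \<tau> - f s) - \<gamma> \<tau>)" using h by simp
          also have "\<dots> \<le> (1 / h) * (\<epsilon>1 + norm (\<gamma> \<tau>))"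
            using h near[OF \<tau>] norm_triangle_ineq4[of "f \<tau> - f s" "\<gamma> \<tau>"] by (intro mult_left_mono) auto
          finally show "norm (g \<tau> - (1 / h) *\<^sub>R f s) \<le> (1 / h) * (\<epsilon>1 + norm (\<gamma> \<tau>))" .
        qed
        then show ?thesis using integral_unique[OF z] by simp
      qed
      also have "\<dots> = (1 / h) * ((t - s) * \<epsilon>1 + integral {s..t} (\<lambda>\<tau>. norm (\<gamma> \<tau>)))"
        using st by (simp add: Henstock_Kurzweil_Integration.integral_add[OF integrable_const_ivl is1(1)])
      finally have nz: "norm z \<le> (1 / h) * ((t - s) * \<epsilon>1 + integral {s..t} (\<lambda>\<tau>. norm (\<gamma> \<tau>)))" .
      have "(1 + (t - s) / h) * m \<le> norm (f t) + norm z"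
      proof -
        have "(1 + (t - s) / h) *\<^sub>R f s = f t - z" by (simp add: z_def scaleR_add_left)
        then have "norm ((1 + (t - s) / h) *\<^sub>R f s) \<le> norm (f t) + norm z" by (simp add: norm_triangle_ineq4)
        then show ?thesis using st h by (simp add: m_def)
      qed
      then have 1: "(1 / h) * ((t - s) * (m - \<epsilon>1) - integral {s..t} (\<lambda>\<tau>. norm (\<gamma> \<tau>))) \<le> norm (f t) - m"
        using nz h by (simp add: field_simps)
      \<comment> \<open>The tangent at \<open>m\<close> is used twice: here below
        \<open>norm (\<gamma> \<tau>) powr p\<close>, afterwards below
        \<open>norm (f t) powr p\<close>. Both times the slope is \<open>?c\<close>, so the two
        estimates fit together through inequality \<open>1\<close>.\<close>
      have "integral {s..t} ?D \<le> integral {s..t} (\<lambda>\<tau>. ?c * (m - \<epsilon>1 - norm (\<gamma> \<tau>)) + (\<epsilon>2 + C * \<epsilon>1))"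
      proof (rule integral_le[OF is1(3)])
        show "(\<lambda>\<tau>. ?c * (m - \<epsilon>1 - norm (\<gamma> \<tau>)) + (\<epsilon>2 + C * \<epsilon>1)) integrable_on {s..t}"
          by (intro integrable_add integrable_on_mult_right integrable_diff integrable_const_ivl is1)
        fix \<tau> assume \<tau>: "\<tau> \<in> {s..t}"
        have "?c * (norm (\<gamma> \<tau>) - m) \<le> norm (\<gamma> \<tau>) powr p - m powr p"
          using m p by (intro powr_tangent) auto
        moreover have "?c * \<epsilon>1 \<le> C * \<epsilon>1" using C[OF m] \<epsilon>12 by (intro mult_right_mono) auto
        ultimately show "?D \<tau> \<le> ?c * (m - \<epsilon>1 - norm (\<gamma> \<tau>)) + (\<epsilon>2 + C * \<epsilon>1)"
          using near(2)[OF \<tau>] by (simp add: algebra_simps)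
      qed
      also have "\<dots> = ?c * ((t - s) * (m - \<epsilon>1) - integral {s..t} (\<lambda>\<tau>. norm (\<gamma> \<tau>))) + (t - s) * (\<epsilon> * h)"
      proof -
        have a: "((\<lambda>\<tau>. ?c * (m - \<epsilon>1 - norm (\<gamma> \<tau>)) + \<epsilon> * h) has_integral
          (?c * ((t - s) * (m - \<epsilon>1) - integral {s..t} (\<lambda>\<tau>. norm (\<gamma> \<tau>))) + (t - s) * (\<epsilon> * h))) {s..t}"
          using has_integral_const_real[of "m - \<epsilon>1" s t] has_integral_const_real[of "\<epsilon> * h" s t] st
          by (intro has_integral_add has_integral_mult_right has_integral_diff integrable_integral is1) auto
        show ?thesis unfolding e by (rule integral_unique[OF a])
      qed
      finally have 2: "integral {s..t} ?D \<le> \<dots>" .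
      have "(1 / h) * (?c * ((t - s) * (m - \<epsilon>1) - integral {s..t} (\<lambda>\<tau>. norm (\<gamma> \<tau>)))) \<le> ?c * (norm (f t) - m)"
        using mult_left_mono[OF 1 c] by (simp add: ac_simps)
      also have "\<dots> \<le> norm (f t) powr p - m powr p" using m p by (intro powr_tangent) auto
      finally have 3: "(1 / h) * (?c * ((t - s) * (m - \<epsilon>1) - integral {s..t} (\<lambda>\<tau>. norm (\<gamma> \<tau>)))) \<le> norm (f t) powr p - m powr p" .
      have "(1 / h) * integral {s..t} ?D \<le> (1 / h) * (?c * ((t - s) * (m - \<epsilon>1) - integral {s..t} (\<lambda>\<tau>. norm (\<gamma> \<tau>))) + (t - s) * (\<epsilon> * h))"
        using h by (intro mult_left_mono 2) auto
      also have "\<dots> = (1 / h) * (?c * ((t - s) * (m - \<epsilon>1) - integral {s..t} (\<lambda>\<tau>. norm (\<gamma> \<tau>)))) + (t - s) * \<epsilon>"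
        using h by (simp add: distrib_left)
      finally have 4: "(1 / h) * integral {s..t} ?D \<le> norm (f t) powr p - m powr p + (t - s) * \<epsilon>"
        using 3 by linarith
      have "integral {a..t} ?D = integral {a..s} ?D + integral {s..t} ?D"
        by (rule integral_split[OF st(1-3) D])
      then have "F t - F s = norm (f t) powr p - m powr p - (1 / h) * integral {s..t} ?D"
        by (simp add: F_def m_def add_divide_distrib)
      then show "- \<epsilon> * (t - s) \<le> F t - F s" using 4 by (simp add: algebra_simps)
    qed
  qed
  then show ?thesis by (simp add: F_def)
qed

text \<open>Variation of constants for f' = (f - \<gamma>) / h. As \<open>\<gamma>\<close> is merely
  integrable, differentiation is avoided: \<open>f\<close> minus the integral of the right-hand side
  is shown to have increments negligible against \<open>K\<close>.\<close>

lemma exp_ode_solution: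
  fixes \<gamma> :: "real \<Rightarrow> 'a::banach"
  assumes h: "0 < h" and ab: "a \<le> b"
    and i1: "(\<lambda>\<tau>. norm (\<gamma> \<tau>)) integrable_on {a..b}" and i0: "\<gamma> integrable_on {a..b}"
    and ie: "(\<lambda>\<tau>. exp (- \<tau> / h) *\<^sub>R \<gamma> \<tau>) integrable_on {a..b}"
    and f: "\<And>s. s \<in> {a..b} \<Longrightarrow> f s = exp (s / h) *\<^sub>R (c - (1 / h) *\<^sub>R integral {a..s} (\<lambda>\<tau>. exp (- \<tau> / h) *\<^sub>R \<gamma> \<tau>))"
  shows "continuous_on {a..b} f"
    and "((\<lambda>\<tau>. (1 / h) *\<^sub>R (f \<tau> - \<gamma> \<tau>)) has_integral (f b - f a)) {a..b}"
proof -
  let ?e = "\<lambda>\<tau>. exp (- \<tau> / h) *\<^sub>R \<gamma> \<tau>"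
  define G where "G s = c - (1 / h) *\<^sub>R integral {a..s} ?e" for s
  have fG: "f s = exp (s / h) *\<^sub>R G s" if "s \<in> {a..b}" for s using f[OF that] by (simp add: G_def)
  have cG: "continuous_on {a..b} G"
    unfolding G_def by (intro continuous_intros indefinite_integral_continuous_1 ie)
  have cf': "continuous_on {a..b} (\<lambda>s. exp (s / h) *\<^sub>R G s)" using h by (intro continuous_intros cG) auto
  then show cf: "continuous_on {a..b} f" by (rule continuous_on_eq) (simp add: fG)
  let ?d = "\<lambda>\<tau>. (1 / h) *\<^sub>R (f \<tau> - \<gamma> \<tau>)"
  have d: "?d integrable_on {a..b}"
    by (intro integrable_cmul integrable_diff i0 integrable_continuous_interval cf)
  define F where "F t = f t - integral {a..t} ?d" for t
  define E where "E = exp (b / h)"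
  \<comment> \<open>The two summands match the two sources of error: the variation of
    \<open>G\<close>, weighted by \<open>exp (\<tau> / h)\<close> which is at most \<open>E\<close>,
    and the factor \<open>exp ((t - \<tau>) / h) - 1\<close> in front of
    \<open>\<gamma>\<close>.\<close>
  define K where "K t = E * t + integral {a..t} (\<lambda>\<tau>. norm (\<gamma> \<tau>))" for t
  have "F b = F a"
  proof (rule local_to_global_const[OF ab, of _ K])
    fix \<epsilon> :: real assume "\<epsilon> > 0"
    define \<epsilon>1 where "\<epsilon>1 = \<epsilon> * h"
    have \<epsilon>1: "\<epsilon>1 > 0" using \<open>\<epsilon> > 0\<close> h by (simp add: \<epsilon>1_def)
    obtain \<delta>1 where \<delta>1: "\<delta>1 > 0" "\<And>s t. s \<in> {a..b} \<Longrightarrow> t \<in> {a..b} \<Longrightarrow> dist t s < \<delta>1 \<Longrightarrow> dist (G t) (G s) < \<epsilon>1"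
      using compact_uniformly_continuous[OF cG] \<epsilon>1 unfolding uniformly_continuous_on_def by (metis compact_Icc)
    have "((\<lambda>x. exp (x / h)) \<longlongrightarrow> exp (0 / h)) (at 0)" using h by (intro tendsto_intros) auto
    from tendstoD[OF this \<epsilon>1]
    obtain \<delta>2 where \<delta>2: "\<delta>2 > 0" "\<And>x. x \<noteq> 0 \<and> dist x 0 < \<delta>2 \<Longrightarrow> dist (exp (x / h)) (exp (0 / h)) < \<epsilon>1"
      unfolding eventually_at by auto
    have \<delta>2': "\<bar>exp (x / h) - 1\<bar> \<le> \<epsilon>1" if "\<bar>x\<bar> < \<delta>2" for x
      using \<delta>2(2)[of x] that \<epsilon>1 by (cases "x = 0") (auto simp: dist_real_def)
    show "\<exists>\<delta>>0. \<forall>s t. a \<le> s \<longrightarrow> s \<le> t \<longrightarrow> t \<le> b \<longrightarrow> t - s < \<delta> \<longrightarrow> norm (F t - F s) \<le> \<epsilon> * (K t - K s)"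
    proof (intro exI conjI allI impI)
      show "min \<delta>1 \<delta>2 > 0" using \<delta>1 \<delta>2 by simp
      fix s t assume st: "a \<le> s" "s \<le> t" "t \<le> b" "t - s < min \<delta>1 \<delta>2"
      have sub: "{s..t} \<subseteq> {a..b}" using st by auto
      have stab: "s \<in> {a..b}" "t \<in> {a..b}" using st by auto
      have ist: "(\<lambda>\<tau>. norm (\<gamma> \<tau>)) integrable_on {s..t}" "\<gamma> integrable_on {s..t}" "?e integrable_on {s..t}" "?d integrable_on {s..t}"
        using integrable_subinterval_real[OF _ sub] i1 i0 ie d by auto
      have split: "integral {a..t} ?d = integral {a..s} ?d + integral {s..t} ?d"
        "integral {a..t} (\<lambda>\<tau>. norm (\<gamma> \<tau>)) = integral {a..s} (\<lambda>\<tau>. norm (\<gamma> \<tau>)) + integral {s..t} (\<lambda>\<tau>. norm (\<gamma> \<tau>))"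
        "integral {a..t} ?e = integral {a..s} ?e + integral {s..t} ?e"
        by (fact integral_split[OF st(1-3) d] integral_split[OF st(1-3) i1] integral_split[OF st(1-3) ie])+
      have h1: "((\<lambda>\<tau>. (exp (\<tau> / h) / h) *\<^sub>R G s) has_integral (exp (t / h) - exp (s / h)) *\<^sub>R G s) {s..t}"
      proof (rule has_integral_scaleR_left, rule fundamental_theorem_of_calculus[OF st(2)])
        fix x assume "x \<in> {s..t}"
        show "((\<lambda>\<tau>. exp (\<tau> / h)) has_vector_derivative exp (x / h) / h) (at x within {s..t})"
          using h by (auto intro!: derivative_eq_intros simp: has_real_derivative_iff_has_vector_derivative[symmetric])
      qed
      have h2: "((\<lambda>\<tau>. (exp (t / h) / h) *\<^sub>R ?e \<tau>) has_integral (exp (t / h) / h) *\<^sub>R integral {s..t} ?e) {s..t}"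
        by (intro has_integral_cmul integrable_integral ist)
      have h3: "(?d has_integral integral {s..t} ?d) {s..t}" by (intro integrable_integral ist)
      \<comment> \<open>The increment is gathered under one integral sign, because the integrand is
        small although its three terms separately are not.\<close>
      have Ft: "F t - F s = (exp (t / h) - exp (s / h)) *\<^sub>R G s - (exp (t / h) / h) *\<^sub>R integral {s..t} ?e - integral {s..t} ?d"
        using split fG[OF stab(1)] fG[OF stab(2)] unfolding F_def G_def
        by (simp add: algebra_simps)
      let ?I = "\<lambda>\<tau>. (exp (\<tau> / h) / h) *\<^sub>R G s - (exp (t / h) / h) *\<^sub>R ?e \<tau> - ?d \<tau>"
      have hI: "(?I has_integral (F t - F s)) {s..t}"
        unfolding Ft by (intro has_integral_diff h1 h2 h3)
      have "norm (integral {s..t} ?I) \<le> integral {s..t} (\<lambda>\<tau>. \<epsilon> * (E + norm (\<gamma> \<tau>)))"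
      proof (rule integral_norm_bound_integral)
        show "?I integrable_on {s..t}" using hI by blast
        show "(\<lambda>\<tau>. \<epsilon> * (E + norm (\<gamma> \<tau>))) integrable_on {s..t}"
          by (intro integrable_on_mult_right integrable_add integrable_const_ivl ist)
        fix \<tau> assume \<tau>: "\<tau> \<in> {s..t}"
        have \<tau>': "\<tau> \<in> {a..b}" using \<tau> sub by auto
        have "exp (t / h) * exp (- \<tau> / h) = exp ((t - \<tau>) / h)"
          by (simp add: exp_add[symmetric] diff_divide_distrib)
        then have "(exp (t / h) / h) *\<^sub>R ?e \<tau> = (exp ((t - \<tau>) / h) / h) *\<^sub>R \<gamma> \<tau>" by simp
        then have "?I \<tau> = (1 / h) *\<^sub>R (exp (\<tau> / h) *\<^sub>R (G s - G \<tau>) - (exp ((t - \<tau>) / h) - 1) *\<^sub>R \<gamma> \<tau>)"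
          using fG[OF \<tau>'] by (simp add: scaleR_diff_right scaleR_diff_left)
        then have "norm (?I \<tau>) = (1 / h) * norm (exp (\<tau> / h) *\<^sub>R (G s - G \<tau>) - (exp ((t - \<tau>) / h) - 1) *\<^sub>R \<gamma> \<tau>)"
          using h by simp
        also have "\<dots> \<le> (1 / h) * (exp (\<tau> / h) * norm (G s - G \<tau>) + \<bar>exp ((t - \<tau>) / h) - 1\<bar> * norm (\<gamma> \<tau>))"
          using h norm_triangle_ineq4[of "exp (\<tau> / h) *\<^sub>R (G s - G \<tau>)" "(exp ((t - \<tau>) / h) - 1) *\<^sub>R \<gamma> \<tau>"]
          by (intro mult_left_mono) auto
        also have "\<dots> \<le> (1 / h) * (E * \<epsilon>1 + \<epsilon>1 * norm (\<gamma> \<tau>))"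
        proof (intro mult_left_mono add_mono mult_mono mult_right_mono)
          show "exp (\<tau> / h) \<le> E" using \<tau>' h by (simp add: E_def divide_right_mono)
          show "norm (G s - G \<tau>) \<le> \<epsilon>1"
            using \<delta>1(2)[OF \<tau>' stab(1)] \<tau> st by (simp add: dist_norm)
          show "\<bar>exp ((t - \<tau>) / h) - 1\<bar> \<le> \<epsilon>1" using \<tau> st by (intro \<delta>2') auto
        qed (use h \<epsilon>1 in \<open>auto simp: E_def\<close>)
        also have "\<dots> = \<epsilon> * (E + norm (\<gamma> \<tau>))" using h by (simp add: \<epsilon>1_def field_simps)
        finally show "norm (?I \<tau>) \<le> \<epsilon> * (E + norm (\<gamma> \<tau>))" .
      qed
      also have "integral {s..t} ?I = F t - F s" by (rule integral_unique[OF hI])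
      also have "integral {s..t} (\<lambda>\<tau>. \<epsilon> * (E + norm (\<gamma> \<tau>))) = \<epsilon> * (K t - K s)"
      proof -
        have "integral {s..t} (\<lambda>\<tau>. \<epsilon> * (E + norm (\<gamma> \<tau>))) = \<epsilon> * ((t - s) * E + integral {s..t} (\<lambda>\<tau>. norm (\<gamma> \<tau>)))"
          using st by (simp add: Henstock_Kurzweil_Integration.integral_add[OF integrable_const_ivl ist(1)])
        then show ?thesis unfolding K_def split(2) by (simp add: algebra_simps)
      qed
      finally show "norm (F t - F s) \<le> \<epsilon> * (K t - K s)" .
    qed
  qed
  then have "integral {a..b} ?d = f b - f a" by (simp add: F_def algebra_simps)
  then show "(?d has_integral (f b - f a)) {a..b}" using integrable_integral[OF d] by simp
qed

section \<open>The spaces $L^p$ and $W^{1,p}$\<close>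

text \<open>The p-th power of the norm. Powers add up over components; the quasi-triangle constant
  \<open>2 powr p\<close> is harmless in completeness and density arguments, and the sharp
  inequality enters through \<open>lpi_split\<close>.\<close>

abbreviation lpi :: "real \<Rightarrow> 'm measure \<Rightarrow> ('m \<Rightarrow> 'b::banach) \<Rightarrow> real" where
  "lpi p M f \<equiv> (\<integral>x. norm (f x) powr p \<partial>M)"

lemma lpi_nonneg: "0 \<le> lpi p M f"
  by (rule integral_nonneg_AE) simp

lemma powr_add_bound:
  fixes a b p :: real
  assumes "0 \<le> a" "0 \<le> b" "0 \<le> p"
  shows "(a + b) powr p \<le> 2 powr p * (a powr p + b powr p)"
proof -
  have "(a + b) powr p \<le> (2 * max a b) powr p" using assms by (intro powr_mono2) auto
  also have "\<dots> = 2 powr p * max a b powr p" using assms by (simp add: powr_mult)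
  also have "\<dots> \<le> 2 powr p * (a powr p + b powr p)"
    by (intro mult_left_mono) (auto simp: max_def)
  finally show ?thesis .
qed

lemma norm_add_powr_bound:
  "0 \<le> p \<Longrightarrow> norm (x + y) powr p \<le> 2 powr p * (norm x powr p + norm y powr p)"
  using powr_mono2[OF _ norm_ge_zero norm_triangle_ineq[of x y], of p]
    powr_add_bound[of "norm x" "norm y" p] by force

lemma le_one_plus_powr: "1 \<le> p \<Longrightarrow> 0 \<le> a \<Longrightarrow> a \<le> 1 + a powr p" for a p :: real
proof (cases "a \<le> 1")
  case False
  assume "1 \<le> p"
  then have "a powr 1 \<le> a powr p" using False by (intro powr_mono) auto
  then show ?thesis using False by simp
qed (simp add: add_increasing2)

lemma memLp_strongly_measurable: "memLp p M f \<Longrightarrow> strongly_measurable M f"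
  by (simp add: memLp_def)

lemma memLp_integrable: "memLp p M f \<Longrightarrow> integrable M (\<lambda>x. norm (f x) powr p)"
  by (simp add: memLp_def)

lemma strongly_measurable_norm_powr [measurable]:
  "strongly_measurable M f \<Longrightarrow> (\<lambda>x. norm (f x) powr p) \<in> borel_measurable M"
  using strongly_measurable_norm[of M f] by measurable

lemma memLp_bound:
  assumes f: "memLp p M f" and g: "strongly_measurable M g" and p: "0 \<le> p"
    and le: "\<And>x. x \<in> space M \<Longrightarrow> norm (g x) powr p \<le> C * norm (f x) powr p"
  shows "memLp p M g"
  unfolding memLp_def
proof (intro conjI g)
  have "integrable M (\<lambda>x. C * norm (f x) powr p)" using memLp_integrable[OF f] by simp
  then show "integrable M (\<lambda>x. norm (g x) powr p)"
    by (rule Bochner_Integration.integrable_bound)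
      (use strongly_measurable_norm_powr[OF g, of p] le in \<open>auto intro!: AE_I2 order_trans[OF _ abs_ge_self]\<close>)
qed

lemma memLp_add:
  assumes f: "memLp p M f" and g: "memLp p M g" and p: "0 \<le> p"
  shows "memLp p M (\<lambda>x. f x + g x)" "lpi p M (\<lambda>x. f x + g x) \<le> 2 powr p * (lpi p M f + lpi p M g)"
proof -
  have i: "integrable M (\<lambda>x. 2 powr p * (norm (f x) powr p + norm (g x) powr p))"
    using memLp_integrable[OF f] memLp_integrable[OF g] by simp
  have sm: "strongly_measurable M (\<lambda>x. f x + g x)"
    by (intro strongly_measurable_add memLp_strongly_measurable[OF f] memLp_strongly_measurable[OF g])
  have "integrable M (\<lambda>x. norm (f x + g x) powr p)"
    by (rule Bochner_Integration.integrable_bound[OF i])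
      (use strongly_measurable_norm_powr[OF sm, of p] norm_add_powr_bound[OF p] in \<open>auto intro!: AE_I2\<close>)
  then show m: "memLp p M (\<lambda>x. f x + g x)" using sm by (simp add: memLp_def)
  have "lpi p M (\<lambda>x. f x + g x) \<le> (\<integral>x. 2 powr p * (norm (f x) powr p + norm (g x) powr p) \<partial>M)"
    by (rule integral_mono[OF memLp_integrable[OF m] i]) (rule norm_add_powr_bound[OF p])
  also have "\<dots> = 2 powr p * (lpi p M f + lpi p M g)"
    using memLp_integrable[OF f] memLp_integrable[OF g] by simp
  finally show "lpi p M (\<lambda>x. f x + g x) \<le> 2 powr p * (lpi p M f + lpi p M g)" .
qed

lemma memLp_bounded_linear:
  assumes T: "bounded_linear T" and f: "memLp p M f" and p: "0 \<le> p"
  shows "memLp p M (\<lambda>x. T (f x))"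
proof -
  obtain K where K: "\<And>x. norm (T x) \<le> norm x * K" "0 \<le> K"
    using bounded_linear.nonneg_bounded[OF T] by blast
  show ?thesis
  proof (rule memLp_bound[OF f strongly_measurable_bounded_linear[OF T memLp_strongly_measurable[OF f]] p, of "K powr p"])
    fix x
    have "norm (T (f x)) powr p \<le> (norm (f x) * K) powr p" using K p by (intro powr_mono2) auto
    then show "norm (T (f x)) powr p \<le> K powr p * norm (f x) powr p"
      using K by (simp add: powr_mult mult.commute)
  qed
qed

lemma memLp_minus: "memLp p M f \<Longrightarrow> 0 \<le> p \<Longrightarrow> memLp p M (\<lambda>x. - f x)"
  by (rule memLp_bounded_linear[OF bounded_linear_minus[OF bounded_linear_ident]])

lemma memLp_scaleR: "memLp p M f \<Longrightarrow> 0 \<le> p \<Longrightarrow> memLp p M (\<lambda>x. c *\<^sub>R f x)"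
  by (rule memLp_bounded_linear[OF bounded_linear_scaleR_right])

lemma memLp_diff:
  assumes f: "memLp p M f" and g: "memLp p M g" and p: "0 \<le> p"
  shows "memLp p M (\<lambda>x. f x - g x)" "lpi p M (\<lambda>x. f x - g x) \<le> 2 powr p * (lpi p M f + lpi p M g)"
  using memLp_add[OF f memLp_minus[OF g p] p] by simp_all

lemma memLp_zero: "memLp p M (\<lambda>_. 0)"
  unfolding memLp_def by (auto intro!: strongly_measurable_simple)

lemma memLp_cong:
  assumes f: "memLp p M f" and eq: "\<And>x. x \<in> space M \<Longrightarrow> f x = g x"
  shows "memLp p M g"
  unfolding memLp_def
proof
  show "strongly_measurable M g" by (rule strongly_measurable_cong[OF memLp_strongly_measurable[OF f] eq])
  show "integrable M (\<lambda>x. norm (g x) powr p)"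
    using memLp_integrable[OF f] eq by (metis (mono_tags, lifting) Bochner_Integration.integrable_cong)
qed

lemma lpi_triangle3:
  assumes f: "memLp p M f" and g: "memLp p M g" and k: "memLp p M k" and p: "0 \<le> p"
  shows "lpi p M (\<lambda>x. f x - k x) \<le> 2 powr p * (lpi p M (\<lambda>x. f x - g x) + lpi p M (\<lambda>x. g x - k x))"
  using memLp_add(2)[OF memLp_diff(1)[OF f g p] memLp_diff(1)[OF g k p] p] by simp

lemma memLp_subset:
  fixes f :: "real \<Rightarrow> 'a::banach"
  assumes f: "memLp p (lebesgue_on S) f" and T: "T \<subseteq> S" "T \<in> sets lebesgue" and S: "S \<in> sets lebesgue"
  shows "memLp p (lebesgue_on T) f"
  unfolding memLp_def
proof
  show "strongly_measurable (lebesgue_on T) f"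
    by (rule strongly_measurable_lebesgue_on_subset[OF memLp_strongly_measurable[OF f] T S])
  have "integrable lebesgue (\<lambda>x. indicat_real S x *\<^sub>R norm (f x) powr p)"
    using memLp_integrable[OF f] S by (subst (asm) integrable_restrict_space) auto
  from integrable_mult_indicator[OF T(2) this]
  have "integrable lebesgue (\<lambda>x. indicat_real T x *\<^sub>R (indicat_real S x *\<^sub>R norm (f x) powr p))" .
  moreover have "(\<lambda>x. indicat_real T x *\<^sub>R (indicat_real S x *\<^sub>R norm (f x) powr p))
      = (\<lambda>x. indicat_real T x *\<^sub>R norm (f x) powr p)"
    using T(1) by (auto simp: fun_eq_iff indicator_def)
  ultimately have "integrable lebesgue (\<lambda>x. indicat_real T x *\<^sub>R norm (f x) powr p)"
    by (simp only:)
  then show "integrable (lebesgue_on T) (\<lambda>x. norm (f x) powr p)"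
    using T by (subst integrable_restrict_space) auto
qed

text \<open>Yields integrability of a pointwise limit that is not known to be integrable beforehand:
  the limit in \<open>memLp_complete\<close>, and the solution on the half line through its
  truncations.\<close>

lemma integral_fatou:
  fixes u :: "nat \<Rightarrow> 'm \<Rightarrow> real"
  assumes u: "\<And>k. integrable M (u k)" "\<And>k x. 0 \<le> u k x" "\<And>k. (\<integral>x. u k x \<partial>M) \<le> C"
    and v: "v \<in> borel_measurable M" "\<And>x. 0 \<le> v x"
    and lim: "AE x in M. (\<lambda>k. u k x) \<longlonglongrightarrow> v x"
  shows "integrable M v" "(\<integral>x. v x \<partial>M) \<le> C"
proof -
  have C: "0 \<le> C" using order_trans[OF integral_nonneg_AE[OF AE_I2[OF u(2)]] u(3)] .
  have "(\<integral>\<^sup>+x. ennreal (v x) \<partial>M) = (\<integral>\<^sup>+x. liminf (\<lambda>k. ennreal (u k x)) \<partial>M)"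
  proof (rule nn_integral_cong_AE)
    show "AE x in M. ennreal (v x) = liminf (\<lambda>k. ennreal (u k x))"
      using lim
    proof eventually_elim
      case (elim x)
      then have "(\<lambda>k. ennreal (u k x)) \<longlonglongrightarrow> ennreal (v x)" by (intro tendsto_ennrealI)
      from lim_imp_Liminf[OF sequentially_bot this] show ?case by simp
    qed
  qed
  also have "\<dots> \<le> liminf (\<lambda>k. \<integral>\<^sup>+x. ennreal (u k x) \<partial>M)"
    by (intro nn_integral_liminf measurable_compose[OF borel_measurable_integrable[OF u(1)] measurable_ennreal])
  also have "\<dots> \<le> liminf (\<lambda>k. ennreal C)"
    using u by (intro Liminf_mono always_eventually allI) (simp add: nn_integral_eq_integral ennreal_leI)
  also have "\<dots> = ennreal C" by (simp add: Liminf_const)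
  finally have le: "(\<integral>\<^sup>+x. ennreal (v x) \<partial>M) \<le> ennreal C" .
  show i: "integrable M v"
    unfolding integrable_iff_bounded using v le
    by (auto simp: less_top[symmetric] top_unique)
  have "ennreal (\<integral>x. v x \<partial>M) \<le> ennreal C"
    using le nn_integral_eq_integral[OF i] v by simp
  then show "(\<integral>x. v x \<partial>M) \<le> C" using C by (simp add: ennreal_le_iff)
qed

lemma memLp_simple_approx:
  assumes f: "memLp p M f" and p: "0 < p" and "\<epsilon> > 0"
  obtains s where "simple_function M s" "memLp p M s" "lpi p M (\<lambda>x. f x - s x) < \<epsilon>"
proof -
  note smf = memLp_strongly_measurable[OF f]
  obtain s where s: "\<And>i. simple_function M (s i)" "\<And>x. x \<in> space M \<Longrightarrow> (\<lambda>i. s i x) \<longlonglongrightarrow> f x"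
    "\<And>i x. norm (s i x) \<le> 2 * norm (f x)"
    using strongly_measurable_simple_dominated[OF smf] by blast
  have sp: "norm (s i x) powr p \<le> 2 powr p * norm (f x) powr p" for i x
  proof -
    have "norm (s i x) powr p \<le> (2 * norm (f x)) powr p" using s(3) p by (intro powr_mono2) auto
    then show ?thesis by (simp add: powr_mult)
  qed
  have ms: "memLp p M (s i)" for i
    by (rule memLp_bound[OF f strongly_measurable_simple[OF s(1)] _ sp]) (use p in auto)
  have md: "memLp p M (\<lambda>x. f x - s i x)" for i by (rule memLp_diff(1)[OF f ms]) (use p in auto)
  have dp: "norm (f x - s i x) powr p \<le> 3 powr p * norm (f x) powr p" for i x
  proof -
    have "norm (f x - s i x) powr p \<le> (3 * norm (f x)) powr p"
      using norm_triangle_ineq4[of "f x" "s i x"] s(3)[of i x] p by (intro powr_mono2) auto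
    then show ?thesis by (simp add: powr_mult)
  qed
  have "(\<lambda>i. lpi p M (\<lambda>x. f x - s i x)) \<longlonglongrightarrow> (\<integral>x. 0 \<partial>M)"
  proof (rule integral_dominated_convergence)
    show "integrable M (\<lambda>x. 3 powr p * norm (f x) powr p)" using memLp_integrable[OF f] by simp
    show "(\<lambda>x. norm (f x - s i x) powr p) \<in> borel_measurable M" for i
      by (rule strongly_measurable_norm_powr[OF memLp_strongly_measurable[OF md]])
    show "AE x in M. norm (norm (f x - s i x) powr p) \<le> 3 powr p * norm (f x) powr p" for i
      using dp by simp
    show "AE x in M. (\<lambda>i. norm (f x - s i x) powr p) \<longlonglongrightarrow> 0"
    proof (rule AE_I2)
      fix x assume "x \<in> space M"
      then have "(\<lambda>i. norm (f x - s i x)) \<longlonglongrightarrow> norm (f x - f x)" by (intro tendsto_intros s)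
      then have "(\<lambda>i. norm (f x - s i x)) \<longlonglongrightarrow> 0" by simp
      from tendsto_powr2[OF this tendsto_const[of p]] show "(\<lambda>i. norm (f x - s i x) powr p) \<longlonglongrightarrow> 0"
        using p by simp
    qed
  qed simp
  then have "\<forall>\<^sub>F i in sequentially. lpi p M (\<lambda>x. f x - s i x) < \<epsilon>"
    using \<open>\<epsilon> > 0\<close> by (intro order_tendstoD(2)) auto
  then obtain i where "lpi p M (\<lambda>x. f x - s i x) < \<epsilon>" using eventually_happens'[OF sequentially_bot] by blast
  then show thesis using that s(1) ms by blast
qed

lemma convergent_fast:
  fixes a :: "nat \<Rightarrow> 'a::banach"
  assumes "\<forall>\<^sub>F k in sequentially. norm (a k - a (Suc k)) < (1 / 2) ^ k"
  shows "convergent a"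
proof -
  have "summable (\<lambda>k. a (Suc k) - a k)"
  proof (rule summable_comparison_test_ev)
    show "summable (\<lambda>k. (1 / 2 :: real) ^ k)" by (rule summable_geometric) simp
    show "\<forall>\<^sub>F k in sequentially. norm (a (Suc k) - a k) \<le> (1 / 2) ^ k"
      using assms by eventually_elim (simp add: norm_minus_commute)
  qed
  then have "convergent (\<lambda>n. \<Sum>k<n. a (Suc k) - a k)" by (simp add: summable_iff_convergent)
  then have "convergent (\<lambda>n. a n - a 0)" by (simp add: sum_lessThan_telescope)
  then have "convergent (\<lambda>n. (a n - a 0) + a 0)" by (intro convergent_add convergent_const)
  then show ?thesis by simp
qed

text \<open>Riesz-Fischer. The limit has to be a pointwise limit of simple functions, so a fast
  subsequence is replaced by nearby simple functions \<open>h k\<close>. Their increments are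
  summable almost everywhere by Markov's inequality and Borel-Cantelli, and Fatou's lemma turns the
  pointwise limit into a limit in norm.\<close>

lemma memLp_complete:
  fixes f :: "nat \<Rightarrow> 'm \<Rightarrow> 'b::banach"
  assumes f: "\<And>n. memLp p M (f n)" and p: "0 < p"
    and Cauchy: "\<And>\<epsilon>. \<epsilon> > 0 \<Longrightarrow> \<exists>n0. \<forall>m\<ge>n0. \<forall>n\<ge>n0. lpi p M (\<lambda>x. f m x - f n x) < \<epsilon>"
  obtains g where "memLp p M g" "(\<lambda>n. lpi p M (\<lambda>x. f n x - g x)) \<longlonglongrightarrow> 0"
proof -
  have p0: "0 \<le> p" using p by simp
  \<comment> \<open>The two quasi-triangle steps in \<open>step\<close> cost \<open>2 powr p\<close>
    each and leave three errors of size \<open>\<eta> k\<close>, which \<open>c\<close> cancels. The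
    ratio in \<open>\<eta>\<close> is such that \<open>(1 / 2) ^ k\<close> survives the division by
    \<open>((1 / 2) ^ k) powr p\<close> in Markov's inequality.\<close>
  define c where "c = 1 / (3 * (2 powr p * 2 powr p))"
  define \<eta> where "\<eta> k = c * (1 / (2 * 2 powr p)) ^ k" for k :: nat
  have c: "0 < c" by (simp add: c_def)
  have \<eta>: "0 < \<eta> k" "\<eta> (Suc k) \<le> \<eta> k" for k
  proof -
    show "0 < \<eta> k" using c by (simp add: \<eta>_def)
    have "1 / (2 * 2 powr p) \<le> 1" using ge_one_powr_ge_zero[of 2 p] p by simp
    then have "(1 / (2 * 2 powr p)) ^ Suc k \<le> (1 / (2 * 2 powr p)) ^ k"
      by (intro power_decreasing) auto
    then show "\<eta> (Suc k) \<le> \<eta> k" using c unfolding \<eta>_def by (intro mult_left_mono) auto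
  qed
  have "\<exists>N. \<forall>k. \<forall>m\<ge>N k. \<forall>n\<ge>N k. lpi p M (\<lambda>x. f m x - f n x) < \<eta> k"
    by (rule choice) (use Cauchy[OF \<eta>(1)] in blast)
  then obtain N :: "nat \<Rightarrow> nat" where N: "\<And>k m n. N k \<le> m \<Longrightarrow> N k \<le> n \<Longrightarrow> lpi p M (\<lambda>x. f m x - f n x) < \<eta> k"
    by blast
  \<comment> \<open>Lies beyond \<open>N i\<close> for every \<open>i \<le> k\<close>, and is at
    least \<open>k\<close>, so that it eventually passes any given index.\<close>
  define R where "R k = k + (\<Sum>i\<le>k. N i)" for k
  have R: "N i \<le> R k" if "i \<le> k" for i k
    unfolding R_def by (rule trans_le_add2, rule member_le_sum) (use that in auto)
  have "\<exists>h. \<forall>k. simple_function M (h k) \<and> memLp p M (h k) \<and> lpi p M (\<lambda>x. f (R k) x - h k x) < \<eta> k"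
    by (rule choice) (use memLp_simple_approx[OF f p \<eta>(1)] in metis)
  then obtain h where h: "\<And>k. simple_function M (h k)" "\<And>k. memLp p M (h k)"
    "\<And>k. lpi p M (\<lambda>x. f (R k) x - h k x) < \<eta> k" by blast
  have h': "lpi p M (\<lambda>x. h k x - f (R k) x) < \<eta> k" for k using h(3)[of k] by (simp add: norm_minus_commute)
  have step: "lpi p M (\<lambda>x. h k x - h (Suc k) x) \<le> (1 / (2 * 2 powr p)) ^ k" for k
  proof -
    have 1: "lpi p M (\<lambda>x. h k x - h (Suc k) x)
        \<le> 2 powr p * (lpi p M (\<lambda>x. h k x - f (R k) x) + lpi p M (\<lambda>x. f (R k) x - h (Suc k) x))"
      by (rule lpi_triangle3[OF h(2) f h(2) p0])
    have 2: "lpi p M (\<lambda>x. f (R k) x - h (Suc k) x)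
        \<le> 2 powr p * (lpi p M (\<lambda>x. f (R k) x - f (R (Suc k)) x) + lpi p M (\<lambda>x. f (R (Suc k)) x - h (Suc k) x))"
      by (rule lpi_triangle3[OF f f h(2) p0])
    have 3: "lpi p M (\<lambda>x. f (R k) x - f (R (Suc k)) x) < \<eta> k" by (rule N) (use R in auto)
    have one: "1 \<le> 2 powr p" using ge_one_powr_ge_zero[of 2 p] p by simp
    have "lpi p M (\<lambda>x. f (R k) x - h (Suc k) x) \<le> 2 powr p * (\<eta> k + \<eta> k)"
      using 2 3 h(3)[of "Suc k"] \<eta>(2)[of k]
      by (intro order_trans[OF 2] mult_left_mono add_mono) auto
    moreover have "\<eta> k \<le> 2 powr p * \<eta> k" using one \<eta>(1)[of k] by simp
    ultimately have "lpi p M (\<lambda>x. h k x - f (R k) x) + lpi p M (\<lambda>x. f (R k) x - h (Suc k) x) \<le> 3 * (2 powr p * \<eta> k)"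
      using h'[of k] by simp
    then have "lpi p M (\<lambda>x. h k x - h (Suc k) x) \<le> 2 powr p * (3 * (2 powr p * \<eta> k))"
      by (intro order_trans[OF 1] mult_left_mono) auto
    also have "\<dots> = (1 / (2 * 2 powr p)) ^ k" by (simp add: \<eta>_def c_def)
    finally show ?thesis .
  qed
  have md: "memLp p M (\<lambda>x. h k x - h (Suc k) x)" for k by (rule memLp_diff(1)[OF h(2) h(2) p0])
  define A where "A k = {x \<in> space M. norm (h k x - h (Suc k) x) powr p \<ge> ((1/2) ^ k) powr p}" for k
  have [measurable]: "(\<lambda>x. norm (h k x - h (Suc k) x) powr p) \<in> borel_measurable M" for k
    by (rule strongly_measurable_norm_powr[OF memLp_strongly_measurable[OF md]])
  have Am: "A k \<in> sets M" for k unfolding A_def by measurable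
  have half: "((1/2::real) ^ k) powr p = (1 / 2 powr p) ^ k" for k
    by (simp add: powr_realpow[symmetric] powr_powr powr_divide mult.commute power_one_over)
  have Ae: "emeasure M (A k) \<le> ennreal ((1/2) ^ k)" for k
  proof -
    have "emeasure M (A k) \<le> ennreal ((1 / ((1/2) ^ k) powr p) * lpi p M (\<lambda>x. h k x - h (Suc k) x))"
      unfolding A_def by (rule integral_Markov_inequality[OF memLp_integrable[OF md]]) auto
    also have "\<dots> \<le> ennreal ((1 / ((1/2) ^ k) powr p) * (1 / (2 * 2 powr p)) ^ k)"
      by (intro ennreal_leI mult_left_mono step) auto
    also have "(1 / ((1/2) ^ k) powr p) * (1 / (2 * 2 powr p)) ^ k = (1/2) ^ k"
      unfolding half by (simp add: power_divide power_mult_distrib)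
    finally show ?thesis .
  qed
  have "AE x in M. \<forall>\<^sub>F k in sequentially. x \<in> space M - A k"
  proof (rule borel_cantelli_AE1[OF Am])
    show "emeasure M (A k) < \<infinity>" for k
      using le_less_trans[OF Ae[of k] ennreal_less_top] by simp
    show "summable (\<lambda>k. measure M (A k))"
    proof (rule summable_comparison_test')
      show "summable (\<lambda>k. (1 / 2 :: real) ^ k)" by (rule summable_geometric) simp
      show "norm (measure M (A k)) \<le> (1 / 2) ^ k" for k
        using Ae[of k] by (simp add: measure_def enn2real_leI)
    qed
  qed
  then have "AE x in M. convergent (\<lambda>k. h k x)"
  proof (rule AE_mp[OF _ AE_I2], intro impI)
    fix x assume "\<forall>\<^sub>F k in sequentially. x \<in> space M - A k"
    then have "\<forall>\<^sub>F k in sequentially. norm (h k x - h (Suc k) x) < (1/2) ^ k"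
    proof eventually_elim
      case (elim k)
      then have "norm (h k x - h (Suc k) x) powr p < ((1/2) ^ k) powr p" by (auto simp: A_def)
      then show ?case using p powr_mono2[of p "(1/2) ^ k" "norm (h k x - h (Suc k) x)"] by fastforce
    qed
    then show "convergent (\<lambda>k. h k x)" by (rule convergent_fast)
  qed
  then obtain Z where Z: "Z \<in> null_sets M" "{x \<in> space M. \<not> convergent (\<lambda>k. h k x)} \<subseteq> Z"
    by (auto elim!: AE_E simp: null_sets_def)
  \<comment> \<open>Strong measurability demands convergence at every point, so both the
    approximants and the limit are set to zero on the null set \<open>Z\<close>.\<close>
  define g where "g x = (if x \<in> Z then 0 else lim (\<lambda>k. h k x))" for x
  have lim: "(\<lambda>k. if x \<in> Z then 0 else h k x) \<longlonglongrightarrow> g x" if "x \<in> space M" for x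
    using Z(2) that by (auto simp: g_def convergent_LIMSEQ_iff)
  have sg: "strongly_measurable M g"
  proof (rule strongly_measurableI[OF _ lim])
    show "simple_function M (\<lambda>x. if x \<in> Z then 0 else h k x)" for k
      using Z(1) by (intro simple_function_If_set simple_function_const h) (auto simp: null_sets_def)
  qed
  have AElim: "AE x in M. (\<lambda>k. h k x) \<longlonglongrightarrow> g x"
    using AE_not_in[OF Z(1)] AE_space
  proof eventually_elim
    case (elim x)
    then show ?case using lim[of x] by simp
  qed
  have bound: "memLp p M (\<lambda>x. f n x - g x) \<and> lpi p M (\<lambda>x. f n x - g x) \<le> 2 powr p * (\<epsilon> + \<epsilon>)"
    if "\<epsilon> > 0" and n0: "\<forall>m\<ge>n0. \<forall>n\<ge>n0. lpi p M (\<lambda>x. f m x - f n x) < \<epsilon>" and "n \<ge> n0" for \<epsilon> n0 n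
  proof -
    have "\<eta> \<longlonglongrightarrow> c * 0"
      unfolding \<eta>_def using ge_one_powr_ge_zero[of 2 p] p by (intro tendsto_intros LIMSEQ_power_zero) simp
    then have "\<forall>\<^sub>F k in sequentially. \<eta> k < \<epsilon>" using \<open>\<epsilon> > 0\<close> by (intro order_tendstoD(2)) auto
    then obtain k0 where k0: "\<And>k. k \<ge> k0 \<Longrightarrow> \<eta> k < \<epsilon>" unfolding eventually_sequentially by blast
    define K where "K = max k0 n0"
    have u: "memLp p M (\<lambda>x. f n x - h k x)" for k by (rule memLp_diff(1)[OF f h(2) p0])
    have le: "lpi p M (\<lambda>x. f n x - h (k + K) x) \<le> 2 powr p * (\<epsilon> + \<epsilon>)" for k
    proof -
      have "n0 \<le> R (k + K)" by (simp add: R_def K_def)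
      then have "lpi p M (\<lambda>x. f n x - f (R (k + K)) x) < \<epsilon>" using n0 \<open>n \<ge> n0\<close> by blast
      moreover have "lpi p M (\<lambda>x. f (R (k + K)) x - h (k + K) x) < \<epsilon>"
        using less_trans[OF h(3)[of "k + K"] k0[of "k + K"]] unfolding K_def by linarith
      moreover have "lpi p M (\<lambda>x. f n x - h (k + K) x)
          \<le> 2 powr p * (lpi p M (\<lambda>x. f n x - f (R (k + K)) x) + lpi p M (\<lambda>x. f (R (k + K)) x - h (k + K) x))"
        by (rule lpi_triangle3[OF f f h(2) p0])
      moreover have "2 powr p * (x + y) \<le> 2 powr p * (\<epsilon> + \<epsilon>)" if "x < \<epsilon>" "y < \<epsilon>" for x y
        using that by (intro mult_left_mono add_mono) auto
      ultimately show ?thesis by (meson order_trans)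
    qed
    have sm: "strongly_measurable M (\<lambda>x. f n x - g x)"
      by (intro strongly_measurable_diff memLp_strongly_measurable[OF f] sg)
    have lm: "AE x in M. (\<lambda>k. norm (f n x - h (k + K) x) powr p) \<longlonglongrightarrow> norm (f n x - g x) powr p"
      using AElim
    proof eventually_elim
      case (elim x)
      have "(\<lambda>k. norm (f n x - h (k + K) x)) \<longlonglongrightarrow> norm (f n x - g x)"
        by (intro tendsto_intros LIMSEQ_ignore_initial_segment elim)
      from tendsto_powr2[OF this tendsto_const[of p]] show ?case using p by simp
    qed
    note F = integral_fatou[OF memLp_integrable[OF u] _ le strongly_measurable_norm_powr[OF sm] _ lm]
    show ?thesis unfolding memLp_def using F sm by simp
  qed
  show thesis
  proof
    obtain n0 where "\<forall>m\<ge>n0. \<forall>n\<ge>n0. lpi p M (\<lambda>x. f m x - f n x) < 1" using Cauchy[of 1] by auto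
    from bound[OF _ this, of n0] have "memLp p M (\<lambda>x. f n0 x - g x)" by simp
    from memLp_diff(1)[OF f this p0, of n0] show "memLp p M g" by simp
    show "(\<lambda>n. lpi p M (\<lambda>x. f n x - g x)) \<longlonglongrightarrow> 0"
    proof (rule LIMSEQ_I)
      fix e :: real assume "e > 0"
      define \<epsilon> where "\<epsilon> = e / (4 * 2 powr p)"
      have \<epsilon>: "\<epsilon> > 0" "2 powr p * (\<epsilon> + \<epsilon>) = e / 2" using \<open>e > 0\<close> by (auto simp: \<epsilon>_def field_simps)
      obtain n0 where n0: "\<forall>m\<ge>n0. \<forall>n\<ge>n0. lpi p M (\<lambda>x. f m x - f n x) < \<epsilon>" using Cauchy[OF \<epsilon>(1)] by blast
      have "norm (lpi p M (\<lambda>x. f n x - g x) - 0) < e" if "n \<ge> n0" for n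
        using bound[OF \<epsilon>(1) n0 that] \<epsilon>(2) \<open>e > 0\<close> lpi_nonneg[where p = p and M = M and f = "\<lambda>x. f n x - g x"] by simp
      then show "\<exists>no. \<forall>n\<ge>no. norm (lpi p M (\<lambda>x. f n x - g x) - 0) < e" by blast
    qed
  qed
qed

lemma strongly_measurable_real:
  fixes f :: "'m \<Rightarrow> real"
  assumes "f \<in> borel_measurable M"
  shows "strongly_measurable M f"
proof -
  obtain F where "\<And>i. simple_function M (F i)" "\<And>x. x \<in> space M \<Longrightarrow> (\<lambda>i. F i x) \<longlonglongrightarrow> f x"
    using borel_measurable_implies_sequence_metric[OF assms, of 0] by blast
  then show ?thesis by (rule strongly_measurableI)
qed

lemma strongly_measurable_scaleR:
  fixes c :: "'m \<Rightarrow> real"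
  assumes "c \<in> borel_measurable M" "strongly_measurable M f"
  shows "strongly_measurable M (\<lambda>x. c x *\<^sub>R f x)"
  by (rule strongly_measurable_compose2[OF strongly_measurable_real[OF assms(1)] assms(2)])
    (rule tendsto_scaleR)

lemma strongly_measurable_const: "strongly_measurable M (\<lambda>_. x)"
  by (rule strongly_measurable_simple) simp

lemma integrable_indicator_Icc_lebesgue_on:
  assumes I: "I \<in> sets lebesgue"
  shows "integrable (lebesgue_on I) (indicat_real {\<alpha>..\<beta>})"
    and "\<alpha> \<le> \<beta> \<Longrightarrow> (\<integral>s. indicat_real {\<alpha>..\<beta>} s \<partial>lebesgue_on I) \<le> \<beta> - \<alpha>"
proof -
  have i: "integrable lebesgue (indicat_real {\<alpha>..\<beta>})"
    by (simp add: integrable_indicator_iff emeasure_lborel_Icc_eq)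
  have i': "integrable lebesgue (\<lambda>s. indicat_real I s *\<^sub>R indicat_real {\<alpha>..\<beta>} s)"
    by (rule integrable_mult_indicator[OF I i])
  show "integrable (lebesgue_on I) (indicat_real {\<alpha>..\<beta>})"
    using I i' by (subst integrable_restrict_space) auto
  assume "\<alpha> \<le> \<beta>"
  have "(\<integral>s. indicat_real {\<alpha>..\<beta>} s \<partial>lebesgue_on I) = (\<integral>s. indicat_real I s *\<^sub>R indicat_real {\<alpha>..\<beta>} s \<partial>lebesgue)"
    using I by (subst integral_restrict_space) auto
  also have "\<dots> \<le> (\<integral>s. indicat_real {\<alpha>..\<beta>} s \<partial>lebesgue)"
    by (rule integral_mono[OF i' i]) (auto simp: indicator_def)
  also have "\<dots> = \<beta> - \<alpha>" using \<open>\<alpha> \<le> \<beta>\<close> by simp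
  finally show "(\<integral>s. indicat_real {\<alpha>..\<beta>} s \<partial>lebesgue_on I) \<le> \<beta> - \<alpha>" .
qed

lemma memLp_bounded_support:
  fixes f :: "real \<Rightarrow> 'a::banach"
  assumes f: "strongly_measurable (lebesgue_on I) f" and I: "I \<in> sets lebesgue" and p: "0 < p"
    and B: "\<And>s. norm (f s) \<le> B" and supp: "\<And>s. s \<notin> {\<alpha>..\<beta>} \<Longrightarrow> f s = 0"
  shows "memLp p (lebesgue_on I) f"
  unfolding memLp_def
proof (intro conjI f)
  have i: "integrable (lebesgue_on I) (\<lambda>s. B powr p * indicat_real {\<alpha>..\<beta>} s)"
    using integrable_indicator_Icc_lebesgue_on(1)[OF I] by simp
  show "integrable (lebesgue_on I) (\<lambda>s. norm (f s) powr p)"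
  proof (rule Bochner_Integration.integrable_bound[OF i strongly_measurable_norm_powr[OF f] AE_I2])
    fix s
    have "norm (f s) powr p \<le> B powr p" using B p by (intro powr_mono2) auto
    then show "norm (norm (f s) powr p) \<le> norm (B powr p * indicat_real {\<alpha>..\<beta>} s)"
      using supp[of s] by (cases "s \<in> {\<alpha>..\<beta>}") auto
  qed
qed

section \<open>Weakly differentiable functions and their density in L^p\<close>

lemma W1p_with_memLp: "W1p_with p I f g \<Longrightarrow> memLp p (lebesgue_on I) f \<and> memLp p (lebesgue_on I) g"
  by (simp add: W1p_with_def)

lemma W1p_with_has_integral:
  "W1p_with p I f g \<Longrightarrow> s \<in> I \<Longrightarrow> t \<in> I \<Longrightarrow> s \<le> t \<Longrightarrow> (g has_integral (f t - f s)) {s..t}"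
  by (simp add: W1p_with_def)

lemma W1p_with_add:
  assumes "W1p_with p I f f'" "W1p_with p I g g'" "0 \<le> p"
  shows "W1p_with p I (\<lambda>x. f x + g x) (\<lambda>x. f' x + g' x)"
  unfolding W1p_with_def
proof (intro conjI ballI impI)
  show "memLp p (lebesgue_on I) (\<lambda>x. f x + g x)" "memLp p (lebesgue_on I) (\<lambda>x. f' x + g' x)"
    using assms W1p_with_memLp by (blast intro: memLp_add(1))+
  fix s t assume "s \<in> I" "t \<in> I" "s \<le> t"
  from has_integral_add[OF W1p_with_has_integral[OF assms(1) this] W1p_with_has_integral[OF assms(2) this]]
  show "((\<lambda>x. f' x + g' x) has_integral f t + g t - (f s + g s)) {s..t}"
    by (simp add: algebra_simps)
qed

lemma W1p_with_bounded_linear: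
  assumes "W1p_with p I f f'" and T: "bounded_linear T" and p: "0 \<le> p"
  shows "W1p_with p I (\<lambda>x. T (f x)) (\<lambda>x. T (f' x))"
  unfolding W1p_with_def
proof (intro conjI ballI impI)
  show "memLp p (lebesgue_on I) (\<lambda>x. T (f x))" "memLp p (lebesgue_on I) (\<lambda>x. T (f' x))"
    using W1p_with_memLp[OF assms(1)] memLp_bounded_linear[OF T _ p] by blast+
  fix s t assume "s \<in> I" "t \<in> I" "s \<le> t"
  from has_integral_linear[OF W1p_with_has_integral[OF assms(1) this] T]
  show "((\<lambda>x. T (f' x)) has_integral T (f t) - T (f s)) {s..t}"
    by (simp add: comp_def linear_diff[OF bounded_linear.linear[OF T]])
qed

lemma W1p_with_diff:
  assumes "W1p_with p I f f'" "W1p_with p I g g'" "0 \<le> p"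
  shows "W1p_with p I (\<lambda>x. f x - g x) (\<lambda>x. f' x - g' x)"
  using W1p_with_add[OF assms(1) W1p_with_bounded_linear[OF assms(2) bounded_linear_minus[OF bounded_linear_ident] assms(3)] assms(3)]
  by simp

text \<open>Membership in the L^p closure of the weakly differentiable functions. Its stability
  under sums, negation and limits is what the induction over Borel sets uses.\<close>

definition W1p_approximable :: "real \<Rightarrow> real set \<Rightarrow> (real \<Rightarrow> 'b::banach) \<Rightarrow> bool" where
  "W1p_approximable p I f \<longleftrightarrow> memLp p (lebesgue_on I) f \<and>
     (\<forall>\<epsilon>>0. \<exists>w w'. W1p_with p I w w' \<and> lpi p (lebesgue_on I) (\<lambda>x. f x - w x) < \<epsilon>)"

lemma W1p_approximable_add:
  assumes f: "W1p_approximable p I f" and g: "W1p_approximable p I g" and p: "0 \<le> p"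
  shows "W1p_approximable p I (\<lambda>x. f x + g x)"
  unfolding W1p_approximable_def
proof (intro conjI allI impI)
  have m: "memLp p (lebesgue_on I) f" "memLp p (lebesgue_on I) g" using f g by (auto simp: W1p_approximable_def)
  show "memLp p (lebesgue_on I) (\<lambda>x. f x + g x)" by (rule memLp_add(1)[OF m p])
  fix \<epsilon> :: real assume "\<epsilon> > 0"
  define e where "e = \<epsilon> / (2 * 2 powr p)"
  have e: "e > 0" "2 powr p * (e + e) = \<epsilon>" using \<open>\<epsilon> > 0\<close> by (auto simp: e_def)
  obtain w w' v v' where w: "W1p_with p I w w'" "lpi p (lebesgue_on I) (\<lambda>x. f x - w x) < e"
    and v: "W1p_with p I v v'" "lpi p (lebesgue_on I) (\<lambda>x. g x - v x) < e"
    using f g e(1) unfolding W1p_approximable_def by meson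
  have mw: "memLp p (lebesgue_on I) (\<lambda>x. f x - w x)" "memLp p (lebesgue_on I) (\<lambda>x. g x - v x)"
    using W1p_with_memLp[OF w(1)] W1p_with_memLp[OF v(1)] m by (auto intro: memLp_diff(1)[OF _ _ p])
  have "lpi p (lebesgue_on I) (\<lambda>x. f x - w x + (g x - v x)) < 2 powr p * (e + e)"
    using memLp_add(2)[OF mw p] w(2) v(2)
    by (intro le_less_trans[OF memLp_add(2)[OF mw p]] mult_strict_left_mono add_strict_mono) auto
  then have "lpi p (lebesgue_on I) (\<lambda>x. f x + g x - (w x + v x)) < \<epsilon>"
    unfolding e(2) by (simp add: algebra_simps)
  then show "\<exists>w w'. W1p_with p I w w' \<and> lpi p (lebesgue_on I) (\<lambda>x. f x + g x - w x) < \<epsilon>"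
    using W1p_with_add[OF w(1) v(1) p] by blast
qed

lemma W1p_approximable_minus:
  assumes f: "W1p_approximable p I f" and p: "0 \<le> p"
  shows "W1p_approximable p I (\<lambda>x. - f x)"
  unfolding W1p_approximable_def
proof (intro conjI allI impI)
  show "memLp p (lebesgue_on I) (\<lambda>x. - f x)" using f p by (auto simp: W1p_approximable_def intro: memLp_minus)
  fix \<epsilon> :: real assume "\<epsilon> > 0"
  then obtain w w' where w: "W1p_with p I w w'" "lpi p (lebesgue_on I) (\<lambda>x. f x - w x) < \<epsilon>"
    using f unfolding W1p_approximable_def by meson
  have eq: "norm (- f x - - w x) = norm (f x - w x)" for x
    using norm_minus_commute[of "f x" "w x"] by simp
  have "W1p_with p I (\<lambda>x. - w x) (\<lambda>x. - w' x)"
    by (rule W1p_with_bounded_linear[OF w(1) bounded_linear_minus[OF bounded_linear_ident] p])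
  moreover have "lpi p (lebesgue_on I) (\<lambda>x. - f x - - w x) < \<epsilon>" unfolding eq by (rule w(2))
  ultimately show "\<exists>w w'. W1p_with p I w w' \<and> lpi p (lebesgue_on I) (\<lambda>x. - f x - w x) < \<epsilon>" by blast
qed

lemma W1p_approximable_limit:
  assumes f: "memLp p (lebesgue_on I) f" and p: "0 \<le> p"
    and lim: "\<And>\<epsilon>. \<epsilon> > 0 \<Longrightarrow> \<exists>g. W1p_approximable p I g \<and> lpi p (lebesgue_on I) (\<lambda>x. f x - g x) < \<epsilon>"
  shows "W1p_approximable p I f"
  unfolding W1p_approximable_def
proof (intro conjI allI impI f)
  fix \<epsilon> :: real assume "\<epsilon> > 0"
  define e where "e = \<epsilon> / (2 * 2 powr p)"
  have e: "e > 0" "2 powr p * (e + e) = \<epsilon>" using \<open>\<epsilon> > 0\<close> by (auto simp: e_def)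
  obtain g where g: "W1p_approximable p I g" "lpi p (lebesgue_on I) (\<lambda>x. f x - g x) < e" using lim[OF e(1)] by blast
  obtain w w' where w: "W1p_with p I w w'" "lpi p (lebesgue_on I) (\<lambda>x. g x - w x) < e"
    using g(1) e(1) unfolding W1p_approximable_def by meson
  have m: "memLp p (lebesgue_on I) g" "memLp p (lebesgue_on I) w"
    using g(1) W1p_with_memLp[OF w(1)] by (auto simp: W1p_approximable_def)
  have "lpi p (lebesgue_on I) (\<lambda>x. f x - w x) < 2 powr p * (e + e)"
    using g(2) w(2) by (intro le_less_trans[OF lpi_triangle3[OF f m p]] mult_strict_left_mono add_strict_mono) auto
  then show "\<exists>w w'. W1p_with p I w w' \<and> lpi p (lebesgue_on I) (\<lambda>x. f x - w x) < \<epsilon>"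
    using w(1) e(2) by metis
qed

lemma W1p_approximable_cong:
  assumes f: "W1p_approximable p I f" and eq: "\<And>x. x \<in> I \<Longrightarrow> f x = g x"
  shows "W1p_approximable p I g"
proof -
  have m: "memLp p (lebesgue_on I) g"
    using f memLp_cong[of p "lebesgue_on I" f g] eq by (auto simp: W1p_approximable_def)
  have "lpi p (lebesgue_on I) (\<lambda>x. g x - w x) = lpi p (lebesgue_on I) (\<lambda>x. f x - w x)" for w
    using eq by (intro Bochner_Integration.integral_cong) auto
  then show ?thesis using f m unfolding W1p_approximable_def by simp
qed

lemma W1p_approximable_zero: "W1p_approximable p I (\<lambda>_. 0)"
proof -
  have "W1p_with p I (\<lambda>_. 0) (\<lambda>_. 0)" by (simp add: W1p_with_def memLp_zero)
  then show ?thesis unfolding W1p_approximable_def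
    by (intro conjI allI impI memLp_zero exI[of _ "\<lambda>_. 0"]) auto
qed

lemma W1p_approximable_sum:
  assumes "finite F" "\<And>i. i \<in> F \<Longrightarrow> W1p_approximable p I (f i)" "0 \<le> p"
  shows "W1p_approximable p I (\<lambda>x. \<Sum>i\<in>F. f i x)"
  using assms
proof (induction F rule: finite_induct)
  case empty
  then show ?case by (simp add: W1p_approximable_zero)
next
  case (insert i F)
  have "W1p_approximable p I (\<lambda>x. f i x + (\<Sum>j\<in>F. f j x))"
    by (rule W1p_approximable_add) (use insert in auto)
  then show ?case using insert by simp
qed

text \<open>The cut-off functions are combinations of shifted absolute values, so this single kink
  formula gives all their weak derivatives.\<close>

lemma sgn_has_integral:
  assumes "s \<le> t"
  shows "((\<lambda>\<tau>::real. sgn (\<tau> - k)) has_integral (\<bar>t - k\<bar> - \<bar>s - k\<bar>)) {s..t}"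
proof (rule fundamental_theorem_of_calculus_interior_strong[of "{k}"])
  show "s \<le> t" by fact
  show "continuous_on {s..t} (\<lambda>\<tau>. \<bar>\<tau> - k\<bar>)" by (intro continuous_intros)
  fix x assume "x \<in> {s<..<t} - {k}"
  then consider "x > k" | "x < k" by fastforce
  then have "((\<lambda>\<tau>. \<bar>\<tau> - k\<bar>) has_real_derivative sgn (x - k)) (at x)"
  proof cases
    case 1
    have "((\<lambda>\<tau>. \<tau> - k) has_real_derivative 1) (at x)" by (auto intro!: derivative_eq_intros)
    then have "((\<lambda>\<tau>. \<bar>\<tau> - k\<bar>) has_real_derivative 1) (at x)"
      by (rule has_field_derivative_transform_within_open[where S = "{k<..}"]) (use 1 in auto)
    then show ?thesis using 1 by simp
  next
    case 2
    have "((\<lambda>\<tau>. k - \<tau>) has_real_derivative - 1) (at x)" by (auto intro!: derivative_eq_intros)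
    then have "((\<lambda>\<tau>. \<bar>\<tau> - k\<bar>) has_real_derivative - 1) (at x)"
      by (rule has_field_derivative_transform_within_open[where S = "{..<k}"]) (use 2 in auto)
    then show ?thesis using 2 by simp
  qed
  then show "((\<lambda>\<tau>. \<bar>\<tau> - k\<bar>) has_vector_derivative sgn (x - k)) (at x)"
    by (simp add: has_real_derivative_iff_has_vector_derivative)
qed simp

lemma W1p_approximable_interval:
  fixes x :: "'a::banach"
  assumes I: "I \<in> sets lebesgue" and p: "0 < p" and ab: "a \<le> b"
  shows "W1p_approximable p I (\<lambda>s. indicat_real {a..b} s *\<^sub>R x)"
  unfolding W1p_approximable_def
proof (intro conjI allI impI)
  have meas: "c \<in> borel_measurable (lebesgue_on I)" if "c \<in> borel_measurable borel" for c :: "real \<Rightarrow> real"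
    using that by (intro measurable_restrict_space1 measurable_completion) simp
  have "strongly_measurable (lebesgue_on I) (\<lambda>s. indicat_real {a..b} s *\<^sub>R x)"
    by (rule strongly_measurable_scaleR[OF meas strongly_measurable_const]) simp
  then show m: "memLp p (lebesgue_on I) (\<lambda>s. indicat_real {a..b} s *\<^sub>R x)"
    by (rule memLp_bounded_support[OF _ I p, of _ "norm x" a b]) (auto simp: indicator_def)
  fix \<epsilon> :: real assume "\<epsilon> > 0"
  \<comment> \<open>The error is bounded by \<open>norm x\<close> and lives on two intervals of
    length \<open>\<delta>\<close>, so its p-th power integrates to at most
    \<open>\<epsilon> / 2\<close>. The \<open>+ 1\<close> covers \<open>x = 0\<close>.\<close>
  define \<delta> where "\<delta> = \<epsilon> / (4 * (norm x powr p + 1))"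
  have np: "0 < norm x powr p + 1" by (simp add: add_nonneg_pos)
  have \<delta>: "\<delta> > 0" unfolding \<delta>_def using \<open>\<epsilon> > 0\<close> np by simp
  \<comment> \<open>A trapezoid: one on \<open>{a..b}\<close>, zero outside
    \<open>{a - \<delta>..b + \<delta>}\<close>, affine in between. The next line is its
    derivative.\<close>
  define c where "c \<tau> = (\<bar>\<tau> - (a - \<delta>)\<bar> - \<bar>\<tau> - a\<bar> - \<bar>\<tau> - b\<bar> + \<bar>\<tau> - (b + \<delta>)\<bar>) / (2 * \<delta>)" for \<tau>
  define c' where "c' \<tau> = (sgn (\<tau> - (a - \<delta>)) - sgn (\<tau> - a) - sgn (\<tau> - b) + sgn (\<tau> - (b + \<delta>))) / (2 * \<delta>)" for \<tau>
  have c01: "0 \<le> c \<tau>" "c \<tau> \<le> 1" for \<tau>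
  proof -
    have "0 \<le> \<bar>\<tau> - (a - \<delta>)\<bar> - \<bar>\<tau> - a\<bar> - \<bar>\<tau> - b\<bar> + \<bar>\<tau> - (b + \<delta>)\<bar>"
      "\<bar>\<tau> - (a - \<delta>)\<bar> - \<bar>\<tau> - a\<bar> - \<bar>\<tau> - b\<bar> + \<bar>\<tau> - (b + \<delta>)\<bar> \<le> 2 * \<delta>"
      using \<delta> ab by linarith+
    then show "0 \<le> c \<tau>" "c \<tau> \<le> 1" using \<delta> by (auto simp: c_def)
  qed
  have c1: "c \<tau> = 1" if "\<tau> \<in> {a..b}" for \<tau>
    using \<delta> that by (simp add: c_def)
  have c0: "c \<tau> = 0" if "\<tau> \<notin> {a - \<delta>..b + \<delta>}" for \<tau>
    using \<delta> ab that by (auto simp: c_def not_le)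
  have c'0: "c' \<tau> = 0" if "\<tau> \<notin> {a - \<delta>..b + \<delta>}" for \<tau>
    using \<delta> ab that by (auto simp: c'_def not_le)
  have c'b: "\<bar>c' \<tau>\<bar> \<le> 4 / (2 * \<delta>)" for \<tau>
  proof -
    have "\<bar>sgn (\<tau> - (a - \<delta>)) - sgn (\<tau> - a) - sgn (\<tau> - b) + sgn (\<tau> - (b + \<delta>))\<bar> \<le> 4"
    proof -
      have "\<bar>sgn y\<bar> \<le> 1" for y :: real by (simp add: sgn_if)
      from this[of "\<tau> - (a - \<delta>)"] this[of "\<tau> - a"] this[of "\<tau> - b"] this[of "\<tau> - (b + \<delta>)"]
      show ?thesis by linarith
    qed
    from divide_right_mono[OF this, of "2 * \<delta>"] show ?thesis
      using \<delta> unfolding c'_def abs_divide by simp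
  qed
  have cm: "c \<in> borel_measurable borel" "c' \<in> borel_measurable borel"
    unfolding c_def[abs_def] c'_def[abs_def] by measurable
  have nc': "norm (c' s *\<^sub>R x) \<le> 4 / (2 * \<delta>) * norm x" for s
    unfolding norm_scaleR by (rule mult_right_mono[OF c'b]) simp
  have W: "W1p_with p I (\<lambda>s. c s *\<^sub>R x) (\<lambda>s. c' s *\<^sub>R x)"
    unfolding W1p_with_def
  proof (intro conjI ballI impI)
    show "memLp p (lebesgue_on I) (\<lambda>s. c s *\<^sub>R x)"
      using c01 c0
      by (intro memLp_bounded_support[OF strongly_measurable_scaleR[OF meas[OF cm(1)] strongly_measurable_const] I p, of _ "norm x" "a - \<delta>" "b + \<delta>"])
        (auto simp: mult_left_le_one_le)
    show "memLp p (lebesgue_on I) (\<lambda>s. c' s *\<^sub>R x)"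
      by (rule memLp_bounded_support[OF strongly_measurable_scaleR[OF meas[OF cm(2)] strongly_measurable_const] I p nc', of "a - \<delta>" "b + \<delta>"])
        (simp add: c'0)
    fix s t :: real assume "s \<le> t"
    have "(c' has_integral ((\<bar>t - (a - \<delta>)\<bar> - \<bar>s - (a - \<delta>)\<bar>) - (\<bar>t - a\<bar> - \<bar>s - a\<bar>) - (\<bar>t - b\<bar> - \<bar>s - b\<bar>)
        + (\<bar>t - (b + \<delta>)\<bar> - \<bar>s - (b + \<delta>)\<bar>)) / (2 * \<delta>)) {s..t}"
      unfolding c'_def[abs_def]
      by (intro has_integral_divide has_integral_add has_integral_diff sgn_has_integral \<open>s \<le> t\<close>)
    then have "(c' has_integral (c t - c s)) {s..t}"
      by (simp add: c_def diff_divide_distrib add_divide_distrib algebra_simps)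
    from has_integral_scaleR_left[OF this, of x] show "((\<lambda>s. c' s *\<^sub>R x) has_integral c t *\<^sub>R x - c s *\<^sub>R x) {s..t}"
      by (simp add: scaleR_diff_left)
  qed
  let ?u = "\<lambda>s. norm x powr p * (indicat_real {a - \<delta>..a} s + indicat_real {b..b + \<delta>} s)"
  note ind = integrable_indicator_Icc_lebesgue_on[OF I]
  have "lpi p (lebesgue_on I) (\<lambda>s. indicat_real {a..b} s *\<^sub>R x - c s *\<^sub>R x) \<le> (\<integral>s. ?u s \<partial>lebesgue_on I)"
  proof (rule integral_mono)
    show "integrable (lebesgue_on I) (\<lambda>s. norm (indicat_real {a..b} s *\<^sub>R x - c s *\<^sub>R x) powr p)"
      using memLp_integrable[OF memLp_diff(1)[OF m]] W1p_with_memLp[OF W] p by simp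
    show "integrable (lebesgue_on I) ?u" using ind(1) by simp
    fix s
    have 1: "\<bar>indicat_real {a..b} s - c s\<bar> \<le> 1" using c01[of s] by (auto simp: indicator_def)
    have eq: "norm (indicat_real {a..b} s *\<^sub>R x - c s *\<^sub>R x) = \<bar>indicat_real {a..b} s - c s\<bar> * norm x"
      by (metis norm_scaleR scaleR_diff_left)
    show "norm (indicat_real {a..b} s *\<^sub>R x - c s *\<^sub>R x) powr p \<le> ?u s"
    proof (cases "s \<in> {a..b} \<or> s \<notin> {a - \<delta>..b + \<delta>}")
      case True
      then have "indicat_real {a..b} s = c s" using c1 c0 \<delta> by (auto simp: indicator_def)
      then show ?thesis by (simp add: eq)
    next
      case False
      then have "1 \<le> indicat_real {a - \<delta>..a} s + indicat_real {b..b + \<delta>} s" by (auto simp: indicator_def)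
      then have "norm x powr p * 1 \<le> ?u s" by (intro mult_left_mono) auto
      moreover have "(\<bar>indicat_real {a..b} s - c s\<bar> * norm x) powr p \<le> norm x powr p"
        using 1 p by (intro powr_mono2) (auto intro: mult_left_le_one_le)
      ultimately show ?thesis unfolding eq by linarith
    qed
  qed
  also have "\<dots> \<le> norm x powr p * (\<delta> + \<delta>)"
    using ind(1) ind(2)[of "a - \<delta>" a] ind(2)[of b "b + \<delta>"] \<delta> by (simp add: mult_left_mono add_mono)
  also have "\<dots> \<le> (norm x powr p + 1) * (\<delta> + \<delta>)" using \<delta> by (intro mult_right_mono) auto
  also have "\<dots> = \<epsilon> / 2"
  proof -
    have "n * (\<epsilon> / (4 * n) + \<epsilon> / (4 * n)) = \<epsilon> / 2" if "0 < n" for n :: real using that by (simp add: field_simps)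
    from this[OF np] show ?thesis by (simp only: \<delta>_def)
  qed
  also have "\<dots> < \<epsilon>" using \<open>\<epsilon> > 0\<close> by simp
  finally show "\<exists>w w'. W1p_with p I w w' \<and> lpi p (lebesgue_on I) (\<lambda>s. indicat_real {a..b} s *\<^sub>R x - w s) < \<epsilon>"
    using W by blast
qed

lemma W1p_approximable_dominated:
  assumes f: "memLp p (lebesgue_on I) f" and p: "0 < p" and g: "\<And>k. W1p_approximable p I (g k)"
    and dom: "\<And>k s. s \<in> I \<Longrightarrow> norm (f s - g k s) powr p \<le> b s" "integrable (lebesgue_on I) b"
    and lim: "\<And>s. s \<in> I \<Longrightarrow> (\<lambda>k. g k s) \<longlonglongrightarrow> f s"
  shows "W1p_approximable p I f"
proof (rule W1p_approximable_limit[OF f])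
  fix \<epsilon> :: real assume "\<epsilon> > 0"
  have m: "memLp p (lebesgue_on I) (\<lambda>s. f s - g k s)" for k
    by (rule memLp_diff(1)[OF f]) (use g[of k] p in \<open>auto simp: W1p_approximable_def\<close>)
  have "(\<lambda>k. lpi p (lebesgue_on I) (\<lambda>s. f s - g k s)) \<longlonglongrightarrow> (\<integral>s. 0 \<partial>lebesgue_on I)"
  proof (rule integral_dominated_convergence[OF _ _ dom(2)])
    show "AE s in lebesgue_on I. (\<lambda>k. norm (f s - g k s) powr p) \<longlonglongrightarrow> 0"
    proof (rule AE_I2)
      fix s assume "s \<in> space (lebesgue_on I)"
      then have "(\<lambda>k. norm (f s - g k s)) \<longlonglongrightarrow> norm (f s - f s)" by (intro tendsto_intros lim) simp
      then have "(\<lambda>k. norm (f s - g k s)) \<longlonglongrightarrow> 0" by simp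
      from tendsto_powr2[OF this tendsto_const[of p]] show "(\<lambda>k. norm (f s - g k s) powr p) \<longlonglongrightarrow> 0"
        using p by simp
    qed
  qed (use dom(1) strongly_measurable_norm_powr[OF memLp_strongly_measurable[OF m]] in auto)
  then have "\<forall>\<^sub>F k in sequentially. lpi p (lebesgue_on I) (\<lambda>s. f s - g k s) < \<epsilon>"
    using \<open>\<epsilon> > 0\<close> by (intro order_tendstoD(2)) auto
  then obtain k where "lpi p (lebesgue_on I) (\<lambda>s. f s - g k s) < \<epsilon>"
    using eventually_happens'[OF sequentially_bot] by blast
  then show "\<exists>g. W1p_approximable p I g \<and> lpi p (lebesgue_on I) (\<lambda>x. f x - g x) < \<epsilon>" using g by blast
qed (use p in simp)

lemma memLp_indicator_bounded:
  fixes x :: "'a::banach" and I S :: "real set" and a b :: real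
  assumes I: "I \<in> sets lebesgue" and p: "0 < p" and S: "S \<in> sets lebesgue" "S \<subseteq> {a..b}"
  shows "memLp p (lebesgue_on I) (\<lambda>s. indicat_real S s *\<^sub>R x)"
proof (rule memLp_bounded_support[OF _ I p, of _ "norm x" a b])
  have "indicat_real S \<in> borel_measurable (lebesgue_on I)"
    using S(1) by (intro measurable_restrict_space1) simp
  then show "strongly_measurable (lebesgue_on I) (\<lambda>s. indicat_real S s *\<^sub>R x)"
    by (rule strongly_measurable_scaleR[OF _ strongly_measurable_const])
qed (use S(2) in \<open>auto simp: indicator_def\<close>)

text \<open>Dynkin's argument over the half lines \<open>{..a}\<close>. Intersecting with
  \<open>{-n..n}\<close> keeps complements and countable unions of finite measure, hence inside
  L^p.\<close>

lemma W1p_approximable_borel: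
  fixes x :: "'a::banach"
  assumes I: "I \<in> sets lebesgue" and p: "0 < p" and S: "S \<in> sets borel" and n: "0 \<le> n"
  shows "W1p_approximable p I (\<lambda>s. indicat_real (S \<inter> {-n..n}) s *\<^sub>R x)"
proof -
  have S': "S \<in> sigma_sets UNIV (range (\<lambda>a::real. {..a}))"
    using S unfolding borel_eq_atMost by (simp add: sets_measure_of)
  have borel: "A \<in> sets borel" if "A \<in> sigma_sets UNIV (range (\<lambda>a::real. {..a}))" for A
    using that unfolding borel_eq_atMost by (simp add: sets_measure_of)
  have J: "W1p_approximable p I (\<lambda>s. indicat_real {-n..n} s *\<^sub>R x)"
    by (rule W1p_approximable_interval[OF I p]) (use n in simp)
  have mem: "memLp p (lebesgue_on I) (\<lambda>s. indicat_real (A \<inter> {-n..n}) s *\<^sub>R x)" if "A \<in> sets borel" for A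
    by (rule memLp_indicator_bounded[OF I p, of _ "-n" n]) (use that in auto)
  show ?thesis
  proof (rule sigma_sets_induct_disjoint[OF _ _ S'])
    show "Int_stable (range (\<lambda>a::real. {..a}))" by (auto simp: Int_stable_def)
    show "range (\<lambda>a::real. {..a}) \<subseteq> Pow UNIV" by auto
    show "W1p_approximable p I (\<lambda>s. indicat_real ({} \<inter> {-n..n}) s *\<^sub>R x)"
      by (simp add: W1p_approximable_zero)
  next
    fix A assume "A \<in> range (\<lambda>a::real. {..a})"
    then obtain c where A: "A = {..c}" by auto
    show "W1p_approximable p I (\<lambda>s. indicat_real (A \<inter> {-n..n}) s *\<^sub>R x)"
    proof (cases "- n \<le> c")
      case True
      have "A \<inter> {-n..n} = {-n..min c n}" by (auto simp: A)
      then show ?thesis using W1p_approximable_interval[OF I p, of "-n" "min c n"] True n by simp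
    next
      case False
      then have "A \<inter> {-n..n} = {}" by (auto simp: A)
      then show ?thesis by (simp add: W1p_approximable_zero)
    qed
  next
    fix A assume "W1p_approximable p I (\<lambda>s. indicat_real (A \<inter> {-n..n}) s *\<^sub>R x)"
    from W1p_approximable_add[OF J W1p_approximable_minus[OF this]] p
    have "W1p_approximable p I (\<lambda>s. indicat_real {-n..n} s *\<^sub>R x + - (indicat_real (A \<inter> {-n..n}) s *\<^sub>R x))" by simp
    then show "W1p_approximable p I (\<lambda>s. indicat_real ((UNIV - A) \<inter> {-n..n}) s *\<^sub>R x)"
      by (rule W1p_approximable_cong) (auto simp: indicator_def)
  next
    fix A :: "nat \<Rightarrow> real set"
    assume dis: "disjoint_family A" and A: "range A \<subseteq> sigma_sets UNIV (range (\<lambda>a::real. {..a}))"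
      and IH: "\<And>i. W1p_approximable p I (\<lambda>s. indicat_real (A i \<inter> {-n..n}) s *\<^sub>R x)"
    have Ab: "A i \<in> sets borel" for i using A by (intro borel) auto
    let ?B = "\<lambda>k. (\<Union>i<k. A i)"
    have B: "W1p_approximable p I (\<lambda>s. indicat_real (?B k \<inter> {-n..n}) s *\<^sub>R x)" for k
    proof (induction k)
      case 0
      then show ?case by (simp add: W1p_approximable_zero)
    next
      case (Suc k)
      have "A i \<inter> A k = {}" if "i < k" for i
        using disjoint_family_onD[OF dis, of i k] that by simp
      then have disj: "A k \<inter> ?B k = {}" by blast
      from W1p_approximable_add[OF Suc IH[of k]] p
      have "W1p_approximable p I (\<lambda>s. indicat_real (?B k \<inter> {-n..n}) s *\<^sub>R x + indicat_real (A k \<inter> {-n..n}) s *\<^sub>R x)" by simp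
      then show ?case
        by (rule W1p_approximable_cong) (use disj in \<open>auto simp: indicator_def lessThan_Suc\<close>)
    qed
    show "W1p_approximable p I (\<lambda>s. indicat_real (\<Union> (range A) \<inter> {-n..n}) s *\<^sub>R x)"
    proof (rule W1p_approximable_dominated[OF mem p B])
      show "\<Union> (range A) \<in> sets borel" using Ab by blast
      show "integrable (lebesgue_on I) (\<lambda>s. norm x powr p * indicat_real {-n..n} s)"
        using integrable_indicator_Icc_lebesgue_on(1)[OF I] by simp
      show "norm (indicat_real (\<Union> (range A) \<inter> {-n..n}) s *\<^sub>R x - indicat_real (?B k \<inter> {-n..n}) s *\<^sub>R x) powr p
          \<le> norm x powr p * indicat_real {-n..n} s" for k s
        using p by (auto simp: indicator_def)
      fix s
      show "(\<lambda>k. indicat_real (?B k \<inter> {-n..n}) s *\<^sub>R x) \<longlonglongrightarrow> indicat_real (\<Union> (range A) \<inter> {-n..n}) s *\<^sub>R x"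
      proof (cases "s \<in> \<Union> (range A)")
        case True
        then obtain i where i: "s \<in> A i" by auto
        have "\<forall>\<^sub>F k in sequentially. indicat_real (?B k \<inter> {-n..n}) s *\<^sub>R x = indicat_real (\<Union> (range A) \<inter> {-n..n}) s *\<^sub>R x"
          using eventually_gt_at_top[of i] by eventually_elim (use i in \<open>auto simp: indicator_def\<close>)
        then show ?thesis by (rule tendsto_eventually)
      next
        case False
        then have "indicat_real (?B k \<inter> {-n..n}) s = 0" for k by (auto simp: indicator_def)
        then show ?thesis using False by (simp add: indicator_def)
      qed
    qed
  qed
qed

text \<open>A Lebesgue set is Borel up to a null set, which the L^p distance does not see. Cutting
  to \<open>{-real k..real k}\<close> handles sets of unbounded extent, a simple function is a
  finite sum over its values, and simple functions are dense.\<close>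

lemma W1p_dense:
  fixes f :: "real \<Rightarrow> 'a::banach"
  assumes I: "I \<in> sets lebesgue" and p: "0 < p" and f: "memLp p (lebesgue_on I) f" and "\<epsilon> > 0"
  shows "\<exists>w w'. W1p_with p I w w' \<and> lpi p (lebesgue_on I) (\<lambda>x. f x - w x) < \<epsilon>"
proof -
  have p0: "0 \<le> p" using p by simp
  have bounded: "W1p_approximable p I (\<lambda>s. indicat_real (S \<inter> {-n..n}) s *\<^sub>R x)"
    if S: "S \<in> sets lebesgue" and n: "0 \<le> n" for S n and x :: 'a
  proof -
    obtain B Z where B: "B \<in> sets borel" and Z: "negligible Z" and BZ: "B \<union> Z = S"
      using sets_lebesgue_almost_borel[OF S] by blast
    show ?thesis
    proof (rule W1p_approximable_limit[OF _ p0])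
      show "memLp p (lebesgue_on I) (\<lambda>s. indicat_real (S \<inter> {-n..n}) s *\<^sub>R x)"
        by (rule memLp_indicator_bounded[OF I p, of _ "-n" n]) (use S in auto)
      fix \<epsilon> :: real assume "\<epsilon> > 0"
      have "AE s in lebesgue. s \<notin> Z" using Z by (intro AE_not_in) (simp add: negligible_iff_null_sets)
      then have "AE s in lebesgue_on I. s \<notin> Z"
        using I by (subst AE_restrict_space_iff) auto
      then have "AE s in lebesgue_on I. norm (indicat_real (S \<inter> {-n..n}) s *\<^sub>R x - indicat_real (B \<inter> {-n..n}) s *\<^sub>R x) powr p = 0"
        by eventually_elim (use BZ in \<open>auto simp: indicator_def\<close>)
      from integral_eq_zero_AE[OF this]
      have "lpi p (lebesgue_on I) (\<lambda>s. indicat_real (S \<inter> {-n..n}) s *\<^sub>R x - indicat_real (B \<inter> {-n..n}) s *\<^sub>R x) < \<epsilon>"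
        using \<open>\<epsilon> > 0\<close> by simp
      then show "\<exists>g. W1p_approximable p I g \<and> lpi p (lebesgue_on I) (\<lambda>s. indicat_real (S \<inter> {-n..n}) s *\<^sub>R x - g s) < \<epsilon>"
        using W1p_approximable_borel[OF I p B n] by blast
    qed
  qed
  have ind: "W1p_approximable p I (\<lambda>s. indicat_real S s *\<^sub>R x)"
    if S: "S \<in> sets lebesgue" and m: "memLp p (lebesgue_on I) (\<lambda>s. indicat_real S s *\<^sub>R x)" for S and x :: 'a
  proof (rule W1p_approximable_dominated[OF m p])
    show "W1p_approximable p I (\<lambda>s. indicat_real (S \<inter> {-real k..real k}) s *\<^sub>R x)" for k
      by (rule bounded[OF S]) simp
    show "integrable (lebesgue_on I) (\<lambda>s. norm (indicat_real S s *\<^sub>R x) powr p)" by (rule memLp_integrable[OF m])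
    show "norm (indicat_real S s *\<^sub>R x - indicat_real (S \<inter> {-real k..real k}) s *\<^sub>R x) powr p
      \<le> norm (indicat_real S s *\<^sub>R x) powr p" for k s
      by (auto simp: indicator_def)
    show "(\<lambda>k. indicat_real (S \<inter> {-real k..real k}) s *\<^sub>R x) \<longlonglongrightarrow> indicat_real S s *\<^sub>R x" for s
    proof (rule tendsto_eventually)
      show "\<forall>\<^sub>F k in sequentially. indicat_real (S \<inter> {-real k..real k}) s *\<^sub>R x = indicat_real S s *\<^sub>R x"
        using eventually_ge_at_top[of "nat \<lceil>\<bar>s\<bar>\<rceil>"]
      proof eventually_elim
        case (elim k)
        then have "\<bar>s\<bar> \<le> real k" by linarith
        then show ?case by (auto simp: indicator_def)
      qed
    qed
  qed
  have simple: "W1p_approximable p I s" if s: "simple_function (lebesgue_on I) s" and m: "memLp p (lebesgue_on I) s" for s :: "real \<Rightarrow> 'a"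
  proof -
    have fin: "finite (s ` I)" using s by (simp add: simple_function_def)
    have "W1p_approximable p I (\<lambda>t. \<Sum>y\<in>s ` I. indicat_real (s -` {y} \<inter> I) t *\<^sub>R y)"
    proof (rule W1p_approximable_sum[OF fin _ p0])
      fix y assume y: "y \<in> s ` I"
      have meas': "s -` {y} \<inter> I \<in> sets (lebesgue_on I)" using s y by (auto simp: simple_function_def)
      then have meas: "s -` {y} \<inter> I \<in> sets lebesgue" using I by (simp add: sets_restrict_space_iff)
      show "W1p_approximable p I (\<lambda>t. indicat_real (s -` {y} \<inter> I) t *\<^sub>R y)"
      proof (rule ind[OF meas])
        show "memLp p (lebesgue_on I) (\<lambda>t. indicat_real (s -` {y} \<inter> I) t *\<^sub>R y)"
          by (rule memLp_bound[OF m strongly_measurable_scaleR[OF borel_measurable_indicator[OF meas'] strongly_measurable_const] p0, of _ 1])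
            (auto simp: indicator_def)
      qed
    qed
    then show ?thesis
    proof (rule W1p_approximable_cong)
      fix t assume t: "t \<in> I"
      have "(\<Sum>y\<in>s ` I. indicat_real (s -` {y} \<inter> I) t *\<^sub>R y) = (\<Sum>y\<in>s ` I. if y = s t then y else 0)"
        using t by (intro sum.cong) (auto simp: indicator_def)
      also have "\<dots> = s t" using fin t by (simp add: sum.delta)
      finally show "(\<Sum>y\<in>s ` I. indicat_real (s -` {y} \<inter> I) t *\<^sub>R y) = s t" .
    qed
  qed
  have "W1p_approximable p I f"
  proof (rule W1p_approximable_limit[OF f p0])
    fix \<epsilon> :: real assume "\<epsilon> > 0"
    from memLp_simple_approx[OF f p this] obtain s where "simple_function (lebesgue_on I) s"
      "memLp p (lebesgue_on I) s" "lpi p (lebesgue_on I) (\<lambda>x. f x - s x) < \<epsilon>" .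
    then show "\<exists>g. W1p_approximable p I g \<and> lpi p (lebesgue_on I) (\<lambda>x. f x - g x) < \<epsilon>"
      using simple by blast
  qed
  then show ?thesis using \<open>\<epsilon> > 0\<close> unfolding W1p_approximable_def by blast
qed

section \<open>The equation \<open>f - h f' = \<gamma>\<close> on intervals and on the half
  line\<close>

lemma memLp_Icc:
  fixes f :: "real \<Rightarrow> 'a::banach"
  assumes f: "memLp p (lebesgue_on S) f" and p: "1 \<le> p" and S: "S \<in> sets lebesgue" "{a..b} \<subseteq> S"
  shows "f integrable_on {a..b}" "(\<lambda>x. norm (f x)) integrable_on {a..b}"
    "(\<lambda>x. norm (f x) powr p) integrable_on {a..b}"
    "integrable (lebesgue_on {a..b}) (\<lambda>x. norm (f x))"
proof -
  have ab: "{a..b} \<in> sets lebesgue" by simp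
  have m: "memLp p (lebesgue_on {a..b}) f" by (rule memLp_subset[OF f S(2) ab S(1)])
  have sm: "strongly_measurable (lebesgue_on {a..b}) f" by (rule memLp_strongly_measurable[OF m])
  have ip: "integrable (lebesgue_on {a..b}) (\<lambda>x. 1 + norm (f x) powr p)"
    using memLp_integrable[OF m] integrable_indicator_Icc_lebesgue_on(1)[OF ab, of a b]
    by (auto simp: finite_measure.integrable_const finite_measure_lebesgue_on)
  show i: "integrable (lebesgue_on {a..b}) (\<lambda>x. norm (f x))"
    by (rule Bochner_Integration.integrable_bound[OF ip strongly_measurable_norm[OF sm]])
      (use le_one_plus_powr[OF p] in auto)
  show "f integrable_on {a..b}" by (rule strongly_measurable_integrable_on[OF ab sm i])
  show "(\<lambda>x. norm (f x)) integrable_on {a..b}"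
    using has_integral_integral_lebesgue_on[OF i ab] by (auto simp: integrable_on_def)
  show "(\<lambda>x. norm (f x) powr p) integrable_on {a..b}"
    using has_integral_integral_lebesgue_on[OF memLp_integrable[OF m] ab] by (auto simp: integrable_on_def)
qed

lemma memLp_exp_mult:
  fixes f :: "real \<Rightarrow> 'a::banach"
  assumes f: "memLp p (lebesgue_on S) f" and p: "0 \<le> p" and h: "0 < h"
    and low: "\<And>x. x \<in> S \<Longrightarrow> a \<le> x"
  shows "memLp p (lebesgue_on S) (\<lambda>x. exp (- x / h) *\<^sub>R f x)"
proof (rule memLp_bound[OF f _ p, of _ "exp (- a / h) powr p"])
  show "strongly_measurable (lebesgue_on S) (\<lambda>x. exp (- x / h) *\<^sub>R f x)"
    by (rule strongly_measurable_scaleR[OF _ memLp_strongly_measurable[OF f]])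
      (intro measurable_restrict_space1 measurable_completion, measurable)
  fix x assume "x \<in> space (lebesgue_on S)"
  then have "exp (- x / h) \<le> exp (- a / h)" using low h by (simp add: divide_right_mono)
  then have "(exp (- x / h) * norm (f x)) powr p \<le> (exp (- a / h) * norm (f x)) powr p"
    using p by (intro powr_mono2 mult_right_mono) auto
  then show "norm (exp (- x / h) *\<^sub>R f x) powr p \<le> exp (- a / h) powr p * norm (f x) powr p"
    by (simp add: powr_mult)
qed

lemma W1p_with_continuous_on:
  assumes W: "W1p_with p I f g" and ab: "{a..b} \<subseteq> I"
  shows "continuous_on {a..b} f"
proof (cases "a \<le> b")
  case True
  have g: "(g has_integral (f t - f a)) {a..t}" if "t \<in> {a..b}" for t
  proof -
    have "a \<in> I" "t \<in> I" using ab that True by auto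
    then show ?thesis using W1p_with_has_integral[OF W, of a t] that by simp
  qed
  have "g integrable_on {a..b}" using g[of b] True by auto
  then have "continuous_on {a..b} (\<lambda>t. f a + integral {a..t} g)"
    by (intro continuous_intros indefinite_integral_continuous_1)
  then show ?thesis by (rule continuous_on_eq) (simp add: integral_unique[OF g])
qed simp

lemma W1p_with_growth:
  fixes f g \<gamma> :: "real \<Rightarrow> 'a::banach"
  assumes W: "W1p_with p I f g" and p: "1 \<le> p" and h: "0 < h" and I: "I \<in> sets lebesgue"
    and ab: "a \<le> b" "{a..b} \<subseteq> I"
  shows "norm (f a) powr p + (1 / h) * (integral {a..b} (\<lambda>\<tau>. norm (f \<tau>) powr p)
      - integral {a..b} (\<lambda>\<tau>. norm (f \<tau> - h *\<^sub>R g \<tau>) powr p)) \<le> norm (f b) powr p"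
proof -
  have p0: "0 \<le> p" using p by simp
  note m = W1p_with_memLp[OF W]
  have m\<gamma>: "memLp p (lebesgue_on I) (\<lambda>\<tau>. f \<tau> - h *\<^sub>R g \<tau>)"
    using m p0 by (intro memLp_diff(1) memLp_scaleR) auto
  note i\<gamma> = memLp_Icc[OF m\<gamma> p I ab(2)]
  have if': "(\<lambda>\<tau>. norm (f \<tau>) powr p) integrable_on {a..b}" by (rule memLp_Icc(3)[OF _ p I ab(2)]) (use m in auto)
  have "norm (f a) powr p + (1 / h) * integral {a..b} (\<lambda>\<tau>. norm (f \<tau>) powr p - norm (f \<tau> - h *\<^sub>R g \<tau>) powr p)
      \<le> norm (f b) powr p"
  proof (rule norm_powr_growth[OF p h ab(1) W1p_with_continuous_on[OF W ab(2)]])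
    fix s t assume "a \<le> s" "s \<le> t" "t \<le> b"
    then show "(g has_integral f t - f s) {s..t}" using ab by (intro W1p_with_has_integral[OF W]) auto
  qed (use i\<gamma> in auto)
  then show ?thesis using Henstock_Kurzweil_Integration.integral_diff[OF if' i\<gamma>(3)] by simp
qed

lemma has_integral_from_left:
  fixes f g :: "real \<Rightarrow> 'a::banach"
  assumes hi: "\<And>t. t \<in> {a..b} \<Longrightarrow> (g has_integral (f t - f a)) {a..t}"
    and st: "s \<in> {a..b}" "t \<in> {a..b}" "s \<le> t"
  shows "(g has_integral (f t - f s)) {s..t}"
proof -
  have i: "g integrable_on {a..t}" using hi[OF st(2)] by blast
  have "integral {a..t} g = integral {a..s} g + integral {s..t} g"
    using st by (intro integral_split[OF _ _ order_refl i]) auto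
  then have "integral {s..t} g = f t - f s"
    using integral_unique[OF hi[OF st(1)]] integral_unique[OF hi[OF st(2)]] by (simp add: algebra_simps)
  moreover have "g integrable_on {s..t}"
    by (rule integrable_subinterval_real[OF i]) (use st in auto)
  ultimately show ?thesis by (metis integrable_integral)
qed

text \<open>The resolvent equation of translation on a compact interval. The constant of integration
  is free and is used to prescribe the value at the right end, as the condition
  \<open>\<phi> 0 = x\<close> of the domain requires.\<close>

lemma ode_Icc:
  fixes \<gamma> :: "real \<Rightarrow> 'a::banach"
  assumes \<gamma>: "memLp p (lebesgue_on {a..b}) \<gamma>" and p: "1 \<le> p" and h: "0 < h" and ab: "a \<le> b"
  obtains f where "W1p_with p {a..b} f (\<lambda>\<tau>. (1 / h) *\<^sub>R (f \<tau> - \<gamma> \<tau>))" "f b = x"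
proof -
  have p0: "0 \<le> p" using p by simp
  have ab': "{a..b} \<in> sets lebesgue" by simp
  let ?e = "\<lambda>\<tau>. exp (- \<tau> / h) *\<^sub>R \<gamma> \<tau>"
  have me: "memLp p (lebesgue_on {a..b}) ?e" by (rule memLp_exp_mult[OF \<gamma> p0 h, of a]) simp
  define c where "c = exp (- b / h) *\<^sub>R x + (1 / h) *\<^sub>R integral {a..b} ?e"
  define f where "f s = exp (s / h) *\<^sub>R (c - (1 / h) *\<^sub>R integral {a..s} ?e)" for s
  have fb: "f b = x" by (simp add: f_def c_def exp_add[symmetric])
  note i\<gamma> = memLp_Icc[OF \<gamma> p ab' order_refl] and ie = memLp_Icc[OF me p ab' order_refl]
  have cont: "continuous_on {a..b} f"
    by (rule exp_ode_solution(1)[OF h ab i\<gamma>(2) i\<gamma>(1) ie(1)]) (simp add: f_def)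
  have hi: "((\<lambda>\<tau>. (1 / h) *\<^sub>R (f \<tau> - \<gamma> \<tau>)) has_integral (f t - f a)) {a..t}" if "t \<in> {a..b}" for t
  proof -
    have sub: "{a..t} \<subseteq> {a..b}" using that by auto
    show ?thesis
      by (rule exp_ode_solution(2)[OF h _ memLp_Icc(2,1)[OF \<gamma> p ab' sub] memLp_Icc(1)[OF me p ab' sub]])
        (use that in \<open>auto simp: f_def\<close>)
  qed
  note hi' = has_integral_from_left[OF hi]
  have smf: "strongly_measurable (lebesgue_on {a..b}) f"
    by (rule strongly_measurable_continuous[OF cont, of a]) (use ab in auto)
  have "bounded (f ` {a..b})" by (intro compact_imp_bounded compact_continuous_image cont) simp
  then obtain B where B: "\<And>s. s \<in> {a..b} \<Longrightarrow> norm (f s) \<le> B" unfolding bounded_iff by blast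
  \<comment> \<open>\<open>memLp_bounded_support\<close> asks for a bound on the whole line, hence
    the extension by zero.\<close>
  have "memLp p (lebesgue_on {a..b}) (\<lambda>s. if s \<in> {a..b} then f s else 0)"
  proof (rule memLp_bounded_support[OF _ ab'])
    show "strongly_measurable (lebesgue_on {a..b}) (\<lambda>s. if s \<in> {a..b} then f s else 0)"
      by (rule strongly_measurable_cong[OF smf]) simp
    show "norm (if s \<in> {a..b} then f s else 0) \<le> max B 0" for s using B[of s] by auto
    show "s \<notin> {a..b} \<Longrightarrow> (if s \<in> {a..b} then f s else 0) = 0" for s by (rule if_not_P)
  qed (use p in simp)
  then have mf: "memLp p (lebesgue_on {a..b}) f" by (rule memLp_cong) simp
  have "W1p_with p {a..b} f (\<lambda>\<tau>. (1 / h) *\<^sub>R (f \<tau> - \<gamma> \<tau>))"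
    unfolding W1p_with_def
    using mf memLp_scaleR[OF memLp_diff(1)[OF mf \<gamma> p0] p0] hi' by blast
  then show thesis using that fb by blast
qed

text \<open>On the half line the homogeneous solution \<open>exp (s / h)\<close> grows, so the
  constant of integration is forced and the value at zero cannot be prescribed. The remaining
  solution is a tail integral; it is bounded, and \<open>norm_powr_growth\<close> upgrades
  boundedness to membership in L^p.\<close>

lemma ode_halfline:
  fixes \<gamma> :: "real \<Rightarrow> 'a::banach"
  assumes \<gamma>: "memLp p (lebesgue_on {0..}) \<gamma>" and p: "1 \<le> p" and h: "0 < h"
  obtains f where "W1p_with p {0..} f (\<lambda>\<tau>. (1 / h) *\<^sub>R (f \<tau> - \<gamma> \<tau>))"
proof -
  have p0: "0 \<le> p" using p by simp
  have S: "{0::real..} \<in> sets lebesgue" by simp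
  let ?e = "\<lambda>\<tau>. exp (- \<tau> / h) *\<^sub>R \<gamma> \<tau>"
  have me: "memLp p (lebesgue_on {0..}) ?e" by (rule memLp_exp_mult[OF \<gamma> p0 h, of 0]) simp
  define Q where "Q = lpi p (lebesgue_on {0..}) \<gamma>"
  have Qi: "((\<lambda>\<tau>. norm (\<gamma> \<tau>) powr p) has_integral Q) {0..}"
    unfolding Q_def by (rule has_integral_integral_lebesgue_on[OF memLp_integrable[OF \<gamma>] S])
  have exi: "((\<lambda>\<tau>. exp (- \<tau> / h)) has_integral h * exp (- s / h)) {s..}" for s
    using has_integral_exp_minus_to_infinity[of "1 / h" s] h by (simp add: mult.commute)
  have Qsub: "(\<lambda>\<tau>. norm (\<gamma> \<tau>) powr p) integrable_on {s..}" "integral {s..} (\<lambda>\<tau>. norm (\<gamma> \<tau>) powr p) \<le> Q"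
    if "0 \<le> s" for s
  proof -
    have sub: "{s..} \<subseteq> {0..}" using that by auto
    have m: "memLp p (lebesgue_on {s..}) \<gamma>" by (rule memLp_subset[OF \<gamma> sub _ S]) simp
    show i: "(\<lambda>\<tau>. norm (\<gamma> \<tau>) powr p) integrable_on {s..}"
      using has_integral_integral_lebesgue_on[OF memLp_integrable[OF m]] by auto
    have "integral {s..} (\<lambda>\<tau>. norm (\<gamma> \<tau>) powr p) \<le> integral {0..} (\<lambda>\<tau>. norm (\<gamma> \<tau>) powr p)"
      by (rule integral_subset_le[OF sub i]) (use Qi in auto)
    then show "integral {s..} (\<lambda>\<tau>. norm (\<gamma> \<tau>) powr p) \<le> Q" using integral_unique[OF Qi] by simp
  qed
  \<comment> \<open>An integrable majorant of \<open>?e\<close> on half lines, obtained from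
    \<open>le_one_plus_powr\<close> applied to \<open>norm (\<gamma> \<tau>)\<close>.\<close>
  let ?b = "\<lambda>\<tau>. exp (- \<tau> / h) + norm (\<gamma> \<tau>) powr p"
  have bi: "?b integrable_on {s..}" if "0 \<le> s" for s
    using exi[of s] Qsub(1)[OF that] by (intro integrable_add) auto
  have ebound: "norm (?e \<tau>) \<le> ?b \<tau>" if "0 \<le> \<tau>" for \<tau>
  proof -
    have "exp (- \<tau> / h) \<le> 1" using that h by simp
    then have "exp (- \<tau> / h) * (1 + norm (\<gamma> \<tau>) powr p) \<le> exp (- \<tau> / h) + norm (\<gamma> \<tau>) powr p"
      by (simp add: distrib_left mult_left_le_one_le)
    moreover have "exp (- \<tau> / h) * norm (\<gamma> \<tau>) \<le> exp (- \<tau> / h) * (1 + norm (\<gamma> \<tau>) powr p)"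
      using le_one_plus_powr[OF p, of "norm (\<gamma> \<tau>)"] by (intro mult_left_mono) auto
    moreover have "norm (?e \<tau>) = exp (- \<tau> / h) * norm (\<gamma> \<tau>)" by simp
    ultimately show ?thesis by linarith
  qed
  have eI: "?e integrable_on {0..}"
  proof (rule strongly_measurable_integrable_on[OF S memLp_strongly_measurable[OF me]])
    have e1: "integrable (lebesgue_on {0..}) (\<lambda>\<tau>. exp (- \<tau> / h))"
    proof -
      have "(\<lambda>\<tau>. exp (- \<tau> / h)) absolutely_integrable_on {0..}"
        by (rule nonnegative_absolutely_integrable_1) (use exi[of 0] in auto)
      then show ?thesis by (simp add: absolutely_integrable_on_def set_integrable_def integrable_restrict_space)
    qed
    have "integrable (lebesgue_on {0..}) ?b" using e1 memLp_integrable[OF \<gamma>] by simp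
    then show "integrable (lebesgue_on {0..}) (\<lambda>\<tau>. norm (?e \<tau>))"
    proof (rule Bochner_Integration.integrable_bound)
      show "(\<lambda>\<tau>. norm (?e \<tau>)) \<in> borel_measurable (lebesgue_on {0..})"
        by (rule strongly_measurable_norm[OF memLp_strongly_measurable[OF me]])
      show "AE \<tau> in lebesgue_on {0..}. norm (norm (?e \<tau>)) \<le> norm (?b \<tau>)"
      proof (rule AE_I2)
        fix \<tau> :: real assume "\<tau> \<in> space (lebesgue_on {0..})"
        then have "norm (?e \<tau>) \<le> ?b \<tau>" by (intro ebound) simp
        then show "norm (norm (?e \<tau>)) \<le> norm (?b \<tau>)" by simp
      qed
    qed
  qed
  \<comment> \<open>The constant that removes the growing exponential: it makes \<open>f s\<close> a
    multiple of the integral of \<open>?e\<close> over \<open>{s..}\<close>, see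
    \<open>fs\<close>.\<close>
  define c where "c = (1 / h) *\<^sub>R integral {0..} ?e"
  define f where "f s = exp (s / h) *\<^sub>R (c - (1 / h) *\<^sub>R integral {0..s} ?e)" for s
  have cont: "continuous_on {0..t} f" if "0 \<le> t" for t
    by (rule exp_ode_solution(1)[OF h that memLp_Icc(2,1)[OF \<gamma> p S] memLp_Icc(1)[OF me p S]]) (auto simp: f_def)
  have cont0: "continuous_on {0..} f"
  proof -
    have "continuous (at x within {0..}) f" if "0 \<le> x" for x
    proof -
      have "continuous (at x within {0..x + 1}) f"
        using cont[of "x + 1"] that by (simp add: continuous_on_eq_continuous_within)
      moreover have "at x within {0..x + 1} = at x within {0..}"
        by (rule at_within_nhd[of _ "{..<x + 1}"]) auto
      ultimately show ?thesis by simp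
    qed
    then show ?thesis by (simp add: continuous_on_eq_continuous_within)
  qed
  have hi: "((\<lambda>\<tau>. (1 / h) *\<^sub>R (f \<tau> - \<gamma> \<tau>)) has_integral (f t - f 0)) {0..t}" if "0 \<le> t" for t
    by (rule exp_ode_solution(2)[OF h that memLp_Icc(2,1)[OF \<gamma> p S] memLp_Icc(1)[OF me p S]]) (auto simp: f_def)
  have hi': "((\<lambda>\<tau>. (1 / h) *\<^sub>R (f \<tau> - \<gamma> \<tau>)) has_integral (f t - f s)) {s..t}"
    if "0 \<le> s" "s \<le> t" for s t
    by (rule has_integral_from_left[of 0 t, OF hi]) (use that in auto)
  have fbound: "norm (f s) \<le> 1 + Q / h" if s: "0 \<le> s" for s
  proof -
    have mes: "memLp p (lebesgue_on {s..}) ?e" by (rule memLp_subset[OF me _ _ S]) (use s in auto)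
    have ei: "?e integrable_on {s..}"
    proof -
      have "(\<lambda>\<tau>. if \<tau> \<in> {0..s} then ?e \<tau> else 0) integrable_on {0..}"
        using memLp_Icc(1)[OF me p S, of 0 s] by (subst integrable_restrict_Int) (auto simp: inf.absorb1)
      from integrable_diff[OF eI this]
      have "(\<lambda>\<tau>. if \<tau> \<in> {s<..} then ?e \<tau> else 0) integrable_on {0..}"
        by (rule integrable_eq) auto
      moreover have "{s<..} \<inter> {0..} = {s<..}" using s by auto
      ultimately have "?e integrable_on {s<..}"
        using integrable_restrict_Int[of "{s<..}" ?e "{0..}"] by (simp only:)
      then show ?thesis
        by (rule integrable_spike_set) (auto intro: negligible_subset[of "{s}"])
    qed
    have "(?e has_integral (integral {0..s} ?e + integral {s..} ?e)) ({0..s} \<union> {s..})"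
      using memLp_Icc(1)[OF me p S, of 0 s] ei
      by (intro has_integral_Un integrable_integral) (auto intro: negligible_subset[of "{s}"])
    moreover have "{0..s} \<union> {s..} = {0..}" using s by auto
    ultimately have "integral {0..} ?e = integral {0..s} ?e + integral {s..} ?e"
      by (simp add: integral_unique)
    then have fs: "f s = exp (s / h) *\<^sub>R ((1 / h) *\<^sub>R integral {s..} ?e)"
      by (simp add: f_def c_def algebra_simps)
    let ?B = "\<lambda>\<tau>. exp (- \<tau> / h) + exp (- s / h) * norm (\<gamma> \<tau>) powr p"
    have Bi: "?B integrable_on {s..}"
      using exi[of s] Qsub(1)[OF s] by (intro integrable_add integrable_on_mult_right) auto
    have "norm (integral {s..} ?e) \<le> integral {s..} ?B"
    proof (rule integral_norm_bound_integral[OF ei Bi])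
      fix \<tau> assume "\<tau> \<in> {s..}"
      then have le: "exp (- \<tau> / h) \<le> exp (- s / h)" using h by (simp add: divide_right_mono)
      have "exp (- \<tau> / h) * norm (\<gamma> \<tau>) \<le> exp (- \<tau> / h) * (1 + norm (\<gamma> \<tau>) powr p)"
        using le_one_plus_powr[OF p, of "norm (\<gamma> \<tau>)"] by (intro mult_left_mono) auto
      also have "\<dots> \<le> ?B \<tau>" using le by (simp add: distrib_left mult_right_mono)
      finally show "norm (?e \<tau>) \<le> ?B \<tau>" by simp
    qed
    also have "\<dots> = h * exp (- s / h) + exp (- s / h) * integral {s..} (\<lambda>\<tau>. norm (\<gamma> \<tau>) powr p)"
    proof -
      have "(?B has_integral h * exp (- s / h) + exp (- s / h) * integral {s..} (\<lambda>\<tau>. norm (\<gamma> \<tau>) powr p)) {s..}"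
        using Qsub(1)[OF s] by (intro has_integral_add exi has_integral_mult_right integrable_integral)
      then show ?thesis by (rule integral_unique)
    qed
    also have "\<dots> \<le> exp (- s / h) * (h + Q)"
      using mult_left_mono[OF Qsub(2)[OF s], of "exp (- s / h)"] by (simp add: algebra_simps)
    finally have n: "norm (integral {s..} ?e) \<le> exp (- s / h) * (h + Q)" .
    have "norm (f s) = (exp (s / h) / h) * norm (integral {s..} ?e)" using h by (simp add: fs)
    also have "\<dots> \<le> (exp (s / h) / h) * (exp (- s / h) * (h + Q))" using h n by (intro mult_left_mono) auto
    also have "\<dots> = (exp (s / h) * exp (- s / h)) * ((h + Q) / h)" by simp
    also have "exp (s / h) * exp (- s / h) = 1" by (simp add: exp_add[symmetric])
    finally show ?thesis using h by (simp add: add_divide_distrib)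
  qed
  have smf: "strongly_measurable (lebesgue_on {0..}) f"
    by (rule strongly_measurable_continuous[OF cont0, of 0]) auto
  \<comment> \<open>Inserting \<open>fbound\<close> at the right end of the growth inequality and
    solving for the integral of \<open>norm (f \<tau>) powr p\<close> gives this bound, uniformly in
    \<open>t\<close>.\<close>
  define B where "B = Q + h * (1 + Q / h) powr p"
  have fint: "(\<lambda>\<tau>. norm (f \<tau>) powr p) integrable_on {0..t}" if "0 \<le> t" for t
    using p0 that by (intro integrable_continuous_interval continuous_on_powr' continuous_intros cont) (use p in auto)
  have fLp: "integral {0..t} (\<lambda>\<tau>. norm (f \<tau>) powr p) \<le> B" if t: "0 \<le> t" for t
  proof -
    have "norm (f 0) powr p + (1 / h) * integral {0..t} (\<lambda>\<tau>. norm (f \<tau>) powr p - norm (\<gamma> \<tau>) powr p)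
      \<le> norm (f t) powr p"
    proof (rule norm_powr_growth[OF p h t cont[OF t], of "\<lambda>\<tau>. (1 / h) *\<^sub>R (f \<tau> - \<gamma> \<tau>)"])
      show "(\<lambda>\<tau>. norm (\<gamma> \<tau>)) integrable_on {0..t}" "(\<lambda>\<tau>. norm (\<gamma> \<tau>) powr p) integrable_on {0..t}"
        by (rule memLp_Icc[OF \<gamma> p S]; simp)+
    qed (use h hi' in auto)
    moreover have "integral {0..t} (\<lambda>\<tau>. norm (f \<tau>) powr p - norm (\<gamma> \<tau>) powr p)
      = integral {0..t} (\<lambda>\<tau>. norm (f \<tau>) powr p) - integral {0..t} (\<lambda>\<tau>. norm (\<gamma> \<tau>) powr p)"
      by (rule Henstock_Kurzweil_Integration.integral_diff[OF fint[OF t] memLp_Icc(3)[OF \<gamma> p S]]) simp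
    moreover have "integral {0..t} (\<lambda>\<tau>. norm (\<gamma> \<tau>) powr p) \<le> Q"
    proof -
      have "integral {0..t} (\<lambda>\<tau>. norm (\<gamma> \<tau>) powr p) \<le> integral {0..} (\<lambda>\<tau>. norm (\<gamma> \<tau>) powr p)"
        by (rule integral_subset_le[OF _ memLp_Icc(3)[OF \<gamma> p S]]) (use Qi in auto)
      then show ?thesis using integral_unique[OF Qi] by simp
    qed
    moreover have "norm (f t) powr p \<le> (1 + Q / h) powr p" using fbound[OF t] p0 by (intro powr_mono2) auto
    ultimately have "(1 / h) * (integral {0..t} (\<lambda>\<tau>. norm (f \<tau>) powr p) - Q) \<le> (1 + Q / h) powr p"
      using h powr_ge_zero[of "norm (f 0)" p]
      by (smt (verit) divide_nonneg_nonneg mult_left_mono)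
    then show ?thesis unfolding B_def using h by (simp add: field_simps)
  qed
  have "integrable (lebesgue_on {0..}) (\<lambda>\<tau>. norm (f \<tau>) powr p)"
  proof (rule integral_fatou(1)[where C = B])
    let ?u = "\<lambda>k \<tau>. indicat_real {0..real k} \<tau> * norm (f \<tau>) powr p"
    have i: "integrable (lebesgue_on {0..real k}) (\<lambda>\<tau>. norm (f \<tau>) powr p)" for k
    proof -
      have "(\<lambda>\<tau>. norm (f \<tau>) powr p) absolutely_integrable_on {0..real k}"
        by (rule nonnegative_absolutely_integrable_1[OF fint]) auto
      then show ?thesis by (simp add: absolutely_integrable_on_def set_integrable_def integrable_restrict_space)
    qed
    have ind: "(\<lambda>\<tau>. indicat_real {0..} \<tau> *\<^sub>R ?u k \<tau>) = ?u k" for k by (auto simp: indicator_def fun_eq_iff)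
    have i': "integrable lebesgue (?u k)" for k
      using i[of k] by (simp add: integrable_restrict_space)
    show "integrable (lebesgue_on {0..}) (?u k)" for k
      using i'[of k] by (subst integrable_restrict_space) (simp_all only: ind, simp)
    show "(\<integral>\<tau>. ?u k \<tau> \<partial>lebesgue_on {0..}) \<le> B" for k
    proof -
      have "(\<integral>\<tau>. ?u k \<tau> \<partial>lebesgue_on {0..}) = (\<integral>\<tau>. norm (f \<tau>) powr p \<partial>lebesgue_on {0..real k})"
        by (subst integral_restrict_space, simp, subst integral_restrict_space, simp, simp only: ind, simp)
      also have "\<dots> = integral {0..real k} (\<lambda>\<tau>. norm (f \<tau>) powr p)"
        by (rule integral_unique[OF has_integral_integral_lebesgue_on[OF i], symmetric]) simp
      also have "\<dots> \<le> B" by (rule fLp) simp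
      finally show ?thesis .
    qed
    show "(\<lambda>\<tau>. norm (f \<tau>) powr p) \<in> borel_measurable (lebesgue_on {0..})"
      by (rule strongly_measurable_norm_powr[OF smf])
    show "AE \<tau> in lebesgue_on {0..}. (\<lambda>k. ?u k \<tau>) \<longlonglongrightarrow> norm (f \<tau>) powr p"
    proof (rule AE_I2)
      fix \<tau> :: real assume "\<tau> \<in> space (lebesgue_on {0..})"
      then have \<tau>: "0 \<le> \<tau>" by simp
      show "(\<lambda>k. ?u k \<tau>) \<longlonglongrightarrow> norm (f \<tau>) powr p"
      proof (rule tendsto_eventually)
        show "\<forall>\<^sub>F k in sequentially. ?u k \<tau> = norm (f \<tau>) powr p"
          using eventually_ge_at_top[of "nat \<lceil>\<tau>\<rceil>"]
        proof eventually_elim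
          case (elim k)
          then have "\<tau> \<le> real k" by linarith
          then show ?case using \<tau> by (simp add: indicator_def)
        qed
      qed
    qed
  qed auto
  then have mf: "memLp p (lebesgue_on {0..}) f" using smf by (simp add: memLp_def)
  have "W1p_with p {0..} f (\<lambda>\<tau>. (1 / h) *\<^sub>R (f \<tau> - \<gamma> \<tau>))"
    unfolding W1p_with_def
    using mf memLp_scaleR[OF memLp_diff(1)[OF mf \<gamma> p0] p0] hi' by auto
  then show thesis using that by blast
qed

section \<open>Riemann--Stieltjes integrals\<close>

lemma is_partition_mono:
  assumes P: "is_partition a b n t" and "i \<le> j" "j \<le> n"
  shows "t i \<le> t j"
  using assms(2,3)
proof (induction j rule: dec_induct)
  case (step k)
  then have "t k \<le> t (Suc k)" using P by (simp add: is_partition_def)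
  then show ?case using step by simp
qed simp

lemma is_partition_range:
  assumes P: "is_partition a b n t" and "i \<le> n"
  shows "t i \<in> {a..b}"
  using is_partition_mono[OF P, of 0 i] is_partition_mono[OF P, of i n] assms
  by (simp add: is_partition_def)

text \<open>Tags are ordered like the partition points, so those up to \<open>s\<close> form an
  initial segment and the sum telescopes to one point \<open>t m\<close>, which lies within the mesh
  size of \<open>s\<close>. The step function of a fine tagged partition therefore follows
  \<open>\<nu>\<close>.\<close>

lemma tagged_partition_step:
  fixes t \<xi> :: "nat \<Rightarrow> real" and \<nu> :: "real \<Rightarrow> 'b::real_vector"
  assumes P: "is_partition a b n t" and tags: "\<And>i. i < n \<Longrightarrow> t (Suc i) - t i < \<delta> \<and> \<xi> i \<in> {t i..t (Suc i)}"
    and s: "s \<in> {a..b}" and \<delta>: "0 < \<delta>"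
  obtains m where "m \<le> n" "\<bar>t m - s\<bar> \<le> \<delta>"
    "(\<Sum>i<n. if \<xi> i \<le> s then \<nu> (t (Suc i)) - \<nu> (t i) else 0) = \<nu> (t m) - \<nu> a"
proof -
  define m where "m = (LEAST i. i = n \<or> s < \<xi> i)"
  have m: "m = n \<or> s < \<xi> m" unfolding m_def by (rule LeastI[of _ n]) simp
  have mn: "m \<le> n" unfolding m_def by (rule Least_le) simp
  have lt: "\<xi> i \<le> s" if "i < m" for i using not_less_Least[of i "\<lambda>i. i = n \<or> s < \<xi> i"] that
    by (auto simp: m_def)
  have ge: "s < \<xi> i" if "m \<le> i" "i < n" for i
  proof (cases "i = m")
    case True
    then show ?thesis using m that by simp
  next
    case False
    then have "t (Suc m) \<le> t i" using that by (intro is_partition_mono[OF P]) auto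
    moreover have "s < \<xi> m" using m that by auto
    ultimately show ?thesis using tags[of m] tags[of i] that by auto
  qed
  have t0: "t 0 = a" and tn: "t n = b" using P by (auto simp: is_partition_def)
  have upper: "s - t m \<le> \<delta>"
  proof (cases "m < n")
    case True
    then show ?thesis using m tags[of m] by auto
  next
    case False
    then show ?thesis using mn tn s \<delta> by auto
  qed
  have lower: "t m - s \<le> \<delta>"
  proof (cases m)
    case 0
    then show ?thesis using t0 s \<delta> by auto
  next
    case (Suc k)
    then show ?thesis using lt[of k] tags[of k] mn by auto
  qed
  have sum: "(\<Sum>i<n. if \<xi> i \<le> s then \<nu> (t (Suc i)) - \<nu> (t i) else 0) = \<nu> (t m) - \<nu> a"
  proof -
    have "(\<Sum>i<n. if \<xi> i \<le> s then \<nu> (t (Suc i)) - \<nu> (t i) else 0)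
        = (\<Sum>i<m. \<nu> (t (Suc i)) - \<nu> (t i))"
    proof (rule sum.mono_neutral_cong_right)
      show "\<forall>i\<in>{..<n} - {..<m}. (if \<xi> i \<le> s then \<nu> (t (Suc i)) - \<nu> (t i) else 0) = 0"
      proof
        fix i assume "i \<in> {..<n} - {..<m}"
        then show "(if \<xi> i \<le> s then \<nu> (t (Suc i)) - \<nu> (t i) else 0) = 0" using ge[of i] by auto
      qed
    qed (use mn lt in auto)
    also have "\<dots> = \<nu> (t m) - \<nu> (t 0)" by (rule sum_lessThan_telescope)
    finally show ?thesis by (simp add: t0)
  qed
  show thesis using that[OF mn _ sum] upper lower by (simp add: abs_le_iff)
qed

lemma var_sums_extend:
  assumes "\<sigma> \<in> var_sums \<mu> a s" "s \<le> u"
  shows "\<sigma> + norm (\<mu> u - \<mu> s) \<in> var_sums \<mu> a u"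
proof -
  obtain n t where \<sigma>: "\<sigma> = (\<Sum>i<n. norm (\<mu> (t (Suc i)) - \<mu> (t i)))" and P: "is_partition a s n t"
    using assms(1) by (auto simp: var_sums_def)
  define t' where "t' i = (if i \<le> n then t i else u)" for i
  have "is_partition a u (Suc n) t'"
    using P assms(2) by (auto simp: is_partition_def t'_def less_Suc_eq)
  moreover have "\<sigma> + norm (\<mu> u - \<mu> s) = (\<Sum>i<Suc n. norm (\<mu> (t' (Suc i)) - \<mu> (t' i)))"
    using P by (simp add: \<sigma> t'_def is_partition_def)
  ultimately show ?thesis unfolding var_sums_def by blast
qed

text \<open>The clamp to \<open>{a..b}\<close> makes the variation a monotone function on the whole
  line, so results on monotone functions apply and windows around a point may leave the
  interval.\<close>

definition variation_fun :: "(real \<Rightarrow> 'b::real_normed_vector) \<Rightarrow> real \<Rightarrow> real \<Rightarrow> real \<Rightarrow> real" where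
  "variation_fun \<mu> a b s = total_variation \<mu> a (max a (min b s))"

context
  fixes \<mu> :: "real \<Rightarrow> 'b::real_normed_vector" and a b :: real
  assumes ab: "a < b" and bv: "bounded_variation \<mu> a b"
begin

lemma var_sums_bdd: "s \<in> {a..b} \<Longrightarrow> bdd_above (var_sums \<mu> a s)"
proof -
  assume s: "s \<in> {a..b}"
  obtain B where B: "\<And>\<sigma>. \<sigma> \<in> var_sums \<mu> a b \<Longrightarrow> \<sigma> \<le> B"
    using bv unfolding bounded_variation_def bdd_above_def by blast
  have "\<sigma> \<le> B" if "\<sigma> \<in> var_sums \<mu> a s" for \<sigma>
  proof -
    have "\<sigma> + norm (\<mu> b - \<mu> s) \<le> B" using B[OF var_sums_extend[OF that, of b]] s by auto
    then show ?thesis using norm_ge_zero[of "\<mu> b - \<mu> s"] by linarith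
  qed
  then show ?thesis by (rule bdd_aboveI)
qed

lemma var_sums_nonempty: "a \<le> s \<Longrightarrow> norm (\<mu> s - \<mu> a) \<in> var_sums \<mu> a s"
proof -
  assume "a \<le> s"
  have "0 \<in> var_sums \<mu> a a"
    unfolding var_sums_def by (rule CollectI, rule exI[of _ 0], rule exI[of _ "\<lambda>_. a"]) (simp add: is_partition_def)
  from var_sums_extend[OF this \<open>a \<le> s\<close>] show ?thesis by simp
qed

lemma variation_fun_increment:
  assumes "a \<le> s" "s \<le> u" "u \<le> b"
  shows "norm (\<mu> u - \<mu> s) \<le> variation_fun \<mu> a b u - variation_fun \<mu> a b s"
proof -
  have "Sup (var_sums \<mu> a s) \<le> Sup (var_sums \<mu> a u) - norm (\<mu> u - \<mu> s)"
  proof (rule cSup_least)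
    show "var_sums \<mu> a s \<noteq> {}" using var_sums_nonempty[of s] assms by auto
    fix \<sigma> assume "\<sigma> \<in> var_sums \<mu> a s"
    from cSup_upper[OF var_sums_extend[OF this assms(2)] var_sums_bdd[of u]]
    show "\<sigma> \<le> Sup (var_sums \<mu> a u) - norm (\<mu> u - \<mu> s)" using assms by simp
  qed
  then show ?thesis using assms by (simp add: variation_fun_def total_variation_def)
qed

lemma variation_fun_mono: "mono (variation_fun \<mu> a b)"
proof (rule monoI)
  fix s u :: real assume "s \<le> u"
  define s' u' where "s' = max a (min b s)" and "u' = max a (min b u)"
  have "a \<le> s'" "s' \<le> u'" "u' \<le> b" using ab \<open>s \<le> u\<close> by (auto simp: s'_def u'_def)
  from variation_fun_increment[OF this] norm_ge_zero[of "\<mu> u' - \<mu> s'"]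
  have "variation_fun \<mu> a b s' \<le> variation_fun \<mu> a b u'" by linarith
  then show "variation_fun \<mu> a b s \<le> variation_fun \<mu> a b u"
    using ab by (simp add: variation_fun_def s'_def u'_def)
qed

lemma variation_fun_bounds: "variation_fun \<mu> a b a \<le> variation_fun \<mu> a b s" "variation_fun \<mu> a b s \<le> variation_fun \<mu> a b b"
proof -
  have "variation_fun \<mu> a b s = variation_fun \<mu> a b (max a (min b s))" using ab by (simp add: variation_fun_def)
  then show "variation_fun \<mu> a b a \<le> variation_fun \<mu> a b s" "variation_fun \<mu> a b s \<le> variation_fun \<mu> a b b"
    using ab monoD[OF variation_fun_mono, of a "max a (min b s)"] monoD[OF variation_fun_mono, of "max a (min b s)" b] by auto
qed

text \<open>The variation in a window of radius \<open>\<delta>\<close> around \<open>s\<close>. It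
  bounds the increments from \<open>s\<close> of both \<open>\<mu>\<close> and its variation, and
  tends to zero with \<open>\<delta>\<close> wherever the variation is continuous.\<close>

definition osc :: "real \<Rightarrow> real \<Rightarrow> real" where
  "osc \<delta> s = variation_fun \<mu> a b (s + \<delta>) - variation_fun \<mu> a b (s - \<delta>)"

lemma osc_bounds:
  assumes "0 \<le> \<delta>"
  shows "0 \<le> osc \<delta> s" "osc \<delta> s \<le> variation_fun \<mu> a b b - variation_fun \<mu> a b a"
  using monoD[OF variation_fun_mono, of "s - \<delta>" "s + \<delta>"] variation_fun_bounds[of "s + \<delta>"] variation_fun_bounds[of "s - \<delta>"] assms
  by (auto simp: osc_def)

lemma variation_fun_measurable [measurable]: "variation_fun \<mu> a b \<in> borel_measurable borel"
  by (rule borel_measurable_mono[OF variation_fun_mono])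

lemma osc_measurable: "osc \<delta> \<in> borel_measurable borel"
  unfolding osc_def[abs_def] by measurable

lemma osc_variation:
  assumes "\<bar>u - s\<bar> \<le> \<delta>"
  shows "\<bar>variation_fun \<mu> a b u - variation_fun \<mu> a b s\<bar> \<le> osc \<delta> s"
proof -
  have "0 \<le> \<delta>" using assms by linarith
  then have "variation_fun \<mu> a b (s - \<delta>) \<le> variation_fun \<mu> a b u" "variation_fun \<mu> a b u \<le> variation_fun \<mu> a b (s + \<delta>)"
    "variation_fun \<mu> a b (s - \<delta>) \<le> variation_fun \<mu> a b s" "variation_fun \<mu> a b s \<le> variation_fun \<mu> a b (s + \<delta>)"
    using assms by (auto intro!: monoD[OF variation_fun_mono])
  then show ?thesis unfolding osc_def by linarith
qed

lemma osc_norm: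
  assumes "\<bar>u - s\<bar> \<le> \<delta>" "u \<in> {a..b}" "s \<in> {a..b}"
  shows "norm (\<mu> u - \<mu> s) \<le> osc \<delta> s"
proof (cases "s \<le> u")
  case True
  then show ?thesis using variation_fun_increment[of s u] osc_variation[OF assms(1)] assms by auto
next
  case False
  then show ?thesis using variation_fun_increment[of u s] osc_variation[OF assms(1)] assms
    by (auto simp: norm_minus_commute)
qed

lemma measurable_lebesgue_on: "w \<in> borel_measurable borel \<Longrightarrow> w \<in> borel_measurable (lebesgue_on I)"
  for w :: "real \<Rightarrow> real"
  by (intro measurable_restrict_space1 measurable_completion) simp

lemma bounded_mult_integrable:
  fixes w u :: "real \<Rightarrow> real"
  assumes w: "w \<in> borel_measurable borel" "\<And>s. \<bar>w s\<bar> \<le> C" and u: "integrable (lebesgue_on I) u"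
  shows "integrable (lebesgue_on I) (\<lambda>s. w s * u s)"
proof (rule Bochner_Integration.integrable_bound[of _ "\<lambda>s. C * \<bar>u s\<bar>"])
  show "integrable (lebesgue_on I) (\<lambda>s. C * \<bar>u s\<bar>)" using u by simp
  show "(\<lambda>s. w s * u s) \<in> borel_measurable (lebesgue_on I)"
    by (intro borel_measurable_times measurable_lebesgue_on[OF w(1)] borel_measurable_integrable[OF u])
  have "0 \<le> C" using w(2)[of 0] by linarith
  then show "AE s in lebesgue_on I. norm (w s * u s) \<le> norm (C * \<bar>u s\<bar>)"
    using w(2) by (auto simp: abs_mult intro!: mult_right_mono)
qed

text \<open>A monotone function has only countably many discontinuities, a Lebesgue null set. Hence
  the oscillation tends to zero almost everywhere, dominated by the total variation: atoms of the
  variation do no harm under a Lebesgue integral.\<close>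

lemma osc_integral_small:
  fixes u :: "real \<Rightarrow> real"
  assumes u: "integrable (lebesgue_on {a..b}) u" and "\<epsilon> > 0"
  obtains \<delta> where "\<delta> > 0" "(\<integral>s. osc \<delta> s * \<bar>u s\<bar> \<partial>lebesgue_on {a..b}) < \<epsilon>"
proof -
  let ?V = "variation_fun \<mu> a b" and ?M = "lebesgue_on {a..b}"
  have "(\<lambda>j. \<integral>s. osc (1 / real (Suc j)) s * \<bar>u s\<bar> \<partial>?M) \<longlonglongrightarrow> (\<integral>s. 0 \<partial>?M)"
  proof (rule integral_dominated_convergence)
    show "integrable ?M (\<lambda>s. (?V b - ?V a) * \<bar>u s\<bar>)" using u by simp
    show "(\<lambda>s. osc (1 / real (Suc j)) s * \<bar>u s\<bar>) \<in> borel_measurable ?M" for j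
      using borel_measurable_integrable[OF u]
      by (intro borel_measurable_times measurable_lebesgue_on[OF osc_measurable] borel_measurable_abs)
    show "AE s in ?M. norm (osc (1 / real (Suc j)) s * \<bar>u s\<bar>) \<le> (?V b - ?V a) * \<bar>u s\<bar>" for j
      using osc_bounds[of "1 / real (Suc j)"] by (auto simp: abs_mult intro!: mult_right_mono)
    have count: "countable {s. \<not> isCont ?V s}" by (rule mono_ctble_discont[OF variation_fun_mono])
    then have "AE s in lborel. s \<notin> {s. \<not> isCont ?V s}"
      by (intro AE_not_in) (simp add: countable_imp_null_set_lborel)
    then have "AE s in lebesgue. s \<notin> {s. \<not> isCont ?V s}" by (rule AE_completion)
    then have "AE s in ?M. s \<notin> {s. \<not> isCont ?V s}" by (subst AE_restrict_space_iff) auto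
    then show "AE s in ?M. (\<lambda>j. osc (1 / real (Suc j)) s * \<bar>u s\<bar>) \<longlonglongrightarrow> 0"
    proof eventually_elim
      case (elim s)
      then have c: "isCont ?V s" by simp
      have l: "(\<lambda>j. 1 / real (Suc j)) \<longlonglongrightarrow> 0" by (rule LIMSEQ_Suc) (rule lim_1_over_n)
      have "(\<lambda>j. s + 1 / real (Suc j)) \<longlonglongrightarrow> s" "(\<lambda>j. s - 1 / real (Suc j)) \<longlonglongrightarrow> s"
        using tendsto_add[OF tendsto_const[of s] l] tendsto_diff[OF tendsto_const[of s] l] by simp_all
      then have "(\<lambda>j. ?V (s + 1 / real (Suc j)) - ?V (s - 1 / real (Suc j))) \<longlonglongrightarrow> ?V s - ?V s"
        by (intro tendsto_diff isCont_tendsto_compose[OF c])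
      then have "(\<lambda>j. osc (1 / real (Suc j)) s) \<longlonglongrightarrow> 0" by (simp add: osc_def)
      from tendsto_mult[OF this tendsto_const[of "\<bar>u s\<bar>"]] show ?case by simp
    qed
  qed simp
  then have "\<forall>\<^sub>F j in sequentially. (\<integral>s. osc (1 / real (Suc j)) s * \<bar>u s\<bar> \<partial>?M) < \<epsilon>"
    using \<open>\<epsilon> > 0\<close> by (intro order_tendstoD(2)) auto
  then obtain j where "(\<integral>s. osc (1 / real (Suc j)) s * \<bar>u s\<bar> \<partial>?M) < \<epsilon>"
    using eventually_happens'[OF sequentially_bot] by blast
  then show thesis by (intro that[of "1 / real (Suc j)"]) auto
qed

end

section \<open>Riemann-Stieltjes sums and existence of the integral\<close>

definition RS_sum ::
  "(real \<Rightarrow> ('a::real_normed_vector \<Rightarrow>\<^sub>L 'b::real_normed_vector)) \<Rightarrow> (real \<Rightarrow> 'a) \<Rightarrow> nat \<Rightarrow> (nat \<Rightarrow> real) \<Rightarrow> (nat \<Rightarrow> real) \<Rightarrow> 'b"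
  where "RS_sum \<mu> \<phi> n t \<xi> = (\<Sum>i<n. blinfun_apply (\<mu> (t (Suc i)) - \<mu> (t i)) (\<phi> (\<xi> i)))"

definition fine_tagged :: "real \<Rightarrow> real \<Rightarrow> real \<Rightarrow> nat \<Rightarrow> (nat \<Rightarrow> real) \<Rightarrow> (nat \<Rightarrow> real) \<Rightarrow> bool" where
  "fine_tagged a b \<delta> n t \<xi> \<longleftrightarrow> is_partition a b n t \<and> (\<forall>i<n. t (Suc i) - t i < \<delta> \<and> \<xi> i \<in> {t i..t (Suc i)})"

lemma has_RS_integral_iff:
  "has_RS_integral \<mu> \<phi> a b I \<longleftrightarrow>
     (\<forall>\<epsilon>>0. \<exists>\<delta>>0. \<forall>n t \<xi>. fine_tagged a b \<delta> n t \<xi> \<longrightarrow> norm (RS_sum \<mu> \<phi> n t \<xi> - I) < \<epsilon>)"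
  by (simp add: has_RS_integral_def RS_sum_def fine_tagged_def)

text \<open>A concrete sequence of arbitrarily fine tagged partitions with \<open>Suc j\<close>
  cells, so that none is empty. It shows uniqueness of the integral, which the definite description
  relies on, and provides the candidate limit for existence.\<close>

definition uniform_point :: "real \<Rightarrow> real \<Rightarrow> nat \<Rightarrow> nat \<Rightarrow> real" where
  "uniform_point a b j i = a + (b - a) * real i / real (Suc j)"

lemma uniform_fine_tagged:
  assumes "a < b" "(b - a) / real (Suc j) < \<delta>"
  shows "fine_tagged a b \<delta> (Suc j) (uniform_point a b j) (uniform_point a b j)"
proof -
  have step: "uniform_point a b j (Suc i) - uniform_point a b j i = (b - a) / real (Suc j)" for i
    by (simp add: uniform_point_def diff_divide_distrib[symmetric] algebra_simps)
  have pos: "0 < (b - a) / real (Suc j)" using assms by simp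
  have "uniform_point a b j i \<le> uniform_point a b j (Suc i)" for i using step[of i] pos by linarith
  then show ?thesis unfolding fine_tagged_def is_partition_def
    using step assms by (auto simp: uniform_point_def)
qed

lemma eventually_uniform_fine_tagged:
  assumes "a < b" "\<delta> > 0"
  shows "\<forall>\<^sub>F j in sequentially. fine_tagged a b \<delta> (Suc j) (uniform_point a b j) (uniform_point a b j)"
proof -
  have "(\<lambda>j. (b - a) * (1 / real (Suc j))) \<longlonglongrightarrow> (b - a) * 0"
    by (intro tendsto_intros LIMSEQ_Suc[OF lim_1_over_n])
  then have "\<forall>\<^sub>F j in sequentially. (b - a) * (1 / real (Suc j)) < \<delta>"
    using assms(2) by (intro order_tendstoD(2)) auto
  then show ?thesis by eventually_elim (simp add: uniform_fine_tagged[OF assms(1)])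
qed

lemma has_RS_integral_uniform:
  assumes I: "has_RS_integral \<mu> \<phi> a b I" and ab: "a < b"
  shows "(\<lambda>j. RS_sum \<mu> \<phi> (Suc j) (uniform_point a b j) (uniform_point a b j)) \<longlonglongrightarrow> I"
proof (rule tendstoI)
  fix \<epsilon> :: real assume "\<epsilon> > 0"
  then obtain \<delta> where \<delta>: "\<delta> > 0" "\<And>n t \<xi>. fine_tagged a b \<delta> n t \<xi> \<Longrightarrow> norm (RS_sum \<mu> \<phi> n t \<xi> - I) < \<epsilon>"
    using I unfolding has_RS_integral_iff by blast
  show "\<forall>\<^sub>F j in sequentially. dist (RS_sum \<mu> \<phi> (Suc j) (uniform_point a b j) (uniform_point a b j)) I < \<epsilon>"
    using eventually_uniform_fine_tagged[OF ab \<delta>(1)]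
    by eventually_elim (simp add: dist_norm \<delta>(2))
qed

lemma RS_integral_eq:
  assumes I: "has_RS_integral \<mu> \<phi> a b I" and ab: "a < b"
  shows "RS_integral \<mu> \<phi> a b = I"
  unfolding RS_integral_def
proof (rule the_equality[of "has_RS_integral \<mu> \<phi> a b", OF I])
  fix J assume "has_RS_integral \<mu> \<phi> a b J"
  from LIMSEQ_unique[OF has_RS_integral_uniform[OF this ab] has_RS_integral_uniform[OF I ab]] show "J = I" .
qed

text \<open>Integration by parts turns a Riemann--Stieltjes sum for \<open>\<phi>\<close> into an integral of a step
  function against \<open>\<phi>'\<close>; the step functions of fine partitions differ by the oscillation of the
  variation, which tends to zero almost everywhere.\<close>

lemma RS_sum_parts:
  fixes \<mu> :: "real \<Rightarrow> ('a::banach \<Rightarrow>\<^sub>L 'b::banach)"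
  assumes P: "is_partition a b n t" and tags: "\<And>i. i < n \<Longrightarrow> \<xi> i \<in> {t i..t (Suc i)}"
    and \<phi>': "\<And>s u. a \<le> s \<Longrightarrow> s \<le> u \<Longrightarrow> u \<le> b \<Longrightarrow> (\<phi>' has_integral (\<phi> u - \<phi> s)) {s..u}"
  shows "((\<lambda>s. blinfun_apply (\<Sum>i<n. if \<xi> i \<le> s then \<mu> (t (Suc i)) - \<mu> (t i) else 0) (\<phi>' s))
      has_integral (blinfun_apply (\<mu> b - \<mu> a) (\<phi> b) - RS_sum \<mu> \<phi> n t \<xi>)) {a..b}"
proof -
  let ?d = "\<lambda>i. \<mu> (t (Suc i)) - \<mu> (t i)"
  have \<xi>: "\<xi> i \<in> {a..b}" if "i < n" for i
    using tags[OF that] is_partition_range[OF P, of i] is_partition_range[OF P, of "Suc i"] that by auto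
  have 1: "((\<lambda>s. blinfun_apply (?d i) (if s \<in> {\<xi> i..b} then \<phi>' s else 0)) has_integral blinfun_apply (?d i) (\<phi> b - \<phi> (\<xi> i))) {a..b}"
    if "i < n" for i
  proof -
    have "(\<phi>' has_integral (\<phi> b - \<phi> (\<xi> i))) {\<xi> i..b}" using \<xi>[OF that] by (intro \<phi>') auto
    then have "((\<lambda>s. if s \<in> {\<xi> i..b} then \<phi>' s else 0) has_integral (\<phi> b - \<phi> (\<xi> i))) {a..b}"
      using \<xi>[OF that] by (subst has_integral_restrict) auto
    from has_integral_linear[OF this blinfun.bounded_linear_right[of "?d i"]] show ?thesis
      by (simp add: comp_def)
  qed
  have "((\<lambda>s. \<Sum>i<n. blinfun_apply (?d i) (if s \<in> {\<xi> i..b} then \<phi>' s else 0)) has_integral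
      (\<Sum>i<n. blinfun_apply (?d i) (\<phi> b - \<phi> (\<xi> i)))) {a..b}"
    by (intro has_integral_sum 1) auto
  moreover have "(\<Sum>i<n. blinfun_apply (?d i) (\<phi> b - \<phi> (\<xi> i))) = blinfun_apply (\<mu> b - \<mu> a) (\<phi> b) - RS_sum \<mu> \<phi> n t \<xi>"
  proof -
    have "\<mu> b - \<mu> a = (\<Sum>i<n. ?d i)"
      using sum_lessThan_telescope[of "\<lambda>i. \<mu> (t i)" n] P by (simp add: is_partition_def)
    then have "blinfun_apply (\<mu> b - \<mu> a) (\<phi> b) = (\<Sum>i<n. blinfun_apply (?d i) (\<phi> b))"
      by (simp only: blinfun.sum_left)
    then show ?thesis by (simp only: RS_sum_def blinfun.diff_right sum_subtractf)
  qed
  ultimately have 2: "((\<lambda>s. \<Sum>i<n. blinfun_apply (?d i) (if s \<in> {\<xi> i..b} then \<phi>' s else 0)) has_integral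
      (blinfun_apply (\<mu> b - \<mu> a) (\<phi> b) - RS_sum \<mu> \<phi> n t \<xi>)) {a..b}" by (simp only:)
  show ?thesis
  proof (rule has_integral_eq[OF _ 2])
    fix s assume "s \<in> {a..b}"
    then show "(\<Sum>i<n. blinfun_apply (?d i) (if s \<in> {\<xi> i..b} then \<phi>' s else 0))
       = blinfun_apply (\<Sum>i<n. if \<xi> i \<le> s then ?d i else 0) (\<phi>' s)"
      unfolding blinfun.sum_left by (intro sum.cong) (auto simp: blinfun.zero_right)
  qed
qed

context
  fixes \<mu> :: "real \<Rightarrow> ('a::banach \<Rightarrow>\<^sub>L 'b::banach)" and a b :: real
  assumes ab: "a < b" and bv: "bounded_variation \<mu> a b"
begin

text \<open>By \<open>RS_sum_parts\<close> the difference of the sums is an integral of the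
  difference of two step functions. Both deviate from \<open>\<mu> s - \<mu> a\<close> by at most
  \<open>osc\<close>, whence the factor two.\<close>

lemma RS_sum_close:
  assumes P: "fine_tagged a b \<delta> n t \<xi>" and Q: "fine_tagged a b \<delta> n' t' \<xi>'" and \<delta>: "\<delta> > 0"
    and \<phi>': "\<And>s u. a \<le> s \<Longrightarrow> s \<le> u \<Longrightarrow> u \<le> b \<Longrightarrow> (\<phi>' has_integral (\<phi> u - \<phi> s)) {s..u}"
    and i: "integrable (lebesgue_on {a..b}) (\<lambda>s. norm (\<phi>' s))"
  shows "norm (RS_sum \<mu> \<phi> n t \<xi> - RS_sum \<mu> \<phi> n' t' \<xi>')
    \<le> 2 * (\<integral>s. osc \<mu> a b \<delta> s * \<bar>norm (\<phi>' s)\<bar> \<partial>lebesgue_on {a..b})"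
proof -
  let ?k = "\<lambda>n t \<xi> s. \<Sum>i<n. if \<xi> i \<le> s then \<mu> (t (Suc i)) - \<mu> (t i) else 0"
  have k: "norm (?k n t \<xi> s - (\<mu> s - \<mu> a)) \<le> osc \<mu> a b \<delta> s"
    if F: "fine_tagged a b \<delta> n t \<xi>" and s: "s \<in> {a..b}" for n and t \<xi> :: "nat \<Rightarrow> real" and s
  proof -
    have F': "is_partition a b n t" "\<And>i. i < n \<Longrightarrow> t (Suc i) - t i < \<delta> \<and> \<xi> i \<in> {t i..t (Suc i)}"
      using F by (auto simp: fine_tagged_def)
    obtain m where m: "m \<le> n" "\<bar>t m - s\<bar> \<le> \<delta>"
      and sum: "?k n t \<xi> s = \<mu> (t m) - \<mu> a"
      by (rule tagged_partition_step[where \<nu> = \<mu>, OF F' s \<delta>])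
    have "norm (\<mu> (t m) - \<mu> s) \<le> osc \<mu> a b \<delta> s"
      by (rule osc_norm[OF ab bv m(2) is_partition_range[OF F'(1) m(1)] s])
    then show ?thesis by (simp add: sum)
  qed
  have P': "is_partition a b n t" "\<And>i. i < n \<Longrightarrow> \<xi> i \<in> {t i..t (Suc i)}" using P by (auto simp: fine_tagged_def)
  have Q': "is_partition a b n' t'" "\<And>i. i < n' \<Longrightarrow> \<xi>' i \<in> {t' i..t' (Suc i)}" using Q by (auto simp: fine_tagged_def)
  have hi: "((\<lambda>s. blinfun_apply (?k n' t' \<xi>' s) (\<phi>' s) - blinfun_apply (?k n t \<xi> s) (\<phi>' s)) has_integral
      (RS_sum \<mu> \<phi> n t \<xi> - RS_sum \<mu> \<phi> n' t' \<xi>')) {a..b}"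
    using has_integral_diff[OF RS_sum_parts[OF Q' \<phi>', where \<mu> = \<mu>] RS_sum_parts[OF P' \<phi>', where \<mu> = \<mu>]] by simp
  have io: "integrable (lebesgue_on {a..b}) (\<lambda>s. osc \<mu> a b \<delta> s * \<bar>norm (\<phi>' s)\<bar>)"
    using osc_bounds[OF ab bv, of \<delta>] \<delta> i
    by (intro bounded_mult_integrable[OF ab bv osc_measurable[OF ab bv], where C = "variation_fun \<mu> a b b - variation_fun \<mu> a b a"]) auto
  have io': "((\<lambda>s. 2 * (osc \<mu> a b \<delta> s * \<bar>norm (\<phi>' s)\<bar>)) has_integral
     2 * (\<integral>s. osc \<mu> a b \<delta> s * \<bar>norm (\<phi>' s)\<bar> \<partial>lebesgue_on {a..b})) {a..b}"
    by (intro has_integral_mult_right has_integral_integral_lebesgue_on io) simp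
  have "norm (integral {a..b} (\<lambda>s. blinfun_apply (?k n' t' \<xi>' s) (\<phi>' s) - blinfun_apply (?k n t \<xi> s) (\<phi>' s)))
      \<le> integral {a..b} (\<lambda>s. 2 * (osc \<mu> a b \<delta> s * \<bar>norm (\<phi>' s)\<bar>))"
  proof (rule integral_norm_bound_integral)
    fix s assume s: "s \<in> {a..b}"
    have "norm (?k n' t' \<xi>' s - ?k n t \<xi> s) \<le> 2 * osc \<mu> a b \<delta> s"
      using norm_triangle_ineq4[of "?k n' t' \<xi>' s - (\<mu> s - \<mu> a)" "?k n t \<xi> s - (\<mu> s - \<mu> a)"]
        k[OF P s] k[OF Q s] by simp
    then have "norm (?k n' t' \<xi>' s - ?k n t \<xi> s) * norm (\<phi>' s) \<le> 2 * osc \<mu> a b \<delta> s * norm (\<phi>' s)"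
      by (intro mult_right_mono) auto
    then show "norm (blinfun_apply (?k n' t' \<xi>' s) (\<phi>' s) - blinfun_apply (?k n t \<xi> s) (\<phi>' s)) \<le> 2 * (osc \<mu> a b \<delta> s * \<bar>norm (\<phi>' s)\<bar>)"
      using norm_blinfun[of "?k n' t' \<xi>' s - ?k n t \<xi> s" "\<phi>' s"] by (simp add: blinfun.diff_left)
  qed (use hi io' in auto)
  then show ?thesis unfolding integral_unique[OF hi] integral_unique[OF io'] .
qed

lemma has_RS_integral_exists:
  assumes \<phi>': "\<And>s u. a \<le> s \<Longrightarrow> s \<le> u \<Longrightarrow> u \<le> b \<Longrightarrow> (\<phi>' has_integral (\<phi> u - \<phi> s)) {s..u}"
    and i: "integrable (lebesgue_on {a..b}) (\<lambda>s. norm (\<phi>' s))"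
  shows "\<exists>I. has_RS_integral \<mu> \<phi> a b I"
proof -
  let ?U = "\<lambda>j. RS_sum \<mu> \<phi> (Suc j) (uniform_point a b j) (uniform_point a b j)"
  have small: "\<exists>\<delta>>0. \<forall>n t \<xi> n' t' \<xi>'. fine_tagged a b \<delta> n t \<xi> \<longrightarrow> fine_tagged a b \<delta> n' t' \<xi>' \<longrightarrow>
      norm (RS_sum \<mu> \<phi> n t \<xi> - RS_sum \<mu> \<phi> n' t' \<xi>') < \<epsilon>" if "\<epsilon> > 0" for \<epsilon>
  proof -
    obtain \<delta> where \<delta>: "\<delta> > 0" "(\<integral>s. osc \<mu> a b \<delta> s * \<bar>norm (\<phi>' s)\<bar> \<partial>lebesgue_on {a..b}) < \<epsilon> / 2"
      using osc_integral_small[OF ab bv i, of "\<epsilon> / 2"] \<open>\<epsilon> > 0\<close> by auto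
    have "norm (RS_sum \<mu> \<phi> n t \<xi> - RS_sum \<mu> \<phi> n' t' \<xi>') < \<epsilon>"
      if "fine_tagged a b \<delta> n t \<xi>" "fine_tagged a b \<delta> n' t' \<xi>'" for n t \<xi> n' t' \<xi>'
      using RS_sum_close[OF that \<delta>(1) \<phi>' i] \<delta>(2) by simp
    then show ?thesis using \<delta>(1) by blast
  qed
  have "Cauchy ?U"
  proof (rule CauchyI)
    fix \<epsilon> :: real assume "\<epsilon> > 0"
    from small[OF this] obtain \<delta> where \<delta>: "\<delta> > 0" "\<And>n t \<xi> n' t' \<xi>'. fine_tagged a b \<delta> n t \<xi> \<Longrightarrow> fine_tagged a b \<delta> n' t' \<xi>' \<Longrightarrow>
      norm (RS_sum \<mu> \<phi> n t \<xi> - RS_sum \<mu> \<phi> n' t' \<xi>') < \<epsilon>" by blast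
    obtain N where N: "\<And>j. j \<ge> N \<Longrightarrow> fine_tagged a b \<delta> (Suc j) (uniform_point a b j) (uniform_point a b j)"
      using eventually_uniform_fine_tagged[OF ab \<delta>(1)] unfolding eventually_sequentially by blast
    show "\<exists>M. \<forall>m\<ge>M. \<forall>n\<ge>M. norm (?U m - ?U n) < \<epsilon>"
      by (intro exI[of _ N] allI impI \<delta>(2) N)
  qed
  then obtain I where I: "?U \<longlonglongrightarrow> I" using Cauchy_convergent_iff convergent_def by blast
  have "has_RS_integral \<mu> \<phi> a b I"
    unfolding has_RS_integral_iff
  proof (intro allI impI)
    fix \<epsilon> :: real assume "\<epsilon> > 0"
    then have "\<epsilon> / 2 > 0" by simp
    from small[OF this] obtain \<delta> where \<delta>: "\<delta> > 0" "\<And>n t \<xi> n' t' \<xi>'. fine_tagged a b \<delta> n t \<xi> \<Longrightarrow> fine_tagged a b \<delta> n' t' \<xi>' \<Longrightarrow>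
      norm (RS_sum \<mu> \<phi> n t \<xi> - RS_sum \<mu> \<phi> n' t' \<xi>') < \<epsilon> / 2" by blast
    have "norm (RS_sum \<mu> \<phi> n t \<xi> - I) < \<epsilon>" if F: "fine_tagged a b \<delta> n t \<xi>" for n t \<xi>
    proof -
      have "(\<lambda>j. norm (RS_sum \<mu> \<phi> n t \<xi> - ?U j)) \<longlonglongrightarrow> norm (RS_sum \<mu> \<phi> n t \<xi> - I)"
        by (intro tendsto_intros I)
      moreover have "\<forall>\<^sub>F j in sequentially. norm (RS_sum \<mu> \<phi> n t \<xi> - ?U j) \<le> \<epsilon> / 2"
        using eventually_uniform_fine_tagged[OF ab \<delta>(1)]
        by eventually_elim (use \<delta>(2)[OF F] in \<open>simp add: less_imp_le\<close>)
      ultimately have "norm (RS_sum \<mu> \<phi> n t \<xi> - I) \<le> \<epsilon> / 2"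
        by (rule tendsto_upperbound) simp
      then show ?thesis using \<open>\<epsilon> > 0\<close> by simp
    qed
    then show "\<exists>\<delta>>0. \<forall>n t \<xi>. fine_tagged a b \<delta> n t \<xi> \<longrightarrow> norm (RS_sum \<mu> \<phi> n t \<xi> - I) < \<epsilon>"
      using \<delta>(1) by blast
  qed
  then show ?thesis ..
qed

end

text \<open>Jensen's inequality for a discrete measure of mass at most \<open>W\<close>, by tangents
  at the mean \<open>m\<close> formed with \<open>W\<close>. The missing mass has a favourable sign
  because \<open>1 \<le> p\<close>.\<close>

lemma weighted_power_mean:
  fixes w c :: "nat \<Rightarrow> real"
  assumes p: "1 \<le> p" and w: "\<And>i. i < n \<Longrightarrow> 0 \<le> w i" and c: "\<And>i. i < n \<Longrightarrow> 0 \<le> c i"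
    and W: "(\<Sum>i<n. w i) \<le> W" "0 < W"
  shows "W powr (1 - p) * (\<Sum>i<n. w i * c i) powr p \<le> (\<Sum>i<n. w i * c i powr p)"
proof -
  define m where "m = (\<Sum>i<n. w i * c i) / W"
  have s0: "0 \<le> (\<Sum>i<n. w i * c i)" using w c by (intro sum_nonneg mult_nonneg_nonneg) auto
  have m: "0 \<le> m" "(\<Sum>i<n. w i * c i) = W * m" using s0 W by (auto simp: m_def)
  have mp: "m powr (p - 1) * m = m powr p"
    using m by (cases "m = 0") (auto simp: powr_mult_base mult.commute)
  have "m powr p * W \<le> m powr p * (p * W - (p - 1) * (\<Sum>i<n. w i))"
  proof (rule mult_left_mono)
    have "(p - 1) * (\<Sum>i<n. w i) \<le> (p - 1) * W" using W p by (intro mult_left_mono) auto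
    then show "W \<le> p * W - (p - 1) * (\<Sum>i<n. w i)" by (simp add: algebra_simps)
  qed simp
  also have "\<dots> = (\<Sum>i<n. w i * (m powr p + p * m powr (p - 1) * (c i - m)))"
  proof -
    have "(\<Sum>i<n. w i * (m powr p + p * m powr (p - 1) * (c i - m)))
      = (\<Sum>i<n. (m powr p - p * (m powr (p - 1) * m)) * w i + p * m powr (p - 1) * (w i * c i))"
      by (intro sum.cong refl) (simp add: algebra_simps)
    also have "\<dots> = (m powr p - p * (m powr (p - 1) * m)) * (\<Sum>i<n. w i) + p * m powr (p - 1) * (W * m)"
      by (simp only: sum.distrib sum_distrib_left[symmetric] m(2))
    also have "p * m powr (p - 1) * (W * m) = p * W * (m powr (p - 1) * m)" by simp
    finally show ?thesis unfolding mp by (simp add: algebra_simps)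
  qed
  also have "\<dots> \<le> (\<Sum>i<n. w i * c i powr p)"
  proof (intro sum_mono mult_left_mono)
    fix i assume "i \<in> {..<n}"
    then show "m powr p + p * m powr (p - 1) * (c i - m) \<le> c i powr p" "0 \<le> w i"
      using powr_tangent[OF m(1) c p, of i] w by auto
  qed
  finally have "m powr p * W \<le> (\<Sum>i<n. w i * c i powr p)" .
  moreover have "W powr (1 - p) * (W * m) powr p = m powr p * W"
    using W m by (simp add: powr_mult mult.assoc[symmetric] powr_add[symmetric] mult.commute)
  ultimately show ?thesis by (simp add: m(2))
qed

lemma RS_integral_powr_bound:
  fixes \<mu> :: "real \<Rightarrow> ('a::banach \<Rightarrow>\<^sub>L 'b::banach)"
  assumes ab: "a < b" and bv: "bounded_variation \<mu> a b" and p: "1 \<le> p" and h: "0 < h"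
    and W1: "W1p_with p {a..b} \<phi> \<phi>'"
    and L: "has_RS_integral \<mu> \<phi> a b L"
  defines "V \<equiv> \<lambda>s. variation_fun \<mu> a b s - variation_fun \<mu> a b a"
  assumes W: "V b \<le> W" "0 < W"
  shows "h * (W powr (1 - p) * norm L powr p) + (\<integral>s. V s * norm (\<phi> s) powr p \<partial>lebesgue_on {a..b})
    \<le> (\<integral>s. V s * norm (\<phi> s - h *\<^sub>R \<phi>' s) powr p \<partial>lebesgue_on {a..b}) + h * (V b * norm (\<phi> b) powr p)"
proof -
  let ?M = "lebesgue_on {a..b}" and ?\<gamma> = "\<lambda>s. \<phi> s - h *\<^sub>R \<phi>' s"
  have p0: "0 \<le> p" using p by simp
  note m = W1p_with_memLp[OF W1]
  have m\<gamma>: "memLp p ?M ?\<gamma>" using m p0 by (intro memLp_diff(1) memLp_scaleR) auto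
  let ?q = "\<lambda>s. norm (\<phi> s) powr p"
  let ?D = "\<lambda>s. norm (\<phi> s) powr p - norm (?\<gamma> s) powr p"
  have i: "integrable ?M ?q" "integrable ?M (\<lambda>s. norm (?\<gamma> s) powr p)"
    using m m\<gamma> memLp_integrable by blast+
  have iD: "integrable ?M ?D" using i by simp
  have V0: "0 \<le> V s" "V s \<le> V b" for s unfolding V_def using variation_fun_bounds[OF ab bv, of s] by auto
  have Vm: "V \<in> borel_measurable borel" unfolding V_def using variation_fun_measurable[OF ab bv] by simp
  have Vabs: "\<bar>V s\<bar> \<le> V b" for s using V0[of s] by simp
  note mult_int = bounded_mult_integrable[OF ab bv]
  have iVD: "integrable ?M (\<lambda>s. V s * ?D s)" by (rule mult_int[OF Vm Vabs iD])
  have hiVD: "((\<lambda>s. V s * ?D s) has_integral (\<integral>s. V s * ?D s \<partial>?M)) {a..b}"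
    by (rule has_integral_integral_lebesgue_on[OF iVD]) simp
  have hD: "?D integrable_on {a..b}" using has_integral_integral_lebesgue_on[OF iD] by auto
  have main: "W powr (1 - p) * norm L powr p \<le> V b * ?q b - (1 / h) * (\<integral>s. V s * ?D s \<partial>?M) + \<epsilon> / h"
    if "\<epsilon> > 0" for \<epsilon>
  proof -
    obtain \<delta> where \<delta>: "\<delta> > 0" "(\<integral>s. osc \<mu> a b \<delta> s * \<bar>?D s\<bar> \<partial>?M) < \<epsilon>"
      using osc_integral_small[OF ab bv iD \<open>\<epsilon> > 0\<close>] by blast
    have io: "integrable ?M (\<lambda>s. osc \<mu> a b \<delta> s * \<bar>?D s\<bar>)"
      using osc_bounds[OF ab bv, of \<delta>] \<delta> iD
      by (intro mult_int[OF osc_measurable[OF ab bv], where C = "variation_fun \<mu> a b b - variation_fun \<mu> a b a"]) auto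
    have hio: "((\<lambda>s. osc \<mu> a b \<delta> s * \<bar>?D s\<bar>) has_integral (\<integral>s. osc \<mu> a b \<delta> s * \<bar>?D s\<bar> \<partial>?M)) {a..b}"
      by (rule has_integral_integral_lebesgue_on[OF io]) simp
    have bound: "W powr (1 - p) * norm (RS_sum \<mu> \<phi> n t \<xi>) powr p \<le> V b * ?q b - (1 / h) * (\<integral>s. V s * ?D s \<partial>?M) + \<epsilon> / h"
      if F: "fine_tagged a b \<delta> n t \<xi>" for n t \<xi>
    proof -
      have P: "is_partition a b n t" and tags: "\<And>i. i < n \<Longrightarrow> t (Suc i) - t i < \<delta> \<and> \<xi> i \<in> {t i..t (Suc i)}"
        using F by (auto simp: fine_tagged_def)
      let ?w = "\<lambda>i. V (t (Suc i)) - V (t i)"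
      have tr: "t i \<in> {a..b}" if "i \<le> n" for i by (rule is_partition_range[OF P that])
      have \<xi>: "\<xi> i \<in> {a..b}" if "i < n" for i using tags[OF that] tr[of i] tr[of "Suc i"] that by auto
      have w0: "0 \<le> ?w i" if "i < n" for i
        using monoD[OF variation_fun_mono[OF ab bv], of "t i" "t (Suc i)"] P that by (auto simp: V_def is_partition_def)
      have dw: "norm (\<mu> (t (Suc i)) - \<mu> (t i)) \<le> ?w i" if "i < n" for i
        using variation_fun_increment[OF ab bv, of "t i" "t (Suc i)"] P tr[of i] tr[of "Suc i"] that
        by (auto simp: V_def is_partition_def)
      have sw: "(\<Sum>i<n. ?w i) \<le> W"
        using sum_lessThan_telescope[of "\<lambda>i. V (t i)" n] P W V0(1)[of a] by (simp add: is_partition_def)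
      have nS: "norm (RS_sum \<mu> \<phi> n t \<xi>) \<le> (\<Sum>i<n. ?w i * norm (\<phi> (\<xi> i)))"
        unfolding RS_sum_def
      proof (rule sum_norm_le)
        fix i assume "i \<in> {..<n}"
        then show "norm (blinfun_apply (\<mu> (t (Suc i)) - \<mu> (t i)) (\<phi> (\<xi> i))) \<le> ?w i * norm (\<phi> (\<xi> i))"
          using norm_blinfun[of "\<mu> (t (Suc i)) - \<mu> (t i)" "\<phi> (\<xi> i)"] mult_right_mono[OF dw[of i], of "norm (\<phi> (\<xi> i))"] by simp
      qed
      have "W powr (1 - p) * norm (RS_sum \<mu> \<phi> n t \<xi>) powr p \<le> W powr (1 - p) * (\<Sum>i<n. ?w i * norm (\<phi> (\<xi> i))) powr p"
        using nS p0 by (intro mult_left_mono powr_mono2) auto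
      also have "\<dots> \<le> (\<Sum>i<n. ?w i * norm (\<phi> (\<xi> i)) powr p)"
        by (rule weighted_power_mean[OF p w0 _ sw W(2)]) auto
      \<comment> \<open>The growth estimate, run from each tag to the right end, trades the value at
        the tag for the value at \<open>b\<close> and an integral.\<close>
      also have "\<dots> \<le> (\<Sum>i<n. ?w i * (?q b - (1 / h) * integral {\<xi> i..b} ?D))"
      proof (intro sum_mono mult_left_mono)
        fix i assume "i \<in> {..<n}"
        then have i: "i < n" by simp
        have sub: "{\<xi> i..b} \<subseteq> {a..b}" using \<xi>[OF i] by auto
        have ab': "{a..b} \<in> sets lebesgue" by simp
        have "norm (\<phi> (\<xi> i)) powr p + (1 / h) * (integral {\<xi> i..b} ?q - integral {\<xi> i..b} (\<lambda>s. norm (?\<gamma> s) powr p)) \<le> ?q b"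
          using W1p_with_growth[OF W1 p h ab' _ sub] \<xi>[OF i] by simp
        moreover have "integral {\<xi> i..b} ?D = integral {\<xi> i..b} ?q - integral {\<xi> i..b} (\<lambda>s. norm (?\<gamma> s) powr p)"
          by (rule Henstock_Kurzweil_Integration.integral_diff)
            (rule memLp_Icc(3)[OF _ p ab' sub], use m m\<gamma> in auto)+
        ultimately show "norm (\<phi> (\<xi> i)) powr p \<le> ?q b - (1 / h) * integral {\<xi> i..b} ?D" by simp
        show "0 \<le> ?w i" by (rule w0[OF i])
      qed
      also have "\<dots> = V b * ?q b - (1 / h) * (\<Sum>i<n. ?w i * integral {\<xi> i..b} ?D)"
      proof -
        have "(\<Sum>i<n. ?w i) = V b" using sum_lessThan_telescope[of "\<lambda>i. V (t i)" n] P
          by (simp add: is_partition_def V_def)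
        moreover have "(\<Sum>i<n. w i * (q - c * J i)) = (\<Sum>i<n. w i) * q - c * (\<Sum>i<n. w i * J i)"
          for w J :: "nat \<Rightarrow> real" and q c
          by (simp add: right_diff_distrib sum_subtractf sum_distrib_left sum_distrib_right mult.left_commute)
        ultimately show ?thesis by (simp only:)
      qed
      also have "\<dots> \<le> V b * ?q b - (1 / h) * ((\<integral>s. V s * ?D s \<partial>?M) - \<epsilon>)"
      proof -
        \<comment> \<open>The exchange of integrations in discrete form: weighting the integrals
          over \<open>{\<xi> i..b}\<close> by \<open>?w i\<close> is integration against the step
          function \<open>?k\<close>. Since \<open>V a = 0\<close>, this step function follows
          \<open>V\<close> itself up to \<open>osc\<close>.\<close>
        let ?k = "\<lambda>s. \<Sum>i<n. if \<xi> i \<le> s then ?w i else 0"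
        have 1: "((\<lambda>s. ?w i * (if s \<in> {\<xi> i..b} then ?D s else 0)) has_integral ?w i * integral {\<xi> i..b} ?D) {a..b}" if "i < n" for i
        proof (rule has_integral_mult_right)
          have sub: "{\<xi> i..b} \<subseteq> {a..b}" using \<xi>[OF that] by auto
          have "(?D has_integral integral {\<xi> i..b} ?D) {\<xi> i..b}"
            by (rule integrable_integral[OF integrable_subinterval_real[OF hD sub]])
          then show "((\<lambda>s. if s \<in> {\<xi> i..b} then ?D s else 0) has_integral integral {\<xi> i..b} ?D) {a..b}"
            using sub by (subst has_integral_restrict) auto
        qed
        have "((\<lambda>s. \<Sum>i<n. ?w i * (if s \<in> {\<xi> i..b} then ?D s else 0)) has_integral (\<Sum>i<n. ?w i * integral {\<xi> i..b} ?D)) {a..b}"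
          by (intro has_integral_sum 1) auto
        then have hk: "((\<lambda>s. ?k s * ?D s) has_integral (\<Sum>i<n. ?w i * integral {\<xi> i..b} ?D)) {a..b}"
        proof (rule has_integral_eq[rotated])
          fix s assume "s \<in> {a..b}"
          then show "(\<Sum>i<n. ?w i * (if s \<in> {\<xi> i..b} then ?D s else 0)) = ?k s * ?D s"
            unfolding sum_distrib_right by (intro sum.cong) auto
        qed
        have "norm (integral {a..b} (\<lambda>s. V s * ?D s - ?k s * ?D s)) \<le> integral {a..b} (\<lambda>s. osc \<mu> a b \<delta> s * \<bar>?D s\<bar>)"
        proof (rule integral_norm_bound_integral)
          fix s assume s: "s \<in> {a..b}"
          obtain k where k: "k \<le> n" "\<bar>t k - s\<bar> \<le> \<delta>"
            and sum: "?k s = V (t k) - V a"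
            by (rule tagged_partition_step[where \<nu> = V, OF P tags s \<delta>(1)])
          have "\<bar>V s - ?k s\<bar> \<le> osc \<mu> a b \<delta> s"
            using osc_variation[OF ab bv k(2)] unfolding sum by (simp add: V_def abs_minus_commute)
          then show "norm (V s * ?D s - ?k s * ?D s) \<le> osc \<mu> a b \<delta> s * \<bar>?D s\<bar>"
            unfolding left_diff_distrib[symmetric] real_norm_def abs_mult by (intro mult_right_mono) auto
        qed (use has_integral_diff[OF hiVD hk] hio in \<open>blast+\<close>)
        then have "\<bar>(\<integral>s. V s * ?D s \<partial>?M) - (\<Sum>i<n. ?w i * integral {\<xi> i..b} ?D)\<bar> \<le> \<epsilon>"
          using \<delta>(2) integral_unique[OF has_integral_diff[OF hiVD hk]] integral_unique[OF hio] by simp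
        then have "(\<integral>s. V s * ?D s \<partial>?M) - \<epsilon> \<le> (\<Sum>i<n. ?w i * integral {\<xi> i..b} ?D)" by linarith
        then show ?thesis using h by (simp add: divide_right_mono)
      qed
      also have "\<dots> = V b * ?q b - (1 / h) * (\<integral>s. V s * ?D s \<partial>?M) + \<epsilon> / h"
        by (simp add: diff_divide_distrib)
      finally show ?thesis .
    qed
    have lim: "(\<lambda>j. W powr (1 - p) * norm (RS_sum \<mu> \<phi> (Suc j) (uniform_point a b j) (uniform_point a b j)) powr p)
        \<longlonglongrightarrow> W powr (1 - p) * norm L powr p"
      using tendsto_powr2[OF tendsto_norm[OF has_RS_integral_uniform[OF L ab]] tendsto_const[of p]] p
      by (intro tendsto_mult tendsto_const) auto
    show ?thesis
    proof (rule tendsto_upperbound[OF lim])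
      show "\<forall>\<^sub>F j in sequentially. W powr (1 - p) * norm (RS_sum \<mu> \<phi> (Suc j) (uniform_point a b j) (uniform_point a b j)) powr p
          \<le> V b * ?q b - (1 / h) * (\<integral>s. V s * ?D s \<partial>?M) + \<epsilon> / h"
        using eventually_uniform_fine_tagged[OF ab \<delta>(1)] by eventually_elim (rule bound)
    qed simp
  qed
  have "W powr (1 - p) * norm L powr p \<le> V b * ?q b - (1 / h) * (\<integral>s. V s * ?D s \<partial>?M)"
  proof (rule field_le_epsilon)
    fix e :: real assume "e > 0"
    then show "W powr (1 - p) * norm L powr p \<le> V b * ?q b - (1 / h) * (\<integral>s. V s * ?D s \<partial>?M) + e"
      using main[of "e * h"] h by simp
  qed
  then have "h * (W powr (1 - p) * norm L powr p) \<le> h * (V b * ?q b - (1 / h) * (\<integral>s. V s * ?D s \<partial>?M))"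
    using h by (intro mult_left_mono) auto
  also have "\<dots> = h * (V b * ?q b) - (\<integral>s. V s * ?D s \<partial>?M)" using h by (simp add: right_diff_distrib)
  also have "(\<integral>s. V s * ?D s \<partial>?M) = (\<integral>s. V s * ?q s \<partial>?M) - (\<integral>s. V s * norm (?\<gamma> s) powr p \<partial>?M)"
    using mult_int[OF Vm Vabs i(1)] mult_int[OF Vm Vabs i(2)] by (simp add: right_diff_distrib)
  finally show ?thesis by simp
qed

section \<open>Quasi-contractive renorming of a strongly continuous semigroup\<close>

text \<open>Baire category gives one set \<open>C n\<close> with an interior ball. A small multiple
  of any \<open>y\<close> is a difference of two points of that ball, at which every operator is
  bounded by \<open>n\<close>.\<close>

lemma uniform_boundedness:
  fixes F :: "('a::banach \<Rightarrow>\<^sub>L 'b::real_normed_vector) set"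
  assumes bdd: "\<And>x. \<exists>B. \<forall>T\<in>F. norm (blinfun_apply T x) \<le> B"
  shows "\<exists>M. \<forall>T\<in>F. norm T \<le> M"
proof -
  define C where "C n = {x. \<forall>T\<in>F. norm (blinfun_apply T x) \<le> real n}" for n :: nat
  have closed: "closed (C n)" for n
  proof -
    have "C n = (\<Inter>T\<in>F. {x. norm (blinfun_apply T x) \<le> real n})" by (auto simp: C_def)
    moreover have "closed {x. norm (blinfun_apply T x) \<le> real n}" for T :: "'a \<Rightarrow>\<^sub>L 'b"
      by (intro closed_Collect_le continuous_intros)
    ultimately show ?thesis by auto
  qed
  have cover: "(\<Union>n. C n) = UNIV"
  proof -
    have "\<exists>n. x \<in> C n" for x
    proof -
      obtain B where B: "\<forall>T\<in>F. norm (blinfun_apply T x) \<le> B" using bdd by blast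
      then have "x \<in> C (nat \<lceil>B\<rceil>)" unfolding C_def by (force intro: order_trans of_nat_ceiling)
      then show ?thesis ..
    qed
    then show ?thesis by auto
  qed
  have "\<exists>n. interior (C n) \<noteq> {}"
  proof (rule ccontr)
    assume "\<not> (\<exists>n. interior (C n) \<noteq> {})"
    then have "Met_TC.mtopology interior_of \<Union>(range C) = {}"
      using closed
      by (intro Met_TC.metric_Baire_category_alt) (auto simp: complete_UNIV)
    then show False using cover by simp
  qed
  then obtain n x where "x \<in> interior (C n)" by blast
  then obtain r where r: "r > 0" "ball x r \<subseteq> C n" unfolding mem_interior by blast
  have "norm T \<le> 4 * real n / r" if T: "T \<in> F" for T
  proof (rule norm_blinfun_bound)
    show "0 \<le> 4 * real n / r" using r by simp
    fix y
    show "norm (blinfun_apply T y) \<le> 4 * real n / r * norm y"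
    proof (cases "y = 0")
      case False
      define c where "c = r / (2 * norm y)"
      have c: "c > 0" using r False by (simp add: c_def)
      have "x + c *\<^sub>R y \<in> ball x r" using r False by (simp add: dist_norm c_def)
      then have 1: "norm (blinfun_apply T (x + c *\<^sub>R y)) \<le> real n" using r(2) T by (auto simp: C_def)
      have "x \<in> C n" using r by (meson centre_in_ball subsetD)
      then have 2: "norm (blinfun_apply T x) \<le> real n" using T by (auto simp: C_def)
      have "c * norm (blinfun_apply T y) = norm (blinfun_apply T (x + c *\<^sub>R y) - blinfun_apply T x)"
        using c by (simp add: blinfun.add_right blinfun.scaleR_right)
      also have "\<dots> \<le> 2 * real n" using 1 2 norm_triangle_ineq4[of "blinfun_apply T (x + c *\<^sub>R y)" "blinfun_apply T x"] by simp
      finally have "norm (blinfun_apply T y) \<le> 2 * real n / c" using c by (simp add: field_simps)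
      also have "\<dots> = 4 * real n / r * norm y" by (simp add: c_def)
      finally show ?thesis .
    qed simp
  qed
  then show ?thesis by blast
qed

section \<open>Complex scalar multiplication\<close>

lemma scaleC_minus_one: "scaleC (-1) (x :: 'a::complex_banach) = - x"
  using scaleR_scaleC[of "-1" x] by simp

lemma scaleC_zero_left [simp]: "scaleC 0 (x :: 'a::complex_banach) = 0"
  using scaleR_scaleC[of 0 x] by simp

lemma scaleC_zero_right [simp]: "scaleC c (0 :: 'a::complex_banach) = 0"
  using norm_scaleC[of c "0 :: 'a"] by simp

lemma scaleC_diff_right: "scaleC c (x - y :: 'a::complex_banach) = scaleC c x - scaleC c y"
  by (metis add_diff_cancel_right' diff_add_cancel scaleC_add_right)

lemma scaleC_scaleR_commute: "scaleC c (s *\<^sub>R x :: 'a::complex_banach) = s *\<^sub>R scaleC c x"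
  by (simp add: scaleR_scaleC scaleC_scaleC mult.commute)

lemma bounded_linear_scaleC: "bounded_linear (scaleC c :: 'a::complex_banach \<Rightarrow> 'a)"
  by (rule bounded_linear_intro[of _ "cmod c"])
    (simp_all add: scaleC_add_right norm_scaleC scaleC_scaleR_commute mult.commute)

lemma vsub_UNIV: "vsub (+) scaleC x (y :: 'a::complex_banach) = x - y"
  by (simp add: vsub_def scaleC_minus_one)

section \<open>Growth, generator and resolvent of the given semigroup\<close>

locale generated_semigroup =
  fixes DA :: "'a::complex_banach set" and A :: "'a \<Rightarrow> 'a" and T :: "real \<Rightarrow> 'a \<Rightarrow> 'a"
  assumes C0: "C0_semigroup UNIV norm (+) scaleC T"
    and gen: "generator_of UNIV norm (+) scaleC T DA A"
begin

lemma T_lin: "0 \<le> t \<Longrightarrow> T t (scaleC c x + scaleC d y) = scaleC c (T t x) + scaleC d (T t y)"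
  and T_bounded: "0 \<le> t \<Longrightarrow> \<exists>M. \<forall>x. norm (T t x) \<le> M * norm x"
  and T_zero: "T 0 x = x"
  and T_plus: "0 \<le> s \<Longrightarrow> 0 \<le> t \<Longrightarrow> T (s + t) x = T s (T t x)"
  and T_cont': "0 \<le> t0 \<Longrightarrow> ((\<lambda>t. norm (T t x - T t0 x)) \<longlongrightarrow> 0) (at t0 within {0..})"
  using C0 unfolding C0_semigroup_def vsub_UNIV by auto

lemma T_add: "0 \<le> t \<Longrightarrow> T t (x + y) = T t x + T t y"
  using T_lin[of t 1 x 1 y] by (simp add: scaleC_one)

lemma T_scaleR: "0 \<le> t \<Longrightarrow> T t (c *\<^sub>R x) = c *\<^sub>R T t x"
  using T_lin[of t "complex_of_real c" x 0 0] by (simp add: scaleR_scaleC)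

lemma T_bounded_linear: "0 \<le> t \<Longrightarrow> bounded_linear (T t)"
proof -
  assume t: "0 \<le> t"
  obtain M where "\<forall>x. norm (T t x) \<le> M * norm x" using T_bounded[OF t] by blast
  then show ?thesis
    by (intro bounded_linear_intro[of _ M]) (auto simp: T_add[OF t] T_scaleR[OF t] mult.commute)
qed

lemma T_continuous: "continuous_on {0..} (\<lambda>t. T t x)"
  unfolding continuous_on_def
proof
  fix t0 :: real assume "t0 \<in> {0..}"
  then show "((\<lambda>t. T t x) \<longlongrightarrow> T t0 x) (at t0 within {0..})"
    using T_cont'[of t0 x] by (simp only: tendsto_norm_zero_iff LIM_zero_iff atLeast_iff)
qed

text \<open>Strong continuity bounds every orbit on \<open>{0..1}\<close>, so the operators are
  uniformly bounded there by some \<open>M\<close>. Splitting \<open>t\<close> into integer and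
  fractional part iterates this bound, and \<open>\<omega> = ln M\<close>.\<close>

lemma growth: "\<exists>M \<omega>. 1 \<le> M \<and> 0 \<le> \<omega> \<and> (\<forall>t\<ge>0. \<forall>x. norm (T t x) \<le> M * exp (\<omega> * t) * norm x)"
proof -
  let ?F = "(\<lambda>t. Blinfun (T t)) ` {0..1}"
  have "\<exists>B. \<forall>S\<in>?F. norm (blinfun_apply S x) \<le> B" for x
  proof -
    have "continuous_on {0..1} (\<lambda>t. T t x)" by (rule continuous_on_subset[OF T_continuous]) auto
    then have "bounded ((\<lambda>t. T t x) ` {0..1})" by (intro compact_imp_bounded compact_continuous_image) auto
    then obtain B where "\<forall>t\<in>{0..1}. norm (T t x) \<le> B" unfolding bounded_iff by auto
    then show ?thesis by (intro exI[of _ B]) (auto simp: bounded_linear_Blinfun_apply T_bounded_linear)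
  qed
  from uniform_boundedness[OF this] obtain M0 where M0: "\<And>t. t \<in> {0..1} \<Longrightarrow> norm (Blinfun (T t)) \<le> M0" by blast
  define M where "M = max M0 1"
  have M: "1 \<le> M" by (simp add: M_def)
  have T1: "norm (T t x) \<le> M * norm x" if "0 \<le> t" "t \<le> 1" for t x
  proof -
    have "norm (T t x) \<le> norm (Blinfun (T t)) * norm x"
      using norm_blinfun[of "Blinfun (T t)" x] that by (simp add: bounded_linear_Blinfun_apply T_bounded_linear)
    also have "\<dots> \<le> M * norm x" using M0[of t] that by (intro mult_right_mono) (auto simp: M_def)
    finally show ?thesis .
  qed
  have Tn: "norm (T (real n) x) \<le> M ^ n * norm x" for n x
  proof (induction n arbitrary: x)
    case 0
    then show ?case by (simp add: T_zero)
  next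
    case (Suc n)
    have "T (real (Suc n)) x = T (real n) (T 1 x)" using T_plus[of "real n" 1 x] by (simp add: add.commute)
    then have "norm (T (real (Suc n)) x) \<le> M ^ n * norm (T 1 x)" using Suc.IH[of "T 1 x"] by simp
    also have "\<dots> \<le> M ^ n * (M * norm x)" using T1[of 1 x] M by (intro mult_left_mono) auto
    finally show ?case by (simp add: mult.assoc mult.left_commute)
  qed
  define \<omega> where "\<omega> = ln M"
  have \<omega>: "0 \<le> \<omega>" using M by (simp add: \<omega>_def)
  have "norm (T t x) \<le> M * exp (\<omega> * t) * norm x" if t: "0 \<le> t" for t x
  proof -
    define n where "n = nat \<lfloor>t\<rfloor>"
    define s where "s = t - real n"
    have s: "0 \<le> s" "s \<le> 1" and n: "real n \<le> t" using t unfolding s_def n_def by linarith+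
    have "M ^ n = exp (\<omega> * real n)" using M by (simp add: \<omega>_def exp_of_nat2_mult)
    also have "\<dots> \<le> exp (\<omega> * t)" using n \<omega> by (simp add: mult_left_mono)
    finally have Mn: "M ^ n \<le> exp (\<omega> * t)" .
    have "T t x = T s (T (real n) x)" using T_plus[of s "real n" x] s by (simp add: s_def)
    then have "norm (T t x) \<le> M * norm (T (real n) x)" using T1[OF s] by simp
    also have "\<dots> \<le> M * (M ^ n * norm x)" using Tn M by (intro mult_left_mono) auto
    also have "\<dots> \<le> M * (exp (\<omega> * t) * norm x)" using Mn M by (intro mult_left_mono mult_right_mono) auto
    finally show ?thesis by (simp add: mult.assoc)
  qed
  then show ?thesis using M \<omega> by blast
qed

lemma A_limit: "x \<in> DA \<Longrightarrow> ((\<lambda>h. (1 / h) *\<^sub>R (T h x - x)) \<longlongrightarrow> A x) (at_right 0)"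
  using gen unfolding generator_of_def vsub_UNIV
  by (simp only: scaleR_scaleC tendsto_norm_zero_iff LIM_zero_iff)

text \<open>On this space the seminorm is a norm, so the clause of \<open>generator_of\<close> up to
  null elements means genuine membership, and limits determine \<open>A\<close> uniquely.\<close>

lemma DA_I:
  assumes "((\<lambda>h. (1 / h) *\<^sub>R (T h x - x)) \<longlongrightarrow> y) (at_right 0)"
  shows "x \<in> DA" "A x = y"
proof -
  have "((\<lambda>h. norm (scaleC (complex_of_real (1 / h)) (T h x - x) - y)) \<longlongrightarrow> 0) (at_right 0)"
    using assms by (simp only: scaleR_scaleC[symmetric] tendsto_norm_zero_iff LIM_zero_iff)
  then show x: "x \<in> DA" using gen unfolding generator_of_def vsub_UNIV by auto
  show "A x = y" using tendsto_unique[OF _ A_limit[OF x] assms] by simp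
qed

lemma A_scaleC_add:
  assumes x: "x \<in> DA" and y: "y \<in> DA"
  shows "x + y \<in> DA" "A (x + y) = A x + A y"
proof -
  have "((\<lambda>h. (1 / h) *\<^sub>R (T h x - x) + (1 / h) *\<^sub>R (T h y - y)) \<longlongrightarrow> A x + A y) (at_right 0)"
    by (intro tendsto_intros A_limit x y)
  moreover have "\<forall>\<^sub>F h in at_right 0. (1 / h) *\<^sub>R (T h x - x) + (1 / h) *\<^sub>R (T h y - y) = (1 / h) *\<^sub>R (T h (x + y) - (x + y))"
    using eventually_at_right_less[of 0] by eventually_elim (simp add: T_add algebra_simps)
  ultimately have "((\<lambda>h. (1 / h) *\<^sub>R (T h (x + y) - (x + y))) \<longlongrightarrow> A x + A y) (at_right 0)"
    by (rule Lim_transform_eventually)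
  from DA_I[OF this] show "x + y \<in> DA" "A (x + y) = A x + A y" .
qed

lemma A_scaleC:
  assumes x: "x \<in> DA"
  shows "scaleC c x \<in> DA" "A (scaleC c x) = scaleC c (A x)"
proof -
  have "((\<lambda>h. scaleC c ((1 / h) *\<^sub>R (T h x - x))) \<longlongrightarrow> scaleC c (A x)) (at_right 0)"
    by (intro bounded_linear.tendsto[OF bounded_linear_scaleC] A_limit x)
  moreover have "\<forall>\<^sub>F h in at_right 0. scaleC c ((1 / h) *\<^sub>R (T h x - x)) = (1 / h) *\<^sub>R (T h (scaleC c x) - scaleC c x)"
    using eventually_at_right_less[of 0]
  proof eventually_elim
    case (elim h)
    have "T h (scaleC c x) = scaleC c (T h x)" using T_lin[of h c x 0 0] elim by simp
    then show ?case by (simp only: scaleC_scaleR_commute scaleC_diff_right)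
  qed
  ultimately have "((\<lambda>h. (1 / h) *\<^sub>R (T h (scaleC c x) - scaleC c x)) \<longlongrightarrow> scaleC c (A x)) (at_right 0)"
    by (rule Lim_transform_eventually)
  from DA_I[OF this] show "scaleC c x \<in> DA" "A (scaleC c x) = scaleC c (A x)" .
qed

text \<open>A truncated Laplace transform of the orbit. With \<open>t\<close> finite the integral
  stays proper; for large \<open>t\<close> and \<open>l\<close> it approximates the resolvent at
  \<open>l\<close>, see \<open>resolvent_surj\<close>.\<close>

definition P :: "real \<Rightarrow> 'a \<Rightarrow> real \<Rightarrow> 'a" where
  "P l y t = integral {0..t} (\<lambda>s. exp (- l * s) *\<^sub>R T s y)"

lemma P_integrable: "0 \<le> a \<Longrightarrow> (\<lambda>s. exp (- l * s) *\<^sub>R T s y) integrable_on {a..b}"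
  by (intro integrable_continuous_interval continuous_intros continuous_on_subset[OF T_continuous]) auto

lemma P_shift:
  assumes s: "0 \<le> s" and t: "0 \<le> t"
  shows "T s (P l y t) = exp (l * s) *\<^sub>R (P l y (t + s) - P l y s)"
proof -
  have "T s (P l y t) = integral {0..t} (\<lambda>r. T s (exp (- l * r) *\<^sub>R T r y))"
    unfolding P_def using integral_linear[OF P_integrable[of 0 l y t] T_bounded_linear[OF s]]
    by (simp add: comp_def)
  also have "\<dots> = integral {0..t} (\<lambda>r. exp (l * s) *\<^sub>R (exp (- l * (r + s)) *\<^sub>R T (r + s) y))"
  proof (rule Henstock_Kurzweil_Integration.integral_cong)
    fix r assume r: "r \<in> {0..t}"
    have "T (r + s) y = T s (T r y)" using T_plus[of s r y] s r by (simp add: add.commute)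
    moreover have "exp (l * s) * exp (- l * (r + s)) = exp (- l * r)"
      by (simp add: exp_add[symmetric] algebra_simps)
    ultimately show "T s (exp (- l * r) *\<^sub>R T r y) = exp (l * s) *\<^sub>R (exp (- l * (r + s)) *\<^sub>R T (r + s) y)"
      using s by (simp add: T_scaleR)
  qed
  also have "\<dots> = exp (l * s) *\<^sub>R integral {0..t} (\<lambda>r. exp (- l * (r + s)) *\<^sub>R T (r + s) y)"
    by (rule Henstock_Kurzweil_Integration.integral_cmul)
  also have "integral {0..t} (\<lambda>r. exp (- l * (r + s)) *\<^sub>R T (r + s) y) = integral {s..t + s} (\<lambda>r. exp (- l * r) *\<^sub>R T r y)"
    using integral_shift_Icc_real[of 0 t "\<lambda>r. exp (- l * r) *\<^sub>R T r y" s] by (simp add: comp_def add.commute)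
  also have "\<dots> = P l y (t + s) - P l y s"
    using Henstock_Kurzweil_Integration.integral_combine[of 0 s "t + s" "\<lambda>r. exp (- l * r) *\<^sub>R T r y"] P_integrable[of 0 l y "t + s"] s t
    unfolding P_def by (simp add: algebra_simps)
  finally show ?thesis .
qed

lemma P_deriv:
  assumes t: "0 \<le> t"
  shows "((\<lambda>h. (1 / h) *\<^sub>R (P l y (t + h) - P l y t)) \<longlongrightarrow> exp (- l * t) *\<^sub>R T t y) (at_right 0)"
proof (rule tendstoI)
  let ?g = "\<lambda>s. exp (- l * s) *\<^sub>R T s y"
  fix \<epsilon> :: real assume "\<epsilon> > 0"
  have "continuous_on {0..} ?g" by (intro continuous_intros T_continuous)
  then have "(?g \<longlongrightarrow> ?g t) (at t within {0..})" using t unfolding continuous_on_def by blast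
  from tendstoD[OF this, of "\<epsilon> / 2"] \<open>\<epsilon> > 0\<close>
  obtain d where d: "d > 0" "\<And>s. s \<in> {0..} \<Longrightarrow> s \<noteq> t \<Longrightarrow> dist s t < d \<Longrightarrow> dist (?g s) (?g t) < \<epsilon> / 2"
    unfolding eventually_at by auto
  have d': "norm (?g s - ?g t) \<le> \<epsilon> / 2" if "t \<le> s" "s < t + d" for s
    using d(2)[of s] that t \<open>\<epsilon> > 0\<close> by (cases "s = t") (auto simp: dist_norm)
  have "\<forall>\<^sub>F h in at_right 0. h \<in> {0<..<d}" using eventually_at_right_real[OF d(1)] .
  then show "\<forall>\<^sub>F h in at_right 0. dist ((1 / h) *\<^sub>R (P l y (t + h) - P l y t)) (?g t) < \<epsilon>"
  proof eventually_elim
    case (elim h)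
    then have h: "0 < h" "h < d" by auto
    have "integral {0..t} ?g + integral {t..t + h} ?g = integral {0..t + h} ?g"
      by (rule Henstock_Kurzweil_Integration.integral_combine) (use t h P_integrable in auto)
    then have P: "P l y (t + h) - P l y t = integral {t..t + h} ?g" by (simp add: P_def algebra_simps)
    have "integral {t..t + h} (\<lambda>s. ?g s - ?g t) = integral {t..t + h} ?g - h *\<^sub>R ?g t"
      using Henstock_Kurzweil_Integration.integral_diff[OF P_integrable[OF t, of l y "t + h"] integrable_const_ivl] h by simp
    moreover have "norm (integral {t..t + h} (\<lambda>s. ?g s - ?g t)) \<le> integral {t..t + h} (\<lambda>s. \<epsilon> / 2)"
      using t h d' by (intro integral_norm_bound_integral integrable_diff P_integrable integrable_const_ivl) auto
    ultimately have 1: "norm (P l y (t + h) - P l y t - h *\<^sub>R ?g t) \<le> h * (\<epsilon> / 2)" using h P by simp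
    have "(1 / h) *\<^sub>R (P l y (t + h) - P l y t) - ?g t = (1 / h) *\<^sub>R (P l y (t + h) - P l y t - h *\<^sub>R ?g t)"
      using h by (simp add: scaleR_diff_right)
    then have "dist ((1 / h) *\<^sub>R (P l y (t + h) - P l y t)) (?g t) = (1 / h) * norm (P l y (t + h) - P l y t - h *\<^sub>R ?g t)"
      using h by (simp add: dist_norm)
    also have "\<dots> \<le> (1 / h) * (h * (\<epsilon> / 2))" using h 1 by (intro mult_left_mono) auto
    also have "\<dots> < \<epsilon>" using h \<open>\<epsilon> > 0\<close> by simp
    finally show ?case .
  qed
qed

lemma exp_quotient_limits:
  "((\<lambda>h. exp (l * h)) \<longlongrightarrow> 1) (at_right (0::real))"
  "((\<lambda>h. (exp (l * h) - 1) / h) \<longlongrightarrow> l) (at_right (0::real))"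
proof -
  have "((\<lambda>h. exp (l * h)) \<longlongrightarrow> exp (l * 0)) (at_right (0::real))" by (intro tendsto_intros)
  then show "((\<lambda>h. exp (l * h)) \<longlongrightarrow> 1) (at_right (0::real))" by simp
  have "((\<lambda>t. exp (l * t)) has_real_derivative l) (at 0)" by (auto intro!: derivative_eq_intros)
  then show "((\<lambda>h. (exp (l * h) - 1) / h) \<longlongrightarrow> l) (at_right 0)"
    unfolding has_field_derivative_iff by (simp add: filterlim_at_split)
qed

lemma P_0: "P l y 0 = 0" by (simp add: P_def)

lemma P_quotient: "((\<lambda>h. (1 / h) *\<^sub>R P l y h) \<longlongrightarrow> y) (at_right 0)"
  using P_deriv[of 0 l y] by (simp add: P_0 T_zero)

text \<open>\<open>P_shift\<close> splits the difference quotient of \<open>P l y t\<close> into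
  three terms whose limits at zero are known.\<close>

lemma P_DA:
  assumes t: "0 \<le> t"
  shows "P l y t \<in> DA" "A (P l y t) = l *\<^sub>R P l y t + exp (- l * t) *\<^sub>R T t y - y"
proof -
  have "((\<lambda>s. exp (l * s) *\<^sub>R ((1 / s) *\<^sub>R (P l y (t + s) - P l y t)) + ((exp (l * s) - 1) / s) *\<^sub>R P l y t
      - exp (l * s) *\<^sub>R ((1 / s) *\<^sub>R P l y s))
      \<longlongrightarrow> 1 *\<^sub>R (exp (- l * t) *\<^sub>R T t y) + l *\<^sub>R P l y t - 1 *\<^sub>R y) (at_right 0)"
    by (intro tendsto_intros exp_quotient_limits P_deriv P_quotient t)
  moreover have "\<forall>\<^sub>F s in at_right 0. exp (l * s) *\<^sub>R ((1 / s) *\<^sub>R (P l y (t + s) - P l y t)) + ((exp (l * s) - 1) / s) *\<^sub>R P l y t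
      - exp (l * s) *\<^sub>R ((1 / s) *\<^sub>R P l y s) = (1 / s) *\<^sub>R (T s (P l y t) - P l y t)"
    using eventually_at_right_less[of 0]
  proof eventually_elim
    case (elim s)
    then show ?case using P_shift[of s t l y] t
      by (simp add: scaleR_diff_right scaleR_diff_left diff_divide_distrib)
  qed
  ultimately have "((\<lambda>s. (1 / s) *\<^sub>R (T s (P l y t) - P l y t))
      \<longlongrightarrow> 1 *\<^sub>R (exp (- l * t) *\<^sub>R T t y) + l *\<^sub>R P l y t - 1 *\<^sub>R y) (at_right 0)"
    by (rule Lim_transform_eventually)
  from DA_I[OF this] show "P l y t \<in> DA" "A (P l y t) = l *\<^sub>R P l y t + exp (- l * t) *\<^sub>R T t y - y"
    by simp_all
qed

lemma A_scaleR:
  assumes "x \<in> DA"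
  shows "c *\<^sub>R x \<in> DA" "A (c *\<^sub>R x) = c *\<^sub>R A x"
  using A_scaleC[OF assms, of "complex_of_real c"] by (simp_all add: scaleR_scaleC)

lemma A_diff:
  assumes x: "x \<in> DA" and y: "y \<in> DA"
  shows "x - y \<in> DA" "A (x - y) = A x - A y"
  using A_scaleC_add[OF x A_scaleR(1)[OF y, of "-1"]] A_scaleR[OF y, of "-1"] by simp_all

text \<open>Means of the orbit over short intervals lie in the domain and tend to
  \<open>y\<close>.\<close>

lemma DA_dense: "\<epsilon> > 0 \<Longrightarrow> \<exists>x\<in>DA. norm (y - x) < \<epsilon>"
proof -
  assume "\<epsilon> > 0"
  from tendstoD[OF P_quotient[of 0 y] this]
  have "\<forall>\<^sub>F h in at_right 0. dist ((1 / h) *\<^sub>R P 0 y h) y < \<epsilon> \<and> 0 < h"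
    using eventually_at_right_less[of 0] by eventually_elim simp
  then obtain h where h: "dist ((1 / h) *\<^sub>R P 0 y h) y < \<epsilon>" "0 < h"
    using eventually_happens'[of "at_right (0::real)"] by auto
  have "(1 / h) *\<^sub>R P 0 y h \<in> DA" using h by (intro A_scaleR P_DA) simp
  then show ?thesis using h(1) by (intro bexI[of _ "(1 / h) *\<^sub>R P 0 y h"]) (auto simp: dist_norm norm_minus_commute)
qed

text \<open>An equivalent norm for which the semigroup satisfies the growth bound with constant one
  in place of \<open>M\<close>, see \<open>renorm_T\<close>. Only a constant one makes a one-step
  resolvent bound stable under iteration.\<close>

definition renorm :: "real \<Rightarrow> 'a \<Rightarrow> real" where
  "renorm \<omega> x = (SUP t\<in>{0..}. exp (- \<omega> * t) * norm (T t x))"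

context
  fixes M \<omega> :: real
  assumes M: "1 \<le> M" and \<omega>: "0 \<le> \<omega>"
    and bound: "\<And>t x. 0 \<le> t \<Longrightarrow> norm (T t x) \<le> M * exp (\<omega> * t) * norm x"
begin

lemma renorm_term: "0 \<le> t \<Longrightarrow> exp (- \<omega> * t) * norm (T t x) \<le> M * norm x"
proof -
  assume "0 \<le> t"
  then have "exp (- \<omega> * t) * norm (T t x) \<le> exp (- \<omega> * t) * (M * exp (\<omega> * t) * norm x)"
    by (intro mult_left_mono bound) auto
  also have "\<dots> = (exp (- \<omega> * t) * exp (\<omega> * t)) * (M * norm x)" by simp
  also have "exp (- \<omega> * t) * exp (\<omega> * t) = 1" by (simp add: exp_add[symmetric])
  finally show ?thesis by simp
qed

lemma renorm_upper: "0 \<le> t \<Longrightarrow> exp (- \<omega> * t) * norm (T t x) \<le> renorm \<omega> x"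
  unfolding renorm_def by (intro cSUP_upper bdd_aboveI2[where M = "M * norm x"] renorm_term) auto

lemma renorm_least: "(\<And>t. 0 \<le> t \<Longrightarrow> exp (- \<omega> * t) * norm (T t x) \<le> C) \<Longrightarrow> renorm \<omega> x \<le> C"
  unfolding renorm_def by (intro cSUP_least) auto

lemma norm_le_renorm: "norm x \<le> renorm \<omega> x"
  using renorm_upper[of 0 x] by (simp add: T_zero)

lemma renorm_le_norm: "renorm \<omega> x \<le> M * norm x"
  by (intro renorm_least renorm_term)

lemma renorm_triangle: "renorm \<omega> (x + y) \<le> renorm \<omega> x + renorm \<omega> y"
proof (rule renorm_least)
  fix t :: real assume t: "0 \<le> t"
  have "exp (- \<omega> * t) * norm (T t (x + y)) \<le> exp (- \<omega> * t) * (norm (T t x) + norm (T t y))"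
    using t by (intro mult_left_mono) (auto simp: T_add norm_triangle_ineq)
  also have "\<dots> \<le> renorm \<omega> x + renorm \<omega> y"
    using renorm_upper[OF t, of x] renorm_upper[OF t, of y] by (simp add: distrib_left)
  finally show "exp (- \<omega> * t) * norm (T t (x + y)) \<le> renorm \<omega> x + renorm \<omega> y" .
qed

lemma T_scaleC: "0 \<le> t \<Longrightarrow> T t (scaleC c x) = scaleC c (T t x)"
  using T_lin[of t c x 0 0] by simp

lemma renorm_scaleC: "renorm \<omega> (scaleC c x) = cmod c * renorm \<omega> x"
proof (cases "c = 0")
  case True
  then show ?thesis using norm_le_renorm[of 0] renorm_le_norm[of 0] by simp
next
  case False
  have le: "renorm \<omega> (scaleC d z) \<le> cmod d * renorm \<omega> z" for d z
  proof (rule renorm_least)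
    fix t :: real assume t: "0 \<le> t"
    have "exp (- \<omega> * t) * norm (T t (scaleC d z)) = cmod d * (exp (- \<omega> * t) * norm (T t z))"
      using t by (simp add: T_scaleC norm_scaleC)
    also have "\<dots> \<le> cmod d * renorm \<omega> z" by (intro mult_left_mono renorm_upper t) simp
    finally show "exp (- \<omega> * t) * norm (T t (scaleC d z)) \<le> cmod d * renorm \<omega> z" .
  qed
  have "renorm \<omega> x \<le> cmod (1 / c) * renorm \<omega> (scaleC c x)"
    using le[of "1 / c" "scaleC c x"] False by (simp add: scaleC_scaleC scaleC_one)
  then have "cmod c * renorm \<omega> x \<le> renorm \<omega> (scaleC c x)"
    using False by (simp add: norm_divide field_simps)
  then show ?thesis using le[of c x] by linarith
qed

lemma renorm_scaleR: "renorm \<omega> (c *\<^sub>R x) = \<bar>c\<bar> * renorm \<omega> x"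
  by (simp add: scaleR_scaleC renorm_scaleC)

lemma renorm_T:
  assumes s: "0 \<le> s"
  shows "renorm \<omega> (T s x) \<le> exp (\<omega> * s) * renorm \<omega> x"
proof (rule renorm_least)
  fix t :: real assume t: "0 \<le> t"
  have "exp (- \<omega> * t) = exp (\<omega> * s) * exp (- \<omega> * (t + s))"
    by (simp add: exp_add[symmetric] algebra_simps)
  then have "exp (- \<omega> * t) * norm (T t (T s x)) = exp (\<omega> * s) * (exp (- \<omega> * (t + s)) * norm (T (t + s) x))"
    using T_plus[OF t s] by simp
  also have "\<dots> \<le> exp (\<omega> * s) * renorm \<omega> x" using s t by (intro mult_left_mono renorm_upper) auto
  finally show "exp (- \<omega> * t) * norm (T t (T s x)) \<le> exp (\<omega> * s) * renorm \<omega> x" .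
qed

text \<open>Replacing \<open>A x\<close> by a difference quotient writes
  \<open>(1 + h / s) *\<^sub>R x\<close> as a sum of \<open>x - h *\<^sub>R A x\<close>, a small
  remainder and a multiple of \<open>T s x\<close>. In norm the terms of order \<open>1 / s\<close>
  combine to \<open>(exp (\<omega> * s) - 1) / s\<close>, which tends to
  \<open>\<omega>\<close>.\<close>

lemma renorm_dissipative:
  assumes x: "x \<in> DA" and h: "0 < h"
  shows "(1 - h * \<omega>) * renorm \<omega> x \<le> renorm \<omega> (x - h *\<^sub>R A x)"
proof -
  let ?\<nu> = "renorm \<omega>"
  let ?z = "\<lambda>s. A x - (1 / s) *\<^sub>R (T s x - x)"
  have key: "\<forall>\<^sub>F s in at_right 0. (1 - h * ((exp (\<omega> * s) - 1) / s)) * ?\<nu> x \<le> ?\<nu> (x - h *\<^sub>R A x) + h * (M * norm (?z s))"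
    using eventually_at_right_less[of 0]
  proof eventually_elim
    case (elim s)
    have "(1 + h / s) *\<^sub>R x = (x - h *\<^sub>R A x) + h *\<^sub>R ?z s + (h / s) *\<^sub>R T s x"
      by (simp add: scaleR_add_left scaleR_diff_right)
    then have "?\<nu> ((1 + h / s) *\<^sub>R x) \<le> ?\<nu> (x - h *\<^sub>R A x) + ?\<nu> (h *\<^sub>R ?z s) + ?\<nu> ((h / s) *\<^sub>R T s x)"
      using renorm_triangle[of "(x - h *\<^sub>R A x) + h *\<^sub>R ?z s" "(h / s) *\<^sub>R T s x"]
        renorm_triangle[of "x - h *\<^sub>R A x" "h *\<^sub>R ?z s"] by simp
    moreover have "?\<nu> ((1 + h / s) *\<^sub>R x) = (1 + h / s) * ?\<nu> x" using h elim by (simp only: renorm_scaleR) (simp add: abs_of_pos add_pos_pos)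
    moreover have "?\<nu> (h *\<^sub>R ?z s) \<le> h * (M * norm (?z s))"
      using h renorm_le_norm[of "?z s"] by (simp only: renorm_scaleR) (simp add: mult_left_mono)
    moreover have "?\<nu> ((h / s) *\<^sub>R T s x) \<le> (h / s) * (exp (\<omega> * s) * ?\<nu> x)"
      using h elim renorm_T[of s x] by (simp only: renorm_scaleR abs_of_pos divide_pos_pos) (intro mult_left_mono, auto)
    moreover have "(1 - h * ((exp (\<omega> * s) - 1) / s)) * ?\<nu> x = (1 + h / s) * ?\<nu> x - (h / s) * (exp (\<omega> * s) * ?\<nu> x)"
      by (simp add: algebra_simps diff_divide_distrib)
    ultimately show ?case by linarith
  qed
  have 1: "((\<lambda>s. (1 - h * ((exp (\<omega> * s) - 1) / s)) * ?\<nu> x) \<longlongrightarrow> (1 - h * \<omega>) * ?\<nu> x) (at_right 0)"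
    by (intro tendsto_intros exp_quotient_limits)
  have 2: "((\<lambda>s. ?\<nu> (x - h *\<^sub>R A x) + h * (M * norm (?z s))) \<longlongrightarrow> ?\<nu> (x - h *\<^sub>R A x) + h * (M * norm (A x - A x))) (at_right 0)"
    by (intro tendsto_intros A_limit x)
  show ?thesis using tendsto_le[OF _ 2 1 key] by simp
qed

text \<open>With \<open>l = 1 / h\<close> the element \<open>P l y t\<close> solves the resolvent
  equation for \<open>h *\<^sub>R (y - exp (- l * t) *\<^sub>R T t y)\<close>, and the remainder
  decays because \<open>\<omega> < l\<close>. Dissipativity makes these elements Cauchy. The limit
  inherits a formula for its orbit from \<open>P_shift\<close>, which exhibits its derivative at
  zero; it solves the equation for \<open>h *\<^sub>R y\<close>, hence the final rescaling by
  \<open>l\<close>.\<close>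

lemma resolvent_surj:
  assumes h: "0 < h" "h * \<omega> < 1"
  shows "\<exists>x\<in>DA. x - h *\<^sub>R A x = y"
proof -
  define l where "l = 1 / h"
  have l: "0 < l" "\<omega> < l" "h * l = 1" using h by (auto simp: l_def field_simps)
  let ?P = "P l y"
  define d where "d t = M * exp ((\<omega> - l) * t) * norm y" for t
  define K where "K = h * M / (1 - h * \<omega>)"
  have K: "0 \<le> K" using h M by (simp add: K_def)
  let ?q = "\<lambda>t. exp (- l * t) *\<^sub>R T t y"
  have q: "norm (?q t) \<le> d t" if "0 \<le> t" for t
  proof -
    have "norm (?q t) \<le> exp (- l * t) * (M * exp (\<omega> * t) * norm y)"
      using bound[OF that] by (simp add: mult_left_mono)
    also have "\<dots> = d t" by (simp add: d_def exp_add[symmetric] algebra_simps)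
    finally show ?thesis .
  qed
  have close: "norm (?P a - ?P b) \<le> K * (d a + d b)" if "0 \<le> a" "0 \<le> b" for a b
  proof -
    note Pa = P_DA[OF that(1), of l y] and Pb = P_DA[OF that(2), of l y]
    have "(?P a - ?P b) - h *\<^sub>R A (?P a - ?P b) = - (h *\<^sub>R (?q a - ?q b))"
      using l by (simp add: A_diff(2)[OF Pa(1) Pb(1)] Pa(2) Pb(2) scaleR_diff_right scaleR_add_right)
    then have "(1 - h * \<omega>) * renorm \<omega> (?P a - ?P b) \<le> renorm \<omega> (- (h *\<^sub>R (?q a - ?q b)))"
      using renorm_dissipative[OF A_diff(1)[OF Pa(1) Pb(1)] h(1)] by simp
    also have "\<dots> \<le> M * norm (- (h *\<^sub>R (?q a - ?q b)))" by (rule renorm_le_norm)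
    also have "\<dots> \<le> M * (h * (d a + d b))"
      using M h q[OF that(1)] q[OF that(2)] norm_triangle_ineq4[of "?q a" "?q b"]
      by (simp only: norm_minus_cancel norm_scaleR) (intro mult_left_mono, auto)
    finally have "(1 - h * \<omega>) * norm (?P a - ?P b) \<le> M * (h * (d a + d b))"
      using norm_le_renorm[of "?P a - ?P b"] h by (smt (verit) mult_left_mono)
    then have "norm (?P a - ?P b) \<le> M * (h * (d a + d b)) / (1 - h * \<omega>)"
      using h by (simp add: pos_le_divide_eq mult.commute)
    then show ?thesis by (simp add: K_def mult.assoc mult.left_commute)
  qed
  have dmono: "d t \<le> d s" if "s \<le> t" for s t
    unfolding d_def using that l M by (intro mult_right_mono mult_left_mono) (auto simp: mult_left_mono_neg)
  have dlim: "(\<lambda>n. d (real n + s)) \<longlonglongrightarrow> 0" for s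
  proof -
    have "(\<lambda>n. M * (exp (\<omega> - l) ^ n * exp ((\<omega> - l) * s)) * norm y) \<longlonglongrightarrow> M * (0 * exp ((\<omega> - l) * s)) * norm y"
      by (intro tendsto_intros LIMSEQ_power_zero) (use l in simp)
    then show ?thesis by (simp add: d_def exp_of_nat_mult[symmetric] exp_add[symmetric] algebra_simps)
  qed
  have "Cauchy (\<lambda>n. ?P (real n))"
  proof (rule CauchyI)
    fix e :: real assume "e > 0"
    have "(\<lambda>n. K * (d (real n + 0) + d (real n + 0))) \<longlonglongrightarrow> K * (0 + 0)" by (intro tendsto_intros dlim)
    then have "\<forall>\<^sub>F n in sequentially. K * (d (real n) + d (real n)) < e"
      using \<open>e > 0\<close> by (intro order_tendstoD(2)) auto
    then obtain N where N: "K * (d (real N) + d (real N)) < e" using eventually_happens'[OF sequentially_bot] by blast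
    have "norm (?P (real m) - ?P (real n)) < e" if "m \<ge> N" "n \<ge> N" for m n
    proof -
      have "norm (?P (real m) - ?P (real n)) \<le> K * (d (real m) + d (real n))" by (rule close) auto
      also have "\<dots> \<le> K * (d (real N) + d (real N))" using that K by (intro mult_left_mono add_mono dmono) auto
      finally show ?thesis using N by linarith
    qed
    then show "\<exists>N. \<forall>m\<ge>N. \<forall>n\<ge>N. norm (?P (real m) - ?P (real n)) < e" by blast
  qed
  then obtain x where x: "(\<lambda>n. ?P (real n)) \<longlonglongrightarrow> x" using Cauchy_convergent_iff convergent_def by blast
  have xs: "(\<lambda>n. ?P (real n + s)) \<longlonglongrightarrow> x" if s: "0 \<le> s" for s
  proof -
    have "(\<lambda>n. ?P (real n + s) - ?P (real n)) \<longlonglongrightarrow> 0"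
    proof (rule Lim_null_comparison)
      show "\<forall>\<^sub>F n in sequentially. norm (?P (real n + s) - ?P (real n)) \<le> K * (d (real n + s) + d (real n + 0))"
        using close s by (intro always_eventually allI) simp
      have "(\<lambda>n. K * (d (real n + s) + d (real n + 0))) \<longlonglongrightarrow> K * (0 + 0)" by (intro tendsto_intros dlim)
      then show "(\<lambda>n. K * (d (real n + s) + d (real n + 0))) \<longlonglongrightarrow> 0" by simp
    qed
    from tendsto_add[OF this x] show ?thesis by simp
  qed
  have Tx: "T s x = exp (l * s) *\<^sub>R (x - ?P s)" if s: "0 \<le> s" for s
  proof (rule LIMSEQ_unique)
    show "(\<lambda>n. T s (?P (real n))) \<longlonglongrightarrow> T s x" by (rule bounded_linear.tendsto[OF T_bounded_linear[OF s] x])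
    have "(\<lambda>n. exp (l * s) *\<^sub>R (?P (real n + s) - ?P s)) \<longlonglongrightarrow> exp (l * s) *\<^sub>R (x - ?P s)"
      by (intro tendsto_intros xs s)
    then show "(\<lambda>n. T s (?P (real n))) \<longlonglongrightarrow> exp (l * s) *\<^sub>R (x - ?P s)" using s by (simp add: P_shift)
  qed
  have "((\<lambda>s. ((exp (l * s) - 1) / s) *\<^sub>R x - exp (l * s) *\<^sub>R ((1 / s) *\<^sub>R ?P s)) \<longlongrightarrow> l *\<^sub>R x - 1 *\<^sub>R y) (at_right 0)"
    by (intro tendsto_intros exp_quotient_limits P_quotient)
  moreover have "\<forall>\<^sub>F s in at_right 0. ((exp (l * s) - 1) / s) *\<^sub>R x - exp (l * s) *\<^sub>R ((1 / s) *\<^sub>R ?P s) = (1 / s) *\<^sub>R (T s x - x)"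
    using eventually_at_right_less[of 0]
    by eventually_elim (simp add: Tx scaleR_diff_right scaleR_diff_left diff_divide_distrib)
  ultimately have "((\<lambda>s. (1 / s) *\<^sub>R (T s x - x)) \<longlongrightarrow> l *\<^sub>R x - 1 *\<^sub>R y) (at_right 0)"
    by (rule Lim_transform_eventually)
  from DA_I[OF this] have xD: "x \<in> DA" "A x = l *\<^sub>R x - y" by simp_all
  have "l *\<^sub>R x - h *\<^sub>R A (l *\<^sub>R x) = y"
    using l by (simp add: A_scaleR[OF xD(1)] xD(2) scaleR_diff_right mult.commute mult.left_commute)
  then show ?thesis using A_scaleR(1)[OF xD(1)] by blast
qed

end

end

section \<open>Convexity estimates\<close>

text \<open>Jensen's inequality for \<open>\<alpha> + \<beta>\<close> as the convex combination of
  \<open>\<alpha> / s\<close> and \<open>\<beta> / (1 - s)\<close>.\<close>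

lemma powr_convex_split:
  fixes \<alpha> \<beta> s p :: real
  assumes "0 \<le> \<alpha>" "0 \<le> \<beta>" "0 < s" "s < 1" and p: "1 \<le> p"
  shows "(\<alpha> + \<beta>) powr p \<le> s powr (1 - p) * \<alpha> powr p + (1 - s) powr (1 - p) * \<beta> powr p"
proof -
  let ?m = "\<alpha> + \<beta>"
  let ?c = "p * ?m powr (p - 1)"
  have 1: "?c * (\<alpha> / s - ?m) \<le> (\<alpha> / s) powr p - ?m powr p" using assms by (intro powr_tangent) auto
  have 2: "?c * (\<beta> / (1 - s) - ?m) \<le> (\<beta> / (1 - s)) powr p - ?m powr p" using assms by (intro powr_tangent) auto
  have "s * (?c * (\<alpha> / s - ?m)) + (1 - s) * (?c * (\<beta> / (1 - s) - ?m)) = ?c * (s * (\<alpha> / s) + (1 - s) * (\<beta> / (1 - s)) - ?m)"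
    by (simp add: algebra_simps)
  also have "\<dots> = 0" using assms by simp
  finally have "0 \<le> s * ((\<alpha> / s) powr p - ?m powr p) + (1 - s) * ((\<beta> / (1 - s)) powr p - ?m powr p)"
    using mult_left_mono[OF 1, of s] mult_left_mono[OF 2, of "1 - s"] assms by linarith
  moreover have "s * (\<alpha> / s) powr p = s powr (1 - p) * \<alpha> powr p"
    using assms by (simp add: powr_divide powr_diff)
  moreover have "(1 - s) * (\<beta> / (1 - s)) powr p = (1 - s) powr (1 - p) * \<beta> powr p"
    using assms by (simp add: powr_divide powr_diff)
  ultimately show ?thesis by (simp add: algebra_simps)
qed

text \<open>The minimum over \<open>s\<close> of the right-hand side is the p-th power of the sum of
  the roots, attained where \<open>s\<close> is the proportion of the roots. Splittings of several
  components with a common \<open>s\<close> thereby become a triangle inequality for the p-th root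
  of their sum.\<close>

lemma root_triangle_of_split:
  fixes A B C p :: real
  assumes nn: "0 \<le> A" "0 \<le> B" "0 \<le> C" and p: "1 \<le> p"
    and le: "\<And>s. 0 < s \<Longrightarrow> s < 1 \<Longrightarrow> C \<le> s powr (1 - p) * A + (1 - s) powr (1 - p) * B"
  shows "C powr (1 / p) \<le> A powr (1 / p) + B powr (1 / p)"
proof (rule field_le_epsilon)
  fix \<epsilon> :: real assume \<epsilon>: "0 < \<epsilon>"
  \<comment> \<open>The added \<open>\<epsilon> / 2\<close> keeps both numbers positive, so that the
    optimal proportion lies strictly between 0 and 1 even if \<open>A\<close> or \<open>B\<close>
    vanishes.\<close>
  define \<alpha> \<beta> where "\<alpha> = A powr (1 / p) + \<epsilon> / 2" and "\<beta> = B powr (1 / p) + \<epsilon> / 2"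
  have pos: "0 < \<alpha>" "0 < \<beta>" using \<epsilon> by (auto simp: \<alpha>_def \<beta>_def intro: add_nonneg_pos)
  let ?s = "\<alpha> / (\<alpha> + \<beta>)"
  have s: "0 < ?s" "?s < 1" "1 - ?s = \<beta> / (\<alpha> + \<beta>)" using pos by (auto simp: field_simps)
  have pw: "A \<le> \<alpha> powr p" "B \<le> \<beta> powr p"
    using powr_mono2[of p "A powr (1 / p)" \<alpha>] powr_mono2[of p "B powr (1 / p)" \<beta>] nn p \<epsilon>
    by (auto simp: \<alpha>_def \<beta>_def powr_powr)
  have q: "(x / (\<alpha> + \<beta>)) powr (1 - p) * x powr p = x * (\<alpha> + \<beta>) powr (p - 1)" if "0 < x" for x
  proof -
    have "x powr (1 - p) * x powr p = x" using that by (simp add: powr_add[symmetric])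
    moreover have "(\<alpha> + \<beta>) powr (p - 1) = 1 / (\<alpha> + \<beta>) powr (1 - p)" by (simp add: powr_minus_divide[symmetric])
    moreover have "(x / (\<alpha> + \<beta>)) powr (1 - p) = x powr (1 - p) / (\<alpha> + \<beta>) powr (1 - p)"
      by (rule powr_divide)
    ultimately show ?thesis by simp
  qed
  have "C \<le> ?s powr (1 - p) * A + (1 - ?s) powr (1 - p) * B" using s by (intro le)
  also have "\<dots> \<le> ?s powr (1 - p) * \<alpha> powr p + (1 - ?s) powr (1 - p) * \<beta> powr p"
    by (intro add_mono mult_left_mono pw) auto
  also have "\<dots> = (\<alpha> + \<beta>) powr (p - 1) * (\<alpha> + \<beta>)"
    unfolding s(3) q[OF pos(1)] q[OF pos(2)] by (simp add: algebra_simps)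
  also have "\<dots> = (\<alpha> + \<beta>) powr p" using pos powr_add[of "\<alpha> + \<beta>" "p - 1" 1] by simp
  finally have "C powr (1 / p) \<le> ((\<alpha> + \<beta>) powr p) powr (1 / p)" using nn p by (intro powr_mono2) auto
  also have "\<dots> = \<alpha> + \<beta>" using pos p by (simp add: powr_powr)
  finally show "C powr (1 / p) \<le> A powr (1 / p) + B powr (1 / p) + \<epsilon>" by (simp add: \<alpha>_def \<beta>_def)
qed

lemma inverse_le_exp:
  fixes x :: real
  assumes "0 \<le> x" "x \<le> 1 / 2"
  shows "1 / (1 - x) \<le> exp (2 * x)"
proof -
  have "1 \<le> (1 + 2 * x) * (1 - x)"
    using mult_nonneg_nonneg[of x "1 - 2 * x"] assms by (simp add: algebra_simps)
  then have "1 / (1 - x) \<le> 1 + 2 * x" using assms by (simp add: field_simps)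
  also have "\<dots> \<le> exp (2 * x)" by (rule exp_ge_add_one_self)
  finally show ?thesis .
qed

lemma powr_neg_le_exp:
  fixes x c :: real
  assumes "0 \<le> x" "x \<le> 1 / 2" "0 \<le> c"
  shows "(1 - x) powr (- c) \<le> exp (2 * c * x)"
proof -
  have "(1 - x) powr (- c) = (1 / (1 - x)) powr c" using assms by (subst powr_divide) (auto simp: powr_minus_divide)
  also have "\<dots> \<le> exp (2 * x) powr c" using assms inverse_le_exp by (intro powr_mono2) auto
  also have "\<dots> = exp (2 * c * x)" by (simp add: powr_def mult_ac)
  finally show ?thesis .
qed

text \<open>Split with proportion \<open>1 - h * \<kappa>\<close>. The perturbation then carries
  \<open>(h * \<kappa>) powr (1 - p) * h powr p\<close>, which is
  \<open>h * \<kappa> powr (1 - p)\<close> and thus of first order in \<open>h\<close>; the main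
  term pays only an exponential rate. For \<open>p > 1\<close> a large \<open>\<kappa>\<close> makes
  the coefficient as small as desired.\<close>

lemma powr_perturbation:
  fixes \<alpha> \<beta> h \<kappa> p :: real
  assumes nn: "0 \<le> \<alpha>" "0 \<le> \<beta>" and h: "0 < h" "0 < \<kappa>" "h * \<kappa> \<le> 1 / 2" and p: "1 \<le> p"
  shows "(\<alpha> + h * \<beta>) powr p \<le> exp (2 * (p - 1) * \<kappa> * h) * \<alpha> powr p + h * \<kappa> powr (1 - p) * \<beta> powr p"
proof -
  have pos: "0 < h * \<kappa>" using h by simp
  have "(\<alpha> + h * \<beta>) powr p \<le> (1 - h * \<kappa>) powr (1 - p) * \<alpha> powr p + (1 - (1 - h * \<kappa>)) powr (1 - p) * (h * \<beta>) powr p"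
    using assms pos by (intro powr_convex_split) auto
  also have "(1 - (1 - h * \<kappa>)) powr (1 - p) * (h * \<beta>) powr p = h * \<kappa> powr (1 - p) * \<beta> powr p"
  proof -
    have "h powr (1 - p) * h powr p = h" using h by (simp add: powr_add[symmetric])
    then show ?thesis using h nn by (simp add: powr_mult algebra_simps)
  qed
  also have "(1 - h * \<kappa>) powr (1 - p) \<le> exp (2 * (p - 1) * (h * \<kappa>))"
    using powr_neg_le_exp[of "h * \<kappa>" "p - 1"] assms pos by simp
  finally show ?thesis by (simp add: mult_right_mono mult_ac)
qed

lemma lpi_split:
  fixes f g :: "'m \<Rightarrow> 'a::banach"
  assumes f: "memLp p M f" and g: "memLp p M g" and s: "0 < s" "s < 1" and p: "1 \<le> p"
  shows "lpi p M (\<lambda>x. f x + g x) \<le> s powr (1 - p) * lpi p M f + (1 - s) powr (1 - p) * lpi p M g"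
proof -
  have p0: "0 \<le> p" using p by simp
  note i = memLp_integrable[OF f] memLp_integrable[OF g] memLp_integrable[OF memLp_add(1)[OF f g p0]]
  have "lpi p M (\<lambda>x. f x + g x)
      \<le> (\<integral>x. s powr (1 - p) * norm (f x) powr p + (1 - s) powr (1 - p) * norm (g x) powr p \<partial>M)"
  proof (rule integral_mono)
    fix x
    have "norm (f x + g x) powr p \<le> (norm (f x) + norm (g x)) powr p"
      using p by (intro powr_mono2 norm_triangle_ineq) auto
    also have "\<dots> \<le> s powr (1 - p) * norm (f x) powr p + (1 - s) powr (1 - p) * norm (g x) powr p"
      using s p by (intro powr_convex_split) auto
    finally show "norm (f x + g x) powr p
      \<le> s powr (1 - p) * norm (f x) powr p + (1 - s) powr (1 - p) * norm (g x) powr p" .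
  qed (use i in \<open>auto intro!: integrable_add\<close>)
  also have "\<dots> = s powr (1 - p) * lpi p M f + (1 - s) powr (1 - p) * lpi p M g"
    using i by simp
  finally show ?thesis .
qed

lemma lpi_perturbation:
  fixes f g :: "'m \<Rightarrow> 'a::banach"
  assumes f: "memLp p M f" and g: "memLp p M g" and h: "0 < h" "0 < \<kappa>" "h * \<kappa> \<le> 1 / 2" and p: "1 \<le> p"
  shows "lpi p M (\<lambda>x. f x + h *\<^sub>R g x) \<le> exp (2 * (p - 1) * \<kappa> * h) * lpi p M f + h * \<kappa> powr (1 - p) * lpi p M g"
proof -
  have p0: "0 \<le> p" using p by simp
  note i = memLp_integrable[OF f] memLp_integrable[OF g] memLp_integrable[OF memLp_add(1)[OF f memLp_scaleR[OF g p0, of h] p0]]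
  have "lpi p M (\<lambda>x. f x + h *\<^sub>R g x)
      \<le> (\<integral>x. exp (2 * (p - 1) * \<kappa> * h) * norm (f x) powr p + h * \<kappa> powr (1 - p) * norm (g x) powr p \<partial>M)"
  proof (rule integral_mono)
    fix x
    have "norm (f x + h *\<^sub>R g x) powr p \<le> (norm (f x) + h * norm (g x)) powr p"
      using p h norm_triangle_ineq[of "f x" "h *\<^sub>R g x"] by (intro powr_mono2) auto
    also have "\<dots> \<le> exp (2 * (p - 1) * \<kappa> * h) * norm (f x) powr p + h * \<kappa> powr (1 - p) * norm (g x) powr p"
      using h p by (intro powr_perturbation) auto
    finally show "norm (f x + h *\<^sub>R g x) powr p
      \<le> exp (2 * (p - 1) * \<kappa> * h) * norm (f x) powr p + h * \<kappa> powr (1 - p) * norm (g x) powr p" .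
  qed (use i in \<open>auto intro!: integrable_add\<close>)
  also have "\<dots> = exp (2 * (p - 1) * \<kappa> * h) * lpi p M f + h * \<kappa> powr (1 - p) * lpi p M g"
    using i by simp
  finally show ?thesis .
qed

lemma integral_Icc_at_top:
  fixes u :: "real \<Rightarrow> real"
  assumes u: "integrable (lebesgue_on {0..}) u"
  shows "(\<lambda>n. integral {0..real n} u) \<longlonglongrightarrow> (\<integral>x. u x \<partial>lebesgue_on {0..})"
proof -
  let ?v = "\<lambda>n x. indicator {0..real n} x * u x"
  have "(\<lambda>n. \<integral>x. ?v n x \<partial>lebesgue_on {0..}) \<longlonglongrightarrow> (\<integral>x. u x \<partial>lebesgue_on {0..})"
  proof (rule integral_dominated_convergence[where w = "\<lambda>x. norm (u x)"])
    show "u \<in> borel_measurable (lebesgue_on {0..})" using u by auto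
    show "?v n \<in> borel_measurable (lebesgue_on {0..})" for n
    proof (intro borel_measurable_times borel_measurable_indicator)
      show "{0..real n} \<in> sets (lebesgue_on {0..})"
        by (subst sets_restrict_space_iff) auto
    qed (use u in auto)
    show "AE x in lebesgue_on {0..}. (\<lambda>n. ?v n x) \<longlonglongrightarrow> u x"
    proof (rule AE_I2)
      fix x :: real assume "x \<in> space (lebesgue_on {0..})"
      then have x: "0 \<le> x" by simp
      obtain n0 where "x \<le> real n0" using real_arch_simple by blast
      then have "\<forall>\<^sub>F n in sequentially. ?v n x = u x"
        using x by (intro eventually_sequentiallyI[of n0]) (auto simp: indicator_def)
      then show "(\<lambda>n. ?v n x) \<longlonglongrightarrow> u x" by (rule tendsto_eventually)
    qed
  qed (use u in \<open>auto simp: indicator_def\<close>)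
  moreover have "(\<integral>x. ?v n x \<partial>lebesgue_on {0..}) = integral {0..real n} u" for n
  proof -
    have ind: "indicator {0..} x * (indicator {0..real n} x * u x) = indicator {0..real n} x * u x" for x
      by (auto simp: indicator_def)
    have iu: "integrable lebesgue (\<lambda>x. indicator {0..} x * u x)" using u by (subst (asm) integrable_restrict_space) auto
    have "integrable lebesgue (\<lambda>x. indicator {0..real n} x *\<^sub>R (indicator {0..} x * u x))"
      by (rule integrable_mult_indicator[OF _ iu]) simp
    then have "integrable lebesgue (\<lambda>x. indicator {0..real n} x * u x)"
      by (rule Bochner_Integration.integrable_cong[THEN iffD1, rotated -1]) (auto simp: indicator_def)
    then have int: "integrable (lebesgue_on {0..real n}) u" by (subst integrable_restrict_space) auto
    have "(\<integral>x. ?v n x \<partial>lebesgue_on {0..}) = (\<integral>x. u x \<partial>lebesgue_on {0..real n})"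
      by (simp add: integral_restrict_space ind)
    also have "\<dots> = integral {0..real n} u" by (rule lebesgue_integral_eq_integral[OF int]) simp
    finally show ?thesis .
  qed
  ultimately show ?thesis by simp
qed

text \<open>The growth estimate on \<open>{0..t}\<close> has the end value
  \<open>norm (g t) powr p\<close> on its right side, which has to disappear as \<open>t\<close>
  grows. If the limit \<open>X\<close> of the left sides were positive, the end values would stay
  above \<open>X / 3\<close>, contradicting integrability.\<close>

lemma W1p_with_halfline_estimate:
  fixes g g' :: "real \<Rightarrow> 'a::banach"
  assumes W: "W1p_with p {0..} g g'" and p: "1 \<le> p" and h: "0 < h"
  shows "lpi p (lebesgue_on {0..}) g + h * norm (g 0) powr p \<le> lpi p (lebesgue_on {0..}) (\<lambda>t. g t - h *\<^sub>R g' t)"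
proof -
  let ?M = "lebesgue_on {0..} :: real measure" and ?k = "\<lambda>t. g t - h *\<^sub>R g' t"
  have p0: "0 \<le> p" using p by simp
  note m = W1p_with_memLp[OF W]
  have mk: "memLp p ?M ?k" using m p0 by (intro memLp_diff(1) memLp_scaleR) auto
  have i: "integrable ?M (\<lambda>t. norm (g t) powr p)" "integrable ?M (\<lambda>t. norm (?k t) powr p)"
    using m mk memLp_integrable by blast+
  let ?I = "\<lambda>t. integral {0..t} (\<lambda>\<tau>. norm (g \<tau>) powr p)" and ?J = "\<lambda>t. integral {0..t} (\<lambda>\<tau>. norm (?k \<tau>) powr p)"
  define X where "X = norm (g 0) powr p + (1 / h) * (lpi p ?M g - lpi p ?M ?k)"
  have growth: "norm (g 0) powr p + (1 / h) * (?I t - ?J t) \<le> norm (g t) powr p" if "0 \<le> t" for t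
    by (rule W1p_with_growth[OF W p h]) (use that in auto)
  have lim: "(\<lambda>n. norm (g 0) powr p + (1 / h) * (?I (real n) - ?J (real n))) \<longlonglongrightarrow> X"
    unfolding X_def by (intro tendsto_intros integral_Icc_at_top i)
  have "X \<le> 0"
  proof (rule ccontr)
    assume "\<not> X \<le> 0"
    then have X: "0 < X / 3" "X / 3 < X" by auto
    have io: "(\<lambda>\<tau>. norm (g \<tau>) powr p) integrable_on {a..b}" "(\<lambda>\<tau>. norm (?k \<tau>) powr p) integrable_on {a..b}" if "0 \<le> a" for a b
      using that memLp_Icc(3)[OF conjunct1[OF m] p] memLp_Icc(3)[OF mk p] by auto
    \<comment> \<open>After division by \<open>h\<close> this error is \<open>X / 3\<close>. Another
      third is spent in the choice of \<open>n2\<close>, and the last third is the lower bound in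
      \<open>low\<close>.\<close>
    define d where "d = h * X / 3"
    have d: "0 < d" using h X by (simp add: d_def)
    from LIMSEQ_D[OF integral_Icc_at_top[OF i(2)] d] obtain n1 where
      n1: "\<And>n. n \<ge> n1 \<Longrightarrow> \<bar>?J (real n) - lpi p ?M ?k\<bar> < d" by auto
    from LIMSEQ_D[OF lim X(1)] obtain n2 where
      n2: "\<And>n. n \<ge> n2 \<Longrightarrow> \<bar>norm (g 0) powr p + (1 / h) * (?I (real n) - ?J (real n)) - X\<bar> < X / 3" by auto
    define N where "N = max n1 n2"
    have low: "X / 3 \<le> norm (g t) powr p" if t: "real N \<le> t" for t
    proof -
      have t0: "0 \<le> t" using t by linarith
      obtain n where n: "t \<le> real n" using real_arch_simple by blast
      then have nN: "N \<le> n" using t by linarith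
      have "?I (real N) \<le> ?I t" using t t0 io by (intro integral_subset_le) auto
      moreover have "?J t \<le> ?J (real n)" using n t0 io by (intro integral_subset_le) auto
      moreover have "?J (real n) \<le> lpi p ?M ?k"
      proof (rule LIMSEQ_le_const[OF integral_Icc_at_top[OF i(2)]], intro exI allI impI)
        fix j assume "n \<le> j"
        then show "?J (real n) \<le> ?J (real j)" using io by (intro integral_subset_le) auto
      qed
      moreover have "lpi p ?M ?k - d < ?J (real N)" using n1[of N] by (simp add: N_def abs_less_iff)
      ultimately have "?I (real N) - ?J (real N) - d \<le> ?I t - ?J t" by linarith
      then have "(1 / h) * (?I (real N) - ?J (real N) - d) \<le> (1 / h) * (?I t - ?J t)"
        using h by (intro mult_left_mono) auto
      moreover have "(1 / h) * (?I (real N) - ?J (real N) - d) = (1 / h) * (?I (real N) - ?J (real N)) - X / 3"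
        using h by (simp add: d_def right_diff_distrib)
      moreover have "n2 \<le> N" by (simp add: N_def)
      from n2[OF this] have "2 * X / 3 < norm (g 0) powr p + (1 / h) * (?I (real N) - ?J (real N))"
        unfolding abs_less_iff by linarith
      ultimately show ?thesis using growth[OF t0] by linarith
    qed
    have "real k * (X / 3) \<le> lpi p ?M g" for k
    proof -
      have "real k * (X / 3) = integral {real N..real (N + k)} (\<lambda>_. X / 3)" by simp
      also have "\<dots> \<le> integral {real N..real (N + k)} (\<lambda>\<tau>. norm (g \<tau>) powr p)"
        using low io by (intro integral_le) auto
      also have "\<dots> \<le> ?I (real (N + k))" using io by (intro integral_subset_le) auto
      also have "\<dots> \<le> lpi p ?M g"
      proof (rule LIMSEQ_le_const[OF integral_Icc_at_top[OF i(1)]], intro exI allI impI)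
        fix j assume "N + k \<le> j"
        then show "?I (real (N + k)) \<le> ?I (real j)" using io by (intro integral_subset_le) auto
      qed
      finally show ?thesis .
    qed
    moreover obtain k where "lpi p ?M g < real k * (X / 3)" using reals_Archimedean3[OF X(1)] by blast
    ultimately show False by (meson not_le)
  qed
  then have "h * X \<le> 0" using h by (simp add: mult_le_0_iff)
  then show ?thesis using h by (simp add: X_def algebra_simps)
qed

lemma RS_integral_add:
  assumes I: "has_RS_integral \<mu> \<phi> a b I" and J: "has_RS_integral \<mu> \<psi> a b J"
  shows "has_RS_integral \<mu> (\<lambda>s. \<phi> s + \<psi> s) a b (I + J)"
  unfolding has_RS_integral_iff
proof (intro allI impI)
  fix \<epsilon> :: real assume "\<epsilon> > 0"
  then have e2: "\<epsilon> / 2 > 0" by simp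
  obtain \<delta> where \<delta>: "\<delta> > 0" "\<And>n t \<xi>. fine_tagged a b \<delta> n t \<xi> \<Longrightarrow> norm (RS_sum \<mu> \<phi> n t \<xi> - I) < \<epsilon> / 2"
    using I[unfolded has_RS_integral_iff] e2 by blast
  obtain \<delta>' where \<delta>': "\<delta>' > 0" "\<And>n t \<xi>. fine_tagged a b \<delta>' n t \<xi> \<Longrightarrow> norm (RS_sum \<mu> \<psi> n t \<xi> - J) < \<epsilon> / 2"
    using J[unfolded has_RS_integral_iff] e2 by blast
  show "\<exists>\<delta>>0. \<forall>n t \<xi>. fine_tagged a b \<delta> n t \<xi> \<longrightarrow> norm (RS_sum \<mu> (\<lambda>s. \<phi> s + \<psi> s) n t \<xi> - (I + J)) < \<epsilon>"
  proof (intro exI conjI allI impI)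
    show "min \<delta> \<delta>' > 0" using \<delta> \<delta>' by simp
    fix n t \<xi> assume "fine_tagged a b (min \<delta> \<delta>') n t \<xi>"
    then have "fine_tagged a b \<delta> n t \<xi>" "fine_tagged a b \<delta>' n t \<xi>" by (auto simp: fine_tagged_def)
    with \<delta>(2) \<delta>'(2) have "norm (RS_sum \<mu> \<phi> n t \<xi> - I) < \<epsilon> / 2" "norm (RS_sum \<mu> \<psi> n t \<xi> - J) < \<epsilon> / 2" by blast+
    moreover have "RS_sum \<mu> (\<lambda>s. \<phi> s + \<psi> s) n t \<xi> = RS_sum \<mu> \<phi> n t \<xi> + RS_sum \<mu> \<psi> n t \<xi>"
      by (simp add: RS_sum_def blinfun.add_right sum.distrib)
    ultimately show "norm (RS_sum \<mu> (\<lambda>s. \<phi> s + \<psi> s) n t \<xi> - (I + J)) < \<epsilon>"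
      using norm_triangle_ineq[of "RS_sum \<mu> \<phi> n t \<xi> - I" "RS_sum \<mu> \<psi> n t \<xi> - J"] by (simp add: algebra_simps)
  qed
qed

text \<open>Operators of the bounded linear function type are real-linear by type; complex
  homogeneity of the values of \<open>\<mu>\<close> comes from \<open>lin\<close>, and partition
  points stay in the interval where it is assumed.\<close>

lemma RS_integral_scaleC:
  fixes \<mu> :: "real \<Rightarrow> ('a::complex_banach \<Rightarrow>\<^sub>L 'a)"
  assumes I: "has_RS_integral \<mu> \<phi> a b I"
    and lin: "\<And>s x. a \<le> s \<Longrightarrow> s \<le> b \<Longrightarrow> blinfun_apply (\<mu> s) (scaleC c x) = scaleC c (blinfun_apply (\<mu> s) x)"
  shows "has_RS_integral \<mu> (\<lambda>s. scaleC c (\<phi> s)) a b (scaleC c I)"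
  unfolding has_RS_integral_iff
proof (intro allI impI)
  fix \<epsilon> :: real assume "\<epsilon> > 0"
  then have e2: "\<epsilon> / (cmod c + 1) > 0" by (simp add: add_nonneg_pos)
  obtain \<delta> where \<delta>: "\<delta> > 0" "\<And>n t \<xi>. fine_tagged a b \<delta> n t \<xi> \<Longrightarrow> norm (RS_sum \<mu> \<phi> n t \<xi> - I) < \<epsilon> / (cmod c + 1)"
    using I[unfolded has_RS_integral_iff] e2 by blast
  show "\<exists>\<delta>>0. \<forall>n t \<xi>. fine_tagged a b \<delta> n t \<xi> \<longrightarrow> norm (RS_sum \<mu> (\<lambda>s. scaleC c (\<phi> s)) n t \<xi> - scaleC c I) < \<epsilon>"
  proof (intro exI conjI allI impI)
    show "\<delta> > 0" by (rule \<delta>)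
    fix n t \<xi> assume f: "fine_tagged a b \<delta> n t \<xi>"
    then have P: "is_partition a b n t" by (simp add: fine_tagged_def)
    have "RS_sum \<mu> (\<lambda>s. scaleC c (\<phi> s)) n t \<xi> = scaleC c (RS_sum \<mu> \<phi> n t \<xi>)"
      unfolding RS_sum_def linear_sum[OF bounded_linear.linear[OF bounded_linear_scaleC]]
    proof (rule sum.cong[OF refl])
      fix i assume "i \<in> {..<n}"
      then have "t i \<in> {a..b}" "t (Suc i) \<in> {a..b}" using is_partition_range[OF P] by auto
      then show "blinfun_apply (\<mu> (t (Suc i)) - \<mu> (t i)) (scaleC c (\<phi> (\<xi> i)))
          = scaleC c (blinfun_apply (\<mu> (t (Suc i)) - \<mu> (t i)) (\<phi> (\<xi> i)))"
        by (simp add: blinfun.diff_left lin scaleC_diff_right)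
    qed
    then have "norm (RS_sum \<mu> (\<lambda>s. scaleC c (\<phi> s)) n t \<xi> - scaleC c I) = cmod c * norm (RS_sum \<mu> \<phi> n t \<xi> - I)"
      by (simp add: scaleC_diff_right[symmetric] norm_scaleC)
    also have "\<dots> \<le> (cmod c + 1) * norm (RS_sum \<mu> \<phi> n t \<xi> - I)" by (simp add: mult_right_mono)
    also have "\<dots> < (cmod c + 1) * (\<epsilon> / (cmod c + 1))"
      using \<delta>(2)[OF f] by (intro mult_strict_left_mono) (auto simp: add_nonneg_pos)
    also have "\<dots> = \<epsilon>" using add_nonneg_pos[of "cmod c" 1] by auto
    finally show "norm (RS_sum \<mu> (\<lambda>s. scaleC c (\<phi> s)) n t \<xi> - scaleC c I) < \<epsilon>" .
  qed
qed

lemma bounded_linear_scaleC_left: "bounded_linear (\<lambda>c. scaleC c (x :: 'a::complex_banach))"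
  by (rule bounded_linear_intro[where K = "norm x"])
    (auto simp: scaleC_add_left scaleR_scaleC scaleC_scaleC scaleR_conv_of_real norm_scaleC)

section \<open>The delay system\<close>

text \<open>Identifies the state operations with the pointwise group structure, so that states form
  a module and the generation locale applies.\<close>

lemma st_add_eq_plus: "st_add = (+)"
  by (intro ext) (auto simp: st_add_def plus_prod_def plus_fun_def split: prod.split)

lemma module_st_scale: "module st_scale"
  by unfold_locales
    (auto simp: st_scale_def plus_prod_def plus_fun_def scaleC_add_left scaleC_add_right scaleC_scaleC scaleC_one split: prod.split)

lemma vsub_st: "vsub st_add st_scale u v = u - v"
  using module.scale_minus_left[OF module_st_scale, of 1 v] module.scale_one[OF module_st_scale, of v]
  by (simp add: vsub_def st_add_eq_plus)

lemma st_scale_Pair: "st_scale c (x, f, \<phi>) = (scaleC c x, \<lambda>t. scaleC c (f t), \<lambda>t. scaleC c (\<phi> t))"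
  by (simp add: st_scale_def)

lemma state_diff: "(x, f, \<phi>) - (y, g, \<psi>) = (x - y, \<lambda>t. f t - g t, \<lambda>t. \<phi> t - \<psi> t)"
  by (simp add: minus_prod_def fun_diff_def)

lemma state_add: "(x, f, \<phi>) + (y, g, \<psi>) = (x + y, \<lambda>t. f t + g t, \<lambda>t. \<phi> t + \<psi> t)"
  by (simp add: plus_prod_def plus_fun_def)

lemma state_space_Pair:
  "(x, f, \<phi>) \<in> st_space p r \<longleftrightarrow> memLp p (lebesgue_on {0..}) f \<and> memLp p (lebesgue_on {-r..0}) \<phi>"
  by (simp add: st_space_def)

lemma lpi_scaleC: "lpi p M (\<lambda>x. scaleC c (f x)) = cmod c powr p * lpi p M f"
  by (simp add: norm_scaleC powr_mult)

lemma memLp_scaleC: "memLp p M f \<Longrightarrow> 0 \<le> p \<Longrightarrow> memLp p M (\<lambda>x. scaleC c (f x))"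
  by (rule memLp_bounded_linear[OF bounded_linear_scaleC])

lemma lpi_scaleC_left: "lpi p M (\<lambda>x. scaleC (b x) y) = norm y powr p * lpi p M b"
  by (simp add: norm_scaleC powr_mult mult.commute)

lemma memLp_scaleC_left: "memLp p M b \<Longrightarrow> 0 \<le> p \<Longrightarrow> memLp p M (\<lambda>x. scaleC (b x) y)"
  by (rule memLp_bounded_linear[OF bounded_linear_scaleC_left])

text \<open>A bridge between the given norm, a sum of three norms, and the renormed functional, a
  root of a sum of p-th powers.\<close>

definition state_sum :: "real \<Rightarrow> real \<Rightarrow> 'a::complex_banach state \<Rightarrow> real" where
  "state_sum p r u = (case u of (x, f, \<phi>) \<Rightarrow>
     norm x powr p + lpi p (lebesgue_on {0..}) f + lpi p (lebesgue_on {-r..0}) \<phi>)"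

lemma state_sum_nonneg: "0 \<le> state_sum p r u"
  by (auto simp: state_sum_def split: prod.split intro!: add_nonneg_nonneg lpi_nonneg)

lemma root_powr: "1 \<le> p \<Longrightarrow> 0 \<le> y \<Longrightarrow> (y powr (1 / p)) powr p = y" for y p :: real
  by (simp add: powr_powr)

lemma state_sum_le_norm: "1 \<le> p \<Longrightarrow> state_sum p r u \<le> 3 * st_norm p r u powr p"
proof (cases u)
  case (fields x f \<phi>)
  assume p: "1 \<le> p"
  have "norm x powr p \<le> st_norm p r u powr p"
    using p fields by (intro powr_mono2) (auto simp: st_norm_def Lpnorm_def)
  moreover have "lpi p (lebesgue_on {0..}) f \<le> st_norm p r u powr p"
    using powr_mono2[of p "Lpnorm p (lebesgue_on {0..}) f" "st_norm p r u"] p fields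
    by (simp add: st_norm_def Lpnorm_def root_powr lpi_nonneg)
  moreover have "lpi p (lebesgue_on {-r..0}) \<phi> \<le> st_norm p r u powr p"
    using powr_mono2[of p "Lpnorm p (lebesgue_on {-r..0}) \<phi>" "st_norm p r u"] p fields
    by (simp add: st_norm_def Lpnorm_def root_powr lpi_nonneg)
  ultimately show ?thesis using fields by (simp add: state_sum_def)
qed

lemma norm_le_state_sum: "1 \<le> p \<Longrightarrow> st_norm p r u \<le> 3 * state_sum p r u powr (1 / p)"
proof (cases u)
  case (fields x f \<phi>)
  assume p: "1 \<le> p"
  have nn: "0 \<le> lpi p (lebesgue_on {0..}) f" "0 \<le> lpi p (lebesgue_on {-r..0}) \<phi>" by (auto intro: lpi_nonneg)
  have "norm x = (norm x powr p) powr (1 / p)" using p by (simp add: powr_powr)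
  also have "\<dots> \<le> state_sum p r u powr (1 / p)"
    using p fields nn by (intro powr_mono2) (auto simp: state_sum_def)
  finally have "norm x \<le> state_sum p r u powr (1 / p)" .
  moreover have "Lpnorm p (lebesgue_on {0..}) f \<le> state_sum p r u powr (1 / p)"
    unfolding Lpnorm_def using p fields nn by (intro powr_mono2) (auto simp: state_sum_def)
  moreover have "Lpnorm p (lebesgue_on {-r..0}) \<phi> \<le> state_sum p r u powr (1 / p)"
    unfolding Lpnorm_def using p fields nn by (intro powr_mono2) (auto simp: state_sum_def)
  ultimately show ?thesis using fields by (simp add: st_norm_def)
qed

lemma state_sum_complete:
  fixes s :: "nat \<Rightarrow> 'a::complex_banach state"
  assumes s: "\<And>n. s n \<in> st_space p r" and p: "1 \<le> p"
    and Cauchy: "\<And>\<epsilon>. \<epsilon> > 0 \<Longrightarrow> \<exists>n0. \<forall>m\<ge>n0. \<forall>n\<ge>n0. state_sum p r (s m - s n) < \<epsilon>"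
  shows "\<exists>l\<in>st_space p r. (\<lambda>n. state_sum p r (s n - l)) \<longlonglongrightarrow> 0"
proof -
  obtain x f \<phi> where s_eq: "\<And>n. s n = (x n, f n, \<phi> n)" by (rule that[of "\<lambda>n. fst (s n)" "\<lambda>n. fst (snd (s n))" "\<lambda>n. snd (snd (s n))"]) simp
  note m = s[unfolded s_eq state_space_Pair]
  have le: "norm (x m - x n) powr p \<le> state_sum p r (s m - s n)"
    "lpi p (lebesgue_on {0..}) (\<lambda>t. f m t - f n t) \<le> state_sum p r (s m - s n)"
    "lpi p (lebesgue_on {-r..0}) (\<lambda>t. \<phi> m t - \<phi> n t) \<le> state_sum p r (s m - s n)" for m n
    unfolding s_eq state_diff state_sum_def by (auto intro!: add_nonneg_nonneg lpi_nonneg)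
  have "Cauchy x"
  proof (rule metric_CauchyI)
    fix \<epsilon> :: real assume e: "\<epsilon> > 0"
    then obtain n0 where n0: "\<And>m n. m \<ge> n0 \<Longrightarrow> n \<ge> n0 \<Longrightarrow> state_sum p r (s m - s n) < \<epsilon> powr p"
      using Cauchy[of "\<epsilon> powr p"] by auto
    have "norm (x m - x n) < \<epsilon>" if "m \<ge> n0" "n \<ge> n0" for m n
    proof (rule ccontr)
      assume "\<not> norm (x m - x n) < \<epsilon>"
      then have "\<epsilon> powr p \<le> norm (x m - x n) powr p" using e p by (intro powr_mono2) auto
      with le(1)[of m n] n0[OF that] show False by linarith
    qed
    then show "\<exists>n0. \<forall>m\<ge>n0. \<forall>n\<ge>n0. dist (x m) (x n) < \<epsilon>" by (auto simp: dist_norm)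
  qed
  then obtain x0 where x0: "x \<longlonglongrightarrow> x0" using Cauchy_convergent convergent_def by blast
  have p0: "0 < p" using p by simp
  obtain f0 where f0: "memLp p (lebesgue_on {0..}) f0" "(\<lambda>n. lpi p (lebesgue_on {0..}) (\<lambda>t. f n t - f0 t)) \<longlonglongrightarrow> 0"
  proof (rule memLp_complete[of p "lebesgue_on {0..}" f])
    fix \<epsilon> :: real assume "\<epsilon> > 0"
    from Cauchy[OF this] le(2) show "\<exists>n0. \<forall>m\<ge>n0. \<forall>n\<ge>n0. lpi p (lebesgue_on {0..}) (\<lambda>t. f m t - f n t) < \<epsilon>"
      by (meson order_le_less_trans)
  qed (use m p0 in auto)
  obtain \<phi>0 where \<phi>0: "memLp p (lebesgue_on {-r..0}) \<phi>0" "(\<lambda>n. lpi p (lebesgue_on {-r..0}) (\<lambda>t. \<phi> n t - \<phi>0 t)) \<longlonglongrightarrow> 0"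
  proof (rule memLp_complete[of p "lebesgue_on {-r..0}" \<phi>])
    fix \<epsilon> :: real assume "\<epsilon> > 0"
    from Cauchy[OF this] le(3) show "\<exists>n0. \<forall>m\<ge>n0. \<forall>n\<ge>n0. lpi p (lebesgue_on {-r..0}) (\<lambda>t. \<phi> m t - \<phi> n t) < \<epsilon>"
      by (meson order_le_less_trans)
  qed (use m p0 in auto)
  have "(\<lambda>n. norm (x n - x0) powr p) \<longlonglongrightarrow> 0"
  proof -
    have "(\<lambda>n. norm (x n - x0)) \<longlonglongrightarrow> 0" using x0 by (simp add: LIM_zero tendsto_norm_zero)
    from tendsto_powr'[OF this tendsto_const[of p]] p0 show ?thesis by auto
  qed
  from tendsto_add[OF tendsto_add[OF this f0(2)] \<phi>0(2)]
  have "(\<lambda>n. state_sum p r (s n - (x0, f0, \<phi>0))) \<longlonglongrightarrow> 0"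
    by (simp add: s_eq state_diff state_sum_def)
  moreover have "(x0, f0, \<phi>0) \<in> st_space p r" using f0 \<phi>0 by (simp add: state_space_Pair)
  ultimately show ?thesis by blast
qed

text \<open>Fixes the choices on which the new norm and the estimates depend: growth constants
  \<open>M\<close> and \<open>\<omega>\<close> and a weak derivative \<open>a'\<close>.\<close>

locale delay_system = generated_semigroup DA A T
  for DA :: "'a::complex_banach set" and A T +
  fixes p r M \<omega> :: real and a a' :: "real \<Rightarrow> complex" and \<mu> :: "real \<Rightarrow> ('a \<Rightarrow>\<^sub>L 'a)"
  assumes p: "1 < p" and r: "0 < r" and M: "1 \<le> M" and \<omega>: "0 \<le> \<omega>"
    and T_bound: "\<And>t x. 0 \<le> t \<Longrightarrow> norm (T t x) \<le> M * exp (\<omega> * t) * norm x"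
    and a_W: "W1p_with p {0..} a a'"
    and \<mu>_scaleC: "\<And>s c x. -r \<le> s \<Longrightarrow> s \<le> 0 \<Longrightarrow> blinfun_apply (\<mu> s) (scaleC c x) = scaleC c (blinfun_apply (\<mu> s) x)"
    and \<mu>_bv: "bounded_variation \<mu> (-r) 0"
begin

abbreviation "\<nu> \<equiv> renorm \<omega>"
abbreviation "Mf \<equiv> (lebesgue_on {0..} :: real measure)"
abbreviation "M\<phi> \<equiv> (lebesgue_on {-r..0} :: real measure)"

lemma p_facts: "0 < p" "0 \<le> p" "1 \<le> p" "-r < 0" using p r by auto

lemmas \<nu>_facts = norm_le_renorm[OF M \<omega> T_bound] renorm_le_norm[OF M \<omega> T_bound]
  renorm_triangle[OF M \<omega> T_bound] renorm_scaleC[OF M \<omega> T_bound] renorm_scaleR[OF M \<omega> T_bound]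

lemma \<nu>_nonneg: "0 \<le> \<nu> x" using \<nu>_facts(1)[of x] norm_ge_zero[of x] by linarith

definition V :: "real \<Rightarrow> real" where
  "V s = variation_fun \<mu> (-r) 0 s - variation_fun \<mu> (-r) 0 (-r)"

text \<open>The p-th root of the weight, so that the weighted integral is \<open>lpi\<close> of a
  product and the L^p lemmas apply unchanged. The summand 1 bounds the weight from below and so
  keeps the norms equivalent.\<close>

definition \<rho> :: "real \<Rightarrow> real" where
  "\<rho> s = (1 + V s) powr (1 / p)"

lemma V_bounds: "0 \<le> V s" "V s \<le> V 0"
  using variation_fun_bounds[OF p_facts(4) \<mu>_bv, of s] by (auto simp: V_def)

lemma V_measurable: "V \<in> borel_measurable borel"
  using variation_fun_measurable[OF p_facts(4) \<mu>_bv] unfolding V_def[abs_def] by measurable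

lemma norm_\<rho>: "norm (\<rho> s *\<^sub>R y) powr p = (1 + V s) * norm y powr p"
  using V_bounds(1)[of s] p_facts by (simp add: \<rho>_def powr_mult powr_powr)

lemma memLp_\<rho>: "memLp p M\<phi> \<phi> \<Longrightarrow> memLp p M\<phi> (\<lambda>s. \<rho> s *\<^sub>R \<phi> s)" for \<phi> :: "real \<Rightarrow> 'a"
proof -
  assume m: "memLp p M\<phi> \<phi>"
  have "\<rho> \<in> borel_measurable M\<phi>"
    unfolding \<rho>_def[abs_def]
    by (intro measurable_lebesgue_on[OF p_facts(4) \<mu>_bv]) (use V_measurable in measurable)
  from strongly_measurable_scaleR[OF this memLp_strongly_measurable[OF m]]
  show ?thesis
  proof (rule memLp_bound[OF m _ p_facts(2), where C = "1 + V 0"])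
    show "norm (\<rho> s *\<^sub>R \<phi> s) powr p \<le> (1 + V 0) * norm (\<phi> s) powr p" for s
      unfolding norm_\<rho> using V_bounds(2)[of s] by (intro mult_right_mono) auto
  qed
qed

lemma lpi_\<rho>: "memLp p M\<phi> \<phi> \<Longrightarrow> lpi p M\<phi> \<phi> \<le> lpi p M\<phi> (\<lambda>s. \<rho> s *\<^sub>R \<phi> s)"
  "memLp p M\<phi> \<phi> \<Longrightarrow> lpi p M\<phi> (\<lambda>s. \<rho> s *\<^sub>R \<phi> s) \<le> (1 + V 0) * lpi p M\<phi> \<phi>" for \<phi> :: "real \<Rightarrow> 'a"
proof -
  assume m: "memLp p M\<phi> \<phi>"
  note i = memLp_integrable[OF m] memLp_integrable[OF memLp_\<rho>[OF m]]
  show "lpi p M\<phi> \<phi> \<le> lpi p M\<phi> (\<lambda>s. \<rho> s *\<^sub>R \<phi> s)"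
  proof (rule integral_mono[OF i])
    show "norm (\<phi> s) powr p \<le> norm (\<rho> s *\<^sub>R \<phi> s) powr p" for s
      unfolding norm_\<rho> using mult_right_mono[of 1 "1 + V s" "norm (\<phi> s) powr p"] V_bounds(1)[of s] by simp
  qed
  have "lpi p M\<phi> (\<lambda>s. \<rho> s *\<^sub>R \<phi> s) \<le> (\<integral>s. (1 + V 0) * norm (\<phi> s) powr p \<partial>M\<phi>)"
  proof (rule integral_mono[OF i(2)])
    show "integrable M\<phi> (\<lambda>s. (1 + V 0) * norm (\<phi> s) powr p)" using i(1) by simp
    show "norm (\<rho> s *\<^sub>R \<phi> s) powr p \<le> (1 + V 0) * norm (\<phi> s) powr p" for s
      unfolding norm_\<rho> using V_bounds(2)[of s] by (intro mult_right_mono) auto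
  qed
  then show "lpi p M\<phi> (\<lambda>s. \<rho> s *\<^sub>R \<phi> s) \<le> (1 + V 0) * lpi p M\<phi> \<phi>" by simp
qed

definition state_pow :: "'a state \<Rightarrow> real" where
  "state_pow u = (case u of (x, f, \<phi>) \<Rightarrow>
     \<nu> x powr p + lpi p Mf (\<lambda>t. f t - scaleC (a t) x) + lpi p M\<phi> (\<lambda>s. \<rho> s *\<^sub>R \<phi> s))"

definition q :: "'a state \<Rightarrow> real" where
  "q u = state_pow u powr (1 / p)"

lemma state_pow_nonneg: "0 \<le> state_pow u"
  by (auto simp: state_pow_def split: prod.split intro!: add_nonneg_nonneg lpi_nonneg)

lemma q_nonneg: "0 \<le> q u" by (simp add: q_def)

lemma q_powr: "q u powr p = state_pow u"
  using p_facts state_pow_nonneg by (simp add: q_def root_powr)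

lemma a_memLp: "memLp p Mf (\<lambda>t. scaleC (a t) x)" "memLp p Mf (\<lambda>t. scaleC (a' t) x)" for x :: 'a
  using W1p_with_memLp[OF a_W] p_facts by (auto intro: memLp_scaleC_left)

lemma st_space_add: "u \<in> st_space p r \<Longrightarrow> v \<in> st_space p r \<Longrightarrow> u + v \<in> st_space p r" for u v :: "'a state"
  using p_facts by (cases u; cases v) (simp only: state_add state_space_Pair memLp_add(1) simp_thms)

lemma st_space_scale: "u \<in> st_space p r \<Longrightarrow> st_scale c u \<in> st_space p r" for u :: "'a state"
  using p_facts by (cases u) (simp only: st_scale_Pair state_space_Pair memLp_scaleC simp_thms)

lemma st_space_zero: "(0 :: 'a state) \<in> st_space p r"
  using memLp_zero by (auto simp: zero_prod_def zero_fun_def state_space_Pair)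

text \<open>The three parts are split with the same \<open>s\<close>, as
  \<open>root_triangle_of_split\<close> demands. The shift by \<open>a x\<close> is linear in the
  state and passes through the splitting.\<close>

lemma q_triangle:
  assumes u: "u \<in> st_space p r" and v: "v \<in> st_space p r"
  shows "q (u + v) \<le> q u + q v"
  unfolding q_def
proof (rule root_triangle_of_split)
  fix s :: real assume s: "0 < s" "s < 1"
  let ?s = "s powr (1 - p)" and ?t = "(1 - s) powr (1 - p)"
  obtain x f \<phi> y g \<psi> where uv: "u = (x, f, \<phi>)" "v = (y, g, \<psi>)" by (metis prod.exhaust)
  note m = u[unfolded uv state_space_Pair] v[unfolded uv state_space_Pair]
  have "\<nu> (x + y) powr p \<le> (\<nu> x + \<nu> y) powr p"
    using \<nu>_facts(3)[of x y] \<nu>_nonneg p by (intro powr_mono2) auto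
  also have "\<dots> \<le> ?s * \<nu> x powr p + ?t * \<nu> y powr p"
    using s p \<nu>_nonneg by (intro powr_convex_split) auto
  finally have 1: "\<nu> (x + y) powr p \<le> ?s * \<nu> x powr p + ?t * \<nu> y powr p" .
  have 2: "lpi p Mf (\<lambda>t. (f t - scaleC (a t) x) + (g t - scaleC (a t) y))
      \<le> ?s * lpi p Mf (\<lambda>t. f t - scaleC (a t) x) + ?t * lpi p Mf (\<lambda>t. g t - scaleC (a t) y)"
    using m a_memLp p_facts s by (intro lpi_split memLp_diff(1)) auto
  have 3: "lpi p M\<phi> (\<lambda>t. \<rho> t *\<^sub>R \<phi> t + \<rho> t *\<^sub>R \<psi> t)
      \<le> ?s * lpi p M\<phi> (\<lambda>t. \<rho> t *\<^sub>R \<phi> t) + ?t * lpi p M\<phi> (\<lambda>t. \<rho> t *\<^sub>R \<psi> t)"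
    using m p_facts s by (intro lpi_split memLp_\<rho>) auto
  have "(f t - scaleC (a t) x) + (g t - scaleC (a t) y) = (f t + g t) - scaleC (a t) (x + y)" for t
    by (simp add: scaleC_add_right algebra_simps)
  from 2[unfolded this] 1 3 show "state_pow (u + v) \<le> ?s * state_pow u + ?t * state_pow v"
    unfolding uv state_add state_pow_def prod.case scaleR_add_right distrib_left by linarith
qed (use p state_pow_nonneg in auto)

lemma q_scale: "q (st_scale c u) = cmod c * q u"
proof (cases u)
  case (fields x f \<phi>)
  have "scaleC c (f t) - scaleC (a t) (scaleC c x) = scaleC c (f t - scaleC (a t) x)" for t
    by (simp add: scaleC_diff_right scaleC_scaleC mult.commute)
  moreover have "\<rho> s *\<^sub>R scaleC c (\<phi> s) = scaleC c (\<rho> s *\<^sub>R \<phi> s)" for s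
    by (simp add: scaleC_scaleR_commute)
  ultimately have "state_pow (st_scale c u) = cmod c powr p * state_pow u"
    unfolding fields st_scale_Pair state_pow_def
    by (simp only: prod.case lpi_scaleC \<nu>_facts(4) powr_mult distrib_left)
  then show ?thesis using p by (simp add: q_def powr_mult powr_powr)
qed

definition a_pow :: real where "a_pow = lpi p Mf a"

lemma a_pow_nonneg: "0 \<le> a_pow" by (simp add: a_pow_def)

lemma state_sum_le_pow:
  assumes u: "u \<in> st_space p r"
  shows "state_sum p r u \<le> (2 + 2 powr p * (1 + a_pow)) * state_pow u"
proof -
  obtain x f \<phi> where uf: "u = (x, f, \<phi>)" by (metis prod.exhaust)
  note m = u[unfolded uf state_space_Pair]
  let ?P1 = "\<nu> x powr p" and ?P2 = "lpi p Mf (\<lambda>t. f t - scaleC (a t) x)" and ?P3 = "lpi p M\<phi> (\<lambda>s. \<rho> s *\<^sub>R \<phi> s)"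
  have P: "state_pow u = ?P1 + ?P2 + ?P3" by (simp add: uf state_pow_def)
  have nn: "0 \<le> ?P1" "0 \<le> ?P2" "0 \<le> ?P3" by (auto intro: lpi_nonneg)
  have 1: "norm x powr p \<le> ?P1" using \<nu>_facts(1)[of x] p by (intro powr_mono2) auto
  have "lpi p Mf (\<lambda>t. (f t - scaleC (a t) x) + scaleC (a t) x)
      \<le> 2 powr p * (?P2 + lpi p Mf (\<lambda>t. scaleC (a t) x))"
    using m a_memLp p_facts by (intro memLp_add(2) memLp_diff(1)) auto
  also have "\<dots> = 2 powr p * (?P2 + norm x powr p * a_pow)" by (simp only: lpi_scaleC_left a_pow_def)
  also have "\<dots> \<le> 2 powr p * (state_pow u + state_pow u * a_pow)"
    by (intro mult_left_mono add_mono mult_right_mono a_pow_nonneg) (use 1 nn P in \<open>linarith+\<close>, simp)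
  finally have 2: "lpi p Mf f \<le> 2 powr p * (1 + a_pow) * state_pow u" by (simp add: algebra_simps)
  have 3: "lpi p M\<phi> \<phi> \<le> ?P3" using m by (intro lpi_\<rho>(1)) auto
  have "state_sum p r u = norm x powr p + lpi p Mf f + lpi p M\<phi> \<phi>" by (simp add: uf state_sum_def)
  also have "\<dots> \<le> state_pow u + 2 powr p * (1 + a_pow) * state_pow u + state_pow u"
    using 1 2 3 nn P by linarith
  finally show ?thesis by (simp add: algebra_simps)
qed

lemma state_pow_le_sum:
  assumes u: "u \<in> st_space p r"
  shows "state_pow u \<le> (M powr p + 2 powr p * (1 + a_pow) + (1 + V 0)) * state_sum p r u"
proof -
  obtain x f \<phi> where uf: "u = (x, f, \<phi>)" by (metis prod.exhaust)
  note m = u[unfolded uf state_space_Pair]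
  have S: "state_sum p r u = norm x powr p + lpi p Mf f + lpi p M\<phi> \<phi>" by (simp add: uf state_sum_def)
  have nn: "0 \<le> norm x powr p" "0 \<le> lpi p Mf f" "0 \<le> lpi p M\<phi> \<phi>" by (auto intro: lpi_nonneg)
  have "\<nu> x powr p \<le> (M * norm x) powr p" using \<nu>_facts(2)[of x] \<nu>_nonneg p by (intro powr_mono2) auto
  also have "\<dots> = M powr p * norm x powr p" using M by (simp add: powr_mult)
  also have "\<dots> \<le> M powr p * state_sum p r u" using S nn by (intro mult_left_mono) auto
  finally have 1: "\<nu> x powr p \<le> M powr p * state_sum p r u" .
  have "lpi p Mf (\<lambda>t. f t - scaleC (a t) x) \<le> 2 powr p * (lpi p Mf f + lpi p Mf (\<lambda>t. scaleC (a t) x))"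
    using m a_memLp p_facts by (intro memLp_diff(2)) auto
  also have "\<dots> = 2 powr p * (lpi p Mf f + norm x powr p * a_pow)" by (simp only: lpi_scaleC_left a_pow_def)
  also have "\<dots> \<le> 2 powr p * (state_sum p r u + state_sum p r u * a_pow)"
    by (intro mult_left_mono add_mono mult_right_mono a_pow_nonneg) (use nn S in \<open>linarith+\<close>, simp)
  finally have 2: "lpi p Mf (\<lambda>t. f t - scaleC (a t) x) \<le> 2 powr p * (1 + a_pow) * state_sum p r u" by (simp add: algebra_simps)
  have "lpi p M\<phi> (\<lambda>s. \<rho> s *\<^sub>R \<phi> s) \<le> (1 + V 0) * lpi p M\<phi> \<phi>" using m by (intro lpi_\<rho>(2)) auto
  also have "\<dots> \<le> (1 + V 0) * state_sum p r u" using S nn V_bounds(1)[of 0] by (intro mult_left_mono) auto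
  finally have 3: "lpi p M\<phi> (\<lambda>s. \<rho> s *\<^sub>R \<phi> s) \<le> (1 + V 0) * state_sum p r u" .
  have "state_pow u = \<nu> x powr p + lpi p Mf (\<lambda>t. f t - scaleC (a t) x) + lpi p M\<phi> (\<lambda>s. \<rho> s *\<^sub>R \<phi> s)"
    by (simp add: uf state_pow_def)
  also have "\<dots> \<le> M powr p * state_sum p r u + 2 powr p * (1 + a_pow) * state_sum p r u + (1 + V 0) * state_sum p r u"
    using 1 2 3 by linarith
  finally show ?thesis by (simp add: algebra_simps)
qed

lemma state_sum_equiv:
  obtains C where "1 \<le> C" "\<And>u. u \<in> st_space p r \<Longrightarrow> state_sum p r u \<le> C * state_pow u"
    "\<And>u. u \<in> st_space p r \<Longrightarrow> state_pow u \<le> C * state_sum p r u"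
proof -
  define C1 C2 where "C1 = 2 + 2 powr p * (1 + a_pow)" and "C2 = M powr p + 2 powr p * (1 + a_pow) + (1 + V 0)"
  have C: "1 \<le> C1" "1 \<le> C2" using a_pow_nonneg V_bounds(1)[of 0] by (auto simp: C1_def C2_def)
  show thesis
  proof (rule that[of "max C1 C2"])
    fix u :: "'a state" assume u: "u \<in> st_space p r"
    show "state_sum p r u \<le> max C1 C2 * state_pow u"
      using state_sum_le_pow[OF u, folded C1_def] mult_right_mono[of C1 "max C1 C2" "state_pow u"] state_pow_nonneg[of u] by simp
    show "state_pow u \<le> max C1 C2 * state_sum p r u"
      using state_pow_le_sum[OF u, folded C2_def] mult_right_mono[of C2 "max C1 C2" "state_sum p r u"] state_sum_nonneg[of p r u] by simp
  qed (use C in simp)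
qed

lemma norm_equiv:
  obtains B where "0 < B" "\<And>u. u \<in> st_space p r \<Longrightarrow> st_norm p r u \<le> B * q u"
    "\<And>u. u \<in> st_space p r \<Longrightarrow> q u \<le> B * st_norm p r u"
proof -
  obtain C where C: "1 \<le> C" "\<And>u. u \<in> st_space p r \<Longrightarrow> state_sum p r u \<le> C * state_pow u"
    "\<And>u. u \<in> st_space p r \<Longrightarrow> state_pow u \<le> C * state_sum p r u" by (rule state_sum_equiv) blast
  define B where "B = 3 * C powr (1 / p) + (C * 3) powr (1 / p)"
  show thesis
  proof (rule that[of B])
    show "0 < B" using C(1) by (auto simp: B_def intro!: add_pos_nonneg)
    fix u :: "'a state" assume u: "u \<in> st_space p r"
    have n0: "0 \<le> st_norm p r u" by (cases u) (simp add: st_norm_def Lpnorm_def)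
    have "st_norm p r u \<le> 3 * state_sum p r u powr (1 / p)" using p_facts by (intro norm_le_state_sum) auto
    also have "\<dots> \<le> 3 * (C * state_pow u) powr (1 / p)"
      using C(2)[OF u] state_sum_nonneg[of p r u] p by (intro mult_left_mono powr_mono2) auto
    also have "\<dots> = 3 * C powr (1 / p) * q u" using C(1) state_pow_nonneg[of u] by (simp add: powr_mult q_def)
    also have "\<dots> \<le> B * q u" using q_nonneg by (intro mult_right_mono) (auto simp: B_def)
    finally show "st_norm p r u \<le> B * q u" .
    have "q u \<le> (C * (3 * st_norm p r u powr p)) powr (1 / p)"
      unfolding q_def using C(1) C(3)[OF u] state_sum_le_norm[of p r u] p state_pow_nonneg
      by (intro powr_mono2) (auto intro: order_trans mult_left_mono)
    also have "\<dots> = (C * 3) powr (1 / p) * (st_norm p r u powr p) powr (1 / p)"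
      using C(1) by (simp add: powr_mult mult.assoc)
    also have "\<dots> = (C * 3) powr (1 / p) * st_norm p r u" using n0 p by (simp add: powr_powr)
    also have "\<dots> \<le> B * st_norm p r u" using n0 by (intro mult_right_mono) (auto simp: B_def)
    finally show "q u \<le> B * st_norm p r u" .
  qed
qed

lemma q_less_iff: "0 < \<epsilon> \<Longrightarrow> q u < \<epsilon> \<longleftrightarrow> state_pow u < \<epsilon> powr p"
  using q_powr[of u] q_nonneg[of u] p powr_less_mono2[of p "q u" \<epsilon>] powr_mono2[of p \<epsilon> "q u"] by force

lemma q_complete:
  assumes s: "\<And>n. s n \<in> st_space p r"
    and Cauchy: "\<And>\<epsilon>. \<epsilon> > 0 \<Longrightarrow> \<exists>n0. \<forall>m\<ge>n0. \<forall>n\<ge>n0. q (s m - s n) < \<epsilon>"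
  shows "\<exists>l\<in>st_space p r. (\<lambda>n. q (s n - l)) \<longlonglongrightarrow> 0"
proof -
  obtain C where C: "1 \<le> C" "\<And>u. u \<in> st_space p r \<Longrightarrow> state_sum p r u \<le> C * state_pow u"
    "\<And>u. u \<in> st_space p r \<Longrightarrow> state_pow u \<le> C * state_sum p r u" by (rule state_sum_equiv) blast
  have diff: "u - v \<in> st_space p r" if "u \<in> st_space p r" "v \<in> st_space p r" for u v :: "'a state"
    using st_space_add[OF that(1) st_space_scale[OF that(2), of "-1"]]
    by (simp add: vsub_st[symmetric] vsub_def st_add_eq_plus)
  have "\<exists>l\<in>st_space p r. (\<lambda>n. state_sum p r (s n - l)) \<longlonglongrightarrow> 0"
  proof (rule state_sum_complete[OF s p_facts(3)])
    fix \<epsilon> :: real assume "\<epsilon> > 0"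
    then have e: "0 < (\<epsilon> / C) powr (1 / p)" "((\<epsilon> / C) powr (1 / p)) powr p = \<epsilon> / C"
      using C(1) p by (auto simp: powr_powr)
    obtain n0 where n0: "\<And>m n. m \<ge> n0 \<Longrightarrow> n \<ge> n0 \<Longrightarrow> q (s m - s n) < (\<epsilon> / C) powr (1 / p)"
      using Cauchy[OF e(1)] by blast
    have "state_sum p r (s m - s n) < \<epsilon>" if "m \<ge> n0" "n \<ge> n0" for m n
    proof -
      have "state_sum p r (s m - s n) \<le> C * state_pow (s m - s n)" by (intro C(2) diff s)
      also have "\<dots> < C * (\<epsilon> / C)"
        using n0[OF that] C(1) by (intro mult_strict_left_mono) (auto simp: q_less_iff[OF e(1)] e(2))
      finally show ?thesis using C(1) by simp
    qed
    then show "\<exists>n0. \<forall>m\<ge>n0. \<forall>n\<ge>n0. state_sum p r (s m - s n) < \<epsilon>" by blast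
  qed
  then obtain l where l: "l \<in> st_space p r" "(\<lambda>n. state_sum p r (s n - l)) \<longlonglongrightarrow> 0" by blast
  have "(\<lambda>n. C * state_sum p r (s n - l)) \<longlonglongrightarrow> 0" using tendsto_mult_left[OF l(2), of C] by simp
  then have "(\<lambda>n. state_pow (s n - l)) \<longlonglongrightarrow> 0"
    by (rule Lim_null_comparison[rotated]) (auto simp: state_pow_nonneg intro!: always_eventually C(3) diff s l)
  from tendsto_powr'[OF this tendsto_const[of "1 / p"]] have "(\<lambda>n. q (s n - l)) \<longlonglongrightarrow> 0"
    using p by (simp add: q_def state_pow_nonneg)
  then show ?thesis using l by blast
qed

end

section \<open>The graph of the operator and its density\<close>

context delay_system
begin

definition Gr :: "('a state \<times> 'a state) set" where
  "Gr = {((x, f, \<phi>), (y, \<eta>, \<psi>)). x \<in> DA \<and> \<phi> 0 = x \<and> y = A x + f 0 + RS_integral \<mu> \<phi> (-r) 0 \<and>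
     W1p_with p {-r..0} \<phi> \<psi> \<and> (\<exists>f'. W1p_with p {0..} f f' \<and> \<eta> = (\<lambda>t. scaleC (a t) (A x) + f' t))}"

lemma Gr_iff: "((x, f, \<phi>), (y, \<eta>, \<psi>)) \<in> Gr \<longleftrightarrow>
    x \<in> DA \<and> \<phi> 0 = x \<and> y = A x + f 0 + RS_integral \<mu> \<phi> (-r) 0 \<and> W1p_with p {-r..0} \<phi> \<psi> \<and>
    W1p_with p {0..} f (\<lambda>t. \<eta> t - scaleC (a t) (A x))"
proof -
  have "\<eta> = (\<lambda>t. scaleC (a t) (A x) + f' t) \<longleftrightarrow> f' = (\<lambda>t. \<eta> t - scaleC (a t) (A x))" for f'
    by (auto simp: fun_eq_iff)
  then show ?thesis by (simp add: Gr_def)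
qed

lemma has_RS: "W1p_with p {-r..0} \<phi> \<psi> \<Longrightarrow> has_RS_integral \<mu> \<phi> (-r) 0 (RS_integral \<mu> \<phi> (-r) 0)" for \<phi> :: "real \<Rightarrow> 'a"
proof -
  assume W: "W1p_with p {-r..0} \<phi> \<psi>"
  have "\<exists>I. has_RS_integral \<mu> \<phi> (-r) 0 I"
  proof (rule has_RS_integral_exists[OF p_facts(4) \<mu>_bv])
    show "(\<psi> has_integral \<phi> u - \<phi> s) {s..u}" if "-r \<le> s" "s \<le> u" "u \<le> 0" for s u
      using that by (intro W1p_with_has_integral[OF W]) auto
    show "integrable M\<phi> (\<lambda>s. norm (\<psi> s))"
      using W1p_with_memLp[OF W] p_facts by (intro memLp_Icc(4)[of p "{-r..0}"]) auto
  qed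
  then show ?thesis using RS_integral_eq[OF _ p_facts(4)] by blast
qed

lemma RS_add: "W1p_with p {-r..0} \<phi> \<psi> \<Longrightarrow> W1p_with p {-r..0} \<phi>' \<psi>' \<Longrightarrow>
    RS_integral \<mu> (\<lambda>s. \<phi> s + \<phi>' s) (-r) 0 = RS_integral \<mu> \<phi> (-r) 0 + RS_integral \<mu> \<phi>' (-r) 0" for \<phi> \<phi>' :: "real \<Rightarrow> 'a"
  by (intro RS_integral_eq[OF _ p_facts(4)] RS_integral_add has_RS)

lemma RS_scaleC: "W1p_with p {-r..0} \<phi> \<psi> \<Longrightarrow>
    RS_integral \<mu> (\<lambda>s. scaleC c (\<phi> s)) (-r) 0 = scaleC c (RS_integral \<mu> \<phi> (-r) 0)" for \<phi> :: "real \<Rightarrow> 'a"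
  by (intro RS_integral_eq[OF _ p_facts(4)] RS_integral_scaleC has_RS \<mu>_scaleC)

lemma Gr_space:
  assumes "(u, v) \<in> Gr"
  shows "u \<in> st_space p r \<and> v \<in> st_space p r"
proof -
  obtain x f \<phi> y \<eta> \<psi> where uv: "u = (x, f, \<phi>)" "v = (y, \<eta>, \<psi>)" by (metis prod.exhaust)
  note G = assms[unfolded uv Gr_iff]
  have "memLp p Mf (\<lambda>t. (\<eta> t - scaleC (a t) (A x)) + scaleC (a t) (A x))"
    using G by (intro memLp_add(1)[OF conjunct2[OF W1p_with_memLp] a_memLp(1) p_facts(2)]) auto
  then show ?thesis using G W1p_with_memLp unfolding uv state_space_Pair by auto
qed

lemma Gr_plus:
  assumes "(u, v) \<in> Gr" "(u', v') \<in> Gr"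
  shows "(u + u', v + v') \<in> Gr"
proof -
  obtain x f \<phi> y \<eta> \<psi> where uv: "u = (x, f, \<phi>)" "v = (y, \<eta>, \<psi>)" by (metis prod.exhaust)
  obtain x' f' \<phi>' y' \<eta>' \<psi>' where uv': "u' = (x', f', \<phi>')" "v' = (y', \<eta>', \<psi>')" by (metis prod.exhaust)
  note G = assms(1)[unfolded uv Gr_iff] and G' = assms(2)[unfolded uv' Gr_iff]
  have A: "x + x' \<in> DA" "A (x + x') = A x + A x'" using A_scaleC_add G G' by auto
  have "W1p_with p {0..} (\<lambda>t. f t + f' t) (\<lambda>t. (\<eta> t - scaleC (a t) (A x)) + (\<eta>' t - scaleC (a t) (A x')))"
    using G G' p_facts by (intro W1p_with_add) auto
  moreover have "(\<eta> t - scaleC (a t) (A x)) + (\<eta>' t - scaleC (a t) (A x')) = (\<eta> t + \<eta>' t) - scaleC (a t) (A (x + x'))" for t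
    by (simp add: A scaleC_add_right)
  moreover have "W1p_with p {-r..0} (\<lambda>t. \<phi> t + \<phi>' t) (\<lambda>t. \<psi> t + \<psi>' t)"
    using G G' p_facts by (intro W1p_with_add) auto
  moreover have "y + y' = A (x + x') + (f 0 + f' 0) + RS_integral \<mu> (\<lambda>s. \<phi> s + \<phi>' s) (-r) 0"
    using G G' by (simp add: A RS_add[of \<phi> \<psi> \<phi>' \<psi>'])
  ultimately show ?thesis unfolding uv uv' state_add Gr_iff using A G G' by (simp del: add_Pair)
qed

lemma Gr_scale:
  assumes "(u, v) \<in> Gr"
  shows "(st_scale c u, st_scale c v) \<in> Gr"
proof -
  obtain x f \<phi> y \<eta> \<psi> where uv: "u = (x, f, \<phi>)" "v = (y, \<eta>, \<psi>)" by (metis prod.exhaust)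
  note G = assms(1)[unfolded uv Gr_iff]
  have A: "scaleC c x \<in> DA" "A (scaleC c x) = scaleC c (A x)" using A_scaleC G by auto
  have "W1p_with p {0..} (\<lambda>t. scaleC c (f t)) (\<lambda>t. scaleC c (\<eta> t - scaleC (a t) (A x)))"
    using G p_facts by (intro W1p_with_bounded_linear[OF _ bounded_linear_scaleC]) auto
  moreover have "scaleC c (\<eta> t - scaleC (a t) (A x)) = scaleC c (\<eta> t) - scaleC (a t) (A (scaleC c x))" for t
    by (simp add: A scaleC_diff_right scaleC_scaleC mult.commute)
  moreover have "W1p_with p {-r..0} (\<lambda>t. scaleC c (\<phi> t)) (\<lambda>t. scaleC c (\<psi> t))"
    using G p_facts by (intro W1p_with_bounded_linear[OF _ bounded_linear_scaleC]) auto
  moreover have "scaleC c y = A (scaleC c x) + scaleC c (f 0) + RS_integral \<mu> (\<lambda>s. scaleC c (\<phi> s)) (-r) 0"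
    using G by (simp add: A RS_scaleC[of \<phi> \<psi>] scaleC_add_right)
  ultimately show ?thesis unfolding uv st_scale_Pair Gr_iff using A G by simp
qed

text \<open>Approximating the components separately breaks the coupling \<open>\<phi> 0 = x\<close>.
  It is repaired by a boundary layer \<open>e\<close>, the exponential solving e = h e' with the
  mismatch \<open>z\<close> as value at zero; the growth estimate bounds its p-th power integral by
  \<open>h * norm z powr p\<close>.\<close>

lemma Gr_dense:
  assumes v: "v \<in> st_space p r" and \<epsilon>: "\<epsilon> > 0"
  shows "\<exists>u w. (u, w) \<in> Gr \<and> q (v - u) < \<epsilon>"
proof -
  obtain C where C: "1 \<le> C" "\<And>u. u \<in> st_space p r \<Longrightarrow> state_pow u \<le> C * state_sum p r u"
    by (rule state_sum_equiv) blast
  obtain x f \<phi> where vf: "v = (x, f, \<phi>)" by (metis prod.exhaust)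
  note m = v[unfolded vf state_space_Pair]
  \<comment> \<open>The errors add up to \<open>d + d + 2 powr p * (d + d)\<close>, the last part
    from the history component and its boundary layer; \<open>C\<close> is the price of the new
    norm.\<close>
  define d where "d = \<epsilon> powr p / C / (2 + 2 * 2 powr p)"
  have "0 < 2 + 2 * 2 powr p" by (intro add_pos_nonneg) auto
  then have d: "0 < d" "C * ((2 + 2 * 2 powr p) * d) = \<epsilon> powr p" using C(1) \<epsilon> by (auto simp: d_def)
  obtain x1 where x1: "x1 \<in> DA" "norm (x - x1) < d powr (1 / p)" using DA_dense[of "d powr (1 / p)" x] d by auto
  have x1': "norm (x - x1) powr p < d"
    using powr_less_mono2[OF p_facts(1) _ x1(2)] d p_facts by (simp add: root_powr)
  obtain f1 f1' where f1: "W1p_with p {0..} f1 f1'" "lpi p Mf (\<lambda>t. f t - f1 t) < d"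
    using W1p_dense[of "{0..}" p f d] m p_facts d by auto
  obtain \<phi>1 \<phi>1' where \<phi>1: "W1p_with p {-r..0} \<phi>1 \<phi>1'" "lpi p M\<phi> (\<lambda>t. \<phi> t - \<phi>1 t) < d"
    using W1p_dense[of "{-r..0}" p \<phi> d] m p_facts d by auto
  define z where "z = x1 - \<phi>1 0"
  define h where "h = d / (norm z powr p + 1)"
  have z1: "0 < norm z powr p + 1" by (intro add_nonneg_pos) auto
  have h: "0 < h" "h * norm z powr p < d" using d z1 by (auto simp: h_def field_simps)
  obtain e where e: "W1p_with p {-r..0} e (\<lambda>s. (1 / h) *\<^sub>R (e s - 0))" "e 0 = z"
    using ode_Icc[OF memLp_zero p_facts(3) h(1), of "-r" 0 z] r by auto
  have "norm (e (-r)) powr p + (1 / h) * (integral {-r..0} (\<lambda>\<tau>. norm (e \<tau>) powr p)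
      - integral {-r..0} (\<lambda>\<tau>. norm (e \<tau> - h *\<^sub>R ((1 / h) *\<^sub>R (e \<tau> - 0))) powr p)) \<le> norm (e 0) powr p"
    using r by (intro W1p_with_growth[OF e(1) p_facts(3) h(1)]) auto
  then have "(1 / h) * integral {-r..0} (\<lambda>\<tau>. norm (e \<tau>) powr p) \<le> norm z powr p - norm (e (-r)) powr p"
    using h e(2) by simp
  also have "\<dots> \<le> norm z powr p" by simp
  finally have "integral {-r..0} (\<lambda>\<tau>. norm (e \<tau>) powr p) \<le> h * norm z powr p"
    using h by (simp add: field_simps)
  moreover have "lpi p M\<phi> e = integral {-r..0} (\<lambda>\<tau>. norm (e \<tau>) powr p)"
    using W1p_with_memLp[OF e(1)] by (intro lebesgue_integral_eq_integral memLp_integrable) auto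
  ultimately have le: "lpi p M\<phi> e < d" using h by linarith
  let ?\<phi> = "\<lambda>s. \<phi>1 s + e s"
  have W\<phi>: "W1p_with p {-r..0} ?\<phi> (\<lambda>s. \<phi>1' s + (1 / h) *\<^sub>R (e s - 0))"
    using \<phi>1 e p_facts by (intro W1p_with_add) auto
  let ?u = "(x1, f1, ?\<phi>)"
  have "(?u, (A x1 + f1 0 + RS_integral \<mu> ?\<phi> (-r) 0, \<lambda>t. scaleC (a t) (A x1) + f1' t, \<lambda>s. \<phi>1' s + (1 / h) *\<^sub>R (e s - 0))) \<in> Gr"
    unfolding Gr_iff using W\<phi> f1(1) x1 e(2) by (simp add: z_def)
  moreover have "q (v - ?u) < \<epsilon>"
  proof -
    have me: "memLp p M\<phi> e" "memLp p M\<phi> (\<lambda>s. \<phi> s - \<phi>1 s)"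
      using m e(1) \<phi>1(1) W1p_with_memLp p_facts by (auto intro!: memLp_diff(1))
    have "lpi p M\<phi> (\<lambda>s. (\<phi> s - \<phi>1 s) - e s) \<le> 2 powr p * (lpi p M\<phi> (\<lambda>s. \<phi> s - \<phi>1 s) + lpi p M\<phi> e)"
      using me p_facts by (intro memLp_diff(2)) auto
    also have "\<dots> < 2 powr p * (d + d)" using \<phi>1(2) le by (intro mult_strict_left_mono) auto
    finally have "lpi p M\<phi> (\<lambda>s. \<phi> s - (\<phi>1 s + e s)) < 2 powr p * (d + d)" by (simp add: algebra_simps)
    then have "state_sum p r (v - ?u) < d + d + 2 powr p * (d + d)"
      unfolding vf state_diff state_sum_def prod.case using x1' f1(2) by linarith
    then have S: "state_sum p r (v - ?u) < (2 + 2 * 2 powr p) * d" by (simp add: algebra_simps)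
    have "v - ?u \<in> st_space p r"
      unfolding vf state_diff state_space_Pair
      using m f1(1) W\<phi> W1p_with_memLp p_facts by (auto intro!: memLp_diff(1))
    then have "state_pow (v - ?u) \<le> C * state_sum p r (v - ?u)" by (rule C(2))
    also have "\<dots> < C * ((2 + 2 * 2 powr p) * d)" using S C(1) by (intro mult_strict_left_mono) auto
    finally show ?thesis using \<epsilon> by (simp add: q_less_iff d(2))
  qed
  ultimately show ?thesis by blast
qed

end

section \<open>Dissipativity of the graph\<close>

context delay_system
begin

text \<open>Here \<open>y\<close> is a perturbation of size \<open>h\<close>. Dividing by
  \<open>(1 - h * \<omega>) powr p\<close> costs \<open>exp (2 * p * \<omega> * h)\<close>; in front
  of \<open>y\<close> this is estimated by \<open>exp p\<close>, which
  \<open>h * \<omega> \<le> 1 / 2\<close> permits.\<close>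

lemma dissipative_x:
  assumes x: "x \<in> DA" and eq: "x - h *\<^sub>R A x = \<xi> + h *\<^sub>R y"
    and h: "0 < h" "0 < \<kappa>" "h * \<kappa> \<le> 1 / 2" "h * \<omega> \<le> 1 / 2"
  shows "\<nu> x powr p \<le> exp (2 * p * \<omega> * h + 2 * (p - 1) * \<kappa> * h) * \<nu> \<xi> powr p
    + h * (\<kappa> powr (1 - p) * (exp p * M powr p) * norm y powr p)"
proof -
  let ?s = "1 - h * \<omega>"
  have s: "0 < ?s" using h by simp
  have "?s * \<nu> x \<le> \<nu> (\<xi> + h *\<^sub>R y)" using renorm_dissipative[OF M \<omega> T_bound x h(1)] eq by simp
  also have "\<dots> \<le> \<nu> \<xi> + h * \<nu> y" using \<nu>_facts(3)[of \<xi> "h *\<^sub>R y"] h by (simp add: \<nu>_facts(5))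
  also have "\<dots> \<le> \<nu> \<xi> + h * (M * norm y)" using \<nu>_facts(2)[of y] h by simp
  finally have "(?s * \<nu> x) powr p \<le> (\<nu> \<xi> + h * (M * norm y)) powr p"
    using s \<nu>_nonneg p by (intro powr_mono2) auto
  also have "\<dots> \<le> exp (2 * (p - 1) * \<kappa> * h) * \<nu> \<xi> powr p + h * \<kappa> powr (1 - p) * (M * norm y) powr p"
    using \<nu>_nonneg M h p by (intro powr_perturbation) auto
  finally have *: "?s powr p * \<nu> x powr p \<le> exp (2 * (p - 1) * \<kappa> * h) * \<nu> \<xi> powr p + h * \<kappa> powr (1 - p) * (M powr p * norm y powr p)"
    by (simp add: powr_mult)
  have e: "?s powr (- p) \<le> exp (2 * p * \<omega> * h)" "exp (2 * p * \<omega> * h) \<le> exp p"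
    using powr_neg_le_exp[of "h * \<omega>" p] h \<omega> p mult_left_mono[OF h(4), of "2 * p"] by (auto simp: mult_ac)
  have "\<nu> x powr p = ?s powr (- p) * (?s powr p * \<nu> x powr p)"
    using s by (simp add: powr_minus)
  also have "\<dots> \<le> exp (2 * p * \<omega> * h) * (exp (2 * (p - 1) * \<kappa> * h) * \<nu> \<xi> powr p + h * \<kappa> powr (1 - p) * (M powr p * norm y powr p))"
    using e(1) * by (intro mult_mono) auto
  also have "\<dots> = exp (2 * p * \<omega> * h + 2 * (p - 1) * \<kappa> * h) * \<nu> \<xi> powr p + exp (2 * p * \<omega> * h) * (h * \<kappa> powr (1 - p) * (M powr p * norm y powr p))"
    by (simp add: exp_add distrib_left mult.assoc)
  also have "exp (2 * p * \<omega> * h) * (h * \<kappa> powr (1 - p) * (M powr p * norm y powr p)) \<le> exp p * (h * \<kappa> powr (1 - p) * (M powr p * norm y powr p))"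
    using e(2) h by (intro mult_right_mono) auto
  finally show ?thesis by (simp add: mult_ac)
qed

definition a'_pow :: real where "a'_pow = lpi p Mf a'"

lemma dissipative_f:
  assumes f: "W1p_with p {0..} f (\<lambda>t. \<eta>' t - scaleC (a t) (A x))" and eq: "x - h *\<^sub>R A x = \<xi> + h *\<^sub>R y"
    and \<eta>: "\<eta> = (\<lambda>t. f t - h *\<^sub>R \<eta>' t)" "memLp p Mf \<eta>"
    and h: "0 < h" "0 < \<kappa>" "h * \<kappa> \<le> 1 / 2"
  shows "lpi p Mf (\<lambda>t. f t - scaleC (a t) x) + h * norm (f 0 - scaleC (a 0) x) powr p
    \<le> exp (2 * (p - 1) * \<kappa> * h) * lpi p Mf (\<lambda>t. \<eta> t - scaleC (a t) \<xi>)
      + h * (\<kappa> powr (1 - p) * (2 powr p * (norm x powr p * a'_pow + norm y powr p * a_pow)))"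
proof -
  let ?g = "\<lambda>t. f t - scaleC (a t) x" and ?g' = "\<lambda>t. (\<eta>' t - scaleC (a t) (A x)) - scaleC (a' t) x"
  have W: "W1p_with p {0..} ?g ?g'"
    using f a_W p_facts by (intro W1p_with_diff W1p_with_bounded_linear[OF _ bounded_linear_scaleC_left]) auto
  have xi: "\<xi> = x - h *\<^sub>R A x - h *\<^sub>R y" using eq by (simp add: algebra_simps)
  \<comment> \<open>Expressing \<open>x - h *\<^sub>R A x\<close> through \<open>\<xi>\<close> and
    \<open>y\<close> removes \<open>A x\<close>. At order \<open>h\<close> only \<open>a' x\<close>
    and \<open>a y\<close> remain.\<close>
  have eq': "?g t - h *\<^sub>R ?g' t = (\<eta> t - scaleC (a t) \<xi>) + h *\<^sub>R (scaleC (a' t) x - scaleC (a t) y)" for t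
    unfolding \<eta> xi by (simp add: scaleC_diff_right scaleC_scaleR_commute scaleR_diff_right)
  have m: "memLp p Mf (\<lambda>t. \<eta> t - scaleC (a t) \<xi>)" "memLp p Mf (\<lambda>t. scaleC (a' t) x - scaleC (a t) y)"
    using \<eta>(2) a_memLp p_facts by (auto intro!: memLp_diff(1))
  have "lpi p Mf ?g + h * norm (?g 0) powr p \<le> lpi p Mf (\<lambda>t. ?g t - h *\<^sub>R ?g' t)"
    by (rule W1p_with_halfline_estimate[OF W p_facts(3) h(1)])
  also have "\<dots> = lpi p Mf (\<lambda>t. (\<eta> t - scaleC (a t) \<xi>) + h *\<^sub>R (scaleC (a' t) x - scaleC (a t) y))"
    unfolding eq' ..
  also have "\<dots> \<le> exp (2 * (p - 1) * \<kappa> * h) * lpi p Mf (\<lambda>t. \<eta> t - scaleC (a t) \<xi>)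
      + h * \<kappa> powr (1 - p) * lpi p Mf (\<lambda>t. scaleC (a' t) x - scaleC (a t) y)"
    by (rule lpi_perturbation[OF m h p_facts(3)])
  also have "lpi p Mf (\<lambda>t. scaleC (a' t) x - scaleC (a t) y)
      \<le> 2 powr p * (lpi p Mf (\<lambda>t. scaleC (a' t) x) + lpi p Mf (\<lambda>t. scaleC (a t) y))"
    by (rule memLp_diff(2)[OF a_memLp(2,1) p_facts(2)])
  also have "\<dots> = 2 powr p * (norm x powr p * a'_pow + norm y powr p * a_pow)"
    by (simp only: lpi_scaleC_left a_pow_def a'_pow_def)
  finally show ?thesis using h by (simp add: mult.assoc)
qed

lemma lpi_\<rho>_split:
  fixes \<phi> :: "real \<Rightarrow> 'a"
  assumes m: "memLp p M\<phi> \<phi>"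
  shows "lpi p M\<phi> (\<lambda>s. \<rho> s *\<^sub>R \<phi> s) = lpi p M\<phi> \<phi> + (\<integral>s. V s * norm (\<phi> s) powr p \<partial>M\<phi>)"
proof -
  have "\<bar>V s\<bar> \<le> V 0" for s using V_bounds[of s] by simp
  from bounded_mult_integrable[OF p_facts(4) \<mu>_bv V_measurable this memLp_integrable[OF m]]
  have "integrable M\<phi> (\<lambda>s. V s * norm (\<phi> s) powr p)" .
  then show ?thesis unfolding norm_\<rho> distrib_right using memLp_integrable[OF m] by simp
qed

text \<open>The unweighted growth estimate and \<open>RS_integral_powr_bound\<close> are added,
  according to the weight \<open>1 + V s\<close>. Using \<open>1 + V 0\<close> as the mass bound
  keeps it positive even if the variation vanishes.\<close>

lemma dissipative_\<phi>:
  fixes \<phi> :: "real \<Rightarrow> 'a"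
  assumes W: "W1p_with p {-r..0} \<phi> \<psi>'" and h: "0 < h" and \<psi>: "\<psi> = (\<lambda>t. \<phi> t - h *\<^sub>R \<psi>' t)"
  shows "lpi p M\<phi> (\<lambda>s. \<rho> s *\<^sub>R \<phi> s) + h * ((1 + V 0) powr (1 - p) * norm (RS_integral \<mu> \<phi> (-r) 0) powr p)
    \<le> lpi p M\<phi> (\<lambda>s. \<rho> s *\<^sub>R \<psi> s) + h * ((1 + V 0) * norm (\<phi> 0) powr p)"
proof -
  note m = W1p_with_memLp[OF W]
  have m\<psi>: "memLp p M\<phi> \<psi>" unfolding \<psi> using m p_facts by (intro memLp_diff(1) memLp_scaleR) auto
  have g: "norm (\<phi> (-r)) powr p + (1 / h) * (integral {-r..0} (\<lambda>\<tau>. norm (\<phi> \<tau>) powr p)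
      - integral {-r..0} (\<lambda>\<tau>. norm (\<psi> \<tau>) powr p)) \<le> norm (\<phi> 0) powr p"
    unfolding \<psi> by (rule W1p_with_growth[OF W p_facts(3) h]) (use r in auto)
  have i\<phi>: "integral {-r..0} (\<lambda>\<tau>. norm (\<phi> \<tau>) powr p) = lpi p M\<phi> \<phi>"
    using m by (intro lebesgue_integral_eq_integral[symmetric] memLp_integrable) auto
  have i\<psi>: "integral {-r..0} (\<lambda>\<tau>. norm (\<psi> \<tau>) powr p) = lpi p M\<phi> \<psi>"
    using m\<psi> by (intro lebesgue_integral_eq_integral[symmetric] memLp_integrable) auto
  have "0 \<le> norm (\<phi> (-r)) powr p" by simp
  with g[unfolded i\<phi> i\<psi>] have "(1 / h) * (lpi p M\<phi> \<phi> - lpi p M\<phi> \<psi>) \<le> norm (\<phi> 0) powr p" by linarith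
  then have 1: "lpi p M\<phi> \<phi> \<le> lpi p M\<phi> \<psi> + h * norm (\<phi> 0) powr p" using h by (simp add: field_simps)
  have "h * ((1 + V 0) powr (1 - p) * norm (RS_integral \<mu> \<phi> (-r) 0) powr p) + (\<integral>s. V s * norm (\<phi> s) powr p \<partial>M\<phi>)
    \<le> (\<integral>s. V s * norm (\<psi> s) powr p \<partial>M\<phi>) + h * (V 0 * norm (\<phi> 0) powr p)"
    unfolding \<psi> V_def
    by (rule RS_integral_powr_bound[OF p_facts(4) \<mu>_bv p_facts(3) h W has_RS[OF W]])
      (use V_bounds(1)[of 0] in \<open>auto simp: V_def\<close>)
  with 1 show ?thesis unfolding lpi_\<rho>_split[OF conjunct1[OF m]] lpi_\<rho>_split[OF m\<psi>]
    by (simp add: algebra_simps)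
qed

text \<open>A balance at order \<open>h\<close>. The losses are \<open>K * C1 * Y\<close> and
  multiples of \<open>X\<close>; the gains are \<open>G0\<close> from the half line and
  \<open>k * L0\<close> from the history interval. Since \<open>Y\<close> is at most
  \<open>4 powr p * (G0 + b * X + L0)\<close>, a small \<open>K\<close> lets the gains win, and what
  is left in \<open>X\<close> goes into the growth rate.\<close>

lemma Gr_dissipative:
  "\<exists>c h0. 0 \<le> c \<and> 0 < h0 \<and> (\<forall>u w h. (u, w) \<in> Gr \<longrightarrow> 0 < h \<longrightarrow> h \<le> h0 \<longrightarrow>
    q u \<le> exp (c * h) * q (u - st_scale (complex_of_real h) w))"
proof -
  define k where "k = (1 + V 0) powr (1 - p)"
  have V0: "0 \<le> V 0" by (rule V_bounds)
  have k: "0 < k" using V0 by (simp add: k_def)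
  define k0 where "k0 = min 1 k"
  have k0: "0 < k0" "k0 \<le> 1" "k0 \<le> k" using k by (auto simp: k0_def)
  define C1 where "C1 = exp p * M powr p + 2 powr p * a_pow"
  have C1: "0 < C1" unfolding C1_def using M a_pow_nonneg by (intro add_pos_nonneg) auto
  \<comment> \<open>The solution of \<open>\<kappa> powr (1 - p) * C1 * 4 powr p = k0\<close>, which
    exists because the exponent \<open>1 - p\<close> is nonzero.\<close>
  define \<kappa> where "\<kappa> = (k0 / (C1 * 4 powr p)) powr (1 / (1 - p))"
  have \<kappa>: "0 < \<kappa>" using k0 C1 by (simp add: \<kappa>_def)
  define K where "K = \<kappa> powr (1 - p)"
  have K: "0 \<le> K" "K * C1 * 4 powr p = k0" using k0 C1 p by (auto simp: K_def \<kappa>_def powr_powr)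
  define b where "b = cmod (a 0) powr p"
  define C3 where "C3 = K * 2 powr p * a'_pow + (1 + V 0) + k0 * b"
  have "0 \<le> a'_pow" by (simp add: a'_pow_def)
  then have C3: "0 \<le> C3" using K V0 k0 by (auto simp: C3_def b_def)
  define c where "c = 2 * p * \<omega> + 2 * (p - 1) * \<kappa>"
  have c: "0 \<le> c" using p \<omega> \<kappa> by (simp add: c_def)
  \<comment> \<open>Makes each of \<open>h * \<kappa>\<close>, \<open>h * \<omega>\<close> and
    \<open>h * C3\<close> at most \<open>1 / 2\<close>.\<close>
  define h0 where "h0 = 1 / (2 * (\<kappa> + \<omega> + C3))"
  have sum_pos: "0 < \<kappa> + \<omega> + C3" using \<kappa> \<omega> C3 by linarith
  have main: "q u \<le> exp ((c + 2 * C3) / p * h) * q (u - st_scale (complex_of_real h) w)"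
    if G: "(u, w) \<in> Gr" and h: "0 < h" "h \<le> h0" for u w h
  proof -
    have "h * (\<kappa> + \<omega> + C3) \<le> 1 / 2" using h(2) sum_pos by (simp add: h0_def field_simps)
    then have sum_le: "h * \<kappa> + h * \<omega> + h * C3 \<le> 1 / 2" by (simp add: distrib_left)
    have "0 \<le> h * \<kappa>" "0 \<le> h * \<omega>" "0 \<le> h * C3" using h \<kappa> \<omega> C3 by auto
    with sum_le have hs: "h * \<kappa> \<le> 1 / 2" "h * \<omega> \<le> 1 / 2" "h * C3 \<le> 1 / 2" "0 \<le> h * C3" by linarith+
    obtain x f \<phi> y \<eta>' \<psi>' where uw: "u = (x, f, \<phi>)" "w = (y, \<eta>', \<psi>')" by (metis prod.exhaust)
    note G' = G[unfolded uw Gr_iff]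
    define \<xi> \<eta> \<psi> where "\<xi> = x - h *\<^sub>R y" and "\<eta> = (\<lambda>t. f t - h *\<^sub>R \<eta>' t)" and "\<psi> = (\<lambda>t. \<phi> t - h *\<^sub>R \<psi>' t)"
    have v: "u - st_scale (complex_of_real h) w = (\<xi>, \<eta>, \<psi>)"
      unfolding uw st_scale_Pair state_diff \<xi>_def \<eta>_def \<psi>_def by (simp add: scaleR_scaleC)
    let ?L = "RS_integral \<mu> \<phi> (-r) 0"
    define y0 where "y0 = f 0 + ?L"
    have eq: "x - h *\<^sub>R A x = \<xi> + h *\<^sub>R y0"
      using G' by (simp add: \<xi>_def y0_def scaleR_add_right)
    have m\<eta>: "memLp p Mf \<eta>"
      using Gr_space[OF G] p_facts unfolding uw state_space_Pair \<eta>_def by (intro memLp_diff(1) memLp_scaleR) auto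
    let ?P1 = "\<nu> x powr p" and ?P2 = "lpi p Mf (\<lambda>t. f t - scaleC (a t) x)" and ?P3 = "lpi p M\<phi> (\<lambda>s. \<rho> s *\<^sub>R \<phi> s)"
    let ?Q1 = "\<nu> \<xi> powr p" and ?Q2 = "lpi p Mf (\<lambda>t. \<eta> t - scaleC (a t) \<xi>)" and ?Q3 = "lpi p M\<phi> (\<lambda>s. \<rho> s *\<^sub>R \<psi> s)"
    define X Y G0 L0 where "X = norm x powr p" and "Y = norm y0 powr p"
      and "G0 = norm (f 0 - scaleC (a 0) x) powr p" and "L0 = norm ?L powr p"
    have nn: "0 \<le> X" "0 \<le> Y" "0 \<le> G0" "0 \<le> L0" by (auto simp: X_def Y_def G0_def L0_def)
    have Qn: "0 \<le> ?Q1" "0 \<le> ?Q2" "0 \<le> ?Q3" and Pn: "0 \<le> ?P2" "0 \<le> ?P3" by (auto intro: lpi_nonneg)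
    define E where "E = exp (c * h)"
    have "0 \<le> 2 * p * \<omega> * h" using h \<omega> p by simp
    then have E: "1 \<le> E" "exp (2 * (p - 1) * \<kappa> * h) \<le> E"
      using mult_nonneg_nonneg[OF c less_imp_le[OF h(1)]] unfolding E_def by (auto simp: c_def distrib_right)
    have 1: "?P1 \<le> E * ?Q1 + h * (K * (exp p * M powr p) * Y)"
      using dissipative_x[OF _ eq h(1) \<kappa> hs(1,2)] G' by (simp add: E_def c_def K_def Y_def distrib_right)
    have "?P2 + h * G0 \<le> exp (2 * (p - 1) * \<kappa> * h) * ?Q2 + h * (K * (2 powr p * (X * a'_pow + Y * a_pow)))"
      using dissipative_f[OF _ eq \<eta>_def m\<eta> h(1) \<kappa> hs(1)] G' by (simp add: K_def X_def Y_def G0_def)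
    also have "exp (2 * (p - 1) * \<kappa> * h) * ?Q2 \<le> E * ?Q2" by (rule mult_right_mono[OF E(2) Qn(2)])
    finally have 2: "?P2 + h * G0 \<le> E * ?Q2 + h * (K * (2 powr p * (X * a'_pow + Y * a_pow)))" by simp
    have "?P3 + h * (k * L0) \<le> ?Q3 + h * ((1 + V 0) * X)"
      using dissipative_\<phi>[OF _ h(1) \<psi>_def] G' by (simp add: k_def L0_def X_def)
    moreover have "?Q3 \<le> E * ?Q3" using mult_right_mono[OF E(1) Qn(3)] by simp
    ultimately have 3: "?P3 + h * (k * L0) \<le> E * ?Q3 + h * ((1 + V 0) * X)" by linarith
    have "Y \<le> 4 powr p * (G0 + b * X + L0)"
    proof -
      have "Y = norm ((f 0 - scaleC (a 0) x + scaleC (a 0) x) + ?L) powr p" by (simp add: Y_def y0_def)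
      also have "\<dots> \<le> 2 powr p * (norm (f 0 - scaleC (a 0) x + scaleC (a 0) x) powr p + L0)"
        unfolding L0_def by (rule norm_add_powr_bound[OF p_facts(2)])
      also have "\<dots> \<le> 2 powr p * (2 powr p * (G0 + b * X) + L0)"
        using norm_add_powr_bound[OF p_facts(2), of "f 0 - scaleC (a 0) x" "scaleC (a 0) x"]
        by (intro mult_left_mono add_right_mono) (auto simp: G0_def b_def X_def norm_scaleC powr_mult)
      also have "\<dots> \<le> 2 powr p * (2 powr p * (G0 + b * X) + 2 powr p * L0)"
        using mult_right_mono[of 1 "2 powr p" L0] nn p by (intro mult_left_mono add_left_mono) (auto simp: ge_one_powr_ge_zero)
      also have "\<dots> = (2 powr p * 2 powr p) * (G0 + b * X + L0)" by (simp add: algebra_simps)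
      also have "2 powr p * 2 powr p = (4 :: real) powr p" by (simp add: powr_mult[symmetric])
      finally show ?thesis .
    qed
    then have "K * C1 * Y \<le> K * C1 * (4 powr p * (G0 + b * X + L0))" using K C1 by (intro mult_left_mono) auto
    also have "\<dots> = k0 * (G0 + b * X + L0)" using K(2) by (simp add: mult.assoc[symmetric])
    also have "\<dots> \<le> G0 + k * L0 + k0 * b * X"
      using mult_right_mono[OF k0(2) nn(3)] mult_right_mono[OF k0(3) nn(4)] by (simp add: distrib_left)
    finally have 4: "h * (K * C1 * Y) \<le> h * (G0 + k * L0 + k0 * b * X)" using h by (intro mult_left_mono) auto
    have XP: "X \<le> ?P1" unfolding X_def using \<nu>_facts(1)[of x] p by (intro powr_mono2) auto
    have P: "state_pow u = ?P1 + ?P2 + ?P3" and Q: "state_pow (\<xi>, \<eta>, \<psi>) = ?Q1 + ?Q2 + ?Q3"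
      by (simp_all only: uw state_pow_def prod.case)
    have "state_pow u \<le> E * state_pow (\<xi>, \<eta>, \<psi>) + h * C3 * X"
    proof -
      have "h * (K * (exp p * M powr p) * Y) + h * (K * (2 powr p * (X * a'_pow + Y * a_pow))) + h * ((1 + V 0) * X) + h * (k0 * b * X)
        = h * (K * C1 * Y) + h * C3 * X" by (simp add: C1_def C3_def algebra_simps)
      moreover have "h * (G0 + k * L0 + k0 * b * X) = h * G0 + h * (k * L0) + h * (k0 * b * X)" by (simp add: distrib_left)
      ultimately show ?thesis unfolding P Q distrib_left[of E] using 1 2 3 4 by linarith
    qed
    \<comment> \<open>\<open>X\<close> is dominated by \<open>state_pow u\<close> itself, so this
      term moves to the left. As \<open>h * C3 \<le> 1 / 2\<close>, dividing by
      \<open>1 - h * C3\<close> costs \<open>exp (2 * (h * C3))\<close>.\<close>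
    also have "h * C3 * X \<le> h * C3 * state_pow u" using hs(4) XP Pn P by (intro mult_left_mono) linarith+
    finally have "(1 - h * C3) * state_pow u \<le> E * state_pow (\<xi>, \<eta>, \<psi>)" by (simp add: left_diff_distrib)
    then have "state_pow u \<le> 1 / (1 - h * C3) * (E * state_pow (\<xi>, \<eta>, \<psi>))" using hs by (simp add: field_simps)
    also have "\<dots> \<le> exp (2 * (h * C3)) * (E * state_pow (\<xi>, \<eta>, \<psi>))"
      using inverse_le_exp[of "h * C3"] hs E state_pow_nonneg by (intro mult_right_mono) auto
    also have "\<dots> = exp ((c + 2 * C3) * h) * state_pow (\<xi>, \<eta>, \<psi>)"
      by (simp add: E_def exp_add[symmetric] mult.assoc[symmetric]) (simp add: algebra_simps)
    finally have "q u \<le> (exp ((c + 2 * C3) * h) * state_pow (\<xi>, \<eta>, \<psi>)) powr (1 / p)"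
      unfolding q_def using p state_pow_nonneg by (intro powr_mono2) auto
    also have "\<dots> = exp ((c + 2 * C3) / p * h) * q (\<xi>, \<eta>, \<psi>)"
      by (simp add: powr_mult q_def) (simp add: powr_def)
    finally show ?thesis unfolding v .
  qed
  have "0 \<le> (c + 2 * C3) / p" "0 < h0" using c C3 p sum_pos by (auto simp: h0_def)
  with main show ?thesis by blast
qed

end

section \<open>Solvability of the resolvent equation\<close>

context delay_system
begin

text \<open>The factor 2 comes from \<open>1 - h * \<omega> \<ge> 1 / 2\<close> and the factor
  \<open>M\<close> from the equivalence of norms.\<close>

lemma resolvent_Lipschitz:
  assumes x: "x \<in> DA" "x' \<in> DA" and eq: "(x - h *\<^sub>R A x) - (x' - h *\<^sub>R A x') = z"
    and h: "0 < h" "h * \<omega> \<le> 1 / 2"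
  shows "norm (x - x') \<le> 2 * M * norm z"
proof -
  have A: "x - x' \<in> DA" "A (x - x') = A x - A x'" using A_diff[OF x] by auto
  have z: "(x - x') - h *\<^sub>R A (x - x') = z" using eq by (simp add: A algebra_simps)
  have "(1 / 2) * \<nu> (x - x') \<le> (1 - h * \<omega>) * \<nu> (x - x')" using h \<nu>_nonneg by (intro mult_right_mono) auto
  also have "\<dots> \<le> \<nu> z" using renorm_dissipative[OF M \<omega> T_bound A(1) h(1)] z by simp
  also have "\<dots> \<le> M * norm z" by (rule \<nu>_facts)
  finally show ?thesis using \<nu>_facts(1)[of "x - x'"] by simp
qed

text \<open>The left side carries only one factor \<open>h\<close>: for data \<open>y\<close> of
  size \<open>h * d\<close> the p-th power of the boundary value is of order
  \<open>h powr (p - 1) * d powr p\<close>, which is small.\<close>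

lemma halfline_solution_bound:
  fixes y :: 'a
  assumes W: "W1p_with p {0..} g g'" and eq: "\<And>t. g t - h *\<^sub>R g' t = scaleC (a t) y" and h: "0 < h"
  shows "h * norm (g 0) powr p \<le> norm y powr p * a_pow"
proof -
  have "lpi p Mf g + h * norm (g 0) powr p \<le> lpi p Mf (\<lambda>t. g t - h *\<^sub>R g' t)"
    by (rule W1p_with_halfline_estimate[OF W p_facts(3) h])
  also have "\<dots> = norm y powr p * a_pow" by (simp only: eq lpi_scaleC_left a_pow_def)
  finally show ?thesis using lpi_nonneg[where p = p and M = Mf and f = g] by linarith
qed

lemma history_solution_bound:
  fixes \<phi> :: "real \<Rightarrow> 'a"
  assumes W: "W1p_with p {-r..0} \<phi> \<psi>" and eq: "\<And>t. \<phi> t - h *\<^sub>R \<psi> t = 0" and h: "0 < h"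
  shows "(1 + V 0) powr (1 - p) * norm (RS_integral \<mu> \<phi> (-r) 0) powr p \<le> (1 + V 0) * norm (\<phi> 0) powr p"
proof -
  have "h * ((1 + V 0) powr (1 - p) * norm (RS_integral \<mu> \<phi> (-r) 0) powr p) \<le> h * ((1 + V 0) * norm (\<phi> 0) powr p)"
  proof -
    have "lpi p M\<phi> (\<lambda>s. \<rho> s *\<^sub>R (0 :: 'a)) = 0" by simp
    with dissipative_\<phi>[OF W h refl, unfolded eq] lpi_nonneg[where p = p and M = M\<phi> and f = "\<lambda>s. \<rho> s *\<^sub>R \<phi> s"]
    show ?thesis by linarith
  qed
  then show ?thesis using h by simp
qed

text \<open>For a given value \<open>y\<close> of \<open>f 0 + L \<phi>\<close> the system decouples
  into a resolvent equation for \<open>A\<close>, an equation on the half line and one on the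
  history interval with end value \<open>x y\<close>. It remains to find a \<open>y\<close> that
  reproduces itself under \<open>F\<close>. As \<open>y\<close> enters the data only as
  \<open>h *\<^sub>R y\<close>, the map \<open>F\<close> contracts for small
  \<open>h\<close>.\<close>

lemma Gr_surj:
  "\<exists>h0. 0 < h0 \<and> (\<forall>h v. 0 < h \<longrightarrow> h \<le> h0 \<longrightarrow> v \<in> st_space p r \<longrightarrow>
    (\<exists>u w. (u, w) \<in> Gr \<and> u - st_scale (complex_of_real h) w = v))"
proof -
  define k where "k = (1 + V 0) powr (1 - p)"
  have V0: "0 \<le> V 0" by (rule V_bounds)
  have k: "0 < k" using V0 by (simp add: k_def)
  \<comment> \<open>Collects the constants of \<open>df\<close> and \<open>dL\<close>; the outer
    \<open>2 powr p\<close> separates the two boundary terms.\<close>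
  define C where "C = 2 powr p * ((2 * M + 1) powr p * a_pow + (1 + V 0) / k * (2 * M) powr p)"
  have C: "0 < C" unfolding C_def using M V0 k a_pow_nonneg by (intro mult_pos_pos add_nonneg_pos) auto
  \<comment> \<open>The last entry gives \<open>C * h powr (p - 1) \<le> (1 / 2) powr p\<close> and
    hence contraction by \<open>1 / 2\<close>.\<close>
  define h0 where "h0 = min (min 1 (1 / (2 * (\<omega> + 1)))) (((1 / 2) powr p / C) powr (1 / (p - 1)))"
  have h0: "0 < h0" using \<omega> C by (auto simp: h0_def)
  have main: "\<exists>u w. (u, w) \<in> Gr \<and> u - st_scale (complex_of_real h) w = v"
    if h: "0 < h" "h \<le> h0" and v: "v \<in> st_space p r" for h v
  proof -
    have h1: "h \<le> 1" and h2: "h \<le> 1 / (2 * (\<omega> + 1))" and h3: "h \<le> ((1 / 2) powr p / C) powr (1 / (p - 1))"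
      using h by (auto simp: h0_def)
    have "h * (\<omega> + 1) \<le> 1 / 2" using h2 \<omega> by (simp add: field_simps)
    then have h\<omega>: "h * \<omega> \<le> 1 / 2" using h by (simp add: distrib_left)
    have "h powr (p - 1) \<le> (((1 / 2) powr p / C) powr (1 / (p - 1))) powr (p - 1)"
      using h h3 p by (intro powr_mono2) auto
    also have "\<dots> = (1 / 2) powr p / C" using C p by (simp add: powr_powr)
    finally have hC: "C * h powr (p - 1) \<le> (1 / 2) powr p" using C by (simp add: field_simps)
    obtain \<xi> \<eta> \<psi> where vf: "v = (\<xi>, \<eta>, \<psi>)" by (metis prod.exhaust)
    note m = v[unfolded vf state_space_Pair]
    have "\<forall>y. \<exists>x\<in>DA. x - h *\<^sub>R A x = \<xi> + h *\<^sub>R y" using resolvent_surj[OF M \<omega> T_bound h(1)] h\<omega> by simp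
    then obtain x where x: "\<And>y. x y \<in> DA" "\<And>y. x y - h *\<^sub>R A (x y) = \<xi> + h *\<^sub>R y" by metis
    \<comment> \<open>The data on the half line contain \<open>A (x y)\<close> only multiplied by
      \<open>h\<close>, and this product has a Lipschitz constant of order \<open>h\<close> in
      \<open>y\<close>, as the formula shows.\<close>
    have hA: "h *\<^sub>R A (x y) = x y - (\<xi> + h *\<^sub>R y)" for y
      using x(2)[of y] by (simp add: diff_eq_eq eq_diff_eq add.commute)
    let ?\<gamma> = "\<lambda>y t. \<eta> t + scaleC (a t) (h *\<^sub>R A (x y))"
    have "\<forall>y. \<exists>f. W1p_with p {0..} f (\<lambda>t. (1 / h) *\<^sub>R (f t - ?\<gamma> y t))"
    proof
      fix y
      have "memLp p Mf (?\<gamma> y)" using m a_memLp p_facts by (intro memLp_add(1)) auto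
      from ode_halfline[OF this p_facts(3) h(1)]
      show "\<exists>f. W1p_with p {0..} f (\<lambda>t. (1 / h) *\<^sub>R (f t - ?\<gamma> y t))" by blast
    qed
    then obtain f where f: "\<And>y. W1p_with p {0..} (f y) (\<lambda>t. (1 / h) *\<^sub>R (f y t - ?\<gamma> y t))" by metis
    have "\<forall>y. \<exists>\<phi>. W1p_with p {-r..0} \<phi> (\<lambda>s. (1 / h) *\<^sub>R (\<phi> s - \<psi> s)) \<and> \<phi> 0 = x y"
    proof
      fix y
      have "memLp p M\<phi> \<psi>" "-r \<le> 0" using m r by auto
      from ode_Icc[OF this(1) p_facts(3) h(1) this(2), of "x y"]
      show "\<exists>\<phi>. W1p_with p {-r..0} \<phi> (\<lambda>s. (1 / h) *\<^sub>R (\<phi> s - \<psi> s)) \<and> \<phi> 0 = x y" by blast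
    qed
    then obtain \<phi> where \<phi>: "\<And>y. W1p_with p {-r..0} (\<phi> y) (\<lambda>s. (1 / h) *\<^sub>R (\<phi> y s - \<psi> s))" "\<And>y. \<phi> y 0 = x y" by metis
    define F where "F y = f y 0 + RS_integral \<mu> (\<phi> y) (-r) 0" for y
    have contr: "dist (F y) (F z) \<le> 1 / 2 * dist y z" for y z
    proof -
      define d where "d = norm (y - z)"
      have dx: "norm (x y - x z) \<le> 2 * M * (h * d)"
      proof -
        have "(x y - h *\<^sub>R A (x y)) - (x z - h *\<^sub>R A (x z)) = h *\<^sub>R (y - z)" unfolding x(2) by (simp add: scaleR_diff_right)
        from resolvent_Lipschitz[OF x(1) x(1) this h(1) h\<omega>] show ?thesis using h by (simp add: d_def)
      qed
      have "h *\<^sub>R A (x y) - h *\<^sub>R A (x z) = (x y - x z) - h *\<^sub>R (y - z)"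
        unfolding hA by (simp add: scaleR_diff_right)
      then have "norm (h *\<^sub>R A (x y) - h *\<^sub>R A (x z)) \<le> 2 * M * (h * d) + h * d"
        using norm_triangle_ineq4[of "x y - x z" "h *\<^sub>R (y - z)"] dx h by (simp add: d_def)
      also have "\<dots> = (2 * M + 1) * (h * d)" by (simp add: algebra_simps)
      finally have dA: "norm (h *\<^sub>R A (x y) - h *\<^sub>R A (x z)) \<le> (2 * M + 1) * (h * d)" .
      define H where "H = h powr (p - 1) * d powr p"
      have H: "0 \<le> H" "h * H = (h * d) powr p" using h powr_add[of h 1 "p - 1"] by (auto simp: H_def powr_mult d_def)
      \<comment> \<open>For the history part no factor \<open>h\<close> is lost, so
        \<open>h \<le> 1\<close> allows measuring both boundary terms by the same
        \<open>H\<close>.\<close>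
      have HH: "(h * d) powr p \<le> H" using mult_right_mono[OF h1 H(1)] H(2) by simp
      have "h * norm (f y 0 - f z 0) powr p \<le> norm (h *\<^sub>R A (x y) - h *\<^sub>R A (x z)) powr p * a_pow"
      proof (rule halfline_solution_bound[OF W1p_with_diff[OF f f p_facts(2)] _ h(1)])
        show "(f y t - f z t) - h *\<^sub>R ((1 / h) *\<^sub>R (f y t - ?\<gamma> y t) - (1 / h) *\<^sub>R (f z t - ?\<gamma> z t))
          = scaleC (a t) (h *\<^sub>R A (x y) - h *\<^sub>R A (x z))" for t
          using h by (simp add: scaleR_diff_right scaleC_diff_right)
      qed
      also have "\<dots> \<le> ((2 * M + 1) * (h * d)) powr p * a_pow"
        using dA p a_pow_nonneg by (intro mult_right_mono powr_mono2) auto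
      also have "\<dots> = h * ((2 * M + 1) powr p * a_pow * H)" 
        unfolding powr_mult[of "2 * M + 1" "h * d"] H(2)[symmetric] by (simp add: mult_ac)
      finally have df: "norm (f y 0 - f z 0) powr p \<le> (2 * M + 1) powr p * a_pow * H" using h by simp
      have RSd: "RS_integral \<mu> (\<lambda>s. \<phi> y s - \<phi> z s) (-r) 0 = RS_integral \<mu> (\<phi> y) (-r) 0 - RS_integral \<mu> (\<phi> z) (-r) 0"
        using RS_add[OF W1p_with_diff[OF \<phi>(1)[of y] \<phi>(1)[of z] p_facts(2)] \<phi>(1)[of z]] by simp
      let ?D = "RS_integral \<mu> (\<phi> y) (-r) 0 - RS_integral \<mu> (\<phi> z) (-r) 0"
      have "k * norm ?D powr p \<le> (1 + V 0) * norm (\<phi> y 0 - \<phi> z 0) powr p"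
        unfolding k_def RSd[symmetric]
      proof (rule history_solution_bound[OF W1p_with_diff[OF \<phi>(1) \<phi>(1) p_facts(2)] _ h(1)])
        show "(\<phi> y t - \<phi> z t) - h *\<^sub>R ((1 / h) *\<^sub>R (\<phi> y t - \<psi> t) - (1 / h) *\<^sub>R (\<phi> z t - \<psi> t)) = 0" for t
          using h by (simp add: scaleR_diff_right)
      qed
      also have "\<dots> \<le> (1 + V 0) * (2 * M * (h * d)) powr p"
        unfolding \<phi>(2) using dx p V0 by (intro mult_left_mono powr_mono2) auto
      also have "\<dots> = (1 + V 0) * ((2 * M) powr p * (h * d) powr p)" by (simp only: powr_mult)
      also have "\<dots> \<le> (1 + V 0) * ((2 * M) powr p * H)" using HH V0 by (intro mult_left_mono) auto
      finally have dL: "norm ?D powr p \<le> (1 + V 0) / k * (2 * M) powr p * H" using k by (simp add: field_simps)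
      have "norm (F y - F z) powr p = norm ((f y 0 - f z 0) + ?D) powr p" by (simp add: F_def algebra_simps)
      also have "\<dots> \<le> 2 powr p * (norm (f y 0 - f z 0) powr p + norm ?D powr p)" by (rule norm_add_powr_bound[OF p_facts(2)])
      also have "\<dots> \<le> 2 powr p * ((2 * M + 1) powr p * a_pow * H + (1 + V 0) / k * (2 * M) powr p * H)"
        by (intro mult_left_mono add_mono df dL) auto
      also have "\<dots> = (C * h powr (p - 1)) * d powr p" by (simp add: C_def H_def algebra_simps)
      also have "\<dots> \<le> (1 / 2) powr p * d powr p" by (rule mult_right_mono[OF hC]) simp
      also have "\<dots> = (1 / 2 * d) powr p" by (simp only: powr_mult)
      finally have le: "norm (F y - F z) powr p \<le> (1 / 2 * d) powr p" .
      have "norm (F y - F z) \<le> 1 / 2 * d"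
      proof (rule ccontr)
        assume "\<not> norm (F y - F z) \<le> 1 / 2 * d"
        then have "(1 / 2 * d) powr p < norm (F y - F z) powr p" using p by (intro powr_less_mono2) (auto simp: d_def)
        with le show False by simp
      qed
      then show ?thesis by (simp add: dist_norm d_def)
    qed
    then have "\<exists>!y. F y = y" by (intro banach_fix_type[of "1 / 2"]) auto
    then obtain y where y: "F y = y" by blast
    let ?w = "(A (x y) + y, \<lambda>t. (1 / h) *\<^sub>R (f y t - \<eta> t), \<lambda>s. (1 / h) *\<^sub>R (\<phi> y s - \<psi> s))"
    have "(1 / h) *\<^sub>R (f y t - \<eta> t) - scaleC (a t) (A (x y)) = (1 / h) *\<^sub>R (f y t - ?\<gamma> y t)" for t
      using h by (simp add: algebra_simps scaleC_scaleR_commute)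
    then have "((x y, f y, \<phi> y), ?w) \<in> Gr"
      unfolding Gr_iff using x(1) \<phi> f[of y] y by (simp add: F_def)
    moreover have "(x y, f y, \<phi> y) - st_scale (complex_of_real h) ?w = v"
      unfolding st_scale_Pair state_diff vf scaleR_scaleC[symmetric] using h x(2)[of y]
      by (simp add: scaleR_add_right algebra_simps)
    ultimately show ?thesis by blast
  qed
  with h0 show ?thesis by blast
qed

end

section \<open>Transfer to the given norm and operator\<close>

context delay_system
begin

text \<open>\<open>wderiv\<close> picks one weak derivative, so the operator is a selection of the
  relation on its domain.\<close>

lemma Gr_AL_op: "u \<in> AL_dom p r DA \<Longrightarrow> (u, AL_op p r A a \<mu> u) \<in> Gr"
proof -
  assume u: "u \<in> AL_dom p r DA"
  obtain x f \<phi> where uf: "u = (x, f, \<phi>)" by (metis prod.exhaust)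
  note m = u[unfolded uf AL_dom_def]
  have "W1p_with p {0..} f (wderiv p {0..} f)" "W1p_with p {-r..0} \<phi> (wderiv p {-r..0} \<phi>)"
    using m someI_ex[of "W1p_with p {0..} f"] someI_ex[of "W1p_with p {-r..0} \<phi>"]
    by (auto simp: W1p_def wderiv_def)
  then show ?thesis using m unfolding uf AL_op_def by (simp add: Gr_iff)
qed

lemma Gr_AL_dom: "(u, w) \<in> Gr \<Longrightarrow> u \<in> AL_dom p r DA"
  by (auto simp: Gr_def AL_dom_def W1p_def)

text \<open>Continuity and differentiability of orbits are stated as limits of norms to zero, which
  equivalent norms share. The membership condition is eventual because quotients make sense only for
  positive times.\<close>

lemma st_norm_tendsto_iff:
  assumes "\<forall>\<^sub>F t in F. g t \<in> st_space p r"
  shows "((\<lambda>t. st_norm p r (g t)) \<longlongrightarrow> 0) F \<longleftrightarrow> ((\<lambda>t. q (g t)) \<longlongrightarrow> 0) F"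
proof -
  obtain B where B: "0 < B" "\<And>u. u \<in> st_space p r \<Longrightarrow> st_norm p r u \<le> B * q u"
    "\<And>u. u \<in> st_space p r \<Longrightarrow> q u \<le> B * st_norm p r u" by (rule norm_equiv) blast
  have n0: "0 \<le> st_norm p r u" for u :: "'a state" by (cases u) (simp add: st_norm_def Lpnorm_def)
  show ?thesis
  proof
    assume "((\<lambda>t. st_norm p r (g t)) \<longlongrightarrow> 0) F"
    then have "((\<lambda>t. B * st_norm p r (g t)) \<longlongrightarrow> 0) F" using tendsto_mult_left[of "\<lambda>t. st_norm p r (g t)" 0 F B] by simp
    then show "((\<lambda>t. q (g t)) \<longlongrightarrow> 0) F"
      by (rule Lim_null_comparison[rotated]) (use assms in eventually_elim, simp add: B(3) q_nonneg)
  next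
    assume "((\<lambda>t. q (g t)) \<longlongrightarrow> 0) F"
    then have "((\<lambda>t. B * q (g t)) \<longlongrightarrow> 0) F" using tendsto_mult_left[of "\<lambda>t. q (g t)" 0 F B] by simp
    then show "((\<lambda>t. st_norm p r (g t)) \<longlongrightarrow> 0) F"
      by (rule Lim_null_comparison[rotated]) (use assms in eventually_elim, simp add: B(2) n0)
  qed
qed

lemma st_norm_zero_iff: "u \<in> st_space p r \<Longrightarrow> st_norm p r u = 0 \<longleftrightarrow> q u = 0"
  using st_norm_tendsto_iff[of "\<lambda>_. u" sequentially] by (simp add: tendsto_const_iff)

theorem generates_delay_semigroup:
  "generates_C0 (st_space p r) (st_norm p r) st_add st_scale (AL_dom p r DA) (AL_op p r A a \<mu>)"
proof -
  obtain c h1 where c: "0 \<le> c" "0 < h1" "\<And>u w h. (u, w) \<in> Gr \<Longrightarrow> 0 < h \<Longrightarrow> h \<le> h1 \<Longrightarrow>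
    q u \<le> exp (c * h) * q (u - st_scale (complex_of_real h) w)" using Gr_dissipative by blast
  obtain h2 where h2: "0 < h2" "\<And>h v. 0 < h \<Longrightarrow> h \<le> h2 \<Longrightarrow> v \<in> st_space p r \<Longrightarrow>
    \<exists>u w. (u, w) \<in> Gr \<and> u - st_scale (complex_of_real h) w = v" using Gr_surj by blast
  interpret sc: module st_scale by (rule module_st_scale)
  interpret D: dissipative_relation st_scale "st_space p r" q Gr c "min h1 h2"
  proof (intro dissipative_relation.intro dissipative_relation_axioms.intro module_st_scale)
    show "0 \<le> c" "0 < min h1 h2" using c h2 by auto
    show "q u \<le> exp (c * h) * q (u - st_scale (complex_of_real h) w)" if "(u, w) \<in> Gr" "0 < h" "h \<le> min h1 h2" for u w h
      using that by (intro c(3)) auto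
    show "\<exists>u w. (u, w) \<in> Gr \<and> u - st_scale (complex_of_real h) w = v" if "0 < h" "h \<le> min h1 h2" "v \<in> st_space p r" for h v
      using that by (intro h2(2)) auto
  qed (rule st_space_zero st_space_add st_space_scale q_triangle q_scale q_complete Gr_space Gr_plus Gr_scale Gr_dense; assumption)+
  have st0: "st_norm p r (u - v) = 0" if "D.eqv u v" for u v
    using that st_norm_zero_iff[OF D.V_diff] by (simp add: D.eqv_def)
  obtain B where B: "0 < B" "\<And>u. u \<in> st_space p r \<Longrightarrow> st_norm p r u \<le> B * q u"
    "\<And>u. u \<in> st_space p r \<Longrightarrow> q u \<le> B * st_norm p r u" by (rule norm_equiv) blast
  note bl = D.T_blin[unfolded D.blin_def]
  have TV: "D.T t u \<in> st_space p r" if "0 \<le> t" "u \<in> st_space p r" for t u using bl that by blast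
  have "\<exists>C. \<forall>u\<in>st_space p r. st_norm p r (D.T t u) \<le> C * st_norm p r u" if t: "0 \<le> t" for t
  proof (intro exI ballI)
    fix u :: "'a state" assume u: "u \<in> st_space p r"
    have "st_norm p r (D.T t u) \<le> B * q (D.T t u)" by (rule B(2)[OF TV[OF t u]])
    also have "\<dots> \<le> B * (exp (c * t) * q u)" using bl[OF t] u B(1) by (intro mult_left_mono) auto
    also have "\<dots> \<le> B * (exp (c * t) * (B * st_norm p r u))" using B u by (intro mult_left_mono) auto
    finally show "st_norm p r (D.T t u) \<le> (B * exp (c * t) * B) * st_norm p r u" by (simp add: mult.assoc)
  qed
  moreover have "((\<lambda>t. st_norm p r (D.T t u - D.T t0 u)) \<longlongrightarrow> 0) (at t0 within {0..})"
    if "u \<in> st_space p r" "0 \<le> t0" for u t0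
  proof (subst st_norm_tendsto_iff)
    show "\<forall>\<^sub>F t in at t0 within {0..}. D.T t u - D.T t0 u \<in> st_space p r"
      unfolding eventually_at_filter using that by (auto intro!: always_eventually D.V_diff TV)
  qed (rule D.T_cont[OF that(2,1)])
  ultimately have C0: "C0_semigroup (st_space p r) (st_norm p r) st_add st_scale D.T"
    unfolding C0_semigroup_def vsub_st unfolding st_add_eq_plus
    using bl TV by (auto intro!: st0 D.T_zero D.T_add)
  have quot: "((\<lambda>h. st_norm p r (st_scale (complex_of_real (1 / h)) (D.T h u - u) - v)) \<longlongrightarrow> 0) (at_right 0) \<longleftrightarrow>
      ((\<lambda>h. q (st_scale (complex_of_real (1 / h)) (D.T h u - u) - v)) \<longlongrightarrow> 0) (at_right 0)"
    if "u \<in> st_space p r" "v \<in> st_space p r" for u v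
  proof (rule st_norm_tendsto_iff)
    show "\<forall>\<^sub>F h in at_right 0. st_scale (complex_of_real (1 / h)) (D.T h u - u) - v \<in> st_space p r"
      using eventually_at_right_less[of 0] by eventually_elim (use that in \<open>auto intro!: D.V_diff D.V_sc TV\<close>)
  qed
  have "generator_of (st_space p r) (st_norm p r) st_add st_scale D.T (AL_dom p r DA) (AL_op p r A a \<mu>)"
    unfolding generator_of_def vsub_st
  proof (intro conjI ballI)
    show "AL_dom p r DA \<subseteq> st_space p r" "AL_op p r A a \<mu> ` AL_dom p r DA \<subseteq> st_space p r"
      using Gr_AL_op Gr_space by blast+
    have gen: "((\<lambda>h. st_norm p r (st_scale (complex_of_real (1 / h)) (D.T h u - u) - w)) \<longlongrightarrow> 0) (at_right 0)"
      if "(u, w) \<in> Gr" for u w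
      using D.T_generator[OF that] quot Gr_space[OF that] by blast
    show "((\<lambda>h. st_norm p r (st_scale (complex_of_real (1 / h)) (D.T h u - u) - AL_op p r A a \<mu> u)) \<longlongrightarrow> 0) (at_right 0)"
      if "u \<in> AL_dom p r DA" for u by (rule gen[OF Gr_AL_op[OF that]])
    fix u :: "'a state" assume u: "u \<in> st_space p r"
    show "(\<exists>w\<in>AL_dom p r DA. st_norm p r (u - w) = 0) \<longleftrightarrow>
      (\<exists>v\<in>st_space p r. ((\<lambda>h. st_norm p r (st_scale (complex_of_real (1 / h)) (D.T h u - u) - v)) \<longlongrightarrow> 0) (at_right 0))"
    proof
      assume "\<exists>v\<in>st_space p r. ((\<lambda>h. st_norm p r (st_scale (complex_of_real (1 / h)) (D.T h u - u) - v)) \<longlongrightarrow> 0) (at_right 0)"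
      then obtain v where "v \<in> st_space p r"
        "((\<lambda>h. q (st_scale (complex_of_real (1 / h)) (D.T h u - u) - v)) \<longlongrightarrow> 0) (at_right 0)" using quot[OF u] by blast
      from D.T_generator_converse[OF u this] obtain w y where w: "(w, y) \<in> Gr" "q (u - w) = 0" by blast
      then have "w \<in> AL_dom p r DA" "st_norm p r (u - w) = 0"
        using Gr_AL_dom Gr_space st_norm_zero_iff[OF D.V_diff[OF u]] by auto
      then show "\<exists>w\<in>AL_dom p r DA. st_norm p r (u - w) = 0" by blast
    next
      assume "\<exists>w\<in>AL_dom p r DA. st_norm p r (u - w) = 0"
      then obtain w where w: "w \<in> AL_dom p r DA" "st_norm p r (u - w) = 0" by blast
      let ?v = "AL_op p r A a \<mu> w"
      have G: "(w, ?v) \<in> Gr" by (rule Gr_AL_op[OF w(1)])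
      have wV: "w \<in> st_space p r" and vV: "?v \<in> st_space p r" using Gr_space[OF G] by auto
      have uw: "q (u - w) = 0" using w(2) st_norm_zero_iff[OF D.V_diff[OF u wV]] by simp
      \<comment> \<open>Here \<open>u\<close> need not lie in the domain but only at distance zero
        from \<open>w\<close>. For each positive \<open>h\<close> the quotients of \<open>u\<close>
        and \<open>w\<close> differ by a null element, so the limit carries over.\<close>
      let ?Q = "\<lambda>u h. st_scale (complex_of_real (1 / h)) (D.T h u - u)"
      have le: "\<forall>\<^sub>F h in at_right 0. norm (q (?Q u h - ?v)) \<le> q (?Q w h - ?v)"
        using eventually_at_right_less[of 0]
      proof eventually_elim
        case (elim h)
        have T: "D.T h u \<in> st_space p r" "D.T h w \<in> st_space p r" using TV u wV elim by auto
        have "q (D.T h u - D.T h w) \<le> exp (c * h) * q (u - w)"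
          using elim by (intro D.blin_N_diff[OF D.T_blin] u wV) auto
        then have qT: "q (D.T h u - D.T h w) = 0" using uw q_nonneg[of "D.T h u - D.T h w"] by simp
        have "(?Q u h - ?v) - (?Q w h - ?v) = st_scale (complex_of_real (1 / h)) ((D.T h u - D.T h w) - (u - w))"
          by (simp add: sc.scale_right_diff_distrib)
        then have "q ((?Q u h - ?v) - (?Q w h - ?v)) = cmod (complex_of_real (1 / h)) * q ((D.T h u - D.T h w) - (u - w))"
          by (simp only: q_scale)
        also have "q ((D.T h u - D.T h w) - (u - w)) = 0"
          using D.N_diff[of "D.T h u - D.T h w" "u - w"] qT uw q_nonneg[of "(D.T h u - D.T h w) - (u - w)"] T u wV D.V_diff by simp
        finally have 0: "q ((?Q u h - ?v) - (?Q w h - ?v)) = 0" by simp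
        have QV: "?Q u h - ?v \<in> st_space p r" "?Q w h - ?v \<in> st_space p r"
          using T u wV vV by (auto intro!: D.V_diff D.V_sc)
        from D.N_triangle[OF D.V_diff[OF QV] QV(2)] have "q (?Q u h - ?v) \<le> q (?Q w h - ?v)"
          unfolding 0 diff_add_cancel by simp
        then show ?case using q_nonneg[of "?Q u h - ?v"] by simp
      qed
      have "((\<lambda>h. q (?Q u h - ?v)) \<longlongrightarrow> 0) (at_right 0)"
        by (rule Lim_null_comparison[OF le D.T_generator[OF G]])
      then show "\<exists>v\<in>st_space p r. ((\<lambda>h. st_norm p r (?Q u h - v)) \<longlongrightarrow> 0) (at_right 0)"
        using quot[OF u vV] vV by blast
    qed
  qed
  with C0 show ?thesis unfolding generates_C0_def by blast
qed

end

theorem theorem3p4: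
  fixes p r :: real
    and DA :: "'a::complex_banach set" and A :: "'a \<Rightarrow> 'a"
    and a :: "real \<Rightarrow> complex"
    and \<mu> :: "real \<Rightarrow> ('a \<Rightarrow>\<^sub>L 'a)"
  assumes p: "1 < p" and r: "0 < r"
    and A_gen: "generates_C0 UNIV norm (+) scaleC DA A"
    and a_W: "W1p p {0..} a"
    and mu_lin: "\<forall>\<theta>\<in>{-r..0}. \<forall>c x. blinfun_apply (\<mu> \<theta>) (scaleC c x) = scaleC c (blinfun_apply (\<mu> \<theta>) x)"
    and mu_bv: "bounded_variation \<mu> (-r) 0"
    and mu_cont: "continuous (at 0 within {-r..0}) \<mu>"
    and mu_var: "((\<lambda>\<epsilon>. total_variation \<mu> (-\<epsilon>) 0) \<longlongrightarrow> 0) (at_right 0)"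
  shows "generates_C0 (st_space p r) (st_norm p r) st_add st_scale (AL_dom p r DA) (AL_op p r A a \<mu>)"
proof -
  obtain T where T: "C0_semigroup UNIV norm (+) scaleC T" "generator_of UNIV norm (+) scaleC T DA A"
    using A_gen by (auto simp: generates_C0_def)
  interpret S: generated_semigroup DA A T using T by unfold_locales
  obtain M \<omega> where M: "1 \<le> M" "0 \<le> \<omega>" "\<And>t x. 0 \<le> t \<Longrightarrow> norm (T t x) \<le> M * exp (\<omega> * t) * norm x"
    using S.growth by blast
  obtain a' where "W1p_with p {0..} a a'" using a_W by (auto simp: W1p_def)
  then interpret delay_system DA A T p r M \<omega> a a' \<mu>
    using p r M mu_lin mu_bv by unfold_locales auto
  show ?thesis by (rule generates_delay_semigroup)
qed

end
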